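(* Consider the two-group mixture model described in the context, with parameters $\delta>0$, $\pi_0\in(0,1)$ (fixed) and correlation matrices $\Gamma=\Gamma^{(m)}$. Assume that $\Gamma^{(m)}$ satisfies either both (a) and (b), or both (c) and (d), where (as $m\to\infty$): (a) $\dfrac{r_m^2}{m^2}\sum_{i\ne j}(\Gamma_{i,j})^2\to0$; (b) there exists $\varepsilon_0>0$ such that $\dfrac{r_m^{4+\varepsilon_0}}{m^2}\sum_{i\ne j}(\Gamma_{i,j})^4\to0$; (c) there exists $\varepsilon_0>0$ such that $\dfrac{r_m^{2+\varepsilon_0}}{m^2}\sum_{i\ne j}(\Gamma_{i,j})^2\to0$; (d) there exists $\varepsilon_0>0$ such that $m\gamma_m^{1+\varepsilon_0}\to+\infty$. Let $\alpha\in(0,1)$, let $t^\star$ be the unique $t\in(0,1)$ such that $G(t)=t/\alpha$, and let $h(t^\star)=\big(\phi(\Phi^{-1}(t^\star))/t^\star\big)^2$. Then, as $m\to\infty$, $$\frac{\mathrm{FDP}_m-\pi_0\alpha}{\pi_0\alpha\left\{(1/t^\star-\pi_0)/(\pi_0m)+h(t^\star)\,\gamma_m\right\}^{1/2}}\ \leadsto\ \mathcal N(0,1)$$ (convergence in distribution).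
   Context: Two-group mixture model: for each $m\ge1$, $H=(H_1,\dots,H_m)$ where $H_1,H_2,\dots$ are i.i.d. Bernoulli variables of parameter $\pi_1=1-\pi_0$; $Y=Y^{(m)}\sim\mathcal N(0,\Gamma^{(m)})$ is an $m$-dimensional centered Gaussian vector, independent of $H$, whose covariance matrix $\Gamma=\Gamma^{(m)}$ has unit diagonal; and $X_i=\delta H_i+Y_i$ for $1\le i\le m$. Thus conditionally on $H$, $X\sim\mathcal N(\delta H,\Gamma)$. Sums over $i\neq j$ run over ordered pairs of distinct indices in $\{1,\dots,m\}$. $\Phi(z)=\mathbb P(Z\ge z)$, $Z\sim\mathcal N(0,1)$, is the UPPER tail function of the standard Gaussian distribution, $\phi$ the standard Gaussian density. For $t\in[0,1]$: $G(t)=\pi_0t+\pi_1\Phi(\Phi^{-1}(t)-\delta)$. $\gamma_m=m^{-2}\sum_{i\ne j}\Gamma_{i,j}$, $r_m=(m^{-1}+|\gamma_m|)^{-1/2}$. Condition (d) is understood to include $\gamma_m>0$ for $m$ large. False discovery proportion of the Benjamini–Hochberg procedure at level $\alpha$: let $\widehat{\mathbb G}_m(t)=m^{-1}\sum_{i=1}^m\mathbf 1\{\Phi(X_i)\le t\}$ and $\widehat T_m=\sup\{t\in[0,1]:\widehat{\mathbb G}_m(t)\ge t/\alpha\}$. Then $$\mathrm{FDP}_m=\frac{m^{-1}\sum_{i=1}^m(1-H_i)\mathbf 1\{\Phi(X_i)\le\widehat T_m\}}{\widehat{\mathbb G}_m(\widehat T_m)}=\alpha\,\frac{m^{-1}\sum_{i=1}^m(1-H_i)\mathbf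 1\{\Phi(X_i)\le\widehat T_m\}}{\widehat T_m}\quad\text{(a.s.)},$$ with the convention $0/0=0$. *)

theory Defs
  imports "HOL-Probability.Probability"
begin

section \<open>Gaussian vectors\<close>

text \<open>Point masses are included, so that Gaussian vectors may have a singular covariance matrix.\<close>

definition gaussian_law :: "real measure \<Rightarrow> bool" where
  "gaussian_law N \<longleftrightarrow>
     (\<exists>\<mu>. N = return borel \<mu>) \<or> (\<exists>\<mu> \<sigma>. \<sigma> > 0 \<and> N = density lborel (normal_density \<mu> \<sigma>))"

definition centered_gaussian_vector ::
    "'a measure \<Rightarrow> nat set \<Rightarrow> (nat \<Rightarrow> 'a \<Rightarrow> real) \<Rightarrow> (nat \<Rightarrow> nat \<Rightarrow> real) \<Rightarrow> bool" where
  "centered_gaussian_vector M I Y C \<longleftrightarrow>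
     (\<forall>i\<in>I. Y i \<in> borel_measurable M) \<and>
     (\<forall>a :: nat \<Rightarrow> real. gaussian_law (distr M borel (\<lambda>\<omega>. \<Sum>i\<in>I. a i * Y i \<omega>))) \<and>
     (\<forall>i\<in>I. (\<integral>\<omega>. Y i \<omega> \<partial>M) = 0) \<and>
     (\<forall>i\<in>I. \<forall>j\<in>I. (\<integral>\<omega>. Y i \<omega> * Y j \<omega> \<partial>M) = C i j)"

section \<open>The two-group mixture model\<close>

text \<open>\<open>Y m\<close> and \<open>\<Gamma> m\<close> are the noise vector and its covariance matrix in dimension \<open>m\<close>, with indices
  in \<open>{1..m}\<close>; nothing is assumed about the joint law of \<open>Y m\<close> and \<open>Y m'\<close> for \<open>m \<noteq> m'\<close>.
  In \<open>H_Y_indep\<close> the vector \<open>H\<close> is encoded by its 0/1 values because \<open>indep_var\<close> requires both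
  random variables to have the same type.\<close>

locale two_group_mixture = prob_space M
  for M :: "'a measure" +
  fixes \<pi>0 :: real
    and H :: "nat \<Rightarrow> 'a \<Rightarrow> bool"
    and Y :: "nat \<Rightarrow> nat \<Rightarrow> 'a \<Rightarrow> real"
    and \<Gamma> :: "nat \<Rightarrow> nat \<Rightarrow> nat \<Rightarrow> real"
  assumes H_indep: "indep_vars (\<lambda>_. count_space UNIV) H {1..}"
    and H_law: "\<And>i. i \<ge> 1 \<Longrightarrow>
      distr M (count_space UNIV) (H i) = measure_pmf (bernoulli_pmf (1 - \<pi>0))"
    and Y_gaussian: "\<And>m. m \<ge> 1 \<Longrightarrow> centered_gaussian_vector M {1..m} (Y m) (\<Gamma> m)"
    and unit_diag: "\<And>m i. i \<in> {1..m} \<Longrightarrow> \<Gamma> m i i = 1"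
    and H_Y_indep: "\<And>m. m \<ge> 1 \<Longrightarrow> indep_var
      (Pi\<^sub>M {1..m} (\<lambda>_. borel)) (\<lambda>\<omega>. \<lambda>i\<in>{1..m}. of_bool (H i \<omega>) :: real)
      (Pi\<^sub>M {1..m} (\<lambda>_. borel)) (\<lambda>\<omega>. \<lambda>i\<in>{1..m}. Y m i \<omega>)"

definition obs :: "real \<Rightarrow> (nat \<Rightarrow> 'a \<Rightarrow> bool) \<Rightarrow> (nat \<Rightarrow> nat \<Rightarrow> 'a \<Rightarrow> real) \<Rightarrow> nat \<Rightarrow> nat \<Rightarrow> 'a \<Rightarrow> real"
  where "obs \<delta> H Y m i \<omega> = \<delta> * of_bool (H i \<omega>) + Y m i \<omega>"

section \<open>Gaussian upper tail and mixture distribution function\<close>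

text \<open>Extended real arguments make \<open>Phi\<close> a bijection onto \<open>{0..1}\<close>, so that its inverse
  is defined at the endpoints too.\<close>

definition Phi :: "ereal \<Rightarrow> real" where
  "Phi z = measure std_normal_distribution {x. z \<le> ereal x}"

definition Phi_inv :: "real \<Rightarrow> ereal" where
  "Phi_inv = the_inv Phi"

definition mixture_G :: "real \<Rightarrow> real \<Rightarrow> real \<Rightarrow> real" where
  "mixture_G \<delta> \<pi>0 t = \<pi>0 * t + (1 - \<pi>0) * Phi (Phi_inv t - ereal \<delta>)"

definition t_star :: "real \<Rightarrow> real \<Rightarrow> real \<Rightarrow> real" where
  "t_star \<delta> \<pi>0 \<alpha> = (THE t. 0 < t \<and> t < 1 \<and> mixture_G \<delta> \<pi>0 t = t / \<alpha>)"

definition h_fun :: "real \<Rightarrow> real" where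
  "h_fun t = (std_normal_density (real_of_ereal (Phi_inv t)) / t)\<^sup>2"

section \<open>The Benjamini--Hochberg procedure\<close>

definition emp_cdf :: "nat \<Rightarrow> (nat \<Rightarrow> real) \<Rightarrow> real \<Rightarrow> real" where
  "emp_cdf m p t = (\<Sum>i\<in>{1..m}. of_bool (p i \<le> t)) / real m"

definition BH_threshold :: "real \<Rightarrow> nat \<Rightarrow> (nat \<Rightarrow> real) \<Rightarrow> real" where
  "BH_threshold \<alpha> m p = Sup {t \<in> {0..1}. emp_cdf m p t \<ge> t / \<alpha>}"

definition BH_FDP :: "real \<Rightarrow> nat \<Rightarrow> (nat \<Rightarrow> bool) \<Rightarrow> (nat \<Rightarrow> real) \<Rightarrow> real" where
  "BH_FDP \<alpha> m \<theta> p =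
     ((\<Sum>i\<in>{1..m}. (1 - of_bool (\<theta> i)) * of_bool (p i \<le> BH_threshold \<alpha> m p)) / real m)
       / emp_cdf m p (BH_threshold \<alpha> m p)"

definition FDP :: "real \<Rightarrow> real \<Rightarrow> (nat \<Rightarrow> 'a \<Rightarrow> bool) \<Rightarrow> (nat \<Rightarrow> nat \<Rightarrow> 'a \<Rightarrow> real) \<Rightarrow> nat \<Rightarrow> 'a \<Rightarrow> real"
  where "FDP \<alpha> \<delta> H Y m \<omega> =
    BH_FDP \<alpha> m (\<lambda>i. H i \<omega>) (\<lambda>i. Phi (ereal (obs \<delta> H Y m i \<omega>)))"

section \<open>Dependence parameters\<close>

definition offdiag_sum :: "nat \<Rightarrow> (nat \<Rightarrow> nat \<Rightarrow> real) \<Rightarrow> real" where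
  "offdiag_sum m a = (\<Sum>i\<in>{1..m}. \<Sum>j\<in>{1..m} - {i}. a i j)"

definition gamma_m :: "(nat \<Rightarrow> nat \<Rightarrow> nat \<Rightarrow> real) \<Rightarrow> nat \<Rightarrow> real" where
  "gamma_m \<Gamma> m = offdiag_sum m (\<Gamma> m) / (real m)\<^sup>2"

definition r_m :: "(nat \<Rightarrow> nat \<Rightarrow> nat \<Rightarrow> real) \<Rightarrow> nat \<Rightarrow> real" where
  "r_m \<Gamma> m = (1 / real m + \<bar>gamma_m \<Gamma> m\<bar>) powr (- 1 / 2)"

definition cond_a :: "(nat \<Rightarrow> nat \<Rightarrow> nat \<Rightarrow> real) \<Rightarrow> bool" where
  "cond_a \<Gamma> \<longleftrightarrow>
     (\<lambda>m. (r_m \<Gamma> m)\<^sup>2 / (real m)\<^sup>2 * offdiag_sum m (\<lambda>i j. (\<Gamma> m i j)\<^sup>2)) \<longlonglongrightarrow> 0"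

definition cond_b :: "(nat \<Rightarrow> nat \<Rightarrow> nat \<Rightarrow> real) \<Rightarrow> bool" where
  "cond_b \<Gamma> \<longleftrightarrow> (\<exists>\<epsilon>>0.
     (\<lambda>m. r_m \<Gamma> m powr (4 + \<epsilon>) / (real m)\<^sup>2 * offdiag_sum m (\<lambda>i j. (\<Gamma> m i j) ^ 4)) \<longlonglongrightarrow> 0)"

definition cond_c :: "(nat \<Rightarrow> nat \<Rightarrow> nat \<Rightarrow> real) \<Rightarrow> bool" where
  "cond_c \<Gamma> \<longleftrightarrow> (\<exists>\<epsilon>>0.
     (\<lambda>m. r_m \<Gamma> m powr (2 + \<epsilon>) / (real m)\<^sup>2 * offdiag_sum m (\<lambda>i j. (\<Gamma> m i j)\<^sup>2)) \<longlonglongrightarrow> 0)"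

text \<open>Eventual positivity is explicit because \<open>powr\<close> is not meaningful at a negative base.\<close>

definition cond_d :: "(nat \<Rightarrow> nat \<Rightarrow> nat \<Rightarrow> real) \<Rightarrow> bool" where
  "cond_d \<Gamma> \<longleftrightarrow> (\<forall>\<^sub>F m in sequentially. gamma_m \<Gamma> m > 0) \<and>
     (\<exists>\<epsilon>>0. filterlim (\<lambda>m. real m * gamma_m \<Gamma> m powr (1 + \<epsilon>)) at_top sequentially)"

end

theory Submission
  imports Defs
begin

text \<open>Write the threshold of the procedure as \<open>T = normal_tail z\<close>. At \<open>T\<close> the empirical distribution function
  equals \<open>T/\<alpha>\<close> exactly, so the false discovery proportion minus \<open>\<pi>0 \<alpha>\<close> is \<open>\<alpha> A(z) / T\<close>, where \<open>A(z)\<close> is the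
  mean of \<open>(1 - H\<^sub>i) 1{Y\<^sub>i \<ge> z}\<close> minus \<open>\<pi>0 normal_tail z\<close> (\<open>FDP_at_threshold\<close>). If \<open>z\<close> may be replaced by the
  deterministic point \<open>z\<^sup>*\<close> with \<open>normal_tail z\<^sup>* = t\<^sup>*\<close>, only a central limit theorem for \<open>A(z\<^sup>*)\<close> remains. The
  scale of everything is \<open>\<rho> = 1/m + |\<gamma>\<^sub>m|\<close>, to which the variance of \<open>A(z\<^sup>*)\<close> is comparable (\<open>sigma2_lower\<close>),
  and the dependence enters through \<open>\<theta>\<close>, the mean squared correlation divided by \<open>\<rho>\<close>. Condition (a) states
  \<open>\<theta> \<rightarrow> 0\<close>; condition (c) implies it because \<open>r\<^sub>m\<close> is bounded below.

  For the central limit theorem, \<open>(1 - h) 1{x \<ge> z} - \<pi>0 normal_tail z\<close> is split into its linear part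
  \<open>\<pi>0 \<phi>(z) x\<close> and a residual orthogonal to the constants and to \<open>x\<close>. The sum of the linear parts is exactly
  Gaussian and accounts for the term with \<open>\<gamma>\<^sub>m\<close> in the variance. Two residuals have a covariance of order
  \<open>\<Gamma>\<^sub>i\<^sub>j\<^sup>2\<close> only. Hence \<open>Y\<close> can be replaced, inside the residuals, by a vector \<open>\<xi>\<close> of independent standard
  Gaussian variables that is close to \<open>Y\<close> in mean square; the Cayley transform of \<open>\<Gamma>\<close> provides one, and the error
  is controlled by \<open>\<theta>\<close> (\<open>coupling_error\<close>). Since \<open>\<Sum>Y\<^sub>i\<close> is a linear combination of the \<open>\<xi>\<^sub>i\<close> plus an
  independent Gaussian variable, the characteristic function now factorises over the indices, and each factor is
  compared with a Gaussian one (\<open>char_gaussian_plus_small\<close>, \<open>null_count_char_bound\<close>).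

  For the replacement of \<open>z\<close>, the mixture distribution function crosses the line of slope \<open>1/\<alpha>\<close> transversally
  at \<open>t\<^sup>*\<close> (\<open>linear_margin\<close>). Chebyshev's inequality on a finite grid confines \<open>z\<close> to a window of width
  \<open>w\<close> around \<open>z\<^sup>*\<close>, and on a second, finer grid it bounds the oscillation of \<open>A\<close> over this window; monotonicity
  fills the gaps between grid points (\<open>threshold_event\<close>). With the widths chosen as powers of \<open>\<rho>\<close> the exceptional
  probability and the error tend to \<open>0\<close> (\<open>FDP_char_bound\<close>), and Levy's continuity theorem concludes.

  The vector \<open>\<xi>\<close> requires auxiliary Gaussian variables. They live on an enlarged probability space
  (\<open>extended\<close>), which does not change the law of the statistic.\<close>

section \<open>The Gaussian upper tail\<close>

definition normal_tail :: "real \<Rightarrow> real" where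
  "normal_tail z = measure std_normal_distribution {z..}"

interpretation std_normal: prob_space std_normal_distribution
  by (rule prob_space_normal_density) simp

lemma space_std_normal [simp]: "space std_normal_distribution = UNIV"
  and sets_std_normal [simp, measurable_cong]: "sets std_normal_distribution = sets borel"
  by simp_all

lemma Phi_ereal: "Phi (ereal z) = normal_tail z"
  by (simp add: Phi_def normal_tail_def atLeast_def)

lemma std_normal_density_le: "std_normal_density x \<le> 1"
proof -
  have "1 \<le> sqrt (2 * pi)" using pi_ge_two by (intro real_le_rsqrt) auto
  moreover have "exp (- x\<^sup>2 / 2) \<le> 1" by simp
  ultimately have "(1 / sqrt (2 * pi)) * exp (- x\<^sup>2 / 2) \<le> 1 * 1"
    by (intro mult_mono) auto
  then show ?thesis by (simp add: std_normal_density_def)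
qed

lemma abs_times_std_normal_density_le: "\<bar>x\<bar> * std_normal_density x \<le> 1"
proof -
  have "\<bar>x\<bar> \<le> 1 + x\<^sup>2 / 2"
    using zero_le_power2[of "\<bar>x\<bar> - 1"] by (simp add: power2_eq_square algebra_simps)
  also have "\<dots> \<le> exp (x\<^sup>2 / 2)" by (rule exp_ge_add_one_self)
  finally have "\<bar>x\<bar> * exp (- x\<^sup>2 / 2) \<le> exp (x\<^sup>2 / 2) * exp (- x\<^sup>2 / 2)"
    by (intro mult_right_mono) auto
  then have *: "\<bar>x\<bar> * exp (- x\<^sup>2 / 2) \<le> 1" by (simp flip: exp_add)
  have "1 \<le> sqrt (2 * pi)" using pi_ge_two by (intro real_le_rsqrt) auto
  then have "(1 / sqrt (2 * pi)) * (\<bar>x\<bar> * exp (- x\<^sup>2 / 2)) \<le> 1 * 1"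
    using * by (intro mult_mono) auto
  then show ?thesis by (simp add: std_normal_density_def)
qed

lemma std_normal_density_DERIV:
  "(std_normal_density has_real_derivative - x * std_normal_density x) (at x)"
  unfolding std_normal_density_def
  by (auto intro!: derivative_eq_intros simp: field_simps)

lemma std_normal_density_DERIV' [derivative_intros]:
  "(f has_real_derivative D) (at x) \<Longrightarrow>
    ((\<lambda>x. std_normal_density (f x)) has_real_derivative
      (- f x * std_normal_density (f x)) * D) (at x)"
  by (rule DERIV_chain2[OF std_normal_density_DERIV])

lemma continuous_on_std_normal_density [continuous_intros]:
  "continuous_on A f \<Longrightarrow> continuous_on A (\<lambda>x. std_normal_density (f x))"
  unfolding std_normal_density_def by (intro continuous_intros) auto

lemma measure_std_normal:
  assumes [measurable]: "A \<in> sets borel"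
  shows "measure std_normal_distribution A = (LINT x:A|lborel. std_normal_density x)"
proof -
  have "measure std_normal_distribution A = (LINT x|std_normal_distribution. indicator A x)" by simp
  also have "\<dots> = (LINT x:A|lborel. std_normal_density x)"
    unfolding set_lebesgue_integral_def
    by (subst integral_density) (auto simp: mult.commute)
  finally show ?thesis .
qed

lemma measure_std_normal_Ico:
  assumes "a \<le> b"
  shows "measure std_normal_distribution {a..<b} = normal_tail a - normal_tail b"
proof -
  have "{a..} = {a..<b} \<union> {b..}" using assms by auto
  then have "normal_tail a = measure std_normal_distribution {a..<b} + normal_tail b"
    unfolding normal_tail_def
    by (simp add: ivl_disj_int std_normal.finite_measure_Union[of "{a..<b}" "{b..}"] del: ivl_disj_un)
  then show ?thesis by simp
qed

lemma normal_tail_diff_integral: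
  assumes "a \<le> b"
  shows "normal_tail a - normal_tail b = integral {a..b} std_normal_density"
proof -
  have "normal_tail a - normal_tail b = (LINT x:{a..<b}|lborel. std_normal_density x)"
    by (subst measure_std_normal_Ico[OF assms, symmetric]) (rule measure_std_normal, simp)
  also have "\<dots> = (LINT x:{a..b}|lborel. std_normal_density x)"
    unfolding set_lebesgue_integral_def
  proof (rule integral_cong_AE)
    have "AE x in lborel. x \<noteq> b" by (rule AE_lborel_singleton)
    then show "AE x in lborel. indicat_real {a..<b} x *\<^sub>R std_normal_density x =
        indicat_real {a..b} x *\<^sub>R std_normal_density x"
      by eventually_elim (auto simp: indicator_def)
  qed auto
  also have "\<dots> = integral {a..b} std_normal_density"
    by (rule set_borel_integral_eq_integral)
       (intro borel_integrable_atLeastAtMost' continuous_intros)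
  finally show ?thesis .
qed

lemma normal_tail_DERIV: "(normal_tail has_real_derivative - std_normal_density z) (at z)"
proof -
  have "((\<lambda>x. integral {z - 1..x} std_normal_density) has_real_derivative std_normal_density z)
      (at z within {z - 1..z + 1})"
    by (rule integral_has_real_derivative) (auto intro!: continuous_intros)
  then have "((\<lambda>x. integral {z - 1..x} std_normal_density) has_real_derivative std_normal_density z)
      (at z)"
    by (simp add: at_within_Icc_at)
  then have "((\<lambda>x. normal_tail (z - 1) - integral {z - 1..x} std_normal_density)
      has_real_derivative 0 - std_normal_density z) (at z)"
    by (intro derivative_intros)
  moreover have "eventually (\<lambda>x. normal_tail (z - 1) - integral {z - 1..x} std_normal_density
      = normal_tail x) (nhds z)"
  proof -
    have "eventually (\<lambda>x. x \<in> {z - 1<..}) (nhds z)" by (rule eventually_nhds_in_open) auto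
    then show ?thesis
    proof eventually_elim
      case (elim x)
      then show ?case using normal_tail_diff_integral[of "z - 1" x] by simp
    qed
  qed
  ultimately show ?thesis by (subst DERIV_cong_ev[OF refl _ refl, symmetric]) auto
qed

lemma normal_tail_DERIV' [derivative_intros]:
  "(f has_real_derivative D) (at x) \<Longrightarrow>
    ((\<lambda>x. normal_tail (f x)) has_real_derivative - std_normal_density (f x) * D) (at x)"
  by (rule DERIV_chain2[OF normal_tail_DERIV])

lemma isCont_normal_tail: "isCont normal_tail z"
  by (rule DERIV_isCont[OF normal_tail_DERIV])

lemma continuous_on_normal_tail [continuous_intros]:
  "continuous_on A f \<Longrightarrow> continuous_on A (\<lambda>x. normal_tail (f x))"
  using continuous_on_compose2[of UNIV normal_tail A f] isCont_normal_tail
  by (simp add: continuous_at_imp_continuous_on)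

lemma normal_tail_measurable [measurable]: "normal_tail \<in> borel_measurable borel"
  using continuous_on_normal_tail[OF continuous_on_id, of UNIV]
  by (rule borel_measurable_continuous_onI)

lemma normal_tail_strict_antimono: "a < b \<Longrightarrow> normal_tail b < normal_tail a"
  by (rule DERIV_neg_imp_decreasing)
     (auto intro!: exI[of _ "- std_normal_density x" for x] normal_tail_DERIV normal_density_pos)

lemma normal_tail_less_iff [simp]: "normal_tail a < normal_tail b \<longleftrightarrow> b < a"
  using normal_tail_strict_antimono by (metis linorder_less_linear order_less_asym)

lemma normal_tail_le_iff [simp]: "normal_tail a \<le> normal_tail b \<longleftrightarrow> b \<le> a"
  by (meson linorder_not_less normal_tail_less_iff)

lemma normal_tail_inj [simp]: "normal_tail a = normal_tail b \<longleftrightarrow> a = b"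
  by (metis linorder_less_linear normal_tail_less_iff order_less_irrefl)

lemma normal_tail_pos [simp]: "0 < normal_tail z"
proof -
  have "0 \<le> normal_tail (z + 1)" by (simp add: normal_tail_def)
  also have "\<dots> < normal_tail z" by simp
  finally show ?thesis .
qed

lemma normal_tail_less_1 [simp]: "normal_tail z < 1"
proof -
  have "normal_tail z < normal_tail (z - 1)" by simp
  also have "\<dots> \<le> 1" by (simp add: normal_tail_def)
  finally show ?thesis .
qed

lemma normal_tail_nonneg [simp]: "0 \<le> normal_tail z" and normal_tail_le_1 [simp]: "normal_tail z \<le> 1"
  using less_imp_le[OF normal_tail_pos] less_imp_le[OF normal_tail_less_1] by auto

lemma normal_tail_Lipschitz: "\<bar>normal_tail a - normal_tail b\<bar> \<le> \<bar>a - b\<bar>"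
proof (induction a b rule: linorder_wlog)
  case (le a b)
  show ?case
  proof (cases "a = b")
    case False
    then have "a < b" using le by simp
    from MVT2[OF this, of normal_tail "\<lambda>x. - std_normal_density x"] obtain x where
      "normal_tail b - normal_tail a = (b - a) * - std_normal_density x"
      using normal_tail_DERIV by blast
    moreover have "(b - a) * std_normal_density x \<le> (b - a) * 1"
      using le std_normal_density_le by (intro mult_left_mono) auto
    ultimately show ?thesis using le by (auto simp: abs_if)
  qed simp
qed (simp add: abs_minus_commute)

lemma std_normal_density_Lipschitz:
  "\<bar>std_normal_density a - std_normal_density b\<bar> \<le> \<bar>a - b\<bar>"
proof (induction a b rule: linorder_wlog)
  case (le a b)
  show ?case
  proof (cases "a = b")
    case False
    then have "a < b" using le by simp
    from MVT2[OF this, of std_normal_density "\<lambda>x. - x * std_normal_density x"] obtain x where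
      x: "std_normal_density b - std_normal_density a = (b - a) * (- x * std_normal_density x)"
      using std_normal_density_DERIV by blast
    have "\<bar>std_normal_density b - std_normal_density a\<bar> = (b - a) * (\<bar>x\<bar> * std_normal_density x)"
      unfolding x abs_mult using le by simp
    also have "\<dots> \<le> (b - a) * 1"
      using le abs_times_std_normal_density_le by (intro mult_left_mono) auto
    finally show ?thesis using le by (simp add: abs_minus_commute)
  qed simp
qed (simp add: abs_minus_commute)

lemma normal_tail_Taylor:
  "\<bar>normal_tail u - normal_tail b + std_normal_density b * (u - b)\<bar> \<le> (u - b)\<^sup>2"
proof -
  have *: "\<exists>x. \<bar>x - b\<bar> \<le> \<bar>u - b\<bar> \<and> normal_tail u - normal_tail b = (u - b) * (- std_normal_density x)"
  proof -
    consider "u < b" | "u = b" | "b < u" by linarith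
    then show ?thesis
    proof cases
      case 1
      from MVT2[OF this, of normal_tail "\<lambda>x. - std_normal_density x"] obtain x where
        "u < x" "x < b" "normal_tail b - normal_tail u = (b - u) * - std_normal_density x"
        using normal_tail_DERIV by blast
      then show ?thesis by (intro exI[of _ x]) (auto simp: algebra_simps)
    next
      case 3
      from MVT2[OF this, of normal_tail "\<lambda>x. - std_normal_density x"] obtain x where
        "b < x" "x < u" "normal_tail u - normal_tail b = (u - b) * - std_normal_density x"
        using normal_tail_DERIV by blast
      then show ?thesis by (intro exI[of _ x]) auto
    qed (auto intro!: exI[of _ b])
  qed
  then obtain x where x: "\<bar>x - b\<bar> \<le> \<bar>u - b\<bar>"
    "normal_tail u - normal_tail b = (u - b) * (- std_normal_density x)" by blast
  have "\<bar>normal_tail u - normal_tail b + std_normal_density b * (u - b)\<bar>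
      = \<bar>u - b\<bar> * \<bar>std_normal_density b - std_normal_density x\<bar>"
    unfolding x(2) abs_mult[symmetric] by (simp add: algebra_simps)
  also have "\<dots> \<le> \<bar>u - b\<bar> * \<bar>u - b\<bar>"
    using x(1) std_normal_density_Lipschitz[of b x] by (intro mult_left_mono) auto
  finally show ?thesis by (simp add: power2_eq_square)
qed

lemma normal_tail_eq_cdf: "normal_tail z = 1 - measure std_normal_distribution {..<z}"
proof -
  have "{z..} = UNIV - {..<z}" by auto
  then show ?thesis
    unfolding normal_tail_def using std_normal.prob_compl[of "{..<z}"] by simp
qed

lemma normal_tail_at_bot: "(normal_tail \<longlongrightarrow> 1) at_bot"
proof (rule tendsto_sandwich[where f = "\<lambda>z. 1 - cdf std_normal_distribution z" and h = "\<lambda>_. 1"])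
  interpret real_distribution std_normal_distribution by (rule real_dist_normal_dist)
  have "((\<lambda>z. 1 - cdf std_normal_distribution z) \<longlongrightarrow> 1 - 0) at_bot"
    by (intro tendsto_intros cdf_lim_at_bot)
  then show "((\<lambda>z. 1 - cdf std_normal_distribution z) \<longlongrightarrow> 1) at_bot" by simp
  show "\<forall>\<^sub>F z in at_bot. 1 - cdf std_normal_distribution z \<le> normal_tail z"
    by (auto simp: normal_tail_eq_cdf cdf_def2 intro!: always_eventually std_normal.finite_measure_mono)
qed auto

lemma normal_tail_at_top: "(normal_tail \<longlongrightarrow> 0) at_top"
proof (rule tendsto_sandwich[where f = "\<lambda>_. 0" and h = "\<lambda>z. 1 - cdf std_normal_distribution (z - 1)"])
  interpret real_distribution std_normal_distribution by (rule real_dist_normal_dist)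
  have "filterlim (\<lambda>z. z - 1) at_top (at_top :: real filter)"
    using filterlim_tendsto_add_at_top[of "\<lambda>_. - 1::real" "-1" at_top "\<lambda>x. x"]
    by (simp add: filterlim_ident)
  then have "((\<lambda>z. 1 - cdf std_normal_distribution (z - 1)) \<longlongrightarrow> 1 - 1) at_top"
    using cdf_lim_at_top_prob by (intro tendsto_intros filterlim_compose[OF cdf_lim_at_top_prob])
  then show "((\<lambda>z. 1 - cdf std_normal_distribution (z - 1)) \<longlongrightarrow> 0) at_top" by simp
  show "\<forall>\<^sub>F z in at_top. normal_tail z \<le> 1 - cdf std_normal_distribution (z - 1)"
    by (auto simp: normal_tail_eq_cdf cdf_def2 intro!: always_eventually std_normal.finite_measure_mono)
qed auto

lemma normal_tail_surj:
  assumes "0 < t" "t < 1"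
  obtains z where "normal_tail z = t"
proof -
  have "\<forall>\<^sub>F z in at_bot. normal_tail z > t"
    using normal_tail_at_bot assms(2) by (rule order_tendstoD)
  then obtain a where a: "normal_tail a > t" using eventually_happens'[OF trivial_limit_at_bot_linorder] by blast
  have "\<forall>\<^sub>F z in at_top. normal_tail z < t"
    using normal_tail_at_top assms(1) by (rule order_tendstoD)
  then obtain b where b: "normal_tail b < t" using eventually_happens'[OF trivial_limit_at_top_linorder] by blast
  have "a \<le> b" using order.strict_trans[OF b a] by simp
  then show ?thesis
    using IVT2[of normal_tail b t a] a b isCont_normal_tail that by auto
qed

lemma inj_Phi: "inj Phi"
proof (rule injI)
  have inf: "Phi \<infinity> = 0" "Phi (-\<infinity>) = 1"
    using std_normal.prob_space by (auto simp: Phi_def)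
  have neq: "normal_tail z \<noteq> 0" "normal_tail z \<noteq> 1" for z
    using normal_tail_pos[of z] normal_tail_less_1[of z] by linarith+
  fix x y assume *: "Phi x = Phi y"
  show "x = y"
    using * neq neq[symmetric] by (cases x; cases y) (simp_all add: Phi_ereal inf)
qed

lemma Phi_inv_normal_tail [simp]: "Phi_inv (normal_tail z) = ereal z"
  unfolding Phi_inv_def by (metis Phi_ereal inj_Phi the_inv_f_f)

lemma integrable_std_normal_abs_moment: "integrable std_normal_distribution (\<lambda>x. \<bar>x\<bar> ^ k)"
  using integrable_std_normal_moment_abs[of k]
  by (subst integrable_density) (auto simp: normal_density_nonneg)

lemma integrable_std_normal_poly: "integrable std_normal_distribution (\<lambda>x. (c + \<bar>x\<bar>) ^ k)"
proof -
  have "integrable std_normal_distribution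
      (\<lambda>x. \<Sum>i\<le>k. (of_nat (k choose i) * c ^ i) * \<bar>x\<bar> ^ (k - i))"
    by (intro Bochner_Integration.integrable_sum Bochner_Integration.integrable_mult_right integrable_std_normal_abs_moment)
  then show ?thesis by (simp add: binomial_ring)
qed

lemma truncated_mean_std_normal:
  "(LINT x|std_normal_distribution. indicator {a..} x * x) = std_normal_density a"
proof -
  have tendsto: "((\<lambda>x. - std_normal_density x) \<longlongrightarrow> 0) at_top"
  proof -
    have "((\<lambda>x. 1 / x) \<longlongrightarrow> 0) (at_top::real filter)"
      by (intro tendsto_divide_0[OF tendsto_const] filterlim_at_top_imp_at_infinity filterlim_ident)
    moreover have "\<forall>\<^sub>F x in at_top. norm (std_normal_density x) \<le> 1 / x"
      using eventually_gt_at_top[of 0]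
    proof eventually_elim
      case (elim x)
      then show ?case using abs_times_std_normal_density_le[of x]
        by (simp add: field_simps)
    qed
    ultimately have "(std_normal_density \<longlongrightarrow> 0) at_top"
      by (rule Lim_null_comparison[rotated])
    then show ?thesis using tendsto_minus[of std_normal_density 0 at_top] by simp
  qed
  have int: "integrable lborel (\<lambda>x. x * std_normal_density x)"
    using integrable_std_normal_moment[of 1] by (simp add: mult.commute)
  have "(LBINT x=ereal a..\<infinity>. x * std_normal_density x) = 0 - (- std_normal_density a)"
  proof (rule interval_integral_FTC_integrable)
    show "((\<lambda>x. - std_normal_density x) has_vector_derivative x * std_normal_density x) (at x)" for x
      using DERIV_minus[OF std_normal_density_DERIV, of x]
      by (simp add: has_real_derivative_iff_has_vector_derivative)
    show "set_integrable lborel (einterval (ereal a) \<infinity>) (\<lambda>x. x * std_normal_density x)"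
      unfolding set_integrable_def real_scaleR_def using int
      by (intro integrable_mult_indicator[where 'b=real, unfolded real_scaleR_def]) auto
    show "(((\<lambda>x. - std_normal_density x) \<circ> real_of_ereal) \<longlongrightarrow> - std_normal_density a) (at_right (ereal a))"
      using DERIV_isCont[OF std_normal_density_DERIV, of a]
      by (auto simp: ereal_tendsto_simps isCont_def intro!: tendsto_minus intro: tendsto_within_subset)
    show "(((\<lambda>x. - std_normal_density x) \<circ> real_of_ereal) \<longlongrightarrow> 0) (at_left \<infinity>)"
      unfolding ereal_tendsto_simps by (rule tendsto)
    show "isCont (\<lambda>x. x * std_normal_density x) x" for x
      using DERIV_isCont[OF std_normal_density_DERIV, of x] by (intro continuous_intros)
  qed auto
  also have "(LBINT x=ereal a..\<infinity>. x * std_normal_density x) =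
      (LINT x|lborel. indicator {a<..} x * (x * std_normal_density x))"
    by (simp add: interval_lebesgue_integral_def set_lebesgue_integral_def einterval_eq)
  also have "\<dots> = (LINT x|lborel. std_normal_density x * (indicator {a..} x * x))"
  proof (rule integral_cong_AE)
    have "AE x in lborel. x \<noteq> a" by (rule AE_lborel_singleton)
    then show "AE x in lborel. indicat_real {a<..} x * (x * std_normal_density x) =
        std_normal_density x * (indicator {a..} x * x)"
      by eventually_elim (auto simp: indicator_def)
  qed auto
  also have "\<dots> = (LINT x|std_normal_distribution. indicator {a..} x * x)"
    by (subst integral_density) auto
  finally show ?thesis by simp
qed

text \<open>The indicator of a half-line minus its projection on the constants and on the identity has
  nonnegative second moment.\<close>

lemma std_normal_density_sq_le: "(std_normal_density z)\<^sup>2 \<le> normal_tail z * (1 - normal_tail z)"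
proof -
  let ?N = std_normal_distribution
  define I where "I = (\<lambda>x. indicator {z..} x :: real)"
  have [measurable]: "I \<in> borel_measurable borel" by (simp add: I_def)
  define t c where "t = normal_tail z" and "c = std_normal_density z"
  have i1: "integrable ?N I" by (rule std_normal.integrable_const_bound[of _ 1]) (auto simp: I_def indicator_def)
  have i2: "integrable ?N (\<lambda>x. x)" using integrable_std_normal_distribution_moment[of 1] by simp
  have i3: "integrable ?N (\<lambda>x. x\<^sup>2)" by (rule integrable_std_normal_distribution_moment)
  have i4: "integrable ?N (\<lambda>x. I x * x)"
    using i2 by (rule Bochner_Integration.integrable_bound) (auto simp: I_def indicator_def)
  have e1: "(LINT x|?N. I x) = t" by (simp add: I_def t_def normal_tail_def)
  have e2: "(LINT x|?N. x) = 0" using integral_std_normal_distribution_moment_odd[of 1] by simp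
  have e3: "(LINT x|?N. x\<^sup>2) = 1" using std_normal_distribution_even_moments[of 1] by simp
  have e4: "(LINT x|?N. I x * x) = c" using truncated_mean_std_normal by (simp add: I_def c_def)
  have "0 \<le> (LINT x|?N. (I x - t - c * x)\<^sup>2)" by simp
  also have "\<dots> = (LINT x|?N. (1 - 2 * t) * I x + t\<^sup>2 + c\<^sup>2 * x\<^sup>2 - 2 * c * (I x * x) + 2 * c * t * x)"
    by (intro Bochner_Integration.integral_cong)
       (auto simp: power2_eq_square algebra_simps I_def indicator_def)
  also have "\<dots> = (1 - 2 * t) * t + t\<^sup>2 + c\<^sup>2 * 1 - 2 * c * c + 2 * c * t * 0"
    using i1 i2 i3 i4 std_normal.prob_space by (simp add: e1 e2 e3 e4)
  also have "\<dots> = t * (1 - t) - c\<^sup>2" by (simp add: power2_eq_square algebra_simps)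
  finally show ?thesis by (simp add: t_def c_def)
qed

text \<open>The likelihood ratio \<open>\<phi>(x - \<delta>) / \<phi>(x) = exp (\<delta>x - \<delta>\<^sup>2/2)\<close> is increasing in \<open>x\<close>, so beyond \<open>z\<close> it exceeds
  its value at \<open>z\<close>; the claim is the integrated form of this.\<close>

lemma normal_tail_shift_lower:
  assumes "\<delta> > 0"
  shows "exp (\<delta> * z - \<delta>\<^sup>2 / 2) * normal_tail z < normal_tail (z - \<delta>)"
proof -
  let ?c = "exp (\<delta> * z - \<delta>\<^sup>2 / 2)"
  define g where "g = (\<lambda>x. normal_tail (x - \<delta>) - ?c * normal_tail x)"
  have dens: "std_normal_density (x - \<delta>) = exp (\<delta> * x - \<delta>\<^sup>2 / 2) * std_normal_density x" for x
    unfolding std_normal_density_def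
    by (simp add: exp_add[symmetric] power2_eq_square field_simps)
  have der: "(g has_real_derivative - std_normal_density (x - \<delta>) + ?c * std_normal_density x) (at x)" for x
    unfolding g_def by (auto intro!: derivative_eq_intros)
  have neg: "- std_normal_density (x - \<delta>) + ?c * std_normal_density x < 0" if "z < x" for x
    unfolding dens using that assms normal_density_pos[of 1 0 x] by simp
  have "(g \<longlongrightarrow> 0 - ?c * 0) at_top"
    unfolding g_def
  proof (intro tendsto_intros normal_tail_at_top)
    have "filterlim (\<lambda>z. z - \<delta>) at_top (at_top :: real filter)"
      using filterlim_tendsto_add_at_top[of "\<lambda>_. - \<delta>" "-\<delta>" at_top "\<lambda>x. x"]
      by (simp add: filterlim_ident)
    then show "((\<lambda>x. normal_tail (x - \<delta>)) \<longlongrightarrow> 0) at_top"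
      by (rule filterlim_compose[OF normal_tail_at_top])
  qed
  then have lim: "(g \<longlongrightarrow> 0) at_top" by simp
  have mono: "g y < g x" if "z \<le> x" "x < y" for x y
  proof (rule DERIV_neg_imp_decreasing_open[OF that(2)])
    show "\<exists>y. (g has_real_derivative y) (at u) \<and> y < 0" if "x < u" "u < y" for u
      using der[of u] neg[of u] that \<open>z \<le> x\<close> by auto
    show "continuous_on {x..y} g"
      by (intro continuous_at_imp_continuous_on ballI DERIV_isCont[OF der])
  qed
  have "0 \<le> g (z + 1)"
  proof (rule tendsto_upperbound[OF lim])
    show "\<forall>\<^sub>F x in at_top. g x \<le> g (z + 1)"
      using eventually_gt_at_top[of "z + 1"]
      by eventually_elim (use mono[of "z + 1"] in force)
  qed simp
  also have "\<dots> < g z" using mono[of z "z + 1"] by simp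
  finally show ?thesis by (simp add: g_def)
qed

section \<open>Independence from characteristic functions\<close>

lemma indep_vars_finite_borelI:
  fixes Z :: "'i \<Rightarrow> 'a \<Rightarrow> real"
  assumes "prob_space M" and fin: "finite I"
    and rv: "\<And>k. k \<in> I \<Longrightarrow> Z k \<in> borel_measurable M"
    and eq: "\<And>B. I \<noteq> {} \<Longrightarrow> (\<And>k. k \<in> I \<Longrightarrow> B k \<in> sets borel) \<Longrightarrow>
      measure M (\<Inter>k\<in>I. Z k -` B k \<inter> space M) = (\<Prod>k\<in>I. measure M (Z k -` B k \<inter> space M))"
  shows "prob_space.indep_vars M (\<lambda>_. borel) Z I"
proof (cases "I = {}")
  case True
  interpret prob_space M by fact
  show ?thesis unfolding indep_vars_def indep_sets_def using True by auto
next
  case False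
  interpret prob_space M by fact
  have "indep_vars (\<lambda>_. borel) Z I \<longleftrightarrow> (\<forall>A\<in>(\<Pi> i\<in>I. sets borel).
      prob (\<Inter>j\<in>I. Z j -` A j \<inter> space M) = (\<Prod>j\<in>I. prob (Z j -` A j \<inter> space M)))"
    using False fin rv
    by (intro indep_vars_finite) (auto simp: sets.sigma_sets_eq Int_stable_def, 
        use sets.sigma_sets_eq[of borel] in auto)
  then show ?thesis using eq[OF False] by (auto simp: Pi_iff)
qed

text \<open>Reweighting by a bounded density \<open>V\<close> leaves the characteristic function, hence the law, of \<open>Z\<close>
  unchanged as soon as it does so for all the exponentials.\<close>

lemma (in prob_space) weighted_prob_if_weighted_char:
  fixes Z V :: "'a \<Rightarrow> real"
  assumes [measurable]: "Z \<in> borel_measurable M" "V \<in> borel_measurable M" "B \<in> sets borel"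
    and V: "\<And>\<omega>. 0 \<le> V \<omega>" "\<And>\<omega>. V \<omega> \<le> c"
    and char: "\<And>a. (CLINT \<omega>|M. V \<omega> * iexp (a * Z \<omega>)) = char (distr M borel Z) a * complex_of_real (\<integral>\<omega>. V \<omega> \<partial>M)"
  shows "(\<integral>\<omega>. V \<omega> * indicator B (Z \<omega>) \<partial>M) = prob (Z -` B \<inter> space M) * (\<integral>\<omega>. V \<omega> \<partial>M)"
proof -
  define v where "v = (\<integral>\<omega>. V \<omega> \<partial>M)"
  have int: "integrable M V"
    by (rule integrable_const_bound[of _ c]) (use V in auto)
  have int': "integrable M (\<lambda>\<omega>. V \<omega> * indicator B (Z \<omega>))"
    by (rule integrable_const_bound[of _ c])
       (use V order_trans[OF V] in \<open>auto simp: indicator_def\<close>)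
  show ?thesis
  proof (cases "v = 0")
    case True
    then have "AE \<omega> in M. V \<omega> = 0"
      using integral_nonneg_eq_0_iff_AE[OF int] V by (auto simp: v_def)
    then have "(\<integral>\<omega>. V \<omega> * indicator B (Z \<omega>) \<partial>M) = (\<integral>\<omega>. 0 \<partial>M)"
      by (intro integral_cong_AE) auto
    then show ?thesis using True by (simp add: v_def)
  next
    case False
    moreover have "0 \<le> v" unfolding v_def using V by simp
    ultimately have v: "0 < v" by simp
    define N where "N = density M (\<lambda>\<omega>. ennreal (V \<omega> / v))"
    have N: "prob_space N"
    proof
      have "emeasure N (space N) = (\<integral>\<^sup>+ \<omega>. ennreal (V \<omega> / v) \<partial>M)"
        unfolding N_def by (subst emeasure_density) (auto intro!: nn_integral_cong)
      also have "\<dots> = ennreal (\<integral>\<omega>. V \<omega> / v \<partial>M)"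
        using int V v by (intro nn_integral_eq_integral) auto
      also have "(\<integral>\<omega>. V \<omega> / v \<partial>M) = 1" using v by (simp add: v_def)
      finally show "emeasure N (space N) = 1" by simp
    qed
    interpret N: prob_space N by fact
    have [measurable]: "Z \<in> borel_measurable N" by (simp add: N_def)
    have "char (distr N borel Z) = char (distr M borel Z)"
    proof
      fix a
      have "char (distr N borel Z) a = (CLINT \<omega>|N. iexp (a * Z \<omega>))"
        unfolding char_def by (subst integral_distr) auto
      also have "\<dots> = (CLINT \<omega>|M. (V \<omega> / v) *\<^sub>R iexp (a * Z \<omega>))"
        unfolding N_def using V v by (subst integral_density) auto
      also have "\<dots> = (CLINT \<omega>|M. (1 / v) *\<^sub>R (V \<omega> * iexp (a * Z \<omega>)))"
        by (simp add: scaleR_conv_of_real)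
      also have "\<dots> = (1 / v) *\<^sub>R (CLINT \<omega>|M. V \<omega> * iexp (a * Z \<omega>))"
        by (rule integral_scaleR_right)
      also have "\<dots> = char (distr M borel Z) a"
        unfolding char using v by (simp add: v_def[symmetric] scaleR_conv_of_real)
      finally show "char (distr N borel Z) a = char (distr M borel Z) a" .
    qed
    then have "distr N borel Z = distr M borel Z"
      by (intro Levy_uniqueness N.real_distribution_distr real_distribution_distr) auto
    then have "measure (distr N borel Z) B = measure (distr M borel Z) B" by simp
    then have "measure N (Z -` B \<inter> space N) = prob (Z -` B \<inter> space M)"
      by (simp add: measure_distr)
    moreover have "measure N (Z -` B \<inter> space N) = (\<integral>\<omega>. indicator B (Z \<omega>) \<partial>N)"
      by (subst Bochner_Integration.integral_cong[OF refl, of N _ "indicator (Z -` B \<inter> space N)"])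
         (auto simp: indicator_def)
    moreover have "(\<integral>\<omega>. indicator B (Z \<omega>) \<partial>N) = (\<integral>\<omega>. V \<omega> / v * indicator B (Z \<omega>) \<partial>M)"
      unfolding N_def using V v by (subst integral_density) auto
    moreover have "\<dots> = (\<integral>\<omega>. V \<omega> * indicator B (Z \<omega>) \<partial>M) / v" by simp
    ultimately show ?thesis using v by (simp add: v_def[symmetric] field_simps)
  qed
qed

lemma Re_integral_mult_iexp:
  assumes "integrable M (\<lambda>\<omega>. complex_of_real (P \<omega>) * iexp (\<theta> \<omega>))"
  shows "(\<integral>\<omega>. P \<omega> * cos (\<theta> \<omega>) \<partial>M) = Re (CLINT \<omega>|M. P \<omega> * iexp (\<theta> \<omega>))"
    and "(\<integral>\<omega>. P \<omega> * sin (\<theta> \<omega>) \<partial>M) = Im (CLINT \<omega>|M. P \<omega> * iexp (\<theta> \<omega>))"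
  using assms by (simp_all flip: integral_Re integral_Im add: Re_exp Im_exp)

text \<open>The weights \<open>P\<close>, \<open>P (1 + cos \<theta>)\<close> and \<open>P (1 + sin \<theta>)\<close> are nonnegative and together determine the
  complex weight \<open>P exp(i\<theta>)\<close>, to which the uniqueness theorem does not apply directly.\<close>

lemma (in prob_space) complex_weighted_prob_if_weighted_char:
  fixes Z P \<theta> :: "'a \<Rightarrow> real"
  assumes [measurable]: "Z \<in> borel_measurable M" "P \<in> borel_measurable M" "\<theta> \<in> borel_measurable M" "B \<in> sets borel"
    and P: "\<And>\<omega>. 0 \<le> P \<omega>" "\<And>\<omega>. P \<omega> \<le> 1"
    and char: "\<And>a s. (CLINT \<omega>|M. P \<omega> * iexp (a * Z \<omega> + s * \<theta> \<omega>))
      = char (distr M borel Z) a * (CLINT \<omega>|M. P \<omega> * iexp (s * \<theta> \<omega>))"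
  shows "(CLINT \<omega>|M. (P \<omega> * indicator B (Z \<omega>)) * iexp (\<theta> \<omega>)) =
    prob (Z -` B \<inter> space M) * (CLINT \<omega>|M. P \<omega> * iexp (\<theta> \<omega>))"
proof -
  have intP: "integrable M (\<lambda>\<omega>. complex_of_real (P \<omega>) * iexp (f \<omega>))"
    if "f \<in> borel_measurable M" for f
    by (rule integrable_const_bound[of _ 1]) (use P that in \<open>auto simp: norm_mult\<close>)
  have intPI: "integrable M (\<lambda>\<omega>. complex_of_real (P \<omega> * indicator B (Z \<omega>)) * iexp (f \<omega>))"
    if "f \<in> borel_measurable M" for f
    by (rule integrable_const_bound[of _ 1]) (use P that in \<open>auto simp: norm_mult indicator_def\<close>)
  have bnd: "integrable M f" if "f \<in> borel_measurable M" "\<And>\<omega>. \<bar>f \<omega>\<bar> \<le> 1" for f :: "'a \<Rightarrow> real"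
    by (rule integrable_const_bound[of _ 1]) (use that in auto)
  have le1: "\<bar>P \<omega> * x\<bar> \<le> 1" if "\<bar>x\<bar> \<le> 1" for \<omega> x
    using P[of \<omega>] that by (simp add: abs_mult mult_le_one)
  have le1': "\<bar>P \<omega> * (x * indicator B (Z \<omega>))\<bar> \<le> 1" if "\<bar>x\<bar> \<le> 1" for \<omega> x
    using that by (intro le1) (auto simp: indicator_def)
  have ints [simp]: "integrable M P" "integrable M (\<lambda>\<omega>. P \<omega> * cos (\<theta> \<omega>))" "integrable M (\<lambda>\<omega>. P \<omega> * sin (\<theta> \<omega>))"
     "integrable M (\<lambda>\<omega>. P \<omega> * indicator B (Z \<omega>))"
     "integrable M (\<lambda>\<omega>. P \<omega> * (cos (\<theta> \<omega>) * indicator B (Z \<omega>)))"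
     "integrable M (\<lambda>\<omega>. P \<omega> * (sin (\<theta> \<omega>) * indicator B (Z \<omega>)))"
    using P by (auto intro!: bnd le1 le1' simp: indicator_def)
  define cf where "cf = char (distr M borel Z)"
  define p where "p = prob (Z -` B \<inter> space M)"
  have weight: "(\<integral>\<omega>. V \<omega> * indicator B (Z \<omega>) \<partial>M) = p * (\<integral>\<omega>. V \<omega> \<partial>M)"
    if "V \<in> borel_measurable M" "\<And>\<omega>. 0 \<le> V \<omega>" "\<And>\<omega>. V \<omega> \<le> 2"
      "\<And>a. (CLINT \<omega>|M. V \<omega> * iexp (a * Z \<omega>)) = cf a * complex_of_real (\<integral>\<omega>. V \<omega> \<partial>M)" for V
    unfolding p_def using that by (intro weighted_prob_if_weighted_char[of Z V B 2]) (auto simp: cf_def)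
  have p0: "(\<integral>\<omega>. P \<omega> * indicator B (Z \<omega>) \<partial>M) = p * (\<integral>\<omega>. P \<omega> \<partial>M)"
    using char[of _ 0] P order_trans[OF P(2), of 2] by (intro weight) (auto simp: cf_def)
  have pc: "(\<integral>\<omega>. P \<omega> * cos (\<theta> \<omega> + c) * indicator B (Z \<omega>) \<partial>M) = p * (\<integral>\<omega>. P \<omega> * cos (\<theta> \<omega> + c) \<partial>M)" for c
  proof -
    have int2: "integrable M (\<lambda>\<omega>. P \<omega> * cos (\<theta> \<omega> + c) * indicator B (Z \<omega>))"
      "integrable M (\<lambda>\<omega>. P \<omega> * cos (\<theta> \<omega> + c))"
      by (rule bnd; use le1 le1' in \<open>simp add: mult.assoc\<close>)+
    have trig: "complex_of_real (1 + cos y) * iexp x = iexp x + (1 / 2) * (iexp (x + y) + iexp (x - y))" for x y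
      by (simp add: complex_eq_iff Re_exp Im_exp cos_add cos_diff sin_add sin_diff field_simps)
    define K where "K = (\<lambda>a s. CLINT \<omega>|M. P \<omega> * iexp (a * Z \<omega> + s * \<theta> \<omega>))"
    have K: "K a s = cf a * K 0 s" for a s
      using char[of a s] by (simp add: K_def cf_def)
    have expand: "(CLINT \<omega>|M. complex_of_real (P \<omega> * (1 + cos (\<theta> \<omega> + c))) * iexp (a * Z \<omega>)) =
      K a 0 + (1 / 2) * (iexp c * K a 1 + iexp (-c) * K a (-1))" for a
    proof -
      have "complex_of_real (P \<omega> * (1 + cos (\<theta> \<omega> + c))) * iexp (a * Z \<omega>) =
        P \<omega> * iexp (a * Z \<omega> + 0 * \<theta> \<omega>) + (1 / 2) * (iexp c * (P \<omega> * iexp (a * Z \<omega> + 1 * \<theta> \<omega>))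
          + iexp (-c) * (P \<omega> * iexp (a * Z \<omega> + (-1) * \<theta> \<omega>)))" for \<omega>
      proof -
        have "complex_of_real (P \<omega> * (1 + cos (\<theta> \<omega> + c))) * iexp (a * Z \<omega>) =
            P \<omega> * (complex_of_real (1 + cos (\<theta> \<omega> + c)) * iexp (a * Z \<omega>))" by simp
        also have "\<dots> = P \<omega> * (iexp (a * Z \<omega>) + (1 / 2) *
            (iexp (a * Z \<omega> + (\<theta> \<omega> + c)) + iexp (a * Z \<omega> - (\<theta> \<omega> + c))))"
          by (subst trig) simp
        also have "iexp (a * Z \<omega> + (\<theta> \<omega> + c)) = iexp c * iexp (a * Z \<omega> + 1 * \<theta> \<omega>)"
          by (subst exp_add[symmetric]) (simp add: algebra_simps)
        also have "iexp (a * Z \<omega> - (\<theta> \<omega> + c)) = iexp (-c) * iexp (a * Z \<omega> + (-1) * \<theta> \<omega>)"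
          by (subst exp_add[symmetric]) (simp add: algebra_simps)
        finally show ?thesis by (simp add: algebra_simps)
      qed
      moreover have i: "integrable M (\<lambda>\<omega>. P \<omega> * iexp (a * Z \<omega> + s * \<theta> \<omega>))" for s
        by (rule intP) simp
      ultimately show ?thesis
        unfolding K_def
        by (simp only: Bochner_Integration.integral_add Bochner_Integration.integrable_add
            integral_mult_right_zero Bochner_Integration.integrable_mult_right i)
    qed
    have "(\<integral>\<omega>. (P \<omega> * (1 + cos (\<theta> \<omega> + c))) * indicator B (Z \<omega>) \<partial>M)
        = p * (\<integral>\<omega>. P \<omega> * (1 + cos (\<theta> \<omega> + c)) \<partial>M)"
    proof (rule weight)
      fix a \<omega>
      show "0 \<le> P \<omega> * (1 + cos (\<theta> \<omega> + c))"
        using P[of \<omega>] cos_ge_minus_one[of "\<theta> \<omega> + c"] by (intro mult_nonneg_nonneg) linarith+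
      have "0 \<le> 1 + cos (\<theta> \<omega> + c)" using cos_ge_minus_one[of "\<theta> \<omega> + c"] by linarith
      then show "P \<omega> * (1 + cos (\<theta> \<omega> + c)) \<le> 2"
        using P[of \<omega>] mult_mono[of "P \<omega>" 1 "1 + cos (\<theta> \<omega> + c)" 2] by simp
      have "complex_of_real (\<integral>\<omega>. P \<omega> * (1 + cos (\<theta> \<omega> + c)) \<partial>M) =
          (CLINT \<omega>|M. complex_of_real (P \<omega> * (1 + cos (\<theta> \<omega> + c))) * iexp (0 * Z \<omega>))"
        by (subst integral_complex_of_real[symmetric]) simp
      note mean = this[unfolded expand]
      show "(CLINT \<omega>|M. complex_of_real (P \<omega> * (1 + cos (\<theta> \<omega> + c))) * iexp (a * Z \<omega>)) =
          cf a * complex_of_real (\<integral>\<omega>. P \<omega> * (1 + cos (\<theta> \<omega> + c)) \<partial>M)"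
        unfolding expand mean K[of a] by (simp add: algebra_simps)
    qed simp
    then show ?thesis
      using p0 int2 ints by (simp add: distrib_left distrib_right)
  qed
  have pcos: "(\<integral>\<omega>. (P \<omega> * indicator B (Z \<omega>)) * cos (\<theta> \<omega>) \<partial>M) = p * (\<integral>\<omega>. P \<omega> * cos (\<theta> \<omega>) \<partial>M)"
    using pc[of 0] by (simp add: mult_ac)
  have psin: "(\<integral>\<omega>. (P \<omega> * indicator B (Z \<omega>)) * sin (\<theta> \<omega>) \<partial>M) = p * (\<integral>\<omega>. P \<omega> * sin (\<theta> \<omega>) \<partial>M)"
    using pc[of "- (pi / 2)"] by (simp add: mult_ac cos_diff)
  show ?thesis
    unfolding p_def[symmetric]
    using pcos psin Re_integral_mult_iexp[of M "\<lambda>\<omega>. P \<omega> * indicator B (Z \<omega>)" \<theta>]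
      Re_integral_mult_iexp[of M P \<theta>] intP[of \<theta>] intPI[of \<theta>]
    by (simp add: complex_eq_iff)
qed

text \<open>Kac's theorem: real random variables whose joint characteristic function factorises are
  independent. The exponentials are traded for indicators one variable at a time.\<close>

theorem (in prob_space) indep_vars_if_char_factorises:
  fixes Z :: "'i \<Rightarrow> 'a \<Rightarrow> real"
  assumes fin: "finite I" and rv: "\<And>k. k \<in> I \<Longrightarrow> Z k \<in> borel_measurable M"
    and char: "\<And>a :: 'i \<Rightarrow> real. (CLINT \<omega>|M. iexp (\<Sum>k\<in>I. a k * Z k \<omega>))
      = (\<Prod>k\<in>I. char (distr M borel (Z k)) (a k))"
  shows "indep_vars (\<lambda>_. borel) Z I"
proof (rule indep_vars_finite_borelI[OF prob_space_axioms fin rv])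
  fix B :: "'i \<Rightarrow> real set" assume "I \<noteq> {}" and B: "\<And>k. k \<in> I \<Longrightarrow> B k \<in> sets borel"
  have step: "(CLINT \<omega>|M. complex_of_real (\<Prod>j\<in>J. indicator (B j) (Z j \<omega>)) * iexp (\<Sum>k\<in>I - J. a k * Z k \<omega>))
      = (\<Prod>j\<in>J. prob (Z j -` B j \<inter> space M)) * (\<Prod>k\<in>I - J. char (distr M borel (Z k)) (a k))"
    if "J \<subseteq> I" for J and a :: "'i \<Rightarrow> real"
    using finite_subset[OF that fin] that
  proof (induction J arbitrary: a)
    case empty
    then show ?case using char by simp
  next
    case (insert j J)
    define K where "K = I - insert j J"
    have K: "I - J = insert j K" "j \<notin> K" "finite K" "K \<subseteq> I"
      using insert fin by (auto simp: K_def)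
    have jI: "j \<in> I" "J \<subseteq> I" using insert by auto
    have meas [measurable]: "\<And>k. k \<in> K \<Longrightarrow> Z k \<in> borel_measurable M" "Z j \<in> borel_measurable M"
       "B j \<in> sets borel"
      using rv B K jI by auto
    define P where "P = (\<lambda>\<omega>. \<Prod>j\<in>J. indicator (B j) (Z j \<omega>) :: real)"
    have [measurable]: "P \<in> borel_measurable M"
      unfolding P_def
    proof (intro borel_measurable_prod)
      fix i assume "i \<in> J"
      then have [measurable]: "Z i \<in> borel_measurable M" "B i \<in> sets borel" using jI rv B by auto
      show "(\<lambda>\<omega>. indicator (B i) (Z i \<omega>) :: real) \<in> borel_measurable M" by simp
    qed
    have P: "0 \<le> P \<omega>" "P \<omega> \<le> 1" for \<omega>
      unfolding P_def by (auto intro!: prod_nonneg prod_le_1)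
    define \<theta> where "\<theta> = (\<lambda>\<omega>. \<Sum>k\<in>K. a k * Z k \<omega>)"
    have [measurable]: "\<theta> \<in> borel_measurable M" unfolding \<theta>_def by simp
    let ?c = "complex_of_real (\<Prod>j\<in>J. prob (Z j -` B j \<inter> space M))"
    have IH: "(CLINT \<omega>|M. P \<omega> * iexp (b * Z j \<omega> + s * \<theta> \<omega>)) =
        ?c * (char (distr M borel (Z j)) b * (\<Prod>k\<in>K. char (distr M borel (Z k)) (s * a k)))" for b s
    proof -
      have "(\<Sum>k\<in>I - J. ((\<lambda>k. s * a k)(j := b)) k * Z k \<omega>) = b * Z j \<omega> + s * \<theta> \<omega>" for \<omega>
        unfolding K(1) using K(2,3)
        by (simp add: \<theta>_def sum_distrib_left mult_ac) (auto intro!: sum.cong)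
      moreover have "(\<Prod>k\<in>K. char (distr M borel (Z k)) (if k = j then b else s * a k)) =
          (\<Prod>k\<in>K. char (distr M borel (Z k)) (s * a k))"
        using K(2) by (intro prod.cong) auto
      ultimately show ?thesis
        using insert.IH[of "(\<lambda>k. s * a k)(j := b)"] jI K by (simp add: P_def)
    qed
    have char0: "char (distr M borel (Z j)) 0 = 1"
      by (intro real_distribution.char_zero) auto
    have "(CLINT \<omega>|M. (P \<omega> * indicator (B j) (Z j \<omega>)) * iexp (\<theta> \<omega>)) =
        prob (Z j -` B j \<inter> space M) * (CLINT \<omega>|M. P \<omega> * iexp (\<theta> \<omega>))"
    proof (rule complex_weighted_prob_if_weighted_char)
      show "(CLINT \<omega>|M. P \<omega> * iexp (b * Z j \<omega> + s * \<theta> \<omega>)) = char (distr M borel (Z j)) b *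
          (CLINT \<omega>|M. P \<omega> * iexp (s * \<theta> \<omega>))" for b s
        using IH[of b s] IH[of 0 s] char0 by simp
    qed (use P in auto)
    also have "(CLINT \<omega>|M. P \<omega> * iexp (\<theta> \<omega>)) = ?c * (\<Prod>k\<in>K. char (distr M borel (Z k)) (a k))"
      using IH[of 0 1] char0 by simp
    finally show ?case
      unfolding K_def[symmetric] \<theta>_def P_def using insert.hyps by (simp add: mult_ac)
  qed
  show "prob (\<Inter>k\<in>I. Z k -` B k \<inter> space M) = (\<Prod>k\<in>I. prob (Z k -` B k \<inter> space M))"
  proof -
    have "(\<Inter>k\<in>I. Z k -` B k \<inter> space M) \<in> sets M"
      using \<open>I \<noteq> {}\<close> fin rv B by (intro sets.finite_INT measurable_sets[OF rv]) auto
    then have "complex_of_real (prob (\<Inter>k\<in>I. Z k -` B k \<inter> space M)) =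
        complex_of_real (\<integral>\<omega>. indicator (\<Inter>k\<in>I. Z k -` B k \<inter> space M) \<omega> \<partial>M)" by simp
    also have "\<dots> = complex_of_real (\<integral>\<omega>. (\<Prod>k\<in>I. indicator (B k) (Z k \<omega>)) \<partial>M)"
      using \<open>I \<noteq> {}\<close> fin
      by (intro arg_cong[of _ _ complex_of_real] Bochner_Integration.integral_cong)
         (auto simp: indicator_def prod_zero_iff)
    also have "\<dots> = (\<Prod>k\<in>I. prob (Z k -` B k \<inter> space M))"
      using step[of I "\<lambda>_. 0"] by (simp flip: integral_complex_of_real)
    finally show ?thesis using of_real_eq_iff by blast
  qed
qed

section \<open>The Cayley transform of a positive semidefinite matrix\<close>

definition quad_form :: "'i set \<Rightarrow> ('i \<Rightarrow> 'i \<Rightarrow> real) \<Rightarrow> ('i \<Rightarrow> real) \<Rightarrow> ('i \<Rightarrow> real) \<Rightarrow> real" where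
  "quad_form I G u v = (\<Sum>i\<in>I. \<Sum>j\<in>I. u i * v j * G i j)"

text \<open>Gaussian elimination: the pivots \<open>1 + G k k\<close> are positive, and the Schur complement of a
  positive semidefinite matrix is again positive semidefinite.\<close>

lemma solve_identity_plus_psd:
  fixes G :: "'i \<Rightarrow> 'i \<Rightarrow> real" and b :: "'i \<Rightarrow> real"
  assumes "finite I"
    and "\<And>i j. i \<in> I \<Longrightarrow> j \<in> I \<Longrightarrow> G i j = G j i"
    and "\<And>v. 0 \<le> quad_form I G v v"
  shows "\<exists>x. \<forall>i\<in>I. x i + (\<Sum>j\<in>I. G i j * x j) = b i"
  using assms
proof (induction I arbitrary: G b rule: finite_induct)
  case empty
  then show ?case by simp
next
  case (insert k I)
  define p where "p = 1 + G k k"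
  have sym: "G i j = G j i" if "i \<in> insert k I" "j \<in> insert k I" for i j
    using insert.prems(1) that by blast
  have quad: "quad_form (insert k I) G (v(k := t)) (v(k := t)) =
      quad_form I G v v + 2 * t * (\<Sum>i\<in>I. v i * G i k) + t\<^sup>2 * G k k" for v t
  proof -
    define w where "w = v(k := t)"
    have upd: "w i = v i" if "i \<in> I" for i using that insert.hyps by (auto simp: w_def)
    have wk: "w k = t" by (simp add: w_def)
    have "quad_form (insert k I) G w w =
      (t * t * G k k + (\<Sum>j\<in>I. t * v j * G k j)) + (\<Sum>i\<in>I. v i * t * G i k + (\<Sum>j\<in>I. v i * v j * G i j))"
      unfolding quad_form_def using insert.hyps by (simp add: upd wk cong: sum.cong)
    also have "(\<Sum>j\<in>I. t * v j * G k j) = t * (\<Sum>i\<in>I. v i * G i k)"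
      by (simp add: sum_distrib_left mult_ac sym cong: sum.cong)
    also have "(\<Sum>i\<in>I. v i * t * G i k + (\<Sum>j\<in>I. v i * v j * G i j)) =
        t * (\<Sum>i\<in>I. v i * G i k) + quad_form I G v v"
      by (simp add: sum.distrib sum_distrib_left quad_form_def mult_ac)
    finally show ?thesis unfolding w_def[symmetric] by (simp add: power2_eq_square)
  qed
  have "0 \<le> G k k"
    using insert.prems(2)[of "(\<lambda>_. 0)(k := 1)"] unfolding quad by (simp add: quad_form_def)
  then have p: "0 < p" "G k k \<le> p" by (simp_all add: p_def)
  define G' where "G' = (\<lambda>i j. G i j - G i k * G k j / p)"
  have "0 \<le> quad_form I G' v v" for v
  proof -
    define s where "s = (\<Sum>i\<in>I. v i * G i k)"
    have "quad_form I G' v v = quad_form I G v v - (\<Sum>i\<in>I. \<Sum>j\<in>I. (v i * G i k) * (v j * G j k)) / p"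
      unfolding quad_form_def G'_def sum_divide_distrib sum_subtractf[symmetric]
      by (intro sum.cong refl) (simp add: sym algebra_simps diff_divide_distrib)
    also have "(\<Sum>i\<in>I. \<Sum>j\<in>I. (v i * G i k) * (v j * G j k)) = s\<^sup>2"
      by (simp add: s_def power2_eq_square sum_product)
    finally have *: "quad_form I G' v v = quad_form I G v v - s\<^sup>2 / p" .
    have "0 \<le> quad_form I G v v + 2 * (- s / p) * s + (- s / p)\<^sup>2 * G k k"
      using insert.prems(2)[of "v(k := - s / p)"] unfolding quad s_def .
    also have "(- s / p)\<^sup>2 * G k k \<le> (- s / p)\<^sup>2 * p"
      using p by (intro mult_left_mono) auto
    also have "(- s / p)\<^sup>2 * p = s\<^sup>2 / p" using p by (simp add: power2_eq_square)
    finally show ?thesis using * by (simp add: power2_eq_square)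
  qed
  moreover have "G' i j = G' j i" if "i \<in> I" "j \<in> I" for i j
    using that by (simp add: G'_def sym)
  ultimately obtain x where x: "\<And>i. i \<in> I \<Longrightarrow> x i + (\<Sum>j\<in>I. G' i j * x j) = b i - G i k * b k / p"
    using insert.IH[of G' "\<lambda>i. b i - G i k * b k / p"] by blast
  define xk where "xk = (b k - (\<Sum>j\<in>I. G k j * x j)) / p"
  have sumx: "(\<Sum>j\<in>I. G i j * (x(k := xk)) j) = (\<Sum>j\<in>I. G i j * x j)" for i
    using insert.hyps by (intro sum.cong) auto
  show ?case
  proof (intro exI[of _ "x(k := xk)"] ballI)
    fix i assume i: "i \<in> insert k I"
    show "(x(k := xk)) i + (\<Sum>j\<in>insert k I. G i j * (x(k := xk)) j) = b i"
    proof (cases "i = k")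
      case True
      have "xk * p = b k - (\<Sum>j\<in>I. G k j * x j)" using p by (simp add: xk_def)
      then show ?thesis
        using True unfolding sum.insert[OF insert.hyps] sumx by (simp add: p_def algebra_simps)
    next
      case False
      then have iI: "i \<in> I" using i by auto
      have "(\<Sum>j\<in>I. G' i j * x j) = (\<Sum>j\<in>I. G i j * x j) - G i k * (\<Sum>j\<in>I. G k j * x j) / p"
        by (simp add: G'_def left_diff_distrib right_diff_distrib sum_subtractf sum_distrib_left sum_divide_distrib mult_ac)
      then have "x i + (\<Sum>j\<in>I. G i j * x j) + G i k * xk = b i"
        using x[OF iI] p by (simp add: xk_def field_simps)
      then show ?thesis
        using False unfolding sum.insert[OF insert.hyps] sumx by simp
    qed
  qed
qed

lemma sum_of_bool_eq [simp]:
  fixes f :: "'i \<Rightarrow> real"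
  assumes "finite I"
  shows "(\<Sum>j\<in>I. of_bool (i = j) * f j) = of_bool (i \<in> I) * f i"
    "(\<Sum>j\<in>I. of_bool (j = i) * f j) = of_bool (i \<in> I) * f i"
    "(\<Sum>j\<in>I. f j * of_bool (i = j)) = of_bool (i \<in> I) * f i"
    "(\<Sum>j\<in>I. f j * of_bool (j = i)) = of_bool (i \<in> I) * f i"
  using assms by (auto simp: of_bool_def if_distrib[of "\<lambda>x. _ * x"] if_distrib[of "\<lambda>x. x * _"] cong: if_cong)

text \<open>\<open>D = (1 - G)(1 + G)\<^sup>-\<^sup>1\<close>. For a Gaussian vector \<open>y\<close> with covariance \<open>G\<close> and an independent standard
  Gaussian vector \<open>n\<close>, the vector \<open>(1 + D) y + D n\<close> has covariance
  \<open>(1 + D) G (1 + D) + D\<^sup>2 = (1 + D)(1 - D) + D\<^sup>2 = 1\<close>, and its covariance with \<open>y\<close> is \<open>1 - D\<close>. Hence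
  \<open>(1 + D) y + D n\<close> is a standard Gaussian vector, close to \<open>y\<close> when \<open>D\<close> is small, and \<open>D\<close> is a rational
  function of \<open>G\<close>.\<close>

locale cayley =
  fixes I :: "'i set" and G D :: "'i \<Rightarrow> 'i \<Rightarrow> real"
  assumes finite_I: "finite I"
    and G_sym: "\<And>i j. i \<in> I \<Longrightarrow> j \<in> I \<Longrightarrow> G i j = G j i"
    and G_psd: "\<And>v. 0 \<le> quad_form I G v v"
    and G_diag: "\<And>i. i \<in> I \<Longrightarrow> G i i = 1"
    and D_sym: "\<And>i j. i \<in> I \<Longrightarrow> j \<in> I \<Longrightarrow> D i j = D j i"
    and D_eq: "\<And>i j. i \<in> I \<Longrightarrow> j \<in> I \<Longrightarrow> D i j + (\<Sum>k\<in>I. G i k * D k j) = of_bool (i = j) - G i j"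
begin

lemma G_mult_1_plus_D:
  assumes "i \<in> I" "j \<in> I"
  shows "(\<Sum>k\<in>I. G i k * (of_bool (k = j) + D k j)) = of_bool (i = j) - D i j"
  using D_eq[OF assms] assms finite_I by (simp add: distrib_left sum.distrib)

lemma cayley_cov:
  assumes "i \<in> I" "j \<in> I"
  shows "quad_form I G (\<lambda>k. of_bool (k = i) + D k i) (\<lambda>k. of_bool (k = j) + D k j)
    + (\<Sum>k\<in>I. D k i * D k j) = of_bool (i = j)"
proof -
  have "quad_form I G (\<lambda>k. of_bool (k = i) + D k i) (\<lambda>k. of_bool (k = j) + D k j) =
      (\<Sum>k\<in>I. (of_bool (k = i) + D k i) * (\<Sum>l\<in>I. G k l * (of_bool (l = j) + D l j)))"
    by (simp add: quad_form_def sum_distrib_left mult_ac)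
  also have "\<dots> = (\<Sum>k\<in>I. (of_bool (k = i) + D k i) * (of_bool (k = j) - D k j))"
    using assms by (intro sum.cong refl) (simp add: G_mult_1_plus_D)
  also have "\<dots> = of_bool (i = j) - D i j + D j i - (\<Sum>k\<in>I. D k i * D k j)"
    using assms finite_I
    by (simp add: distrib_left distrib_right right_diff_distrib left_diff_distrib sum.distrib sum_subtractf)
  finally show ?thesis using D_sym[OF assms] by simp
qed

lemma cayley_cross_cov:
  assumes "i \<in> I" "j \<in> I"
  shows "quad_form I G (\<lambda>k. of_bool (k = i)) (\<lambda>k. of_bool (k = j) + D k j) = of_bool (i = j) - D i j"
proof -
  have "quad_form I G (\<lambda>k. of_bool (k = i)) (\<lambda>k. of_bool (k = j) + D k j) =
      (\<Sum>k\<in>I. of_bool (k = i) * (\<Sum>l\<in>I. G k l * (of_bool (l = j) + D l j)))"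
    by (simp add: quad_form_def sum_distrib_left mult_ac)
  then show ?thesis using assms finite_I by (simp add: G_mult_1_plus_D)
qed

text \<open>In \<open>1 - G = D + G D\<close> the cross term between \<open>D\<close> and \<open>G D\<close> is nonnegative because \<open>G\<close> is, so the Frobenius
  norm of \<open>D\<close> is at most that of \<open>1 - G\<close>.\<close>

lemma sum_D_sq_le: "(\<Sum>i\<in>I. \<Sum>j\<in>I. (D i j)\<^sup>2) \<le> (\<Sum>i\<in>I. \<Sum>j\<in>I - {i}. (G i j)\<^sup>2)"
proof -
  have "(\<Sum>i\<in>I. (D i j)\<^sup>2) \<le> (\<Sum>i\<in>I. (of_bool (i = j) - G i j)\<^sup>2)" if j: "j \<in> I" for j
  proof -
    define g where "g = (\<lambda>i. \<Sum>k\<in>I. G i k * D k j)"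
    have "(\<Sum>i\<in>I. D i j * g i) = quad_form I G (\<lambda>k. D k j) (\<lambda>k. D k j)"
      by (simp add: g_def quad_form_def sum_distrib_left mult_ac)
    then have 1: "0 \<le> (\<Sum>i\<in>I. D i j * g i)" using G_psd by simp
    have "(\<Sum>i\<in>I. (of_bool (i = j) - G i j)\<^sup>2) = (\<Sum>i\<in>I. (D i j + g i)\<^sup>2)"
      using j by (intro sum.cong refl) (simp add: D_eq[symmetric] g_def)
    also have "\<dots> = (\<Sum>i\<in>I. (D i j)\<^sup>2) + 2 * (\<Sum>i\<in>I. D i j * g i) + (\<Sum>i\<in>I. (g i)\<^sup>2)"
      by (simp add: power2_sum sum.distrib sum_distrib_left mult_ac)
    finally show ?thesis using 1 sum_nonneg[of I "\<lambda>i. (g i)\<^sup>2"] by simp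
  qed
  then have "(\<Sum>j\<in>I. \<Sum>i\<in>I. (D i j)\<^sup>2) \<le> (\<Sum>j\<in>I. \<Sum>i\<in>I. (of_bool (i = j) - G i j)\<^sup>2)"
    by (rule sum_mono)
  also have "\<dots> = (\<Sum>i\<in>I. \<Sum>j\<in>I. (of_bool (i = j) - G i j)\<^sup>2)" by (rule sum.swap)
  also have "\<dots> = (\<Sum>i\<in>I. \<Sum>j\<in>I - {i}. (G i j)\<^sup>2)"
  proof (rule sum.cong[OF refl])
    fix i assume i: "i \<in> I"
    have "(\<Sum>j\<in>I. (of_bool (i = j) - G i j)\<^sup>2) =
        (of_bool (i = i) - G i i)\<^sup>2 + (\<Sum>j\<in>I - {i}. (of_bool (i = j) - G i j)\<^sup>2)"
      by (rule sum.remove[OF finite_I i])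
    also have "(\<Sum>j\<in>I - {i}. (of_bool (i = j) - G i j)\<^sup>2) = (\<Sum>j\<in>I - {i}. (G i j)\<^sup>2)"
      by (intro sum.cong) auto
    finally show "(\<Sum>j\<in>I. (of_bool (i = j) - G i j)\<^sup>2) = (\<Sum>j\<in>I - {i}. (G i j)\<^sup>2)"
      using G_diag[OF i] by simp
  qed
  finally show ?thesis by (subst sum.swap) simp
qed

text \<open>The diagonal of the defining equation gives \<open>2 D i i\<close> as a sum of products \<open>- G i k * D i k\<close>; the
  trace is therefore of second order in the off-diagonal entries, although \<open>D\<close> itself is of first order.\<close>

lemma trace_D_le: "2 * (\<Sum>i\<in>I. D i i) \<le> (\<Sum>i\<in>I. \<Sum>j\<in>I - {i}. (G i j)\<^sup>2)"
proof -
  have diag: "2 * D i i = - (\<Sum>k\<in>I - {i}. G i k * D i k)" if i: "i \<in> I" for i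
  proof -
    have "(\<Sum>k\<in>I. G i k * D k i) = G i i * D i i + (\<Sum>k\<in>I - {i}. G i k * D k i)"
      by (rule sum.remove[OF finite_I i])
    moreover have "(\<Sum>k\<in>I - {i}. G i k * D k i) = (\<Sum>k\<in>I - {i}. G i k * D i k)"
      using i by (intro sum.cong) (auto simp: D_sym)
    ultimately show ?thesis using D_eq[OF i i] G_diag[OF i] by simp
  qed
  have young: "- (x * y) \<le> (x\<^sup>2 + y\<^sup>2) / 2" for x y :: real
    using zero_le_power2[of "x + y"] by (simp add: power2_sum)
  have "2 * (\<Sum>i\<in>I. D i i) = (\<Sum>i\<in>I. \<Sum>k\<in>I - {i}. - (G i k * D i k))"
    by (simp add: sum_distrib_left diag sum_negf cong: sum.cong)
  also have "\<dots> \<le> (\<Sum>i\<in>I. \<Sum>k\<in>I - {i}. ((G i k)\<^sup>2 + (D i k)\<^sup>2) / 2)"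
    by (intro sum_mono young)
  also have "\<dots> = ((\<Sum>i\<in>I. \<Sum>k\<in>I - {i}. (G i k)\<^sup>2) + (\<Sum>i\<in>I. \<Sum>k\<in>I - {i}. (D i k)\<^sup>2)) / 2"
    by (simp add: sum.distrib sum_divide_distrib add_divide_distrib)
  also have "(\<Sum>i\<in>I. \<Sum>k\<in>I - {i}. (D i k)\<^sup>2) \<le> (\<Sum>i\<in>I. \<Sum>k\<in>I. (D i k)\<^sup>2)"
    using finite_I by (intro sum_mono sum_mono2) auto
  also have "\<dots> \<le> (\<Sum>i\<in>I. \<Sum>j\<in>I - {i}. (G i j)\<^sup>2)" by (rule sum_D_sq_le)
  finally show ?thesis by simp
qed

end

text \<open>With \<open>B = (1 + G)\<^sup>-\<^sup>1\<close>, the matrix is \<open>D = 2 B - 1\<close>.\<close>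

lemma cayley_exists:
  fixes G :: "'i \<Rightarrow> 'i \<Rightarrow> real"
  assumes fin: "finite I"
    and sym: "\<And>i j. i \<in> I \<Longrightarrow> j \<in> I \<Longrightarrow> G i j = G j i"
    and psd: "\<And>v. 0 \<le> quad_form I G v v"
    and diag: "\<And>i. i \<in> I \<Longrightarrow> G i i = 1"
  obtains D where "cayley I G D"
proof -
  have "\<forall>j. \<exists>x. \<forall>i\<in>I. x i + (\<Sum>k\<in>I. G i k * x k) = of_bool (i = j)"
    by (intro allI solve_identity_plus_psd fin sym psd)
  then obtain B where B: "\<And>i j. i \<in> I \<Longrightarrow> B j i + (\<Sum>k\<in>I. G i k * B j k) = of_bool (i = j)"
    by metis
  \<comment> \<open>The symmetric expression \<open>B = B\<^sup>T (1 + G) B\<close> shows that the inverse is symmetric\<close>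
  have B_eq: "B j i = (\<Sum>k\<in>I. B i k * B j k) + quad_form I G (B i) (B j)" if "i \<in> I" for i j
  proof -
    have "B j i = (\<Sum>k\<in>I. of_bool (k = i) * B j k)" using that fin by simp
    also have "\<dots> = (\<Sum>k\<in>I. (B i k + (\<Sum>l\<in>I. G k l * B i l)) * B j k)"
      by (simp add: B cong: sum.cong)
    also have "\<dots> = (\<Sum>k\<in>I. B i k * B j k) + (\<Sum>k\<in>I. \<Sum>l\<in>I. B i l * B j k * G k l)"
      by (simp add: distrib_right distrib_left sum.distrib sum_distrib_left sum_distrib_right mult_ac)
    also have "(\<Sum>k\<in>I. \<Sum>l\<in>I. B i l * B j k * G k l) = quad_form I G (B i) (B j)"
      unfolding quad_form_def by (subst sum.swap) (intro sum.cong refl, simp add: sym)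
    finally show ?thesis .
  qed
  have quad_sym: "quad_form I G u v = quad_form I G v u" for u v
    unfolding quad_form_def by (subst sum.swap) (intro sum.cong refl, simp add: sym)
  have B_sym: "B j i = B i j" if "i \<in> I" "j \<in> I" for i j
    using B_eq[OF that(1), of j] B_eq[OF that(2), of i] quad_sym[of "B i" "B j"] by (simp add: mult.commute)
  show ?thesis
  proof (rule that[of "\<lambda>i j. 2 * B j i - of_bool (i = j)"], unfold_locales)
    fix i j assume ij: "i \<in> I" "j \<in> I"
    show "2 * B j i - of_bool (i = j) = 2 * B i j - of_bool (j = i)"
      using B_sym[OF ij] by (auto simp: of_bool_def)
    have "(\<Sum>k\<in>I. G i k * (2 * B j k - of_bool (k = j))) = 2 * (\<Sum>k\<in>I. G i k * B j k) - G i j"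
      using ij fin by (simp add: right_diff_distrib sum_subtractf sum_distrib_left mult_ac)
    then show "2 * B j i - of_bool (i = j) + (\<Sum>k\<in>I. G i k * (2 * B j k - of_bool (k = j)))
        = of_bool (i = j) - G i j"
      using B[OF ij(1), of j] by simp
  qed (use assms in auto)
qed

section \<open>Gaussian linear forms mixed with independent Bernoulli variables\<close>

lemma Gaussian_tail_argument_expansion:
  assumes "\<bar>\<rho>\<bar> \<le> 1 / 2"
  shows "\<bar>normal_tail ((b - \<rho> * x) / sqrt (1 - \<rho>\<^sup>2)) - normal_tail b - \<rho> * x * std_normal_density b\<bar>
    \<le> 5 * \<rho>\<^sup>2 * (1 + \<bar>b\<bar> + \<bar>x\<bar>)\<^sup>2"
proof -
  define s u where "s = sqrt (1 - \<rho>\<^sup>2)" and "u = (b - \<rho> * x) / s"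
  define m where "m = 1 + \<bar>b\<bar> + \<bar>x\<bar>"
  have r: "\<rho>\<^sup>2 \<le> 1 / 4"
    using power_mono[OF assms, of 2] by (simp add: power2_eq_square)
  have s: "0 < s" "s \<le> 1" using r by (auto simp: s_def)
  \<comment> \<open>\<open>1 / s \<le> 1 + \<rho>\<^sup>2\<close> because \<open>(1 + r)\<^sup>2 (1 - r) \<ge> 1\<close> for \<open>0 \<le> r \<le> 1 / 4\<close>\<close>
  have "1 \<le> (1 + \<rho>\<^sup>2)\<^sup>2 * (1 - \<rho>\<^sup>2)"
  proof -
    have "\<rho>\<^sup>2 * (\<rho>\<^sup>2 + (\<rho>\<^sup>2)\<^sup>2) \<le> \<rho>\<^sup>2 * (1/4 + (1/4)\<^sup>2)"
      using r by (intro mult_left_mono add_mono power_mono) auto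
    also have "\<dots> \<le> \<rho>\<^sup>2 * 1" by (intro mult_left_mono) (auto simp: power2_eq_square)
    finally show ?thesis by (simp add: power2_eq_square algebra_simps)
  qed
  then have "1 \<le> (1 + \<rho>\<^sup>2) * s"
    using real_sqrt_le_mono[of 1 "(1 + \<rho>\<^sup>2)\<^sup>2 * (1 - \<rho>\<^sup>2)"] by (simp add: s_def real_sqrt_mult)
  then have s1: "1 / s - 1 \<le> \<rho>\<^sup>2" "0 \<le> 1 / s - 1"
    using s by (simp_all add: field_simps)
  have m: "1 \<le> m" "\<bar>b\<bar> + \<bar>x\<bar> \<le> m" by (auto simp: m_def)
  have rho1: "\<bar>\<rho>\<bar> \<le> 1" using assms by simp
  have bx: "\<bar>b - \<rho> * x\<bar> \<le> m"
  proof -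
    have "\<bar>\<rho> * x\<bar> \<le> 1 * \<bar>x\<bar>" unfolding abs_mult using rho1 by (intro mult_right_mono) auto
    then show ?thesis using m by linarith
  qed
  have "u - b + \<rho> * x = (b - \<rho> * x) * (1 / s - 1)" using s by (simp add: u_def field_simps)
  then have e1: "\<bar>u - b + \<rho> * x\<bar> \<le> m * \<rho>\<^sup>2"
    unfolding abs_mult using bx s1 m by (simp add: abs_mult mult_mono)
  have "\<rho>\<^sup>2 \<le> \<bar>\<rho>\<bar> * 1" using rho1 mult_left_mono[of "\<bar>\<rho>\<bar>" 1 "\<bar>\<rho>\<bar>"] by (simp add: power2_eq_square)
  then have "m * \<rho>\<^sup>2 \<le> m * \<bar>\<rho>\<bar>" using m by (intro mult_left_mono) auto
  moreover have "\<bar>\<rho> * x\<bar> \<le> m * \<bar>\<rho>\<bar>" unfolding abs_mult using m mult_left_mono[of "\<bar>x\<bar>" m "\<bar>\<rho>\<bar>"]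
    by (simp add: mult.commute m_def)
  ultimately have "\<bar>u - b\<bar> \<le> 2 * (m * \<bar>\<rho>\<bar>)" using e1 by linarith
  then have "(u - b)\<^sup>2 \<le> (2 * (m * \<bar>\<rho>\<bar>))\<^sup>2" by (metis abs_ge_zero power2_abs power_mono)
  then have e2: "(u - b)\<^sup>2 \<le> 4 * \<rho>\<^sup>2 * m\<^sup>2" by (simp add: power_mult_distrib mult_ac)
  have "\<bar>std_normal_density b * (u - b + \<rho> * x)\<bar> \<le> 1 * (m * \<rho>\<^sup>2)"
    unfolding abs_mult using e1 std_normal_density_le[of b] by (intro mult_mono) auto
  also have "\<dots> \<le> \<rho>\<^sup>2 * m\<^sup>2" using m mult_right_mono[of m "m * m" "\<rho>\<^sup>2"] by (simp add: power2_eq_square mult_ac)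
  finally have e3: "\<bar>std_normal_density b * (u - b + \<rho> * x)\<bar> \<le> \<rho>\<^sup>2 * m\<^sup>2" .
  have "normal_tail u - normal_tail b - \<rho> * x * std_normal_density b =
      (normal_tail u - normal_tail b + std_normal_density b * (u - b)) - std_normal_density b * (u - b + \<rho> * x)"
    by (simp add: algebra_simps)
  then have "\<bar>normal_tail u - normal_tail b - \<rho> * x * std_normal_density b\<bar> \<le> 4 * \<rho>\<^sup>2 * m\<^sup>2 + \<rho>\<^sup>2 * m\<^sup>2"
    using e2 e3 normal_tail_Taylor[of u b] by linarith
  then show ?thesis by (simp add: u_def s_def m_def)
qed

text \<open>Integrating out the component \<open>V\<close> of \<open>\<rho> U + sqrt (1 - \<rho>\<^sup>2) V\<close> turns the event into a Gaussian
  tail, a smooth function of \<open>\<rho>\<close>; the first-order term is the covariance explained by the linear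
  parts, and the remainder is quadratic in \<open>\<rho>\<close> with the weight \<open>Z\<close> still in place.\<close>

lemma (in prob_space) bivariate_tail_expansion:
  fixes u z v :: "'c \<Rightarrow> real"
  assumes indep: "indep_var S X T Y"
    and meas [measurable]: "u \<in> borel_measurable S" "z \<in> borel_measurable S" "v \<in> borel_measurable T"
    and V: "distr M borel (\<lambda>\<omega>. v (Y \<omega>)) = std_normal_distribution"
    and \<rho>: "\<bar>\<rho>\<bar> \<le> 1 / 2"
    and int: "integrable M (\<lambda>\<omega>. \<bar>z (X \<omega>)\<bar> * (1 + \<bar>b\<bar> + \<bar>u (X \<omega>)\<bar>)\<^sup>2)"
  shows "\<bar>(\<integral>\<omega>. z (X \<omega>) * indicator {b..} (\<rho> * u (X \<omega>) + sqrt (1 - \<rho>\<^sup>2) * v (Y \<omega>)) \<partial>M)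
      - (normal_tail b * (\<integral>\<omega>. z (X \<omega>) \<partial>M) + \<rho> * std_normal_density b * (\<integral>\<omega>. z (X \<omega>) * u (X \<omega>) \<partial>M))\<bar>
    \<le> 5 * \<rho>\<^sup>2 * (\<integral>\<omega>. \<bar>z (X \<omega>)\<bar> * (1 + \<bar>b\<bar> + \<bar>u (X \<omega>)\<bar>)\<^sup>2 \<partial>M)"
proof -
  define s where "s = sqrt (1 - \<rho>\<^sup>2)"
  have r: "\<rho>\<^sup>2 \<le> 1 / 4"
    using power_mono[OF \<rho>, of 2] by (simp add: power2_eq_square)
  have s: "0 < s" using r by (auto simp: s_def)
  have rv [measurable]: "random_variable S X" "random_variable T Y"
    using indep indep_var_rv1 indep_var_rv2 by blast+
  define U Z V where "U = (\<lambda>\<omega>. u (X \<omega>))" and "Z = (\<lambda>\<omega>. z (X \<omega>))" and "V = (\<lambda>\<omega>. v (Y \<omega>))"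
  have [measurable]: "U \<in> borel_measurable M" "Z \<in> borel_measurable M" "V \<in> borel_measurable M"
    by (simp_all add: U_def Z_def V_def)
  define m where "m = (\<lambda>\<omega>. 1 + \<bar>b\<bar> + \<bar>U \<omega>\<bar>)"
  have m1: "1 \<le> m \<omega>" "\<bar>U \<omega>\<bar> \<le> m \<omega>" "m \<omega> \<le> (m \<omega>)\<^sup>2" for \<omega>
    using mult_left_mono[of 1 "m \<omega>" "m \<omega>"] by (auto simp: m_def power2_eq_square)
  have int: "integrable M (\<lambda>\<omega>. \<bar>Z \<omega>\<bar> * (m \<omega>)\<^sup>2)"
    using int by (simp add: m_def U_def Z_def)
  have intZ: "integrable M Z"
  proof (rule Bochner_Integration.integrable_bound[OF int])
    have "\<bar>Z \<omega>\<bar> * 1 \<le> \<bar>Z \<omega>\<bar> * (m \<omega>)\<^sup>2" for \<omega>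
      using m1(1,3)[of \<omega>] by (intro mult_left_mono) auto
    then show "AE \<omega> in M. norm (Z \<omega>) \<le> norm (\<bar>Z \<omega>\<bar> * (m \<omega>)\<^sup>2)" by (simp add: abs_mult)
  qed simp
  have intZU: "integrable M (\<lambda>\<omega>. Z \<omega> * U \<omega>)"
  proof (rule Bochner_Integration.integrable_bound[OF int])
    have "\<bar>Z \<omega>\<bar> * \<bar>U \<omega>\<bar> \<le> \<bar>Z \<omega>\<bar> * (m \<omega>)\<^sup>2" for \<omega>
      using m1(2,3)[of \<omega>] by (intro mult_left_mono) auto
    then show "AE \<omega> in M. norm (Z \<omega> * U \<omega>) \<le> norm (\<bar>Z \<omega>\<bar> * (m \<omega>)\<^sup>2)" by (simp add: abs_mult)
  qed simp
  define D E where "D = distr M S X" and "E = distr M T Y"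
  interpret D: prob_space D unfolding D_def by (rule prob_space_distr[OF rv(1)])
  interpret E: prob_space E unfolding E_def by (rule prob_space_distr[OF rv(2)])
  interpret DE: pair_prob_space D E ..
  have joint: "distr M (S \<Otimes>\<^sub>M T) (\<lambda>\<omega>. (X \<omega>, Y \<omega>)) = D \<Otimes>\<^sub>M E"
    using indep unfolding indep_var_distribution_eq D_def E_def by simp
  have sD [measurable_cong]: "sets D = sets S" and sE [measurable_cong]: "sets E = sets T"
    by (simp_all add: D_def E_def)
  have vE: "distr E borel v = std_normal_distribution"
    unfolding E_def V[symmetric] by (subst distr_distr) (auto simp: comp_def)
  define g where "g = (\<lambda>(x, y). z x * indicator {b..} (\<rho> * u x + s * v y) :: real)"
  have g [measurable]: "g \<in> borel_measurable (S \<Otimes>\<^sub>M T)"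
    unfolding g_def by measurable
  have intg: "integrable M (\<lambda>\<omega>. g (X \<omega>, Y \<omega>))"
    by (rule Bochner_Integration.integrable_bound[OF intZ]) (auto simp: g_def indicator_def Z_def)
  have intg': "integrable (D \<Otimes>\<^sub>M E) g"
    unfolding joint[symmetric] using intg by (subst integrable_distr_eq) auto
  have "(\<integral>\<omega>. Z \<omega> * indicator {b..} (\<rho> * U \<omega> + s * V \<omega>) \<partial>M) = (\<integral>x. g x \<partial>(D \<Otimes>\<^sub>M E))"
    unfolding joint[symmetric] by (subst integral_distr) (auto simp: g_def U_def Z_def V_def)
  also have "\<dots> = (\<integral>x. (\<integral>y. g (x, y) \<partial>E) \<partial>D)"
    by (rule DE.integral_fst'[OF intg', symmetric])
  also have "\<dots> = (\<integral>x. z x * normal_tail ((b - \<rho> * u x) / s) \<partial>D)"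
  proof (rule Bochner_Integration.integral_cong[OF refl])
    fix x
    have "b \<le> \<rho> * u x + s * r \<longleftrightarrow> (b - \<rho> * u x) / s \<le> r" for r
      using s by (simp add: field_simps)
    then have "(\<integral>y. g (x, y) \<partial>E) = (\<integral>y. z x * indicator {(b - \<rho> * u x) / s..} (v y) \<partial>E)"
      unfolding g_def by (intro Bochner_Integration.integral_cong) (auto simp: indicator_def)
    also have "\<dots> = z x * (\<integral>r. indicator {(b - \<rho> * u x) / s..} r \<partial>distr E borel v)"
      by (subst integral_distr) auto
    finally show "(\<integral>y. g (x, y) \<partial>E) = z x * normal_tail ((b - \<rho> * u x) / s)"
      unfolding vE by (simp add: normal_tail_def)
  qed
  also have "\<dots> = (\<integral>\<omega>. Z \<omega> * normal_tail ((b - \<rho> * U \<omega>) / s) \<partial>M)"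
    unfolding D_def by (subst integral_distr) (auto simp: U_def Z_def)
  finally have main: "(\<integral>\<omega>. Z \<omega> * indicator {b..} (\<rho> * U \<omega> + s * V \<omega>) \<partial>M) = \<dots>" .
  have alg: "z * q - (t * z + r * d * (z * u)) = z * (q - t - r * u * d)" for z q t r d u :: real
    by (simp add: algebra_simps)
  have int3: "integrable M (\<lambda>\<omega>. Z \<omega> * normal_tail ((b - \<rho> * U \<omega>) / s))"
    by (rule Bochner_Integration.integrable_bound[OF intZ]) (auto simp: abs_mult intro!: mult_left_le)
  have diff: "(\<integral>\<omega>. Z \<omega> * indicator {b..} (\<rho> * U \<omega> + s * V \<omega>) \<partial>M)
      - (normal_tail b * (\<integral>\<omega>. Z \<omega> \<partial>M) + \<rho> * std_normal_density b * (\<integral>\<omega>. Z \<omega> * U \<omega> \<partial>M)) =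
    (\<integral>\<omega>. Z \<omega> * normal_tail ((b - \<rho> * U \<omega>) / s)
      - (normal_tail b * Z \<omega> + \<rho> * std_normal_density b * (Z \<omega> * U \<omega>)) \<partial>M)"
    unfolding main using int3 intZ intZU by simp
  have "\<bar>(\<integral>\<omega>. Z \<omega> * normal_tail ((b - \<rho> * U \<omega>) / s)
      - (normal_tail b * Z \<omega> + \<rho> * std_normal_density b * (Z \<omega> * U \<omega>)) \<partial>M)\<bar> \<le> (\<integral>\<omega>. \<bar>Z \<omega> * normal_tail ((b - \<rho> * U \<omega>) / s)
      - (normal_tail b * Z \<omega> + \<rho> * std_normal_density b * (Z \<omega> * U \<omega>))\<bar> \<partial>M)"
    by (rule integral_abs_bound)
  also have "\<dots> \<le> (\<integral>\<omega>. 5 * \<rho>\<^sup>2 * (\<bar>Z \<omega>\<bar> * (m \<omega>)\<^sup>2) \<partial>M)"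
  proof (rule integral_mono)
    fix \<omega>
    have eq: "Z \<omega> * normal_tail ((b - \<rho> * U \<omega>) / s) - (normal_tail b * Z \<omega> + \<rho> * std_normal_density b * (Z \<omega> * U \<omega>))
      = Z \<omega> * (normal_tail ((b - \<rho> * U \<omega>) / s) - normal_tail b - \<rho> * U \<omega> * std_normal_density b)"
      by (rule alg)
    have "\<bar>Z \<omega>\<bar> * \<bar>normal_tail ((b - \<rho> * U \<omega>) / s) - normal_tail b - \<rho> * U \<omega> * std_normal_density b\<bar>
        \<le> \<bar>Z \<omega>\<bar> * (5 * \<rho>\<^sup>2 * (m \<omega>)\<^sup>2)"
      unfolding m_def s_def by (intro mult_left_mono Gaussian_tail_argument_expansion \<rho>) auto
    then show "\<bar>Z \<omega> * normal_tail ((b - \<rho> * U \<omega>) / s)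
      - (normal_tail b * Z \<omega> + \<rho> * std_normal_density b * (Z \<omega> * U \<omega>))\<bar> \<le> 5 * \<rho>\<^sup>2 * (\<bar>Z \<omega>\<bar> * (m \<omega>)\<^sup>2)"
      unfolding eq abs_mult by (simp add: mult_ac)
  qed (use int int3 intZ intZU in auto)
  finally show ?thesis using diff by (simp add: m_def s_def U_def Z_def V_def)
qed

lemma quad_form_sum:
  assumes "finite K"
  shows "quad_form I G (\<lambda>i. \<Sum>k\<in>K. a k * B k i) v = (\<Sum>k\<in>K. a k * quad_form I G (B k) v)"
    and "quad_form I G v (\<lambda>i. \<Sum>k\<in>K. a k * B k i) = (\<Sum>k\<in>K. a k * quad_form I G v (B k))"
  using assms
  by (induction K rule: finite_induct)
     (simp_all add: quad_form_def distrib_left distrib_right sum.distrib sum_distrib_left mult_ac)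

text \<open>\<open>h\<close> are the Bernoulli labels, \<open>y\<close> the correlated Gaussian noise and \<open>n\<close> auxiliary independent standard
  Gaussian variables, in a fixed dimension. The joint law is prescribed by its characteristic function, which
  makes sense for singular \<open>G\<close> too and is directly usable with Kac's theorem.\<close>

locale gaussian_mixture = prob_space P
  for P :: "'b measure" +
  fixes I :: "nat set" and p0 :: real and h :: "nat \<Rightarrow> 'b \<Rightarrow> bool"
    and y n :: "nat \<Rightarrow> 'b \<Rightarrow> real" and G :: "nat \<Rightarrow> nat \<Rightarrow> real"
  assumes finite_I: "finite I" and p0: "0 \<le> p0" "p0 \<le> 1"
    and h_meas: "\<And>i. i \<in> I \<Longrightarrow> Measurable.pred P (h i)"
    and y_meas: "\<And>i. i \<in> I \<Longrightarrow> y i \<in> borel_measurable P"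
    and n_meas: "\<And>i. i \<in> I \<Longrightarrow> n i \<in> borel_measurable P"
    and G_sym: "\<And>i j. i \<in> I \<Longrightarrow> j \<in> I \<Longrightarrow> G i j = G j i"
    and G_psd: "\<And>v. 0 \<le> quad_form I G v v"
    and G_diag: "\<And>i. i \<in> I \<Longrightarrow> G i i = 1"
    and joint_char: "\<And>a b c. (CLINT \<omega>|P. iexp ((\<Sum>i\<in>I. a i * of_bool (h i \<omega>))
        + ((\<Sum>i\<in>I. b i * y i \<omega>) + (\<Sum>i\<in>I. c i * n i \<omega>)))) =
      (\<Prod>i\<in>I. complex_of_real p0 + complex_of_real (1 - p0) * iexp (a i)) *
      complex_of_real (exp (- (quad_form I G b b + (\<Sum>i\<in>I. c i * c i)) / 2))"
begin

definition form :: "(nat \<Rightarrow> real) \<Rightarrow> (nat \<Rightarrow> real) \<Rightarrow> 'b \<Rightarrow> real" where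
  "form b c \<omega> = (\<Sum>i\<in>I. b i * y i \<omega>) + (\<Sum>i\<in>I. c i * n i \<omega>)"

definition fcov :: "(nat \<Rightarrow> real) \<Rightarrow> (nat \<Rightarrow> real) \<Rightarrow> (nat \<Rightarrow> real) \<Rightarrow> (nat \<Rightarrow> real) \<Rightarrow> real" where
  "fcov b c b' c' = quad_form I G b b' + (\<Sum>i\<in>I. c i * c' i)"

lemma form_meas [measurable]: "form b c \<in> borel_measurable P"
  unfolding form_def using y_meas n_meas by measurable

lemma fcov_sym: "fcov b c b' c' = fcov b' c' b c"
proof -
  have "quad_form I G b b' = quad_form I G b' b"
    unfolding quad_form_def by (subst sum.swap) (intro sum.cong refl, simp add: G_sym)
  then show ?thesis by (simp add: fcov_def mult.commute)
qed

lemma fcov_sum: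
  assumes "finite K"
  shows "fcov (\<lambda>i. \<Sum>k\<in>K. a k * B k i) (\<lambda>i. \<Sum>k\<in>K. a k * C k i) b c = (\<Sum>k\<in>K. a k * fcov (B k) (C k) b c)"
proof -
  have "(\<Sum>i\<in>I. (\<Sum>k\<in>K. a k * C k i) * c i) = (\<Sum>k\<in>K. a k * (\<Sum>i\<in>I. C k i * c i))"
    unfolding sum_distrib_left sum_distrib_right by (subst sum.swap) (simp add: mult_ac)
  then show ?thesis
    unfolding fcov_def using assms by (simp add: quad_form_sum distrib_left sum.distrib)
qed

lemma fcov_sum2:
  assumes "finite K"
  shows "fcov b c (\<lambda>i. \<Sum>k\<in>K. a k * B k i) (\<lambda>i. \<Sum>k\<in>K. a k * C k i) = (\<Sum>k\<in>K. a k * fcov b c (B k) (C k))"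
  using fcov_sum[OF assms] by (subst (1 2) fcov_sym) simp

lemma fcov_nonneg: "0 \<le> fcov b c b c"
  unfolding fcov_def using G_psd by (auto intro!: add_nonneg_nonneg sum_nonneg)

lemma form_sum:
  assumes "finite K"
  shows "form (\<lambda>i. \<Sum>k\<in>K. a k * B k i) (\<lambda>i. \<Sum>k\<in>K. a k * C k i) \<omega> = (\<Sum>k\<in>K. a k * form (B k) (C k) \<omega>)"
proof -
  have *: "(\<Sum>i\<in>I. (\<Sum>k\<in>K. a k * C k i) * x i) = (\<Sum>k\<in>K. a k * (\<Sum>i\<in>I. C k i * x i))" for C and x :: "nat \<Rightarrow> real"
    unfolding sum_distrib_left sum_distrib_right by (subst sum.swap) (simp add: mult_ac)
  show ?thesis unfolding form_def * by (simp add: distrib_left sum.distrib)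
qed

lemma char_form: "char (distr P borel (form b c)) s = complex_of_real (exp (- s\<^sup>2 * fcov b c b c / 2))"
proof -
  have "char (distr P borel (form b c)) s = (CLINT \<omega>|P. iexp (s * form b c \<omega>))"
    unfolding char_def by (subst integral_distr) auto
  also have "\<dots> = (CLINT \<omega>|P. iexp ((\<Sum>i\<in>I. 0 * of_bool (h i \<omega>))
        + ((\<Sum>i\<in>I. (s * b i) * y i \<omega>) + (\<Sum>i\<in>I. (s * c i) * n i \<omega>))))"
    by (simp add: form_def distrib_left sum_distrib_left mult_ac)
  also have "\<dots> = complex_of_real (exp (- (quad_form I G (\<lambda>i. s * b i) (\<lambda>i. s * b i)
      + (\<Sum>i\<in>I. (s * c i) * (s * c i))) / 2))"
    by (subst joint_char) simp
  also have "quad_form I G (\<lambda>i. s * b i) (\<lambda>i. s * b i) + (\<Sum>i\<in>I. (s * c i) * (s * c i)) = s\<^sup>2 * fcov b c b c"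
    by (simp add: quad_form_def fcov_def sum_distrib_left distrib_left power2_eq_square mult_ac)
  finally show ?thesis by simp
qed

lemma distr_form:
  assumes "fcov b c b c = 1"
  shows "distr P borel (form b c) = std_normal_distribution"
  by (rule Levy_uniqueness)
     (auto simp: char_form assms char_std_normal_distribution real_dist_normal_dist)

lemma char_h:
  assumes "i \<in> I"
  shows "char (distr P borel (\<lambda>\<omega>. of_bool (h i \<omega>))) s = complex_of_real p0 + complex_of_real (1 - p0) * iexp s"
proof -
  note [measurable] = h_meas[OF assms]
  have "char (distr P borel (\<lambda>\<omega>. of_bool (h i \<omega>))) s = (CLINT \<omega>|P. iexp (s * of_bool (h i \<omega>)))"
    unfolding char_def by (subst integral_distr) auto
  also have "\<dots> = (CLINT \<omega>|P. iexp ((\<Sum>j\<in>I. (if j = i then s else 0) * of_bool (h j \<omega>))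
        + ((\<Sum>i\<in>I. 0 * y i \<omega>) + (\<Sum>i\<in>I. 0 * n i \<omega>))))"
    using assms finite_I by (simp add: if_distrib[of "\<lambda>x. x * _"] cong: if_cong)
  also have "\<dots> = (\<Prod>j\<in>I. complex_of_real p0 + complex_of_real (1 - p0) * iexp (if j = i then s else 0))"
    by (subst joint_char) (simp add: quad_form_def)
  also have "\<dots> = (complex_of_real p0 + complex_of_real (1 - p0) * iexp s) *
      (\<Prod>j\<in>I - {i}. complex_of_real p0 + complex_of_real (1 - p0) * iexp (if j = i then s else 0))"
    by (subst prod.remove[OF finite_I assms]) simp
  also have "(\<Prod>j\<in>I - {i}. complex_of_real p0 + complex_of_real (1 - p0) * iexp (if j = i then s else 0)) = 1"
    by (intro prod.neutral) auto
  finally show ?thesis by simp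
qed

text \<open>The labels and the forms are indexed by the two halves of a sum type; orthogonality makes the quadratic
  form in the exponent a sum of squares, so that the joint characteristic function factorises.\<close>

lemma indep_forms:
  assumes K: "finite K"
    and orth: "\<And>k l. k \<in> K \<Longrightarrow> l \<in> K \<Longrightarrow> k \<noteq> l \<Longrightarrow> fcov (B k) (C k) (B l) (C l) = 0"
  shows "indep_vars (\<lambda>_. borel)
    (case_sum (\<lambda>i \<omega>. of_bool (h i \<omega>)) (\<lambda>k :: nat. form (B k) (C k))) (Inl ` I \<union> Inr ` K)"
proof (rule indep_vars_if_char_factorises)
  let ?Z = "case_sum (\<lambda>i \<omega>. of_bool (h i \<omega>)) (\<lambda>k :: nat. form (B k) (C k)) :: nat + nat \<Rightarrow> 'b \<Rightarrow> real"
  show "finite (Inl ` I \<union> Inr ` K)" using finite_I K by simp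
  show "?Z k \<in> borel_measurable P" if "k \<in> Inl ` I \<union> Inr ` K" for k
    using that h_meas by auto
  fix a :: "nat + nat \<Rightarrow> real"
  define \<beta> \<kappa> where "\<beta> = (\<lambda>i. \<Sum>k\<in>K. a (Inr k) * B k i)" and "\<kappa> = (\<lambda>i. \<Sum>k\<in>K. a (Inr k) * C k i)"
  have split: "(\<Sum>k\<in>Inl ` I \<union> Inr ` K. f k) = (\<Sum>i\<in>I. f (Inl i)) + (\<Sum>k\<in>K. f (Inr k))" for f :: "nat + nat \<Rightarrow> real"
    using finite_I K by (subst sum.union_disjoint) (auto simp: sum.reindex inj_on_def)
  have split': "(\<Prod>k\<in>Inl ` I \<union> Inr ` K. f k) = (\<Prod>i\<in>I. f (Inl i)) * (\<Prod>k\<in>K. f (Inr k))" for f :: "nat + nat \<Rightarrow> complex"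
    using finite_I K by (subst prod.union_disjoint) (auto simp: prod.reindex inj_on_def)
  have "(\<Sum>k\<in>Inl ` I \<union> Inr ` K. a k * ?Z k \<omega>) = (\<Sum>i\<in>I. a (Inl i) * of_bool (h i \<omega>)) + form \<beta> \<kappa> \<omega>" for \<omega>
    unfolding split \<beta>_def \<kappa>_def by (subst form_sum[OF K]) simp
  then have "(CLINT \<omega>|P. iexp (\<Sum>k\<in>Inl ` I \<union> Inr ` K. a k * ?Z k \<omega>)) =
      (\<Prod>i\<in>I. complex_of_real p0 + complex_of_real (1 - p0) * iexp (a (Inl i))) *
      complex_of_real (exp (- fcov \<beta> \<kappa> \<beta> \<kappa> / 2))"
    unfolding form_def fcov_def by (simp only: joint_char)
  also have "fcov \<beta> \<kappa> \<beta> \<kappa> = (\<Sum>k\<in>K. (a (Inr k))\<^sup>2 * fcov (B k) (C k) (B k) (C k))"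
  proof -
    have "fcov \<beta> \<kappa> \<beta> \<kappa> = (\<Sum>k\<in>K. a (Inr k) * (\<Sum>l\<in>K. a (Inr l) * fcov (B k) (C k) (B l) (C l)))"
      unfolding \<beta>_def \<kappa>_def by (subst fcov_sum[OF K]) (subst fcov_sum2[OF K], rule refl)
    also have "\<dots> = (\<Sum>k\<in>K. a (Inr k) * (a (Inr k) * fcov (B k) (C k) (B k) (C k)))"
    proof (rule sum.cong[OF refl])
      fix k assume k: "k \<in> K"
      have "(\<Sum>l\<in>K. a (Inr l) * fcov (B k) (C k) (B l) (C l)) = a (Inr k) * fcov (B k) (C k) (B k) (C k)
          + (\<Sum>l\<in>K - {k}. a (Inr l) * fcov (B k) (C k) (B l) (C l))"
        by (rule sum.remove[OF K k])
      also have "(\<Sum>l\<in>K - {k}. a (Inr l) * fcov (B k) (C k) (B l) (C l)) = 0"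
        using k orth by (intro sum.neutral) auto
      finally show "a (Inr k) * (\<Sum>l\<in>K. a (Inr l) * fcov (B k) (C k) (B l) (C l)) =
          a (Inr k) * (a (Inr k) * fcov (B k) (C k) (B k) (C k))" by simp
    qed
    finally show ?thesis by (simp add: power2_eq_square mult_ac)
  qed
  also have "complex_of_real (exp (- (\<Sum>k\<in>K. (a (Inr k))\<^sup>2 * fcov (B k) (C k) (B k) (C k)) / 2)) =
      (\<Prod>k\<in>K. char (distr P borel (form (B k) (C k))) (a (Inr k)))"
    using K unfolding char_form
    by (simp add: exp_sum sum_negf[symmetric] sum_divide_distrib of_real_prod)
  also have "(\<Prod>i\<in>I. complex_of_real p0 + complex_of_real (1 - p0) * iexp (a (Inl i))) =
      (\<Prod>i\<in>I. char (distr P borel (\<lambda>\<omega>. of_bool (h i \<omega>))) (a (Inl i)))"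
    by (intro prod.cong refl) (simp add: char_h)
  finally show "(CLINT \<omega>|P. iexp (\<Sum>k\<in>Inl ` I \<union> Inr ` K. a k * ?Z k \<omega>)) =
      (\<Prod>k\<in>Inl ` I \<union> Inr ` K. char (distr P borel (?Z k)) (a k))"
    unfolding split' by simp
qed

lemma fcov_lin:
  "fcov (\<lambda>i. r * x i + s * x' i) (\<lambda>i. r * z i + s * z' i) e d = r * fcov x z e d + s * fcov x' z' e d"
  by (simp add: fcov_def quad_form_def sum.distrib sum_distrib_left distrib_left distrib_right mult_ac)

definition label_mean :: "(bool \<Rightarrow> real) \<Rightarrow> real" where
  "label_mean f = p0 * f False + (1 - p0) * f True"

lemma expectation_label:
  assumes i: "i \<in> I"
  shows "(\<integral>\<omega>. f (h i \<omega>) \<partial>P) = label_mean f"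
proof -
  note [measurable] = h_meas[OF i]
  define q :: real where "q = (\<integral>\<omega>. of_bool (h i \<omega>) \<partial>P)"
  have int: "integrable P (\<lambda>\<omega>. of_bool (h i \<omega>) :: real)"
    by (rule integrable_const_bound[of _ 1]) auto
  have intc: "integrable P (\<lambda>\<omega>. complex_of_real (of_bool (h i \<omega>)))"
    using int by (rule integrable_of_real)
  have "char (distr P borel (\<lambda>\<omega>. of_bool (h i \<omega>))) pi = (CLINT \<omega>|P. iexp (pi * of_bool (h i \<omega>)))"
    unfolding char_def by (subst integral_distr) auto
  also have "\<dots> = (CLINT \<omega>|P. 1 - 2 * complex_of_real (of_bool (h i \<omega>)))"
    by (intro Bochner_Integration.integral_cong) (auto simp: exp_pi_i')
  also have "\<dots> = 1 - 2 * (CLINT \<omega>|P. complex_of_real (of_bool (h i \<omega>)))"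
    using intc by (simp add: prob_space)
  also have "(CLINT \<omega>|P. complex_of_real (of_bool (h i \<omega>))) = complex_of_real q"
    unfolding q_def by (rule integral_complex_of_real)
  finally have "complex_of_real (1 - 2 * q) = complex_of_real (p0 - (1 - p0))"
    using char_h[OF i, of pi] by (simp add: exp_pi_i')
  then have q: "q = 1 - p0" unfolding of_real_eq_iff by simp
  have "(\<integral>\<omega>. f (h i \<omega>) \<partial>P) = (\<integral>\<omega>. f False + (f True - f False) * of_bool (h i \<omega>) \<partial>P)"
    by (intro Bochner_Integration.integral_cong) auto
  also have "\<dots> = f False + (f True - f False) * q"
    using int by (simp add: prob_space q_def)
  finally show ?thesis by (simp add: q label_mean_def algebra_simps)
qed

lemma integrable_form:
  assumes "fcov b c b c = 1" "integrable std_normal_distribution k"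
  shows "integrable P (\<lambda>\<omega>. k (form b c \<omega>) :: real)"
proof -
  have "integrable (distr P borel (form b c)) k" using assms by (simp add: distr_form)
  then show ?thesis by (rule integrable_distr[OF form_meas])
qed

lemma expectation_form:
  assumes "fcov b c b c = 1" and [measurable]: "k \<in> borel_measurable borel"
  shows "(\<integral>\<omega>. k (form b c \<omega>) \<partial>P) = (LINT x|std_normal_distribution. k x :: real)"
  unfolding distr_form[OF assms(1), symmetric] by (subst integral_distr) auto

lemma borel_measurable_eq_1: "(\<lambda>x :: real. f (x = 1) :: real) \<in> borel_measurable borel"
proof -
  have "(\<lambda>x :: real. f (x = 1)) = (\<lambda>x. if x = 1 then f True else f False)" by auto
  then show ?thesis by simp
qed

lemma expectation_labels_two_forms:
  assumes J: "J \<subseteq> I" and v: "fcov b c b c = 1" and k: "integrable std_normal_distribution k"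
    and orth: "fcov b c b' c' = 0"
    and g: "integrable P (\<lambda>\<omega>. g (form b' c' \<omega>) :: real)" and [measurable]: "g \<in> borel_measurable borel"
  shows "(\<integral>\<omega>. (\<Prod>j\<in>J. f j (h j \<omega>)) * (k (form b c \<omega>) * g (form b' c' \<omega>)) \<partial>P)
      = (\<Prod>j\<in>J. label_mean (f j)) * ((LINT x|std_normal_distribution. k x) * (\<integral>\<omega>. g (form b' c' \<omega>) \<partial>P))"
    and "integrable P (\<lambda>\<omega>. (\<Prod>j\<in>J. f j (h j \<omega>)) * (k (form b c \<omega>) * g (form b' c' \<omega>)))"
proof -
  have finJ: "finite J" using J finite_I finite_subset by blast
  have [measurable]: "k \<in> borel_measurable borel" using k by auto
  define L :: "(nat + nat) set" where "L = Inl ` J \<union> {Inr 0, Inr 1}"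
  define B C where "B = (\<lambda>k :: nat. if k = 0 then b else b')" and "C = (\<lambda>k :: nat. if k = 0 then c else c')"
  define K where "K = (\<lambda>r :: nat. if r = 0 then k else g)"
  have [measurable]: "K r \<in> borel_measurable borel" for r by (simp add: K_def)
  define Z where "Z = case_sum (\<lambda>j \<omega>. f j (h j \<omega>)) (\<lambda>r \<omega>. K r (form (B r) (C r) \<omega>))"
  have "indep_vars (\<lambda>_. borel)
    (case_sum (\<lambda>i \<omega>. of_bool (h i \<omega>)) (\<lambda>k :: nat. form (B k) (C k))) (Inl ` I \<union> Inr ` {0, 1})"
    by (rule indep_forms) (use orth in \<open>auto simp: B_def C_def fcov_sym[of b' c' b c]\<close>)
  then have "indep_vars (\<lambda>_. borel)
    (case_sum (\<lambda>i \<omega>. of_bool (h i \<omega>)) (\<lambda>k :: nat. form (B k) (C k))) L"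
    by (rule indep_vars_subset) (use J in \<open>auto simp: L_def\<close>)
  then have "indep_vars (\<lambda>_. borel) (\<lambda>s \<omega>. case_sum (\<lambda>j x. f j (x = 1)) K s
      (case_sum (\<lambda>i \<omega>. of_bool (h i \<omega>)) (\<lambda>k :: nat. form (B k) (C k)) s \<omega>)) L"
    by (rule indep_vars_compose2) (auto split: sum.split simp: borel_measurable_eq_1)
  moreover have "(\<lambda>s \<omega>. case_sum (\<lambda>j x. f j (x = 1)) K s
      (case_sum (\<lambda>i \<omega>. of_bool (h i \<omega>)) (\<lambda>k :: nat. form (B k) (C k)) s \<omega>)) = Z"
    by (auto simp: Z_def fun_eq_iff split: sum.split)
  ultimately have ind: "indep_vars (\<lambda>_. borel) Z L" by simp
  have int: "integrable P (Z s)" if s: "s \<in> L" for s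
  proof (cases s)
    case (Inl j)
    then have "j \<in> I" using s J by (auto simp: L_def)
    then have [measurable]: "Measurable.pred P (h j)" by (rule h_meas)
    have "(\<lambda>\<omega>. f j (h j \<omega>)) = (\<lambda>\<omega>. if h j \<omega> then f j True else f j False)" by auto
    moreover have "\<bar>f j x\<bar> \<le> \<bar>f j True\<bar> + \<bar>f j False\<bar>" for x by (cases x) auto
    ultimately have "integrable P (\<lambda>\<omega>. f j (h j \<omega>))"
      by (intro integrable_const_bound[of _ "\<bar>f j True\<bar> + \<bar>f j False\<bar>"]) auto
    then show ?thesis by (simp add: Z_def Inl)
  next
    case (Inr r)
    then show ?thesis using integrable_form[OF v k] g by (simp add: Z_def K_def B_def C_def)
  qed
  have finL: "finite L" using finJ by (simp add: L_def)
  have notin: "Inr r \<notin> Inl ` J" for r :: nat by auto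
  have prod: "(\<Prod>s\<in>L. u s) = (\<Prod>j\<in>J. u (Inl j)) * (u (Inr 0) * u (Inr 1))" for u :: "nat + nat \<Rightarrow> real"
    unfolding L_def using finJ by (simp add: prod.reindex inj_on_def notin mult_ac)
  have "(\<integral>\<omega>. (\<Prod>s\<in>L. Z s \<omega>) \<partial>P) = (\<Prod>s\<in>L. \<integral>\<omega>. Z s \<omega> \<partial>P)"
    by (rule indep_vars_lebesgue_integral[OF finL ind int])
  also have "\<dots> = (\<Prod>j\<in>J. label_mean (f j)) * ((LINT x|std_normal_distribution. k x) * (\<integral>\<omega>. g (form b' c' \<omega>) \<partial>P))"
    unfolding prod using J expectation_form[OF v]
    by (auto simp: Z_def K_def B_def C_def subset_iff expectation_label intro!: prod.cong)
  finally show "(\<integral>\<omega>. (\<Prod>j\<in>J. f j (h j \<omega>)) * (k (form b c \<omega>) * g (form b' c' \<omega>)) \<partial>P)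
      = (\<Prod>j\<in>J. label_mean (f j)) * ((LINT x|std_normal_distribution. k x) * (\<integral>\<omega>. g (form b' c' \<omega>) \<partial>P))"
    unfolding prod by (simp add: Z_def K_def B_def C_def)
  have "integrable P (\<lambda>\<omega>. \<Prod>s\<in>L. Z s \<omega>)"
    by (rule indep_vars_integrable[OF finL ind int])
  then show "integrable P (\<lambda>\<omega>. (\<Prod>j\<in>J. f j (h j \<omega>)) * (k (form b c \<omega>) * g (form b' c' \<omega>)))"
    unfolding prod by (simp add: Z_def K_def B_def C_def)
qed

lemma expectation_labels_form:
  assumes J: "J \<subseteq> I" and v: "fcov b c b c = 1" and k: "integrable std_normal_distribution k"
  shows "(\<integral>\<omega>. (\<Prod>j\<in>J. f j (h j \<omega>)) * k (form b c \<omega>) \<partial>P)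
      = (\<Prod>j\<in>J. label_mean (f j)) * (LINT x|std_normal_distribution. k x)"
    and "integrable P (\<lambda>\<omega>. (\<Prod>j\<in>J. f j (h j \<omega>)) * k (form b c \<omega>))"
proof -
  have "fcov b c (\<lambda>_. 0) (\<lambda>_. 0) = 0" by (simp add: fcov_def quad_form_def)
  from expectation_labels_two_forms[OF J v k this, of "\<lambda>_. 1" f]
  show "(\<integral>\<omega>. (\<Prod>j\<in>J. f j (h j \<omega>)) * k (form b c \<omega>) \<partial>P)
      = (\<Prod>j\<in>J. label_mean (f j)) * (LINT x|std_normal_distribution. k x)"
    "integrable P (\<lambda>\<omega>. (\<Prod>j\<in>J. f j (h j \<omega>)) * k (form b c \<omega>))"
    by (simp_all add: prob_space)
qed

text \<open>The remainder is uniform in the threshold and quadratic in the covariance \<open>\<rho>\<close> of the two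
  forms. For \<open>\<rho>\<close> bounded away from \<open>0\<close> there is nothing to gain, and the trivial bounds suffice.\<close>

lemma pair_tail_expansion:
  fixes k :: "real \<Rightarrow> real" and f :: "nat \<Rightarrow> bool \<Rightarrow> real"
  assumes J: "J \<subseteq> I" and U: "fcov b c b c = 1" and V: "fcov b' c' b' c' = 1"
    and \<rho>: "fcov b c b' c' = \<rho>"
    and f: "\<And>j x. 0 \<le> f j x" "\<And>j x. f j x \<le> 1"
    and k: "integrable std_normal_distribution (\<lambda>x. \<bar>k x\<bar> * (1 + \<bar>a\<bar> + \<bar>x\<bar>)\<^sup>2)"
      "k \<in> borel_measurable borel"
  shows "\<bar>(\<integral>\<omega>. (\<Prod>j\<in>J. f j (h j \<omega>)) * k (form b c \<omega>) * indicator {a..} (form b' c' \<omega>) \<partial>P)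
     - (\<Prod>j\<in>J. label_mean (f j)) * (normal_tail a * (LINT x|std_normal_distribution. k x)
        + \<rho> * std_normal_density a * (LINT x|std_normal_distribution. k x * x))\<bar>
    \<le> 10 * \<rho>\<^sup>2 * (LINT x|std_normal_distribution. \<bar>k x\<bar> * (1 + \<bar>a\<bar> + \<bar>x\<bar>)\<^sup>2)"
proof -
  let ?N = std_normal_distribution
  note [measurable] = k(2)
  define w where "w = (\<lambda>x. (1 + \<bar>a\<bar> + \<bar>x\<bar>)\<^sup>2)"
  have w: "1 \<le> w x" "\<bar>x\<bar> \<le> w x" "0 \<le> w x" for x
    using one_le_power[of "1 + \<bar>a\<bar> + \<bar>x\<bar>" 2] self_le_power[of "1 + \<bar>a\<bar> + \<bar>x\<bar>" 2] by (auto simp: w_def)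
  have intk: "integrable ?N k"
  proof (rule Bochner_Integration.integrable_bound[OF k(1)])
    show "AE x in ?N. norm (k x) \<le> norm (\<bar>k x\<bar> * (1 + \<bar>a\<bar> + \<bar>x\<bar>)\<^sup>2)"
      using mult_left_mono[OF w(1), of "\<bar>k x\<bar>" for x] by (auto simp: abs_mult w_def)
  qed simp
  have intkx: "integrable ?N (\<lambda>x. k x * x)"
  proof (rule Bochner_Integration.integrable_bound[OF k(1)])
    show "AE x in ?N. norm (k x * x) \<le> norm (\<bar>k x\<bar> * (1 + \<bar>a\<bar> + \<bar>x\<bar>)\<^sup>2)"
      using mult_left_mono[OF w(2), of "\<bar>k x\<bar>" for x] by (auto simp: abs_mult w_def)
  qed simp
  define F where "F = (\<lambda>\<omega>. \<Prod>j\<in>J. f j (h j \<omega>))"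
  have F: "0 \<le> F \<omega>" "F \<omega> \<le> 1" for \<omega>
    unfolding F_def using f by (auto intro!: prod_nonneg prod_le_1)
  define m where "m = (\<Prod>j\<in>J. label_mean (f j))"
  have lm: "0 \<le> label_mean (f j)" "label_mean (f j) \<le> 1" for j
    unfolding label_mean_def using f[of j] p0 convex_bound_le[of "f j False" 1 "f j True" p0 "1 - p0"] by auto
  have m: "0 \<le> m" "m \<le> 1"
    unfolding m_def using lm by (auto intro!: prod_nonneg prod_le_1)
  have hmeas [measurable]: "F \<in> borel_measurable P"
  proof -
    have "(\<lambda>\<omega>. f j (h j \<omega>)) \<in> borel_measurable P" if "j \<in> J" for j
    proof -
      have [measurable]: "Measurable.pred P (h j)" using that J by (intro h_meas) auto
      have "(\<lambda>\<omega>. f j (h j \<omega>)) = (\<lambda>\<omega>. if h j \<omega> then f j True else f j False)" by auto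
      then show ?thesis by simp
    qed
    then show ?thesis unfolding F_def by (intro borel_measurable_prod) auto
  qed
  define R where "R = (LINT x|?N. \<bar>k x\<bar> * w x)"
  have R_eq: "R = (LINT x|?N. \<bar>k x\<bar> * (1 + \<bar>a\<bar> + \<bar>x\<bar>)\<^sup>2)" by (simp add: R_def w_def)
  have E1: "(\<integral>\<omega>. F \<omega> * k (form b c \<omega>) \<partial>P) = m * (LINT x|?N. k x)"
    and E2: "(\<integral>\<omega>. F \<omega> * (k (form b c \<omega>) * form b c \<omega>) \<partial>P) = m * (LINT x|?N. k x * x)"
    and E3: "(\<integral>\<omega>. F \<omega> * (\<bar>k (form b c \<omega>)\<bar> * w (form b c \<omega>)) \<partial>P) = m * R"
    and I1: "integrable P (\<lambda>\<omega>. F \<omega> * k (form b c \<omega>))"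
    and I3: "integrable P (\<lambda>\<omega>. F \<omega> * (\<bar>k (form b c \<omega>)\<bar> * w (form b c \<omega>)))"
    unfolding F_def m_def R_def w_def
    using expectation_labels_form[OF J U intk, of f] expectation_labels_form[OF J U intkx, of f]
      expectation_labels_form[OF J U k(1), of f]
    by auto
  have R0: "0 \<le> R" unfolding R_def using w by (intro Bochner_Integration.integral_nonneg) auto
  have mR: "m * R \<le> R" using m R0 by (intro mult_left_le_one_le) auto
  show ?thesis
  proof (cases "\<bar>\<rho>\<bar> \<le> 1 / 2")
    case True
    have r: "\<rho>\<^sup>2 \<le> 1 / 4"
      using power_mono[OF True, of 2] by (simp add: power2_eq_square)
    define s where "s = sqrt (1 - \<rho>\<^sup>2)"
    have s: "0 < s" "s\<^sup>2 = 1 - \<rho>\<^sup>2" using r by (auto simp: s_def)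
    \<comment> \<open>The second form is \<open>\<rho>\<close> times the first plus \<open>s\<close> times a normalised form independent of it\<close>
    define bv cv where "bv = (\<lambda>i. (b' i - \<rho> * b i) / s)" and "cv = (\<lambda>i. (c' i - \<rho> * c i) / s)"
    have formv: "\<rho> * form b c \<omega> + s * form bv cv \<omega> = form b' c' \<omega>" for \<omega>
    proof -
      have "s * form bv cv \<omega> = form (\<lambda>i. b' i - \<rho> * b i) (\<lambda>i. c' i - \<rho> * c i) \<omega>"
        using s by (simp add: form_def bv_def cv_def sum_distrib_left distrib_left)
      also have "\<dots> = form b' c' \<omega> - \<rho> * form b c \<omega>"
        by (simp add: form_def left_diff_distrib sum_subtractf sum_distrib_left distrib_left mult.assoc)
      finally show ?thesis by simp
    qed
    have lin: "fcov (\<lambda>i. (x i - \<rho> * x' i) / s) (\<lambda>i. (z i - \<rho> * z' i) / s) e d =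
        (fcov x z e d - \<rho> * fcov x' z' e d) / s" for x x' z z' e d
    proof -
      have "(\<lambda>i. (u i - \<rho> * u' i) / s) = (\<lambda>i. (1 / s) * u i + (- \<rho> / s) * u' i)" for u u' :: "nat \<Rightarrow> real"
        by (simp add: diff_divide_distrib)
      then show ?thesis by (simp only: fcov_lin) (simp add: diff_divide_distrib)
    qed
    have cov0: "fcov bv cv b c = 0"
      unfolding bv_def cv_def lin using U \<rho> by (simp add: fcov_sym[of b' c' b c])
    have cov0': "fcov b c bv cv = 0" using cov0 fcov_sym by metis
    have cov1: "fcov bv cv bv cv = 1"
    proof -
      have "fcov bv cv bv cv = fcov b' c' bv cv / s"
        using lin[of b' b c' c bv cv] cov0' by (simp add: bv_def[symmetric] cv_def[symmetric])
      also have "fcov b' c' bv cv = (1 - \<rho> * \<rho>) / s"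
        unfolding fcov_sym[of b' c'] unfolding bv_def cv_def lin V \<rho> ..
      finally have "fcov bv cv bv cv = (s * s) / (s * s)"
        using s(2) by (simp add: power2_eq_square)
      then show ?thesis using s(1) by simp
    qed
    define B C where "B = (\<lambda>k :: nat. if k = 0 then b else bv)" and "C = (\<lambda>k :: nat. if k = 0 then c else cv)"
    have ind: "indep_vars (\<lambda>_. borel)
      (case_sum (\<lambda>i \<omega>. of_bool (h i \<omega>)) (\<lambda>k :: nat. form (B k) (C k))) (Inl ` I \<union> Inr ` {0, 1})"
      by (rule indep_forms) (auto simp: B_def C_def cov0 cov0')
    define Z where "Z = case_sum (\<lambda>i \<omega>. of_bool (h i \<omega>)) (\<lambda>k :: nat. form (B k) (C k))"
    define A1 A2 :: "(nat + nat) set" where "A1 = Inl ` J \<union> {Inr 0}" and "A2 = {Inr 1}"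
    have ind': "indep_var (PiM A1 (\<lambda>_. borel)) (\<lambda>\<omega>. restrict (\<lambda>i. Z i \<omega>) A1)
        (PiM A2 (\<lambda>_. borel)) (\<lambda>\<omega>. restrict (\<lambda>i. Z i \<omega>) A2)"
      by (rule indep_var_restrict[OF ind[folded Z_def]]) (use J in \<open>auto simp: A1_def A2_def\<close>)
    define u v where "u = (\<lambda>x :: nat + nat \<Rightarrow> real. x (Inr 0))" and "v = (\<lambda>x :: nat + nat \<Rightarrow> real. x (Inr 1))"
    define z where "z = (\<lambda>x :: nat + nat \<Rightarrow> real. (\<Prod>j\<in>J. f j (x (Inl j) = 1)) * k (x (Inr 0)))"
    have um [measurable]: "u \<in> borel_measurable (PiM A1 (\<lambda>_. borel))" 
      unfolding u_def by (rule measurable_component_singleton) (simp add: A1_def)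
    have vm: "v \<in> borel_measurable (PiM A2 (\<lambda>_. borel))" 
      unfolding v_def by (rule measurable_component_singleton) (simp add: A2_def)
    have zm: "z \<in> borel_measurable (PiM A1 (\<lambda>_. borel))"
    proof -
      have "(\<lambda>x :: nat + nat \<Rightarrow> real. f j (x (Inl j) = 1)) \<in> borel_measurable (PiM A1 (\<lambda>_. borel))" if "j \<in> J" for j
      proof -
        have comp: "(\<lambda>x. x (Inl j)) \<in> measurable (PiM A1 (\<lambda>_. borel :: real measure)) borel"
          using that by (intro measurable_component_singleton) (simp add: A1_def)
        show ?thesis by (rule measurable_compose[OF comp borel_measurable_eq_1[of "f j"]])
      qed
      moreover have "(\<lambda>x. k (u x)) \<in> borel_measurable (PiM A1 (\<lambda>_. borel))" by simp
      ultimately show ?thesis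
        unfolding z_def u_def by (intro borel_measurable_times borel_measurable_prod) auto
    qed
    have zX: "z (restrict (\<lambda>i. Z i \<omega>) A1) = F \<omega> * k (form b c \<omega>)" for \<omega>
      by (auto simp: z_def A1_def Z_def F_def B_def C_def intro!: prod.cong)
    have uX: "u (restrict (\<lambda>i. Z i \<omega>) A1) = form b c \<omega>" and vY: "v (restrict (\<lambda>i. Z i \<omega>) A2) = form bv cv \<omega>" for \<omega>
      by (simp_all add: u_def v_def A1_def A2_def Z_def B_def C_def)
    have "\<bar>(\<integral>\<omega>. (F \<omega> * k (form b c \<omega>)) * indicator {a..} (\<rho> * form b c \<omega> + sqrt (1 - \<rho>\<^sup>2) * form bv cv \<omega>) \<partial>P)
      - (normal_tail a * (\<integral>\<omega>. F \<omega> * k (form b c \<omega>) \<partial>P)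
        + \<rho> * std_normal_density a * (\<integral>\<omega>. (F \<omega> * k (form b c \<omega>)) * form b c \<omega> \<partial>P))\<bar>
      \<le> 5 * \<rho>\<^sup>2 * (\<integral>\<omega>. \<bar>F \<omega> * k (form b c \<omega>)\<bar> * (1 + \<bar>a\<bar> + \<bar>form b c \<omega>\<bar>)\<^sup>2 \<partial>P)"
      using bivariate_tail_expansion[OF ind' um zm vm _ True, of a, unfolded zX uX vY] distr_form[OF cov1] I3 F
      by (simp add: w_def abs_mult mult.assoc)
    also have "(\<integral>\<omega>. \<bar>F \<omega> * k (form b c \<omega>)\<bar> * (1 + \<bar>a\<bar> + \<bar>form b c \<omega>\<bar>)\<^sup>2 \<partial>P) = m * R"
      using E3 F by (simp add: w_def abs_mult mult.assoc)
    also have "5 * \<rho>\<^sup>2 * (m * R) \<le> 10 * \<rho>\<^sup>2 * R"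
      using mR R0 m by (intro mult_mono) auto
    finally have bound: "\<bar>(\<integral>\<omega>. F \<omega> * k (form b c \<omega>) * indicator {a..} (form b' c' \<omega>) \<partial>P)
      - (normal_tail a * (\<integral>\<omega>. F \<omega> * k (form b c \<omega>) \<partial>P)
        + \<rho> * std_normal_density a * (\<integral>\<omega>. (F \<omega> * k (form b c \<omega>)) * form b c \<omega> \<partial>P))\<bar> \<le> 10 * \<rho>\<^sup>2 * R"
      unfolding s_def[symmetric] formv .
    have eqm: "m * (normal_tail a * q + \<rho> * std_normal_density a * q') =
        normal_tail a * (m * q) + \<rho> * std_normal_density a * (m * q')" for q q' by (simp add: algebra_simps)
    have E2': "(\<integral>\<omega>. (F \<omega> * k (form b c \<omega>)) * form b c \<omega> \<partial>P) = m * (LINT x|?N. k x * x)"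
      using E2 by (simp add: mult.assoc)
    show ?thesis
      using bound unfolding E1 E2' unfolding F_def m_def[symmetric] R_eq[symmetric] eqm .
  next
    case False
    have r: "1 \<le> 4 * \<rho>\<^sup>2" "\<bar>\<rho>\<bar> \<le> 2 * \<rho>\<^sup>2"
      using False power_mono[of "1/2" "\<bar>\<rho>\<bar>" 2] mult_right_mono[of "1 / 2" "\<bar>\<rho>\<bar>" "\<bar>\<rho>\<bar>"]
      by (auto simp: power2_eq_square)
    have "\<bar>\<integral>\<omega>. F \<omega> * k (form b c \<omega>) * indicator {a..} (form b' c' \<omega>) \<partial>P\<bar>
        \<le> (\<integral>\<omega>. \<bar>F \<omega> * k (form b c \<omega>) * indicator {a..} (form b' c' \<omega>)\<bar> \<partial>P)"
      by (rule integral_abs_bound)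
    also have "\<dots> \<le> (\<integral>\<omega>. F \<omega> * (\<bar>k (form b c \<omega>)\<bar> * w (form b c \<omega>)) \<partial>P)"
    proof (rule integral_mono)
      show "integrable P (\<lambda>\<omega>. \<bar>F \<omega> * k (form b c \<omega>) * indicator {a..} (form b' c' \<omega>)\<bar>)"
        by (rule Bochner_Integration.integrable_bound[OF I1]) (auto simp: indicator_def)
      fix \<omega>
      have "\<bar>k (form b c \<omega>)\<bar> * 1 \<le> \<bar>k (form b c \<omega>)\<bar> * w (form b c \<omega>)"
        using w by (intro mult_left_mono) auto
      then show "\<bar>F \<omega> * k (form b c \<omega>) * indicator {a..} (form b' c' \<omega>)\<bar> \<le>
          F \<omega> * (\<bar>k (form b c \<omega>)\<bar> * w (form b c \<omega>))"
        using F[of \<omega>] w(3)[of "form b c \<omega>"] by (auto simp: abs_mult indicator_def intro!: mult_left_mono mult_nonneg_nonneg)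
    qed (rule I3)
    finally have 1: "\<bar>\<integral>\<omega>. F \<omega> * k (form b c \<omega>) * indicator {a..} (form b' c' \<omega>) \<partial>P\<bar> \<le> R"
      using E3 mR by simp
    have "\<bar>LINT x|?N. k x\<bar> \<le> (LINT x|?N. \<bar>k x\<bar>)" by (rule integral_abs_bound)
    also have "\<dots> \<le> R"
      unfolding R_def using intk k(1) mult_left_mono[OF w(1), of "\<bar>k x\<bar>" for x]
      by (intro integral_mono) (auto simp: w_def)
    finally have k1: "\<bar>LINT x|?N. k x\<bar> \<le> R" .
    have "\<bar>LINT x|?N. k x * x\<bar> \<le> (LINT x|?N. \<bar>k x * x\<bar>)" by (rule integral_abs_bound)
    also have "\<dots> \<le> R"
      unfolding R_def using integrable_abs[OF intkx, unfolded abs_mult] k(1) mult_left_mono[OF w(2), of "\<bar>k x\<bar>" for x]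
      by (intro integral_mono) (auto simp: w_def abs_mult)
    finally have k2: "\<bar>LINT x|?N. k x * x\<bar> \<le> R" .
    have 2: "\<bar>m * (normal_tail a * (LINT x|?N. k x))\<bar> \<le> 1 * (1 * R)"
      unfolding abs_mult using m k1 by (intro mult_mono) auto
    have "\<bar>m * (\<rho> * std_normal_density a * (LINT x|?N. k x * x))\<bar> \<le> 1 * (\<bar>\<rho>\<bar> * 1 * R)"
      unfolding abs_mult using m k2 std_normal_density_le[of a] by (intro mult_mono) auto
    also have "\<dots> \<le> 2 * \<rho>\<^sup>2 * R" using r R0 by (simp add: mult_right_mono)
    finally have 3: "\<bar>m * (\<rho> * std_normal_density a * (LINT x|?N. k x * x))\<bar> \<le> 2 * \<rho>\<^sup>2 * R" .
    have "2 * R \<le> 2 * (4 * \<rho>\<^sup>2 * R)" using mult_right_mono[OF r(1) R0] by (simp add: mult_ac)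
    \<comment> \<open>The three terms add up to at most \<open>(4 + 4 + 2) \<rho>\<^sup>2 R\<close>\<close>
    then show ?thesis
      using 1 2 3 unfolding F_def m_def[symmetric] R_eq[symmetric] distrib_left
      by linarith
  qed
qed

lemma form_unit:
  assumes "i \<in> I"
  shows "form (\<lambda>k. of_bool (k = i)) (\<lambda>_. 0) \<omega> = y i \<omega>" "form (\<lambda>_. 0) (\<lambda>k. of_bool (k = i)) \<omega> = n i \<omega>"
  using assms finite_I by (simp_all add: form_def)

lemma fcov_unit:
  assumes "i \<in> I"
  shows "j \<in> I \<Longrightarrow> fcov (\<lambda>k. of_bool (k = i)) (\<lambda>_. 0) (\<lambda>k. of_bool (k = j)) (\<lambda>_. 0) = G i j"
    and "fcov (\<lambda>_. 0) (\<lambda>k. of_bool (k = i)) (\<lambda>_. 0) (\<lambda>k. of_bool (k = i)) = 1"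
  using assms finite_I by (simp_all add: fcov_def quad_form_def mult.assoc sum_distrib_left[symmetric])

lemma std_normal_moments:
  "integrable std_normal_distribution (\<lambda>x. x)" "(LINT x|std_normal_distribution. x) = 0"
  "integrable std_normal_distribution (\<lambda>x. x\<^sup>2)" "(LINT x|std_normal_distribution. x\<^sup>2) = 1"
  using integrable_std_normal_distribution_moment[of 1] integrable_std_normal_distribution_moment[of 2]
    integral_std_normal_distribution_moment_odd[of 1] std_normal_distribution_even_moments[of 1] by simp_all

lemma form_mean: "integrable P (form b c)" "(\<integral>\<omega>. form b c \<omega> \<partial>P) = 0"
proof -
  have y: "integrable P (y i) \<and> (\<integral>\<omega>. y i \<omega> \<partial>P) = 0 \<and> integrable P (n i) \<and> (\<integral>\<omega>. n i \<omega> \<partial>P) = 0" if i: "i \<in> I" for i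
  proof -
    have 1: "fcov (\<lambda>k. of_bool (k = i)) (\<lambda>_. 0) (\<lambda>k. of_bool (k = i)) (\<lambda>_. 0) = 1"
      using fcov_unit(1)[OF i i] G_diag[OF i] by simp
    note 2 = fcov_unit(2)[OF i]
    show ?thesis
      using integrable_form[OF 1, of "\<lambda>x. x"] integrable_form[OF 2, of "\<lambda>x. x"]
        expectation_form[OF 1, of "\<lambda>x. x"] expectation_form[OF 2, of "\<lambda>x. x"]
      by (simp add: std_normal_moments form_unit[OF i])
  qed
  then show "integrable P (form b c)"
    unfolding form_def by (auto intro!: Bochner_Integration.integrable_add Bochner_Integration.integrable_sum)
  show "(\<integral>\<omega>. form b c \<omega> \<partial>P) = 0"
    unfolding form_def using y by (simp add: Bochner_Integration.integral_sum)
qed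

lemma form_diff: "form (\<lambda>i. b' i - r * b i) (\<lambda>i. c' i - r * c i) \<omega> = form b' c' \<omega> - r * form b c \<omega>"
  by (simp add: form_def left_diff_distrib sum_subtractf sum_distrib_left distrib_left mult.assoc)

lemma fcov_diff:
  "fcov (\<lambda>i. b' i - r * b i) (\<lambda>i. c' i - r * c i) e d = fcov b' c' e d - r * fcov b c e d"
  using fcov_lin[of 1 b' "- r" b c' c e d] by simp

lemma expectation_labels_form_times_form:
  assumes J: "J \<subseteq> I" and U: "fcov b c b c = 1"
    and k: "integrable std_normal_distribution k" "integrable std_normal_distribution (\<lambda>x. k x * x)"
  shows "(\<integral>\<omega>. (\<Prod>j\<in>J. f j (h j \<omega>)) * (k (form b c \<omega>) * form b' c' \<omega>) \<partial>P)
      = fcov b c b' c' * ((\<Prod>j\<in>J. label_mean (f j)) * (LINT x|std_normal_distribution. k x * x))"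
    and "integrable P (\<lambda>\<omega>. (\<Prod>j\<in>J. f j (h j \<omega>)) * (k (form b c \<omega>) * form b' c' \<omega>))"
proof -
  define \<rho> where "\<rho> = fcov b c b' c'"
  define bv cv where "bv = (\<lambda>i. b' i - \<rho> * b i)" and "cv = (\<lambda>i. c' i - \<rho> * c i)"
  have "fcov bv cv b c = 0"
    unfolding bv_def cv_def fcov_diff using U by (simp add: \<rho>_def fcov_sym[of b' c' b c])
  then have orth: "fcov b c bv cv = 0" by (subst fcov_sym)
  have V: "form b' c' \<omega> = form bv cv \<omega> + \<rho> * form b c \<omega>" for \<omega>
    unfolding bv_def cv_def form_diff by simp
  have eq: "(\<lambda>\<omega>. (\<Prod>j\<in>J. f j (h j \<omega>)) * (k (form b c \<omega>) * form b' c' \<omega>)) =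
     (\<lambda>\<omega>. (\<Prod>j\<in>J. f j (h j \<omega>)) * (k (form b c \<omega>) * form bv cv \<omega>)
       + \<rho> * ((\<Prod>j\<in>J. f j (h j \<omega>)) * (k (form b c \<omega>) * form b c \<omega>)))"
    by (simp add: V algebra_simps)
  note 1 = expectation_labels_two_forms[OF J U k(1) orth, of "\<lambda>x. x" f]
  note 2 = expectation_labels_form[OF J U k(2), of f]
  show "(\<integral>\<omega>. (\<Prod>j\<in>J. f j (h j \<omega>)) * (k (form b c \<omega>) * form b' c' \<omega>) \<partial>P)
      = fcov b c b' c' * ((\<Prod>j\<in>J. label_mean (f j)) * (LINT x|std_normal_distribution. k x * x))"
    unfolding eq using 1 2 form_mean[of bv cv] by (simp add: \<rho>_def)
  show "integrable P (\<lambda>\<omega>. (\<Prod>j\<in>J. f j (h j \<omega>)) * (k (form b c \<omega>) * form b' c' \<omega>))"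
    unfolding eq using 1 2 form_mean[of bv cv] by simp
qed

lemma expectation_form_times_form:
  assumes "fcov b c b c = 1"
  shows "(\<integral>\<omega>. form b c \<omega> * form b' c' \<omega> \<partial>P) = fcov b c b' c'" "integrable P (\<lambda>\<omega>. form b c \<omega> * form b' c' \<omega>)"
  using expectation_labels_form_times_form[of "{}" b c "\<lambda>x. x" _ b' c'] assms std_normal_moments
  by (simp_all add: power2_eq_square)

end

section \<open>Second moments of sums over the sample\<close>

lemma second_moment_sum:
  fixes X :: "'i \<Rightarrow> 'a \<Rightarrow> real"
  assumes fin: "finite I" and int: "\<And>i j. i \<in> I \<Longrightarrow> j \<in> I \<Longrightarrow> integrable M (\<lambda>\<omega>. X i \<omega> * X j \<omega>)"
  shows "(\<integral>\<omega>. (\<Sum>i\<in>I. X i \<omega>)\<^sup>2 \<partial>M) =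
      (\<Sum>i\<in>I. \<integral>\<omega>. (X i \<omega>)\<^sup>2 \<partial>M) + (\<Sum>i\<in>I. \<Sum>j\<in>I - {i}. \<integral>\<omega>. X i \<omega> * X j \<omega> \<partial>M)"
    and "integrable M (\<lambda>\<omega>. (\<Sum>i\<in>I. X i \<omega>)\<^sup>2)"
proof -
  have sq: "(\<Sum>i\<in>I. X i \<omega>)\<^sup>2 = (\<Sum>i\<in>I. \<Sum>j\<in>I. X i \<omega> * X j \<omega>)" for \<omega>
    by (simp add: power2_eq_square sum_product)
  have "(\<integral>\<omega>. (\<Sum>i\<in>I. X i \<omega>)\<^sup>2 \<partial>M) = (\<Sum>i\<in>I. \<Sum>j\<in>I. \<integral>\<omega>. X i \<omega> * X j \<omega> \<partial>M)"
    unfolding sq using int by (simp add: Bochner_Integration.integral_sum Bochner_Integration.integrable_sum)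
  also have "\<dots> = (\<Sum>i\<in>I. (\<integral>\<omega>. X i \<omega> * X i \<omega> \<partial>M) + (\<Sum>j\<in>I - {i}. \<integral>\<omega>. X i \<omega> * X j \<omega> \<partial>M))"
    by (intro sum.cong refl sum.remove[OF fin])
  finally show "(\<integral>\<omega>. (\<Sum>i\<in>I. X i \<omega>)\<^sup>2 \<partial>M) =
      (\<Sum>i\<in>I. \<integral>\<omega>. (X i \<omega>)\<^sup>2 \<partial>M) + (\<Sum>i\<in>I. \<Sum>j\<in>I - {i}. \<integral>\<omega>. X i \<omega> * X j \<omega> \<partial>M)"
    by (simp add: sum.distrib power2_eq_square)
  show "integrable M (\<lambda>\<omega>. (\<Sum>i\<in>I. X i \<omega>)\<^sup>2)"
    unfolding sq using int by (intro Bochner_Integration.integrable_sum)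
qed

lemma integrable_indicator_weight:
  assumes "0 \<le> B"
  shows "integrable std_normal_distribution (\<lambda>x. indicator {z..} x * (1 + B + \<bar>x\<bar>)\<^sup>2)"
proof (rule Bochner_Integration.integrable_bound[OF integrable_std_normal_poly[of "1 + B" 2]])
  show "AE x in std_normal_distribution. norm (indicat_real {z..} x * (1 + B + \<bar>x\<bar>)\<^sup>2) \<le> norm ((1 + B + \<bar>x\<bar>)\<^sup>2)"
    by (auto simp: indicator_def)
qed simp

lemma integrable_indicator_times_id:
  "integrable std_normal_distribution (\<lambda>x. indicator {z..} x * x :: real)"
  by (rule Bochner_Integration.integrable_bound[OF integrable_std_normal_abs_moment[of 1]])
     (auto simp: indicator_def)

context gaussian_mixture
begin

definition offdiag :: "(nat \<Rightarrow> nat \<Rightarrow> real) \<Rightarrow> real" where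
  "offdiag C = (\<Sum>i\<in>I. \<Sum>j\<in>I - {i}. C i j)"

lemma label_mean_bounds:
  assumes "\<And>x. 0 \<le> f x" "\<And>x. f x \<le> 1"
  shows "0 \<le> label_mean f" "label_mean f \<le> 1"
  unfolding label_mean_def using assms p0 convex_bound_le[of "f False" 1 "f True" p0 "1 - p0"] by auto

text \<open>\<open>\<tau> = 1\<close> gives the indicator of \<open>[a, b)\<close> and \<open>\<tau> = 0\<close> that of the half-line \<open>[a, \<infinity>)\<close>. The covariance of
  two summands is linear in \<open>G i j\<close> up to a quadratic error. The linear terms are added up before absolute
  values are taken, so that they contribute the mean correlation and not the mean absolute correlation. The
  weights \<open>\<mu>\<close>, \<open>c\<close> and \<open>\<kappa>\<close> are kept explicit because all three are small for a short interval.\<close>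

lemma threshold_count_variance:
  fixes a b \<tau> B \<mu> c \<kappa> :: real and k :: "real \<Rightarrow> real" and f :: "bool \<Rightarrow> real"
  assumes \<tau>: "\<tau> = 0 \<or> \<tau> = 1 \<and> a \<le> b \<and> \<bar>b\<bar> \<le> B" and a: "\<bar>a\<bar> \<le> B"
    and f: "\<And>x. f x = 0 \<or> f x = 1"
  defines "k \<equiv> \<lambda>x. indicator {a..} x - \<tau> * indicator {b..} x"
    and "\<mu> \<equiv> normal_tail a - \<tau> * normal_tail b"
    and "c \<equiv> std_normal_density a - \<tau> * std_normal_density b"
  defines "\<kappa> \<equiv> LINT x|std_normal_distribution. k x * (1 + B + \<bar>x\<bar>)\<^sup>2"
  shows "(\<integral>\<omega>. (\<Sum>i\<in>I. f (h i \<omega>) * k (y i \<omega>) - label_mean f * \<mu>)\<^sup>2 \<partial>P)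
      \<le> real (card I) * \<mu> + c\<^sup>2 * \<bar>offdiag G\<bar> + 20 * \<kappa> * offdiag (\<lambda>i j. (G i j)\<^sup>2)"
    and "integrable P (\<lambda>\<omega>. (\<Sum>i\<in>I. f (h i \<omega>) * k (y i \<omega>) - label_mean f * \<mu>)\<^sup>2)"
proof -
  let ?N = std_normal_distribution
  have k01: "k x = 0 \<or> k x = 1" for x using \<tau> by (auto simp: k_def indicator_def)
  have k0: "0 \<le> k x" "k x \<le> 1" for x using k01[of x] by auto
  have f0: "0 \<le> f x" "f x \<le> 1" for x using f[of x] by auto
  have \<tau>01: "0 \<le> \<tau>" "\<tau> \<le> 1" using \<tau> by auto
  have B0: "0 \<le> B" using a by linarith
  have [measurable]: "k \<in> borel_measurable borel" by (simp add: k_def)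
  have intk: "integrable ?N k" by (rule std_normal.integrable_const_bound[of _ 1]) (use k0 in auto)
  have ind_int: "integrable ?N (indicator {z..} :: real \<Rightarrow> real)" for z
    by (rule std_normal.integrable_const_bound[of _ 1]) (auto simp: indicator_def)
  have Nk: "(LINT x|?N. k x) = \<mu>"
    unfolding k_def \<mu>_def by (simp add: ind_int normal_tail_def)
  have kx: "k x * x = indicator {a..} x * x - \<tau> * (indicator {b..} x * x)" for x
    by (simp add: k_def algebra_simps)
  have Nkx: "(LINT x|?N. k x * x) = c" "integrable ?N (\<lambda>x. k x * x)"
    unfolding kx c_def using integrable_indicator_times_id by (simp_all add: truncated_mean_std_normal)
  have intw: "integrable ?N (\<lambda>x. k x * (1 + A + \<bar>x\<bar>)\<^sup>2)" if "0 \<le> A" for A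
  proof -
    have "k x * (1 + A + \<bar>x\<bar>)\<^sup>2 = indicator {a..} x * (1 + A + \<bar>x\<bar>)\<^sup>2 - \<tau> * (indicator {b..} x * (1 + A + \<bar>x\<bar>)\<^sup>2)" for x
      by (simp add: k_def algebra_simps)
    then show ?thesis using integrable_indicator_weight[OF that] by simp
  qed
  have kappa_mono: "(LINT x|?N. \<bar>k x\<bar> * (1 + \<bar>A\<bar> + \<bar>x\<bar>)\<^sup>2) \<le> \<kappa>" if "\<bar>A\<bar> \<le> B" for A
    unfolding \<kappa>_def using intw[of "\<bar>A\<bar>"] intw[OF B0] k0 that
    by (intro integral_mono) (auto intro!: mult_left_mono power_mono)
  have kappa0: "0 \<le> \<kappa>" unfolding \<kappa>_def using k0 by (intro Bochner_Integration.integral_nonneg) auto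
  define l where "l = label_mean f"
  have l: "0 \<le> l" "l \<le> 1" unfolding l_def using label_mean_bounds f0 by auto
  have mu0: "0 \<le> \<mu>" unfolding Nk[symmetric] using k0 by (intro Bochner_Integration.integral_nonneg) auto
  define Z where "Z = (\<lambda>i \<omega>. f (h i \<omega>) * k (y i \<omega>))"
  have Z01: "Z i \<omega> = 0 \<or> Z i \<omega> = 1" for i \<omega> unfolding Z_def using f[of "h i \<omega>"] k01[of "y i \<omega>"] by auto
  have Zm [measurable]: "Z i \<in> borel_measurable P" if i: "i \<in> I" for i
  proof -
    have [measurable]: "Measurable.pred P (h i)" "y i \<in> borel_measurable P" using i h_meas y_meas by auto
    have "Z i = (\<lambda>\<omega>. (if h i \<omega> then f True else f False) * k (y i \<omega>))" by (auto simp: Z_def)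
    then show ?thesis by simp
  qed
  have bdd: "integrable P g" if "g \<in> borel_measurable P" "\<And>\<omega>. \<bar>g \<omega>\<bar> \<le> 1" for g :: "'b \<Rightarrow> real"
    by (rule integrable_const_bound[of _ 1]) (use that in auto)
  have ZZ: "\<bar>Z i \<omega> * Z j \<omega>\<bar> \<le> 1" for i j \<omega> using Z01[of i \<omega>] Z01[of j \<omega>] by auto
  have Z1: "\<bar>Z i \<omega>\<bar> \<le> 1" for i \<omega> using Z01[of i \<omega>] by auto
  have intZ: "integrable P (Z i)" "integrable P (\<lambda>\<omega>. Z i \<omega> * Z j \<omega>)" if "i \<in> I" "j \<in> I" for i j
    by (rule bdd; use that Z1 ZZ in simp)+
  have EZ: "(\<integral>\<omega>. Z i \<omega> \<partial>P) = l * \<mu>" if i: "i \<in> I" for i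
    using expectation_labels_form(1)[of "{i}" "\<lambda>k. of_bool (k = i)" "\<lambda>_. 0" k "\<lambda>_. f"] i fcov_unit(1)[OF i i] G_diag[OF i] intk
    by (simp add: form_unit Z_def l_def Nk)
  define X where "X = (\<lambda>i \<omega>. Z i \<omega> - l * \<mu>)"
  have XX: "X i \<omega> * X j \<omega> = Z i \<omega> * Z j \<omega> - l * \<mu> * Z i \<omega> - l * \<mu> * Z j \<omega> + (l * \<mu>)\<^sup>2" for i j \<omega>
    by (simp add: X_def algebra_simps power2_eq_square)
  have intXX: "integrable P (\<lambda>\<omega>. X i \<omega> * X j \<omega>)" if "i \<in> I" "j \<in> I" for i j
    unfolding XX using intZ[OF that] intZ[OF that(2) that(1)] by simp
  have EXX: "(\<integral>\<omega>. X i \<omega> * X j \<omega> \<partial>P) = (\<integral>\<omega>. Z i \<omega> * Z j \<omega> \<partial>P) - (l * \<mu>)\<^sup>2" if "i \<in> I" "j \<in> I" for i j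
    unfolding XX using intZ[OF that] intZ[OF that(2) that(1)] EZ[OF that(1)] EZ[OF that(2)]
    by (simp add: prob_space power2_eq_square)
  have diag: "(\<integral>\<omega>. (X i \<omega>)\<^sup>2 \<partial>P) \<le> \<mu>" if i: "i \<in> I" for i
  proof -
    have "(\<integral>\<omega>. Z i \<omega> * Z i \<omega> \<partial>P) = (\<integral>\<omega>. Z i \<omega> \<partial>P)"
      by (intro Bochner_Integration.integral_cong refl) (use Z01 in force)
    then have "(\<integral>\<omega>. (X i \<omega>)\<^sup>2 \<partial>P) = l * \<mu> - (l * \<mu>)\<^sup>2"
      using EXX[OF i i] EZ[OF i] by (simp add: power2_eq_square)
    also have "\<dots> \<le> 1 * \<mu>" using mult_right_mono[OF l(2) mu0] zero_le_power2[of "l * \<mu>"] by linarith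
    finally show ?thesis by simp
  qed
  have off: "(\<integral>\<omega>. X i \<omega> * X j \<omega> \<partial>P) \<le> l\<^sup>2 * c\<^sup>2 * G i j + 20 * \<kappa> * (G i j)\<^sup>2" if ij: "i \<in> I" "j \<in> I" "i \<noteq> j" for i j
  proof -
    have expand: "\<bar>(\<integral>\<omega>. f (h i \<omega>) * f (h j \<omega>) * k (y i \<omega>) * indicator {A..} (y j \<omega>) \<partial>P)
       - l\<^sup>2 * (normal_tail A * \<mu> + G i j * std_normal_density A * c)\<bar> \<le> 10 * (G i j)\<^sup>2 * \<kappa>" if A: "\<bar>A\<bar> \<le> B" for A
    proof -
      have "\<bar>(\<integral>\<omega>. (\<Prod>j\<in>{i, j}. f (h j \<omega>)) * k (form (\<lambda>k. of_bool (k = i)) (\<lambda>_. 0) \<omega>)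
            * indicator {A..} (form (\<lambda>k. of_bool (k = j)) (\<lambda>_. 0) \<omega>) \<partial>P)
          - (\<Prod>j\<in>{i, j}. label_mean f) * (normal_tail A * (LINT x|?N. k x)
            + G i j * std_normal_density A * (LINT x|?N. k x * x))\<bar>
        \<le> 10 * (G i j)\<^sup>2 * (LINT x|?N. \<bar>k x\<bar> * (1 + \<bar>A\<bar> + \<bar>x\<bar>)\<^sup>2)"
        by (rule pair_tail_expansion)
           (use ij f0 fcov_unit(1) G_diag intw[of "\<bar>A\<bar>"] k0 in auto)
      also have "\<dots> \<le> 10 * (G i j)\<^sup>2 * \<kappa>" using kappa_mono[OF A] by (intro mult_left_mono) auto
      finally show ?thesis
        using ij by (simp add: form_unit Nk Nkx l_def power2_eq_square)
    qed
    define E1 E2 where "E1 = (\<integral>\<omega>. f (h i \<omega>) * f (h j \<omega>) * k (y i \<omega>) * indicator {a..} (y j \<omega>) \<partial>P)"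
      and "E2 = (\<integral>\<omega>. f (h i \<omega>) * f (h j \<omega>) * k (y i \<omega>) * indicator {b..} (y j \<omega>) \<partial>P)"
    have intE: "integrable P (\<lambda>\<omega>. f (h i \<omega>) * f (h j \<omega>) * k (y i \<omega>) * indicator {A..} (y j \<omega>))" for A
    proof (rule bdd)
      have [measurable]: "Measurable.pred P (h i)" "Measurable.pred P (h j)" "y i \<in> borel_measurable P" "y j \<in> borel_measurable P"
        using ij h_meas y_meas by auto
      have "(\<lambda>\<omega>. f (h i \<omega>) * f (h j \<omega>) * k (y i \<omega>) * indicator {A..} (y j \<omega>)) =
          (\<lambda>\<omega>. (if h i \<omega> then f True else f False) * (if h j \<omega> then f True else f False) * k (y i \<omega>) * indicator {A..} (y j \<omega>))" by auto
      then show "(\<lambda>\<omega>. f (h i \<omega>) * f (h j \<omega>) * k (y i \<omega>) * indicator {A..} (y j \<omega>)) \<in> borel_measurable P" by simp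
      show "\<bar>f (h i \<omega>) * f (h j \<omega>) * k (y i \<omega>) * indicator {A..} (y j \<omega>)\<bar> \<le> 1" for \<omega>
        using f[of "h i \<omega>"] f[of "h j \<omega>"] k01[of "y i \<omega>"] by (auto simp: indicator_def)
    qed
    have "(\<integral>\<omega>. Z i \<omega> * Z j \<omega> \<partial>P) = (\<integral>\<omega>. f (h i \<omega>) * f (h j \<omega>) * k (y i \<omega>) * indicator {a..} (y j \<omega>)
        - \<tau> * (f (h i \<omega>) * f (h j \<omega>) * k (y i \<omega>) * indicator {b..} (y j \<omega>)) \<partial>P)"
    proof (rule Bochner_Integration.integral_cong[OF refl])
      fix \<omega>
      have kj: "k (y j \<omega>) = indicator {a..} (y j \<omega>) - \<tau> * indicator {b..} (y j \<omega>)" by (simp add: k_def)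
      show "Z i \<omega> * Z j \<omega> = f (h i \<omega>) * f (h j \<omega>) * k (y i \<omega>) * indicator {a..} (y j \<omega>)
        - \<tau> * (f (h i \<omega>) * f (h j \<omega>) * k (y i \<omega>) * indicator {b..} (y j \<omega>))"
        unfolding Z_def kj by (simp add: algebra_simps)
    qed
    also have "\<dots> = E1 - \<tau> * E2" unfolding E1_def E2_def using intE by simp
    finally have ZE: "(\<integral>\<omega>. Z i \<omega> * Z j \<omega> \<partial>P) = E1 - \<tau> * E2" .
    have e1: "E1 \<le> l\<^sup>2 * (normal_tail a * \<mu> + G i j * std_normal_density a * c) + 10 * (G i j)\<^sup>2 * \<kappa>"
      using expand[OF a] unfolding E1_def by linarith
    have e2: "- \<tau> * E2 \<le> - \<tau> * (l\<^sup>2 * (normal_tail b * \<mu> + G i j * std_normal_density b * c)) + 10 * (G i j)\<^sup>2 * \<kappa>"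
    proof (cases "\<tau> = 0")
      case False
      then have "\<tau> = 1" "\<bar>b\<bar> \<le> B" using \<tau> by auto
      then show ?thesis using expand[of b] unfolding E2_def by simp
    qed (use kappa0 in simp)
    have "l\<^sup>2 * (normal_tail a * \<mu> + G i j * std_normal_density a * c) - \<tau> * (l\<^sup>2 * (normal_tail b * \<mu> + G i j * std_normal_density b * c))
        = l\<^sup>2 * (\<mu> * (normal_tail a - \<tau> * normal_tail b) + G i j * c * (std_normal_density a - \<tau> * std_normal_density b))"
      by (simp add: algebra_simps)
    also have "\<dots> = (l * \<mu>)\<^sup>2 + l\<^sup>2 * c\<^sup>2 * G i j"
      unfolding \<mu>_def[symmetric] c_def[symmetric] by (simp add: power2_eq_square algebra_simps)
    finally show ?thesis
      using e1 e2 unfolding EXX[OF ij(1,2)] ZE by (simp add: mult_ac)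
  qed
  have sum: "(\<Sum>i\<in>I. f (h i \<omega>) * k (y i \<omega>) - label_mean f * \<mu>) = (\<Sum>i\<in>I. X i \<omega>)" for \<omega>
    by (simp add: X_def Z_def l_def)
  have "(\<integral>\<omega>. (\<Sum>i\<in>I. X i \<omega>)\<^sup>2 \<partial>P) =
      (\<Sum>i\<in>I. \<integral>\<omega>. (X i \<omega>)\<^sup>2 \<partial>P) + (\<Sum>i\<in>I. \<Sum>j\<in>I - {i}. \<integral>\<omega>. X i \<omega> * X j \<omega> \<partial>P)"
    by (rule second_moment_sum[OF finite_I intXX])
  also have "\<dots> \<le> (\<Sum>i\<in>I. \<mu>) + (\<Sum>i\<in>I. \<Sum>j\<in>I - {i}. l\<^sup>2 * c\<^sup>2 * G i j + 20 * \<kappa> * (G i j)\<^sup>2)"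
    by (intro add_mono sum_mono diag off) auto
  also have "\<dots> = real (card I) * \<mu> + l\<^sup>2 * (c\<^sup>2 * offdiag G) + 20 * \<kappa> * offdiag (\<lambda>i j. (G i j)\<^sup>2)"
    by (simp add: offdiag_def sum.distrib sum_distrib_left mult_ac)
  also have "l\<^sup>2 * (c\<^sup>2 * offdiag G) \<le> l\<^sup>2 * (c\<^sup>2 * \<bar>offdiag G\<bar>)" by (intro mult_left_mono) auto
  also have "l\<^sup>2 * (c\<^sup>2 * \<bar>offdiag G\<bar>) \<le> 1 * (c\<^sup>2 * \<bar>offdiag G\<bar>)"
    using l by (intro mult_right_mono) (auto intro: power_le_one)
  finally show "(\<integral>\<omega>. (\<Sum>i\<in>I. f (h i \<omega>) * k (y i \<omega>) - label_mean f * \<mu>)\<^sup>2 \<partial>P)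
      \<le> real (card I) * \<mu> + c\<^sup>2 * \<bar>offdiag G\<bar> + 20 * \<kappa> * offdiag (\<lambda>i j. (G i j)\<^sup>2)"
    unfolding sum by simp
  show "integrable P (\<lambda>\<omega>. (\<Sum>i\<in>I. f (h i \<omega>) * k (y i \<omega>) - label_mean f * \<mu>)\<^sup>2)"
    unfolding sum by (rule second_moment_sum[OF finite_I intXX])
qed

text \<open>What remains of \<open>(1 - H) 1{x \<ge> z}\<close> after subtracting the mean and the linear part in \<open>x\<close>. Being
  orthogonal to the constants and to \<open>x\<close>, it has covariances of second order only.\<close>

definition resid :: "real \<Rightarrow> bool \<Rightarrow> real \<Rightarrow> real" where
  "resid z l x = of_bool (\<not> l) * indicator {z..} x - p0 * (normal_tail z + std_normal_density z * x)"

lemma resid_meas: "i \<in> I \<Longrightarrow> (\<lambda>\<omega>. resid z (h i \<omega>) (form b c \<omega>)) \<in> borel_measurable P"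
proof -
  assume "i \<in> I"
  then have [measurable]: "Measurable.pred P (h i)" by (rule h_meas)
  show ?thesis unfolding resid_def by measurable
qed

lemma resid_abs_le: "\<bar>resid z l x\<bar> \<le> 1 + \<bar>x\<bar>"
proof -
  have "\<bar>of_bool (\<not> l) * indicator {z..} x - p0 * normal_tail z\<bar> \<le> 1"
  proof -
    have "0 \<le> p0 * normal_tail z" using p0 by simp
    moreover have "p0 * normal_tail z \<le> 1" using p0 by (intro mult_le_one) auto
    moreover define e :: real where "e = of_bool (\<not> l) * indicator {z..} x"
    moreover have "e = 0 \<or> e = 1" by (auto simp: e_def indicator_def)
    ultimately show ?thesis by (smt (verit))
  qed
  moreover have "\<bar>p0 * (std_normal_density z * x)\<bar> \<le> 1 * (1 * \<bar>x\<bar>)"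
    unfolding abs_mult using p0 std_normal_density_le[of z] by (intro mult_mono) auto
  ultimately show ?thesis unfolding resid_def distrib_left by linarith
qed

lemma resid_moments:
  fixes z v :: real
  assumes i: "i \<in> I" and U: "fcov b c b c = 1"
  defines "v \<equiv> p0 * normal_tail z - p0\<^sup>2 * ((normal_tail z)\<^sup>2 + (std_normal_density z)\<^sup>2)"
  shows "(\<integral>\<omega>. resid z (h i \<omega>) (form b c \<omega>) \<partial>P) = 0"
    and "(\<integral>\<omega>. resid z (h i \<omega>) (form b c \<omega>) * form b c \<omega> \<partial>P) = 0"
    and "(\<integral>\<omega>. (resid z (h i \<omega>) (form b c \<omega>))\<^sup>2 \<partial>P) = v"
proof -
  let ?N = std_normal_distribution
  define q where "q = (\<lambda>l. of_bool (\<not> l) :: real)"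
  have lq: "label_mean q = p0" by (simp add: label_mean_def q_def)
  define t d where "t = normal_tail z" and "d = std_normal_density z"
  define k where "k = (indicator {z..} :: real \<Rightarrow> real)"
  have intk: "integrable ?N k" unfolding k_def
    by (rule std_normal.integrable_const_bound[of _ 1]) (auto simp: indicator_def)
  have intkx: "integrable ?N (\<lambda>x. k x * x)" unfolding k_def by (rule integrable_indicator_times_id)
  have Nk: "(LINT x|?N. k x) = t" "(LINT x|?N. k x * x) = d"
    by (simp_all add: k_def t_def d_def normal_tail_def truncated_mean_std_normal)
  have A: "(\<integral>\<omega>. q (h i \<omega>) * k (form b c \<omega>) \<partial>P) = p0 * t" "integrable P (\<lambda>\<omega>. q (h i \<omega>) * k (form b c \<omega>))"
    "(\<integral>\<omega>. q (h i \<omega>) * (k (form b c \<omega>) * form b c \<omega>) \<partial>P) = p0 * d"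
    "integrable P (\<lambda>\<omega>. q (h i \<omega>) * (k (form b c \<omega>) * form b c \<omega>))"
    using expectation_labels_form[of "{i}" b c k "\<lambda>_. q"] expectation_labels_form[of "{i}" b c "\<lambda>x. k x * x" "\<lambda>_. q"]
      i U intk intkx by (simp_all add: lq Nk)
  note F = form_mean[of b c]
  have F2: "integrable P (\<lambda>\<omega>. form b c \<omega> * form b c \<omega>)" "(\<integral>\<omega>. form b c \<omega> * form b c \<omega> \<partial>P) = 1"
    using expectation_form_times_form[OF U, of b c] U by auto
  have r: "resid z (h i \<omega>) (form b c \<omega>) = q (h i \<omega>) * k (form b c \<omega>) - (p0 * t + p0 * d * form b c \<omega>)" for \<omega>
    by (simp add: resid_def q_def k_def t_def d_def algebra_simps)
  show "(\<integral>\<omega>. resid z (h i \<omega>) (form b c \<omega>) \<partial>P) = 0"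
    unfolding r using A F by (simp add: prob_space)
  have "resid z (h i \<omega>) (form b c \<omega>) * form b c \<omega> =
      q (h i \<omega>) * (k (form b c \<omega>) * form b c \<omega>) - (p0 * t * form b c \<omega> + p0 * d * (form b c \<omega> * form b c \<omega>))" for \<omega>
    unfolding r by (simp add: algebra_simps)
  then show "(\<integral>\<omega>. resid z (h i \<omega>) (form b c \<omega>) * form b c \<omega> \<partial>P) = 0"
    using A F F2 by simp
  have "(resid z (h i \<omega>) (form b c \<omega>))\<^sup>2 = (1 - 2 * p0 * t) * (q (h i \<omega>) * k (form b c \<omega>))
      - 2 * p0 * d * (q (h i \<omega>) * (k (form b c \<omega>) * form b c \<omega>))
      + ((p0 * t)\<^sup>2 + 2 * p0 * t * p0 * d * form b c \<omega> + (p0 * d)\<^sup>2 * (form b c \<omega> * form b c \<omega>))" for \<omega>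
    unfolding r by (auto simp: algebra_simps power2_eq_square q_def k_def indicator_def)
  then have "(\<integral>\<omega>. (resid z (h i \<omega>) (form b c \<omega>))\<^sup>2 \<partial>P) = (1 - 2 * p0 * t) * (p0 * t)
      - 2 * p0 * d * (p0 * d) + ((p0 * t)\<^sup>2 + (p0 * d)\<^sup>2)"
    using A F F2 by (simp add: prob_space)
  also have "\<dots> = v" by (simp add: v_def t_def d_def power2_eq_square algebra_simps)
  finally show "(\<integral>\<omega>. (resid z (h i \<omega>) (form b c \<omega>))\<^sup>2 \<partial>P) = v" .
qed

text \<open>The linear term in the expansion of the covariance of the two indicators is exactly the part carried by
  the linear forms that \<open>resid\<close> subtracts.\<close>

lemma resid_pair:
  fixes z \<kappa> :: real
  assumes ij: "i \<in> I" "j \<in> I" "i \<noteq> j" and U: "fcov b c b c = 1" and V: "fcov b' c' b' c' = 1"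
  defines "\<kappa> \<equiv> LINT x|std_normal_distribution. indicator {z..} x * (1 + \<bar>z\<bar> + \<bar>x\<bar>)\<^sup>2"
  shows "\<bar>\<integral>\<omega>. resid z (h i \<omega>) (form b c \<omega>) * resid z (h j \<omega>) (form b' c' \<omega>) \<partial>P\<bar> \<le> 10 * (fcov b c b' c')\<^sup>2 * \<kappa>"
proof -
  let ?N = std_normal_distribution
  define \<rho> where "\<rho> = fcov b c b' c'"
  define q where "q = (\<lambda>l. of_bool (\<not> l) :: real)"
  have lq: "label_mean q = p0" by (simp add: label_mean_def q_def)
  define t d where "t = normal_tail z" and "d = std_normal_density z"
  define k where "k = (indicator {z..} :: real \<Rightarrow> real)"
  have [measurable]: "k \<in> borel_measurable borel" by (simp add: k_def)
  have [measurable]: "Measurable.pred P (h i)" "Measurable.pred P (h j)" using ij h_meas by auto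
  have intk: "integrable ?N k" unfolding k_def
    by (rule std_normal.integrable_const_bound[of _ 1]) (auto simp: indicator_def)
  have intkx: "integrable ?N (\<lambda>x. k x * x)" unfolding k_def by (rule integrable_indicator_times_id)
  have Nk: "(LINT x|?N. k x) = t" "(LINT x|?N. k x * x) = d"
    by (simp_all add: k_def t_def d_def normal_tail_def truncated_mean_std_normal)
  define UU VV where "UU = form b c" and "VV = form b' c'"
  have single: "(\<integral>\<omega>. q (h i' \<omega>) * k (form e g \<omega>) \<partial>P) = p0 * t" "integrable P (\<lambda>\<omega>. q (h i' \<omega>) * k (form e g \<omega>))"
    "(\<integral>\<omega>. q (h i' \<omega>) * k (form e g \<omega>) * form e' g' \<omega> \<partial>P) = fcov e g e' g' * (p0 * d)"
    "integrable P (\<lambda>\<omega>. q (h i' \<omega>) * k (form e g \<omega>) * form e' g' \<omega>)"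
    if "fcov e g e g = 1" "i' \<in> I" for e g e' g' i'
    using expectation_labels_form[of "{i'}" e g k "\<lambda>_. q"]
      expectation_labels_form_times_form[of "{i'}" e g k "\<lambda>_. q" e' g']
      that intk intkx by (simp_all add: lq Nk mult.assoc)
  note A = single(1,2)[OF U ij(1), folded UU_def]
    single(3,4)[OF U ij(1), of b' c', folded UU_def VV_def \<rho>_def]
  note B = single(1,2)[OF V ij(2), folded VV_def]
    single(3,4)[OF V ij(2), of b c, folded UU_def VV_def, unfolded fcov_sym[of b' c' b c], folded \<rho>_def]
  note F = form_mean[of b c, folded UU_def] form_mean[of b' c', folded VV_def]
  note F2 = expectation_form_times_form[OF U, of b' c', folded UU_def VV_def \<rho>_def]
  define E where "E = (\<integral>\<omega>. q (h i \<omega>) * q (h j \<omega>) * k (UU \<omega>) * k (VV \<omega>) \<partial>P)"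
  have intE: "integrable P (\<lambda>\<omega>. q (h i \<omega>) * q (h j \<omega>) * k (UU \<omega>) * k (VV \<omega>))"
    unfolding UU_def VV_def q_def
    by (rule integrable_const_bound[of _ 1]) (auto simp: k_def indicator_def)
  have E: "\<bar>E - p0\<^sup>2 * (t * t + \<rho> * d * d)\<bar> \<le> 10 * \<rho>\<^sup>2 * \<kappa>"
  proof -
    have "\<bar>(\<integral>\<omega>. (\<Prod>j\<in>{i, j}. q (h j \<omega>)) * k (form b c \<omega>) * indicator {z..} (form b' c' \<omega>) \<partial>P)
          - (\<Prod>j\<in>{i, j}. label_mean q) * (normal_tail z * (LINT x|?N. k x)
            + \<rho> * std_normal_density z * (LINT x|?N. k x * x))\<bar>
        \<le> 10 * \<rho>\<^sup>2 * (LINT x|?N. \<bar>k x\<bar> * (1 + \<bar>z\<bar> + \<bar>x\<bar>)\<^sup>2)"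
      by (rule pair_tail_expansion)
         (use ij U V integrable_indicator_weight[of "\<bar>z\<bar>" z] in \<open>auto simp: \<rho>_def q_def k_def\<close>)
    then show ?thesis
      using ij by (simp add: E_def Nk lq \<kappa>_def UU_def VV_def power2_eq_square flip: t_def d_def k_def) (simp add: k_def)
  qed
  have "resid z (h i \<omega>) (UU \<omega>) * resid z (h j \<omega>) (VV \<omega>) = q (h i \<omega>) * q (h j \<omega>) * k (UU \<omega>) * k (VV \<omega>)
      - p0 * (t * (q (h i \<omega>) * k (UU \<omega>)) + d * (q (h i \<omega>) * k (UU \<omega>) * VV \<omega>))
      - p0 * (t * (q (h j \<omega>) * k (VV \<omega>)) + d * (q (h j \<omega>) * k (VV \<omega>) * UU \<omega>))
      + p0\<^sup>2 * (t\<^sup>2 + t * d * UU \<omega> + t * d * VV \<omega> + d\<^sup>2 * (UU \<omega> * VV \<omega>))" for \<omega>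
    by (simp add: resid_def flip: q_def k_def t_def d_def) (simp add: q_def k_def algebra_simps power2_eq_square)
  then have "(\<integral>\<omega>. resid z (h i \<omega>) (UU \<omega>) * resid z (h j \<omega>) (VV \<omega>) \<partial>P) =
      E - p0 * (t * (p0 * t) + d * (\<rho> * (p0 * d))) - p0 * (t * (p0 * t) + d * (\<rho> * (p0 * d)))
      + p0\<^sup>2 * (t\<^sup>2 + d\<^sup>2 * \<rho>)"
    using A B F F2 intE by (simp add: prob_space E_def)
  also have "\<dots> = E - p0\<^sup>2 * (t * t + \<rho> * d * d)"
    by (simp add: power2_eq_square algebra_simps)
  finally show ?thesis using E unfolding UU_def VV_def \<rho>_def by simp
qed

lemma resid_products_integrable:
  assumes ij: "i \<in> I" "j \<in> I" and U: "fcov b c b c = 1" and V: "fcov b' c' b' c' = 1"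
  shows "integrable P (\<lambda>\<omega>. resid z (h i \<omega>) (form b c \<omega>) * resid z (h j \<omega>) (form b' c' \<omega>))"
proof (rule Bochner_Integration.integrable_bound)
  have "integrable P (\<lambda>\<omega>. (1 + \<bar>form b c \<omega>\<bar>)\<^sup>2)" "integrable P (\<lambda>\<omega>. (1 + \<bar>form b' c' \<omega>\<bar>)\<^sup>2)"
    using integrable_form[OF U integrable_std_normal_poly[of 1 2]] integrable_form[OF V integrable_std_normal_poly[of 1 2]] by auto
  then show "integrable P (\<lambda>\<omega>. (1 + \<bar>form b c \<omega>\<bar>)\<^sup>2 + (1 + \<bar>form b' c' \<omega>\<bar>)\<^sup>2)" by simp
  show "(\<lambda>\<omega>. resid z (h i \<omega>) (form b c \<omega>) * resid z (h j \<omega>) (form b' c' \<omega>)) \<in> borel_measurable P"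
    using resid_meas[OF ij(1)] resid_meas[OF ij(2)] by measurable
  have young: "\<bar>x * x'\<bar> \<le> u\<^sup>2 + u'\<^sup>2" if "\<bar>x\<bar> \<le> u" "\<bar>x'\<bar> \<le> u'" for x x' u u' :: real
  proof -
    have "\<bar>x * x'\<bar> \<le> u * u'" unfolding abs_mult using that by (intro mult_mono) auto
    moreover have "2 * (u * u') \<le> u\<^sup>2 + u'\<^sup>2" using zero_le_power2[of "u - u'"] by (simp add: power2_diff)
    moreover have "0 \<le> u\<^sup>2 + u'\<^sup>2" by simp
    ultimately show ?thesis by linarith
  qed
  show "AE \<omega> in P. norm (resid z (h i \<omega>) (form b c \<omega>) * resid z (h j \<omega>) (form b' c' \<omega>))
      \<le> norm ((1 + \<bar>form b c \<omega>\<bar>)\<^sup>2 + (1 + \<bar>form b' c' \<omega>\<bar>)\<^sup>2)"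
    using young[OF resid_abs_le resid_abs_le] by (intro AE_I2) (auto simp: abs_of_nonneg)
qed

end

section \<open>Replacing the noise by independent Gaussian variables\<close>

locale coupled_mixture = gaussian_mixture P I p0 h y n G
  for P :: "'b measure" and I p0 h y n G +
  fixes D :: "nat \<Rightarrow> nat \<Rightarrow> real"
  assumes cayley: "cayley I G D"
begin

sublocale cayley I G D by (rule cayley)

definition xi_y :: "nat \<Rightarrow> nat \<Rightarrow> real" where "xi_y i = (\<lambda>k. of_bool (k = i) + D k i)"
definition xi_n :: "nat \<Rightarrow> nat \<Rightarrow> real" where "xi_n i = (\<lambda>k. D k i)"
definition xi :: "nat \<Rightarrow> 'b \<Rightarrow> real" where "xi i = form (xi_y i) (xi_n i)"

lemma fcov_xi: "i \<in> I \<Longrightarrow> j \<in> I \<Longrightarrow> fcov (xi_y i) (xi_n i) (xi_y j) (xi_n j) = of_bool (i = j)"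
  using cayley_cov unfolding fcov_def xi_y_def xi_n_def by simp

lemma fcov_y_xi:
  "i \<in> I \<Longrightarrow> j \<in> I \<Longrightarrow> fcov (\<lambda>k. of_bool (k = i)) (\<lambda>_. 0) (xi_y j) (xi_n j) = of_bool (i = j) - D i j"
  using cayley_cross_cov unfolding fcov_def xi_y_def xi_n_def by simp

lemma fcov_y_self: "i \<in> I \<Longrightarrow> fcov (\<lambda>k. of_bool (k = i)) (\<lambda>_. 0) (\<lambda>k. of_bool (k = i)) (\<lambda>_. 0) = 1"
  using fcov_unit(1) G_diag by simp

lemma fcov_xi_self: "i \<in> I \<Longrightarrow> fcov (xi_y i) (xi_n i) (xi_y i) (xi_n i) = 1"
  using fcov_xi by simp

lemma coupling_distance:
  assumes i: "i \<in> I"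
  shows "(\<integral>\<omega>. (y i \<omega> - xi i \<omega>)\<^sup>2 \<partial>P) = 2 * D i i" and "integrable P (\<lambda>\<omega>. (y i \<omega> - xi i \<omega>)\<^sup>2)"
proof -
  note Y = expectation_form_times_form[OF fcov_y_self[OF i], unfolded form_unit[OF i]]
  note X = expectation_form_times_form[OF fcov_xi_self[OF i], folded xi_def]
  have eq: "(\<lambda>\<omega>. (y i \<omega> - xi i \<omega>)\<^sup>2) = (\<lambda>\<omega>. y i \<omega> * form (\<lambda>k. of_bool (k = i)) (\<lambda>_. 0) \<omega>
      - 2 * (y i \<omega> * form (xi_y i) (xi_n i) \<omega>) + xi i \<omega> * form (xi_y i) (xi_n i) \<omega>)"
    by (simp add: power2_eq_square algebra_simps form_unit[OF i] xi_def)
  show "(\<integral>\<omega>. (y i \<omega> - xi i \<omega>)\<^sup>2 \<partial>P) = 2 * D i i" "integrable P (\<lambda>\<omega>. (y i \<omega> - xi i \<omega>)\<^sup>2)"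
    unfolding eq using X Y i by (simp_all add: fcov_y_self fcov_xi_self fcov_y_xi)
qed

definition resid_gap :: "real \<Rightarrow> nat \<Rightarrow> 'b \<Rightarrow> real" where
  "resid_gap z i \<omega> = resid z (h i \<omega>) (y i \<omega>) - resid z (h i \<omega>) (xi i \<omega>)"

text \<open>The two indicators differ only if \<open>\<xi>\<close> lies within \<open>\<eta>\<close> of the threshold or is further than \<open>\<eta>\<close> away
  from \<open>y\<close>.\<close>

lemma resid_gap_sq:
  assumes i: "i \<in> I" and \<eta>: "0 < \<eta>"
  shows "(\<integral>\<omega>. (resid_gap z i \<omega>)\<^sup>2 \<partial>P) \<le> 4 * \<eta> + (4 / \<eta>\<^sup>2 + 4) * D i i"
    and "integrable P (\<lambda>\<omega>. (resid_gap z i \<omega>)\<^sup>2)"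
proof -
  note [measurable] = h_meas[OF i] y_meas[OF i]
  have [measurable]: "xi i \<in> borel_measurable P" by (simp add: xi_def)
  define J where "J = (\<lambda>\<omega>. indicator {z - \<eta>..} (xi i \<omega>) - indicator {z + \<eta>..} (xi i \<omega>) :: real)"
  have intJ: "integrable P J" unfolding J_def
    by (rule integrable_const_bound[of _ 1]) (auto simp: indicator_def)
  have EJ: "(\<integral>\<omega>. J \<omega> \<partial>P) = normal_tail (z - \<eta>) - normal_tail (z + \<eta>)"
  proof -
    have "(\<integral>\<omega>. J \<omega> \<partial>P) = (LINT x|std_normal_distribution. indicator {z - \<eta>..} x - indicator {z + \<eta>..} x)"
      unfolding J_def xi_def using fcov_xi_self[OF i]
      by (subst expectation_form[of "xi_y i" "xi_n i" "\<lambda>x. indicator {z - \<eta>..} x - indicator {z + \<eta>..} x"]) auto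
    also have "\<dots> = normal_tail (z - \<eta>) - normal_tail (z + \<eta>)"
      unfolding normal_tail_def
      by (subst Bochner_Integration.integral_diff)
         (auto intro!: std_normal.integrable_const_bound[of _ 1] simp: indicator_def)
    finally show ?thesis .
  qed
  have pw: "(resid_gap z i \<omega>)\<^sup>2 \<le> 2 * J \<omega> + (2 / \<eta>\<^sup>2 + 2) * (y i \<omega> - xi i \<omega>)\<^sup>2" for \<omega>
  proof -
    define u v where "u = y i \<omega>" and "v = xi i \<omega>"
    define d where "d = (indicator {z..} u - indicator {z..} v :: real)"
    define e where "e = p0 * std_normal_density z * (u - v)"
    have gap: "resid_gap z i \<omega> = of_bool (\<not> h i \<omega>) * d - e"
      by (simp add: resid_gap_def resid_def u_def v_def d_def e_def algebra_simps)
    have e: "e\<^sup>2 \<le> (u - v)\<^sup>2"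
    proof -
      have "\<bar>p0 * std_normal_density z\<bar> \<le> 1 * 1"
        unfolding abs_mult using p0 std_normal_density_le[of z] by (intro mult_mono) auto
      then have "\<bar>e\<bar> \<le> 1 * \<bar>u - v\<bar>" unfolding e_def abs_mult[of _ "u - v"] by (intro mult_right_mono) auto
      then show ?thesis by (simp add: abs_le_square_iff)
    qed
    have d: "d\<^sup>2 \<le> J \<omega> + (u - v)\<^sup>2 / \<eta>\<^sup>2"
    proof (cases "\<bar>u - v\<bar> < \<eta>")
      case True
      then have "d\<^sup>2 \<le> J \<omega>"
        unfolding d_def J_def v_def[symmetric] by (auto simp: indicator_def)
      then show ?thesis by (smt (verit) divide_nonneg_nonneg zero_le_power2)
    next
      case False
      then have "1 \<le> (u - v)\<^sup>2 / \<eta>\<^sup>2"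
        using \<eta> power_mono[of \<eta> "\<bar>u - v\<bar>" 2] by simp
      moreover have "d\<^sup>2 \<le> 1" "0 \<le> J \<omega>" using \<eta> by (auto simp: d_def J_def indicator_def)
      ultimately show ?thesis by linarith
    qed
    define g where "g = of_bool (\<not> h i \<omega>) * d"
    have "g\<^sup>2 \<le> d\<^sup>2" by (simp add: g_def)
    moreover have "(g - e)\<^sup>2 \<le> 2 * g\<^sup>2 + 2 * e\<^sup>2"
      using zero_le_power2[of "g + e"] by (simp add: power2_sum power2_diff)
    moreover have "a' \<le> 2 * q + 2 * s" if "g' \<le> d'" "a' \<le> 2 * g' + 2 * e'" "d' \<le> q" "e' \<le> s" for a' g' d' e' q s :: real
      using that by linarith
    ultimately have "(resid_gap z i \<omega>)\<^sup>2 \<le> 2 * (J \<omega> + (u - v)\<^sup>2 / \<eta>\<^sup>2) + 2 * (u - v)\<^sup>2"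
      using d e unfolding gap g_def[symmetric] by blast
    then show ?thesis by (simp add: u_def v_def algebra_simps)
  qed
  have intR: "integrable P (\<lambda>\<omega>. 2 * J \<omega> + (2 / \<eta>\<^sup>2 + 2) * (y i \<omega> - xi i \<omega>)\<^sup>2)"
    using intJ coupling_distance(2)[OF i] by simp
  show int: "integrable P (\<lambda>\<omega>. (resid_gap z i \<omega>)\<^sup>2)"
  proof (rule Bochner_Integration.integrable_bound[OF intR])
    show "(\<lambda>\<omega>. (resid_gap z i \<omega>)\<^sup>2) \<in> borel_measurable P"
      unfolding resid_gap_def resid_def by measurable
    show "AE \<omega> in P. norm ((resid_gap z i \<omega>)\<^sup>2) \<le> norm (2 * J \<omega> + (2 / \<eta>\<^sup>2 + 2) * (y i \<omega> - xi i \<omega>)\<^sup>2)"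
      using pw by (intro AE_I2) (smt (verit) real_norm_def zero_le_power2)
  qed
  have "(\<integral>\<omega>. (resid_gap z i \<omega>)\<^sup>2 \<partial>P) \<le> (\<integral>\<omega>. 2 * J \<omega> + (2 / \<eta>\<^sup>2 + 2) * (y i \<omega> - xi i \<omega>)\<^sup>2 \<partial>P)"
    by (rule integral_mono[OF int intR pw])
  also have "\<dots> = 2 * (normal_tail (z - \<eta>) - normal_tail (z + \<eta>)) + (2 / \<eta>\<^sup>2 + 2) * (2 * D i i)"
    using intJ coupling_distance[OF i] by (simp add: EJ)
  also have "normal_tail (z - \<eta>) - normal_tail (z + \<eta>) \<le> 2 * \<eta>"
    using normal_tail_Lipschitz[of "z - \<eta>" "z + \<eta>"] \<eta> by linarith
  finally show "(\<integral>\<omega>. (resid_gap z i \<omega>)\<^sup>2 \<partial>P) \<le> 4 * \<eta> + (4 / \<eta>\<^sup>2 + 4) * D i i"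
    by (simp add: algebra_simps)
qed

text \<open>Off the diagonal only squared covariances enter, and they are controlled by the Frobenius norm of
  \<open>D\<close>; on the diagonal the trace of \<open>D\<close> controls the mean squared distances.\<close>

lemma coupling_error:
  fixes z \<kappa> \<eta> :: real
  assumes \<eta>: "0 < \<eta>"
  defines "\<kappa> \<equiv> LINT x|std_normal_distribution. indicator {z..} x * (1 + \<bar>z\<bar> + \<bar>x\<bar>)\<^sup>2"
  shows "(\<integral>\<omega>. (\<Sum>i\<in>I. resid_gap z i \<omega>)\<^sup>2 \<partial>P)
      \<le> 4 * \<eta> * real (card I) + (30 * \<kappa> + 2 + 2 / \<eta>\<^sup>2) * offdiag (\<lambda>i j. (G i j)\<^sup>2)"
    and "integrable P (\<lambda>\<omega>. (\<Sum>i\<in>I. resid_gap z i \<omega>)\<^sup>2)"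
proof -
  define F where "F = offdiag (\<lambda>i j. (G i j)\<^sup>2)"
  have kappa0: "0 \<le> \<kappa>" unfolding \<kappa>_def by (intro Bochner_Integration.integral_nonneg) auto
  define r rx where "r = (\<lambda>i \<omega>. resid z (h i \<omega>) (y i \<omega>))" and "rx = (\<lambda>i \<omega>. resid z (h i \<omega>) (xi i \<omega>))"
  have r_form: "r i = (\<lambda>\<omega>. resid z (h i \<omega>) (form (\<lambda>k. of_bool (k = i)) (\<lambda>_. 0) \<omega>))" if "i \<in> I" for i
    using that by (simp add: r_def form_unit)
  have rx_form: "rx i = (\<lambda>\<omega>. resid z (h i \<omega>) (form (xi_y i) (xi_n i) \<omega>))" for i
    by (simp add: rx_def xi_def)
  have int: "integrable P (\<lambda>\<omega>. r i \<omega> * r j \<omega>)" "integrable P (\<lambda>\<omega>. r i \<omega> * rx j \<omega>)"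
     "integrable P (\<lambda>\<omega>. rx i \<omega> * r j \<omega>)" "integrable P (\<lambda>\<omega>. rx i \<omega> * rx j \<omega>)" if "i \<in> I" "j \<in> I" for i j
    unfolding r_form[OF that(1)] r_form[OF that(2)] rx_form
    using that by (auto intro!: resid_products_integrable fcov_y_self fcov_xi_self)
  have prod: "resid_gap z i \<omega> * resid_gap z j \<omega> = r i \<omega> * r j \<omega> - r i \<omega> * rx j \<omega> - rx i \<omega> * r j \<omega> + rx i \<omega> * rx j \<omega>" for i j \<omega>
    by (simp add: resid_gap_def r_def rx_def algebra_simps)
  have intg: "integrable P (\<lambda>\<omega>. resid_gap z i \<omega> * resid_gap z j \<omega>)" if "i \<in> I" "j \<in> I" for i j
    unfolding prod using int[OF that] by simp
  have off: "(\<integral>\<omega>. resid_gap z i \<omega> * resid_gap z j \<omega> \<partial>P) \<le> 10 * \<kappa> * (G i j)\<^sup>2 + 10 * \<kappa> * (D i j)\<^sup>2 + 10 * \<kappa> * (D j i)\<^sup>2"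
    if ij: "i \<in> I" "j \<in> I" "i \<noteq> j" for i j
  proof -
    have sym: "fcov (xi_y i) (xi_n i) (\<lambda>k. of_bool (k = j)) (\<lambda>_. 0) = - D j i"
      using fcov_y_xi[OF ij(2,1)] ij by (subst fcov_sym) simp
    have "(\<integral>\<omega>. resid_gap z i \<omega> * resid_gap z j \<omega> \<partial>P) =
        (\<integral>\<omega>. r i \<omega> * r j \<omega> \<partial>P) - (\<integral>\<omega>. r i \<omega> * rx j \<omega> \<partial>P) - (\<integral>\<omega>. rx i \<omega> * r j \<omega> \<partial>P) + (\<integral>\<omega>. rx i \<omega> * rx j \<omega> \<partial>P)"
      unfolding prod using int[OF ij(1,2)] by simp
    moreover have "\<bar>\<integral>\<omega>. r i \<omega> * r j \<omega> \<partial>P\<bar> \<le> 10 * (G i j)\<^sup>2 * \<kappa>"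
      using resid_pair[OF ij fcov_y_self[OF ij(1)] fcov_y_self[OF ij(2)], of z] ij
      by (simp add: r_form fcov_unit(1) \<kappa>_def)
    moreover have "\<bar>\<integral>\<omega>. r i \<omega> * rx j \<omega> \<partial>P\<bar> \<le> 10 * (D i j)\<^sup>2 * \<kappa>"
      using resid_pair[OF ij fcov_y_self[OF ij(1)] fcov_xi_self[OF ij(2)], of z] ij
      by (simp add: r_form rx_form fcov_y_xi \<kappa>_def)
    moreover have "\<bar>\<integral>\<omega>. rx i \<omega> * r j \<omega> \<partial>P\<bar> \<le> 10 * (D j i)\<^sup>2 * \<kappa>"
      using resid_pair[OF ij fcov_xi_self[OF ij(1)] fcov_y_self[OF ij(2)], of z] ij
      by (simp add: r_form rx_form sym \<kappa>_def)
    moreover have "\<bar>\<integral>\<omega>. rx i \<omega> * rx j \<omega> \<partial>P\<bar> \<le> 0"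
      using resid_pair[OF ij fcov_xi_self[OF ij(1)] fcov_xi_self[OF ij(2)], of z] ij
      by (simp add: rx_form fcov_xi)
    ultimately show ?thesis by (simp add: mult_ac)
  qed
  have "(\<integral>\<omega>. (\<Sum>i\<in>I. resid_gap z i \<omega>)\<^sup>2 \<partial>P) =
      (\<Sum>i\<in>I. \<integral>\<omega>. (resid_gap z i \<omega>)\<^sup>2 \<partial>P) + (\<Sum>i\<in>I. \<Sum>j\<in>I - {i}. \<integral>\<omega>. resid_gap z i \<omega> * resid_gap z j \<omega> \<partial>P)"
    by (rule second_moment_sum[OF finite_I intg])
  also have "\<dots> \<le> (\<Sum>i\<in>I. 4 * \<eta> + (4 / \<eta>\<^sup>2 + 4) * D i i) + (\<Sum>i\<in>I. \<Sum>j\<in>I - {i}.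
      10 * \<kappa> * (G i j)\<^sup>2 + 10 * \<kappa> * (D i j)\<^sup>2 + 10 * \<kappa> * (D j i)\<^sup>2)"
    by (intro add_mono sum_mono resid_gap_sq(1) off \<eta>) auto
  also have "\<dots> = 4 * \<eta> * real (card I) + (2 / \<eta>\<^sup>2 + 2) * (2 * (\<Sum>i\<in>I. D i i))
      + 10 * \<kappa> * F + 10 * \<kappa> * (\<Sum>i\<in>I. \<Sum>j\<in>I - {i}. (D i j)\<^sup>2) + 10 * \<kappa> * (\<Sum>i\<in>I. \<Sum>j\<in>I - {i}. (D j i)\<^sup>2)"
    by (simp add: sum.distrib sum_distrib_left F_def offdiag_def algebra_simps)
  also have "(\<Sum>i\<in>I. \<Sum>j\<in>I - {i}. (D j i)\<^sup>2) = (\<Sum>i\<in>I. \<Sum>j\<in>I - {i}. (D i j)\<^sup>2)"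
    by (intro sum.cong refl) (use D_sym in auto)
  also have "4 * \<eta> * real (card I) + (2 / \<eta>\<^sup>2 + 2) * (2 * (\<Sum>i\<in>I. D i i))
      + 10 * \<kappa> * F + 10 * \<kappa> * (\<Sum>i\<in>I. \<Sum>j\<in>I - {i}. (D i j)\<^sup>2) + 10 * \<kappa> * (\<Sum>i\<in>I. \<Sum>j\<in>I - {i}. (D i j)\<^sup>2)
     \<le> 4 * \<eta> * real (card I) + (2 / \<eta>\<^sup>2 + 2) * F + 10 * \<kappa> * F + 10 * \<kappa> * F + 10 * \<kappa> * F"
  proof -
    have "(\<Sum>i\<in>I. \<Sum>j\<in>I - {i}. (D i j)\<^sup>2) \<le> (\<Sum>i\<in>I. \<Sum>j\<in>I. (D i j)\<^sup>2)"
      using finite_I by (intro sum_mono sum_mono2) auto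
    then have "(\<Sum>i\<in>I. \<Sum>j\<in>I - {i}. (D i j)\<^sup>2) \<le> F" using sum_D_sq_le by (simp add: F_def offdiag_def)
    moreover have "2 * (\<Sum>i\<in>I. D i i) \<le> F" using trace_D_le by (simp add: F_def offdiag_def)
    ultimately show ?thesis using kappa0 less_imp_le[OF \<eta>] by (intro add_mono mult_left_mono) auto
  qed
  finally show "(\<integral>\<omega>. (\<Sum>i\<in>I. resid_gap z i \<omega>)\<^sup>2 \<partial>P)
      \<le> 4 * \<eta> * real (card I) + (30 * \<kappa> + 2 + 2 / \<eta>\<^sup>2) * offdiag (\<lambda>i j. (G i j)\<^sup>2)"
    by (simp add: F_def algebra_simps)
  show "integrable P (\<lambda>\<omega>. (\<Sum>i\<in>I. resid_gap z i \<omega>)\<^sup>2)"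
    by (rule second_moment_sum[OF finite_I intg])
qed

end

section \<open>The characteristic function of the linearised statistic\<close>

lemma exp_minus_quadratic_bound:
  fixes x :: real
  assumes "0 \<le> x"
  shows "\<bar>exp (- x) - (1 - x)\<bar> \<le> x\<^sup>2"
proof (cases "x = 0")
  case False
  then have x: "0 < x" using assms by simp
  have "1 + x \<le> exp x" by (rule exp_ge_add_one_self)
  then have "exp (- x) \<le> 1 / (1 + x)" using x by (simp add: exp_minus field_simps)
  also have "1 / (1 + x) - (1 - x) = x\<^sup>2 / (1 + x)" using x by (simp add: field_simps power2_eq_square)
  then have "1 / (1 + x) \<le> 1 - x + x\<^sup>2" using x
    by (smt (verit) divide_le_eq_1_pos mult_left_le power2_eq_square divide_le_eq zero_le_power2 mult_le_cancel_left1)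
  finally show ?thesis using exp_ge_add_one_self[of "-x"] by (simp add: abs_if)
qed simp

text \<open>A Gaussian variable of arbitrary size plus a small perturbation uncorrelated with it: since \<open>f\<close> is
  orthogonal to \<open>1\<close> and \<open>\<xi>\<close>, the term linear in \<open>w\<close> only contributes \<open>w u\<^sup>2\<close>, which is still small after
  summation because the squares of the coefficients \<open>u\<close> have a bounded sum. The factor \<open>exp (- u\<^sup>2 / 2)\<close> is kept
  exact, so a single \<open>u\<close> may carry a large share of the variance.\<close>

lemma (in prob_space) char_gaussian_plus_small:
  fixes \<xi> f :: "'a \<Rightarrow> real"
  assumes [measurable]: "\<xi> \<in> borel_measurable M" "f \<in> borel_measurable M"
    and law: "distr M borel \<xi> = std_normal_distribution"
    and f: "\<And>\<omega>. \<bar>f \<omega>\<bar> \<le> 1 + \<bar>\<xi> \<omega>\<bar>"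
    and f0: "(\<integral>\<omega>. f \<omega> \<partial>M) = 0" "(\<integral>\<omega>. f \<omega> * \<xi> \<omega> \<partial>M) = 0" "(\<integral>\<omega>. (f \<omega>)\<^sup>2 \<partial>M) = v"
    and w: "\<bar>w\<bar> \<le> 1"
  defines "C \<equiv> LINT x|std_normal_distribution. (1 + \<bar>x\<bar>) ^ 3"
  shows "cmod ((CLINT \<omega>|M. iexp (u * \<xi> \<omega> + w * f \<omega>)) - exp (- (u\<^sup>2 + w\<^sup>2 * v) / 2))
    \<le> 4 * (C + C\<^sup>2) * \<bar>w\<bar> * (w\<^sup>2 + u\<^sup>2)"
proof -
  define m where "m = (\<lambda>\<omega>. 1 + \<bar>\<xi> \<omega>\<bar>)"
  have m1: "1 \<le> m \<omega>" "\<bar>\<xi> \<omega>\<bar> \<le> m \<omega>" "\<bar>f \<omega>\<bar> \<le> m \<omega>" for \<omega> using f by (auto simp: m_def)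
  have [measurable]: "m \<in> borel_measurable M" by (simp add: m_def)
  have "integrable (distr M borel \<xi>) (\<lambda>x. (1 + \<bar>x\<bar>) ^ 3)" unfolding law by (rule integrable_std_normal_poly)
  then have intm: "integrable M (\<lambda>\<omega>. m \<omega> ^ 3)"
    unfolding m_def by (rule integrable_distr[rotated]) simp
  have Em: "(\<integral>\<omega>. m \<omega> ^ 3 \<partial>M) = C"
    unfolding m_def C_def law[symmetric] by (subst integral_distr) auto
  have m3: "m \<omega> \<le> m \<omega> ^ 3" "m \<omega> * m \<omega> \<le> m \<omega> ^ 3" for \<omega>
    using m1(1)[of \<omega>] self_le_power[of "m \<omega>" 3] power_increasing[of 2 3 "m \<omega>"] by (auto simp: power2_eq_square)
  have bnd: "integrable M g" if "g \<in> borel_measurable M" "\<And>\<omega>. norm (g \<omega>) \<le> m \<omega> ^ 3"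
    for g :: "'a \<Rightarrow> 'b :: {banach, second_countable_topology}"
    by (rule Bochner_Integration.integrable_bound[OF intm that(1)])
       (use that(2) m1(1) in \<open>auto intro!: AE_I2 order_trans[OF _ abs_ge_self]\<close>)
  have C1: "1 \<le> C"
  proof -
    have "(\<integral>\<omega>. 1 \<partial>M) \<le> (\<integral>\<omega>. m \<omega> ^ 3 \<partial>M)"
      using intm m1(1) by (intro integral_mono) (auto intro: one_le_power)
    then show ?thesis by (simp add: Em prob_space)
  qed
  have f2: "(f \<omega>)\<^sup>2 \<le> m \<omega> * m \<omega>" for \<omega>
    using power_mono[OF m1(3)[of \<omega>], of 2] by (simp add: power2_eq_square)
  have f3: "\<bar>f \<omega>\<bar> ^ 3 \<le> m \<omega> ^ 3" for \<omega> using m1(3)[of \<omega>] by (intro power_mono) auto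
  have ff: "\<bar>\<xi> \<omega>\<bar> * (f \<omega>)\<^sup>2 \<le> m \<omega> ^ 3" for \<omega>
    using mult_mono[OF m1(2)[of \<omega>] f2[of \<omega>]] m1(1)[of \<omega>] by (simp add: power3_eq_cube mult.assoc)
  have xf: "(\<xi> \<omega>)\<^sup>2 * \<bar>f \<omega>\<bar> \<le> m \<omega> ^ 3" for \<omega>
  proof -
    have "(\<xi> \<omega>)\<^sup>2 \<le> m \<omega> * m \<omega>" using power_mono[OF m1(2)[of \<omega>], of 2] by (simp add: power2_eq_square)
    then show ?thesis
      using mult_mono[OF _ m1(3)[of \<omega>], of "(\<xi> \<omega>)\<^sup>2" "m \<omega> * m \<omega>"] m1(1)[of \<omega>] by (simp add: power3_eq_cube)
  qed
  have intf: "integrable M f" "integrable M (\<lambda>\<omega>. f \<omega> * \<xi> \<omega>)" "integrable M (\<lambda>\<omega>. (f \<omega>)\<^sup>2)"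
  proof -
    show "integrable M f" using m1(3) m3(1) by (intro bnd) (auto intro: order_trans)
    have "\<bar>f \<omega>\<bar> * \<bar>\<xi> \<omega>\<bar> \<le> m \<omega> ^ 3" for \<omega>
      using mult_mono[OF m1(3) m1(2), of \<omega> \<omega>] m1(1)[of \<omega>] m3(2)[of \<omega>] by simp
    then show "integrable M (\<lambda>\<omega>. f \<omega> * \<xi> \<omega>)" by (intro bnd) (auto simp: abs_mult)
    show "integrable M (\<lambda>\<omega>. (f \<omega>)\<^sup>2)" using f2 m3(2) by (intro bnd) (auto intro: order_trans)
  qed
  have v: "0 \<le> v" "v \<le> C"
  proof -
    show "0 \<le> v" unfolding f0(3)[symmetric] by simp
    show "v \<le> C" unfolding f0(3)[symmetric] Em[symmetric] using intf(3) intm f2 m3(2)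
      by (intro integral_mono) (auto intro: order_trans)
  qed
  define e where "e = (\<lambda>\<omega>. iexp (u * \<xi> \<omega>))"
  have [measurable]: "e \<in> borel_measurable M" by (simp add: e_def)
  have e1: "norm (e \<omega>) = 1" for \<omega> by (simp add: e_def)
  have int_e: "integrable M e" by (rule integrable_const_bound[of _ 1]) (auto simp: e1)
  have int_ef: "integrable M (\<lambda>\<omega>. e \<omega> * f \<omega>)"
    using m1(3) m3(1) by (intro bnd) (auto simp: norm_mult e1 intro: order_trans)
  have int_ef2: "integrable M (\<lambda>\<omega>. e \<omega> * complex_of_real ((f \<omega>)\<^sup>2))"
    using f2 m3(2) by (intro bnd) (auto simp: norm_mult e1 norm_power intro: order_trans)
  have int_all: "integrable M (\<lambda>\<omega>. iexp (u * \<xi> \<omega> + w * f \<omega>))"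
    by (rule integrable_const_bound[of _ 1]) auto
  have Ee: "(CLINT \<omega>|M. e \<omega>) = exp (- (u\<^sup>2) / 2)"
  proof -
    have "(CLINT \<omega>|M. e \<omega>) = char (distr M borel \<xi>) u"
      unfolding char_def e_def by (subst integral_distr) auto
    then show ?thesis by (simp add: law char_std_normal_distribution)
  qed
  \<comment> \<open>First order in \<open>w\<close>: orthogonality removes the constant and linear terms of \<open>e\<close>\<close>
  have E1: "cmod (CLINT \<omega>|M. e \<omega> * f \<omega>) \<le> u\<^sup>2 * C"
  proof -
    have i: "integrable M (\<lambda>\<omega>. complex_of_real (f \<omega>))" "integrable M (\<lambda>\<omega>. complex_of_real (f \<omega> * \<xi> \<omega>))"
      by (intro integrable_of_real intf)+
    have "(CLINT \<omega>|M. (e \<omega> - (1 + \<i> * (u * \<xi> \<omega>))) * f \<omega>) =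
        (CLINT \<omega>|M. e \<omega> * f \<omega> - (complex_of_real (f \<omega>) + \<i> * u * complex_of_real (f \<omega> * \<xi> \<omega>)))"
      by (intro Bochner_Integration.integral_cong) (auto simp: algebra_simps)
    also have "\<dots> = (CLINT \<omega>|M. e \<omega> * f \<omega>) - (complex_of_real (\<integral>\<omega>. f \<omega> \<partial>M)
        + \<i> * u * complex_of_real (\<integral>\<omega>. f \<omega> * \<xi> \<omega> \<partial>M))"
      using int_ef i by (simp del: of_real_mult add: integral_complex_of_real)
    finally have "(CLINT \<omega>|M. e \<omega> * f \<omega>) = (CLINT \<omega>|M. (e \<omega> - (1 + \<i> * (u * \<xi> \<omega>))) * f \<omega>)"
      using f0 by simp
    also have "cmod \<dots> \<le> (\<integral>\<omega>. cmod ((e \<omega> - (1 + \<i> * (u * \<xi> \<omega>))) * f \<omega>) \<partial>M)"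
      by (rule integral_norm_bound)
    also have "\<dots> \<le> (\<integral>\<omega>. u\<^sup>2 * m \<omega> ^ 3 \<partial>M)"
    proof (rule integral_mono')
      fix \<omega>
      have "cmod (e \<omega> - (1 + \<i> * (u * \<xi> \<omega>))) \<le> (u * \<xi> \<omega>)\<^sup>2 / 2"
        using iexp_approx1[of "u * \<xi> \<omega>" 1] by (simp add: e_def numeral_2_eq_2)
      then have "cmod ((e \<omega> - (1 + \<i> * (u * \<xi> \<omega>))) * f \<omega>) \<le> (u * \<xi> \<omega>)\<^sup>2 / 2 * \<bar>f \<omega>\<bar>"
        unfolding norm_mult by (intro mult_mono) auto
      also have "\<dots> = u\<^sup>2 / 2 * ((\<xi> \<omega>)\<^sup>2 * \<bar>f \<omega>\<bar>)" by (simp add: power_mult_distrib)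
      also have "\<dots> \<le> u\<^sup>2 * m \<omega> ^ 3" using xf[of \<omega>] by (intro mult_mono) auto
      finally show "cmod ((e \<omega> - (1 + \<i> * (u * \<xi> \<omega>))) * f \<omega>) \<le> u\<^sup>2 * m \<omega> ^ 3" .
      show "0 \<le> u\<^sup>2 * m \<omega> ^ 3" using m1(1)[of \<omega>] by simp
    qed (use intm in simp)
    finally show ?thesis by (simp add: Em)
  qed
  \<comment> \<open>Second order in \<open>w\<close>: replacing \<open>e\<close> by its mean costs a factor \<open>u\<close>\<close>
  have E2: "cmod ((CLINT \<omega>|M. e \<omega> * complex_of_real ((f \<omega>)\<^sup>2)) - exp (- (u\<^sup>2) / 2) * v) \<le> \<bar>u\<bar> * C + u\<^sup>2 * C"
  proof -
    have i: "integrable M (\<lambda>\<omega>. complex_of_real ((f \<omega>)\<^sup>2))" using intf by (intro integrable_of_real)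
    have "(CLINT \<omega>|M. (e \<omega> - 1) * complex_of_real ((f \<omega>)\<^sup>2)) =
        (CLINT \<omega>|M. e \<omega> * complex_of_real ((f \<omega>)\<^sup>2) - complex_of_real ((f \<omega>)\<^sup>2))"
      by (intro Bochner_Integration.integral_cong) (auto simp: algebra_simps)
    also have "\<dots> = (CLINT \<omega>|M. e \<omega> * complex_of_real ((f \<omega>)\<^sup>2)) - complex_of_real (\<integral>\<omega>. (f \<omega>)\<^sup>2 \<partial>M)"
      using int_ef2 i by (simp del: of_real_power add: integral_complex_of_real)
    finally have eq: "(CLINT \<omega>|M. e \<omega> * complex_of_real ((f \<omega>)\<^sup>2)) - v = (CLINT \<omega>|M. (e \<omega> - 1) * complex_of_real ((f \<omega>)\<^sup>2))"
      using f0 by simp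
    have "cmod \<dots> \<le> (\<integral>\<omega>. cmod ((e \<omega> - 1) * complex_of_real ((f \<omega>)\<^sup>2)) \<partial>M)"
      by (rule integral_norm_bound)
    also have "\<dots> \<le> (\<integral>\<omega>. \<bar>u\<bar> * m \<omega> ^ 3 \<partial>M)"
    proof (rule integral_mono')
      fix \<omega>
      have "cmod (e \<omega> - 1) \<le> \<bar>u * \<xi> \<omega>\<bar>"
        using iexp_approx1[of "u * \<xi> \<omega>" 0] by (simp add: e_def)
      then have "cmod ((e \<omega> - 1) * complex_of_real ((f \<omega>)\<^sup>2)) \<le> \<bar>u * \<xi> \<omega>\<bar> * (f \<omega>)\<^sup>2"
        unfolding norm_mult norm_of_real by (intro mult_mono) auto
      also have "\<dots> = \<bar>u\<bar> * (\<bar>\<xi> \<omega>\<bar> * (f \<omega>)\<^sup>2)" by (simp add: abs_mult)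
      also have "\<dots> \<le> \<bar>u\<bar> * m \<omega> ^ 3" using ff[of \<omega>] by (intro mult_left_mono) auto
      finally show "cmod ((e \<omega> - 1) * complex_of_real ((f \<omega>)\<^sup>2)) \<le> \<bar>u\<bar> * m \<omega> ^ 3" .
      show "0 \<le> \<bar>u\<bar> * m \<omega> ^ 3" using m1(1)[of \<omega>] by simp
    qed (use intm in simp)
    finally have 1: "cmod ((CLINT \<omega>|M. e \<omega> * complex_of_real ((f \<omega>)\<^sup>2)) - v) \<le> \<bar>u\<bar> * C"
      unfolding eq by (simp add: Em)
    have "0 \<le> v * (1 - exp (- (u\<^sup>2) / 2))" using v by (intro mult_nonneg_nonneg) auto
    moreover have "v - exp (- (u\<^sup>2) / 2) * v = v * (1 - exp (- (u\<^sup>2) / 2))" by (simp add: algebra_simps)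
    ultimately have "\<bar>v - exp (- (u\<^sup>2) / 2) * v\<bar> = v * (1 - exp (- (u\<^sup>2) / 2))"
      by (simp only: abs_of_nonneg)
    also have "\<dots> \<le> C * u\<^sup>2"
    proof (intro mult_mono)
      show "1 - exp (- (u\<^sup>2) / 2) \<le> u\<^sup>2"
        using exp_ge_add_one_self[of "- (u\<^sup>2) / 2"] zero_le_power2[of u] by linarith
    qed (use v in auto)
    finally have "cmod (complex_of_real v - exp (- (u\<^sup>2) / 2) * v) \<le> u\<^sup>2 * C"
      unfolding of_real_diff[symmetric] norm_of_real by (simp only: mult.commute)
    then show ?thesis using 1 norm_triangle_ineq[of "(CLINT \<omega>|M. e \<omega> * complex_of_real ((f \<omega>)\<^sup>2)) - v"
        "complex_of_real v - exp (- (u\<^sup>2) / 2) * v"] by simp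
  qed
  \<comment> \<open>The Taylor remainder in \<open>w\<close>\<close>
  have E3: "cmod ((CLINT \<omega>|M. iexp (u * \<xi> \<omega> + w * f \<omega>)) - ((CLINT \<omega>|M. e \<omega>) + \<i> * w * (CLINT \<omega>|M. e \<omega> * f \<omega>)
      - w\<^sup>2 / 2 * (CLINT \<omega>|M. e \<omega> * complex_of_real ((f \<omega>)\<^sup>2)))) \<le> \<bar>w\<bar> ^ 3 * C"
  proof -
    have eq: "(CLINT \<omega>|M. iexp (u * \<xi> \<omega> + w * f \<omega>)) - ((CLINT \<omega>|M. e \<omega>) + \<i> * w * (CLINT \<omega>|M. e \<omega> * f \<omega>)
      - w\<^sup>2 / 2 * (CLINT \<omega>|M. e \<omega> * complex_of_real ((f \<omega>)\<^sup>2))) =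
      (CLINT \<omega>|M. iexp (u * \<xi> \<omega> + w * f \<omega>) - (e \<omega> + \<i> * w * (e \<omega> * f \<omega>)
        - w\<^sup>2 / 2 * (e \<omega> * complex_of_real ((f \<omega>)\<^sup>2))))"
      using int_e int_ef int_ef2 int_all by simp
    let ?d = "\<lambda>\<omega>. iexp (u * \<xi> \<omega> + w * f \<omega>) - (e \<omega> + \<i> * w * (e \<omega> * f \<omega>)
        - w\<^sup>2 / 2 * (e \<omega> * complex_of_real ((f \<omega>)\<^sup>2)))"
    have "cmod (CLINT \<omega>|M. ?d \<omega>) \<le> (\<integral>\<omega>. cmod (?d \<omega>) \<partial>M)"
      by (rule integral_norm_bound)
    also have "\<dots> \<le> (\<integral>\<omega>. \<bar>w\<bar> ^ 3 * m \<omega> ^ 3 \<partial>M)"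
    proof (rule integral_mono')
      fix \<omega>
      have split: "iexp (u * \<xi> \<omega> + w * f \<omega>) = e \<omega> * iexp (w * f \<omega>)"
        by (simp add: e_def distrib_left exp_add)
      define g where "g = iexp (w * f \<omega>)"
      have fac: "iexp (u * \<xi> \<omega> + w * f \<omega>) - (e \<omega> + \<i> * w * (e \<omega> * f \<omega>) - w\<^sup>2 / 2 * (e \<omega> * complex_of_real ((f \<omega>)\<^sup>2)))
          = e \<omega> * (iexp (w * f \<omega>) - (1 + \<i> * (w * f \<omega>) - (w * f \<omega>)\<^sup>2 / 2))"
        unfolding split g_def[symmetric] by (simp add: algebra_simps power_mult_distrib)
      have "cmod (e \<omega> * (iexp (w * f \<omega>) - (1 + \<i> * (w * f \<omega>) - (w * f \<omega>)\<^sup>2 / 2))) = cmod (iexp (w * f \<omega>) - (1 + \<i> * (w * f \<omega>) - (w * f \<omega>)\<^sup>2 / 2))"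
        by (simp add: norm_mult e1)
      also have "\<dots> \<le> \<bar>w * f \<omega>\<bar> ^ 3 / 6"
        using iexp_approx1[of "w * f \<omega>" 2] by (simp add: numeral_eq_Suc power_mult_distrib algebra_simps)
      also have "\<dots> \<le> \<bar>w\<bar> ^ 3 * m \<omega> ^ 3"
        using mult_left_mono[OF f3[of \<omega>], of "\<bar>w\<bar> ^ 3"] m1(1)[of \<omega>]
        by (simp add: abs_mult power_mult_distrib) (smt (verit) zero_le_power abs_ge_zero mult_nonneg_nonneg)
      finally show "cmod (iexp (u * \<xi> \<omega> + w * f \<omega>) - (e \<omega> + \<i> * w * (e \<omega> * f \<omega>)
        - w\<^sup>2 / 2 * (e \<omega> * complex_of_real ((f \<omega>)\<^sup>2)))) \<le> \<bar>w\<bar> ^ 3 * m \<omega> ^ 3" unfolding fac .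
      show "0 \<le> \<bar>w\<bar> ^ 3 * m \<omega> ^ 3" using m1(1)[of \<omega>] by simp
    qed (use intm in simp)
    finally show ?thesis unfolding eq by (simp add: Em)
  qed
  define x where "x = w\<^sup>2 * v / 2"
  have x0: "0 \<le> x" using v by (simp add: x_def)
  have E4: "cmod (exp (- (u\<^sup>2) / 2) * complex_of_real (1 - x) - exp (- (u\<^sup>2 + w\<^sup>2 * v) / 2)) \<le> x\<^sup>2"
  proof -
    have "exp (- (u\<^sup>2 + w\<^sup>2 * v) / 2) = exp (- (u\<^sup>2) / 2) * exp (- x)"
      by (simp add: x_def exp_add[symmetric] field_simps)
    then have "exp (- (u\<^sup>2) / 2) * (1 - x) - exp (- (u\<^sup>2 + w\<^sup>2 * v) / 2) = exp (- (u\<^sup>2) / 2) * ((1 - x) - exp (- x))"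
      by (simp add: algebra_simps)
    moreover have "\<bar>exp (- (u\<^sup>2) / 2) * ((1 - x) - exp (- x))\<bar> \<le> 1 * x\<^sup>2"
      unfolding abs_mult using exp_minus_quadratic_bound[OF x0] by (intro mult_mono) (auto simp: abs_minus_commute)
    ultimately show ?thesis
      by (subst of_real_mult[symmetric], subst of_real_diff[symmetric], subst norm_of_real) simp
  qed
  have "cmod ((CLINT \<omega>|M. iexp (u * \<xi> \<omega> + w * f \<omega>)) - exp (- (u\<^sup>2 + w\<^sup>2 * v) / 2))
      \<le> \<bar>w\<bar> ^ 3 * C + \<bar>w\<bar> * (u\<^sup>2 * C) + w\<^sup>2 / 2 * (\<bar>u\<bar> * C + u\<^sup>2 * C) + x\<^sup>2"
  proof -
    define T0 T1 T2 T3 where "T0 = (CLINT \<omega>|M. iexp (u * \<xi> \<omega> + w * f \<omega>))" and "T1 = (CLINT \<omega>|M. e \<omega> * f \<omega>)"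
      and "T2 = (CLINT \<omega>|M. e \<omega> * complex_of_real ((f \<omega>)\<^sup>2))" and "T3 = complex_of_real (exp (- (u\<^sup>2) / 2))"
    have "T0 - exp (- (u\<^sup>2 + w\<^sup>2 * v) / 2) = (T0 - (T3 + \<i> * w * T1 - w\<^sup>2 / 2 * T2)) + (\<i> * w * T1
        + (- (w\<^sup>2 / 2 * (T2 - T3 * v)) + (T3 * complex_of_real (1 - x) - exp (- (u\<^sup>2 + w\<^sup>2 * v) / 2))))"
      by (simp add: x_def field_simps)
    also have "cmod \<dots> \<le> cmod (T0 - (T3 + \<i> * w * T1 - w\<^sup>2 / 2 * T2)) + (cmod (\<i> * w * T1)
        + (cmod (- (w\<^sup>2 / 2 * (T2 - T3 * v))) + cmod (T3 * complex_of_real (1 - x) - exp (- (u\<^sup>2 + w\<^sup>2 * v) / 2))))"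
      by (intro order_trans[OF norm_triangle_ineq] add_left_mono order_refl)
    also have "\<dots> \<le> \<bar>w\<bar> ^ 3 * C + (\<bar>w\<bar> * (u\<^sup>2 * C) + (w\<^sup>2 / 2 * (\<bar>u\<bar> * C + u\<^sup>2 * C) + x\<^sup>2))"
    proof (intro add_mono)
      show "cmod (T0 - (T3 + \<i> * w * T1 - w\<^sup>2 / 2 * T2)) \<le> \<bar>w\<bar> ^ 3 * C"
        using E3 unfolding Ee T0_def T1_def T2_def T3_def .
      show "cmod (\<i> * w * T1) \<le> \<bar>w\<bar> * (u\<^sup>2 * C)"
        using E1 unfolding T1_def by (simp add: norm_mult mult_left_mono)
      show "cmod (- (w\<^sup>2 / 2 * (T2 - T3 * v))) \<le> w\<^sup>2 / 2 * (\<bar>u\<bar> * C + u\<^sup>2 * C)"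
        using E2 mult_left_mono[OF E2, of "w\<^sup>2 / 2"] unfolding T2_def T3_def
        by (simp add: norm_mult norm_power norm_divide)
      show "cmod (T3 * complex_of_real (1 - x) - exp (- (u\<^sup>2 + w\<^sup>2 * v) / 2)) \<le> x\<^sup>2"
        using E4 unfolding T3_def .
    qed
    finally show ?thesis unfolding T0_def by simp
  qed
  also have "\<dots> \<le> 4 * (C + C\<^sup>2) * \<bar>w\<bar> * (w\<^sup>2 + u\<^sup>2)"
  proof -
    define a b where "a = \<bar>w\<bar>" and "b = \<bar>u\<bar>"
    have ab: "0 \<le> a" "a \<le> 1" "0 \<le> b" using w by (auto simp: a_def b_def)
    have sq: "w\<^sup>2 = a\<^sup>2" "u\<^sup>2 = b\<^sup>2" by (simp_all add: a_def b_def)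
    have s1: "a\<^sup>2 * b \<le> a * (a\<^sup>2 + b\<^sup>2)"
    proof -
      have "a * b \<le> a\<^sup>2 + b\<^sup>2" using zero_le_power2[of "a - b"] zero_le_power2[of "a + b"]
        unfolding power2_sum power2_diff by linarith
      from mult_left_mono[OF this ab(1)] show ?thesis by (simp add: power2_eq_square mult.assoc)
    qed
    have s2: "a\<^sup>2 * b\<^sup>2 \<le> a * (a\<^sup>2 + b\<^sup>2)"
      using mult_right_mono[OF ab(2), of "a * b\<^sup>2"] ab by (simp add: power2_eq_square algebra_simps) (smt (verit) mult_nonneg_nonneg)
    have s3: "a ^ 3 \<le> a * (a\<^sup>2 + b\<^sup>2)" "a * b\<^sup>2 \<le> a * (a\<^sup>2 + b\<^sup>2)"
      using ab by (auto simp: power3_eq_cube power2_eq_square algebra_simps)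
    have "x \<le> a\<^sup>2 * C" using v mult_left_mono[OF v(2), of "a\<^sup>2"] by (simp add: x_def sq) (smt (verit) mult_nonneg_nonneg zero_le_power2)
    then have "x\<^sup>2 \<le> (a\<^sup>2 * C)\<^sup>2" using x0 by (rule power_mono)
    also have "\<dots> = a * (a * (a\<^sup>2 * C\<^sup>2))" by (simp add: power2_eq_square mult_ac)
    also have "\<dots> \<le> 1 * (a * (a\<^sup>2 * C\<^sup>2))" using ab by (intro mult_right_mono) auto
    also have "\<dots> = C\<^sup>2 * a ^ 3" by (simp add: power3_eq_cube power2_eq_square mult_ac)
    also have "\<dots> \<le> C\<^sup>2 * (a * (a\<^sup>2 + b\<^sup>2))" using s3 by (intro mult_left_mono) auto
    finally have s4: "x\<^sup>2 \<le> C\<^sup>2 * (a * (a\<^sup>2 + b\<^sup>2))" .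
    define X where "X = a * (a\<^sup>2 + b\<^sup>2)"
    have X0: "0 \<le> X" unfolding X_def using ab by simp
    have "a ^ 3 * C + a * (b\<^sup>2 * C) + a\<^sup>2 / 2 * (b * C + b\<^sup>2 * C) + x\<^sup>2 =
        C * a ^ 3 + C * (a * b\<^sup>2) + C / 2 * (a\<^sup>2 * b) + C / 2 * (a\<^sup>2 * b\<^sup>2) + x\<^sup>2"
      by (simp add: algebra_simps)
    also have "\<dots> \<le> C * X + C * X + C / 2 * X + C / 2 * X + C\<^sup>2 * X"
      using ab C1 s1 s2 s3 s4 unfolding X_def by (intro add_mono mult_left_mono) auto
    also have "\<dots> \<le> 4 * (C + C\<^sup>2) * X"
      using C1 X0 mult_nonneg_nonneg[of C X] mult_nonneg_nonneg[of "C\<^sup>2" X] by (simp add: algebra_simps)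
    finally show ?thesis unfolding X_def sq a_def[symmetric] b_def[symmetric] by (simp add: mult.assoc)
  qed
  finally show ?thesis .
qed

lemma cmod_iexp_diff_le: "cmod (iexp x - iexp y) \<le> \<bar>x - y\<bar>"
proof -
  have "iexp x - iexp y = iexp y * (iexp (x - y) - 1)"
    by (simp add: right_diff_distrib exp_add[symmetric])
  then have "cmod (iexp x - iexp y) = cmod (iexp (x - y) - 1)" by (simp add: norm_mult)
  also have "\<dots> \<le> \<bar>x - y\<bar>" using iexp_approx1[of "x - y" 0] by simp
  finally show ?thesis .
qed

lemma (in prob_space) expectation_abs_le_sqrt:
  fixes X :: "'a \<Rightarrow> real"
  assumes "X \<in> borel_measurable M" "integrable M (\<lambda>\<omega>. (X \<omega>)\<^sup>2)"
  shows "(\<integral>\<omega>. \<bar>X \<omega>\<bar> \<partial>M) \<le> sqrt (\<integral>\<omega>. (X \<omega>)\<^sup>2 \<partial>M)" "integrable M X"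
proof -
  show int: "integrable M X"
  proof (rule Bochner_Integration.integrable_bound)
    show "integrable M (\<lambda>\<omega>. 1 + (X \<omega>)\<^sup>2)" using assms by simp
    have "\<bar>x\<bar> \<le> 1 + x\<^sup>2" for x :: real
      using zero_le_power2[of "\<bar>x\<bar> - 1"] zero_le_power2[of x] by (simp add: power2_diff)
    then show "AE \<omega> in M. norm (X \<omega>) \<le> norm (1 + (X \<omega>)\<^sup>2)" by (auto intro!: AE_I2 simp: abs_of_nonneg add_nonneg_nonneg)
  qed fact
  define m where "m = (\<integral>\<omega>. \<bar>X \<omega>\<bar> \<partial>M)"
  have "0 \<le> (\<integral>\<omega>. (\<bar>X \<omega>\<bar> - m)\<^sup>2 \<partial>M)" by simp
  also have "(\<integral>\<omega>. (\<bar>X \<omega>\<bar> - m)\<^sup>2 \<partial>M) = (\<integral>\<omega>. (X \<omega>)\<^sup>2 - 2 * m * \<bar>X \<omega>\<bar> + m\<^sup>2 \<partial>M)"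
    by (intro Bochner_Integration.integral_cong) (auto simp: power2_diff)
  also have "\<dots> = (\<integral>\<omega>. (X \<omega>)\<^sup>2 \<partial>M) - 2 * m * m + m\<^sup>2"
    using assms int by (simp add: m_def prob_space)
  finally have "m\<^sup>2 \<le> (\<integral>\<omega>. (X \<omega>)\<^sup>2 \<partial>M)" by (simp add: power2_eq_square)
  then show "m \<le> sqrt (\<integral>\<omega>. (X \<omega>)\<^sup>2 \<partial>M)" by (rule real_le_rsqrt)
qed

context coupled_mixture
begin

lemma resid_variance_nonneg: "0 \<le> p0 * normal_tail z - p0\<^sup>2 * ((normal_tail z)\<^sup>2 + (std_normal_density z)\<^sup>2)"
proof -
  have "(normal_tail z)\<^sup>2 + (std_normal_density z)\<^sup>2 \<le> normal_tail z"
    using std_normal_density_sq_le[of z] by (simp add: power2_eq_square algebra_simps)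
  then have "p0\<^sup>2 * ((normal_tail z)\<^sup>2 + (std_normal_density z)\<^sup>2) \<le> p0\<^sup>2 * normal_tail z"
    by (intro mult_left_mono) auto
  also have "\<dots> \<le> p0 * normal_tail z"
    using p0 by (intro mult_right_mono) (auto simp: power2_eq_square mult_left_le)
  finally show ?thesis by simp
qed

text \<open>The projection of \<open>\<Sum>y\<^sub>i\<close> on the \<open>\<xi>\<^sub>j\<close> distributes the linear part over the indices, with coefficients
  \<open>w j\<close> whose squares add up to at most the variance of \<open>\<Sum>y\<^sub>i\<close>. The orthogonal remainder is independent of
  all labels and all \<open>\<xi>\<^sub>j\<close> and contributes an exact Gaussian factor.\<close>

lemma char_linear_plus_resid:
  fixes z c \<beta> :: real
  assumes \<beta>: "\<bar>\<beta>\<bar> \<le> 1"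
  defines "C \<equiv> LINT x|std_normal_distribution. (1 + \<bar>x\<bar>) ^ 3"
    and "v \<equiv> p0 * normal_tail z - p0\<^sup>2 * ((normal_tail z)\<^sup>2 + (std_normal_density z)\<^sup>2)"
    and "VS \<equiv> real (card I) + offdiag G"
  shows "cmod ((CLINT \<omega>|P. iexp (c * (\<Sum>i\<in>I. y i \<omega>) + \<beta> * (\<Sum>i\<in>I. resid z (h i \<omega>) (xi i \<omega>))))
      - exp (- (c\<^sup>2 * VS + real (card I) * (\<beta>\<^sup>2 * v)) / 2))
    \<le> 4 * (C + C\<^sup>2) * \<bar>\<beta>\<bar> * (real (card I) * \<beta>\<^sup>2 + c\<^sup>2 * VS)"
proof -
  let ?o = "\<lambda>_ :: nat. 1 :: real" and ?z = "\<lambda>_ :: nat. 0 :: real"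
  have S: "form ?o ?z \<omega> = (\<Sum>i\<in>I. y i \<omega>)" for \<omega> by (simp add: form_def)
  have VS: "fcov ?o ?z ?o ?z = VS"
  proof -
    have "fcov ?o ?z ?o ?z = (\<Sum>i\<in>I. G i i + (\<Sum>j\<in>I - {i}. G i j))"
      unfolding fcov_def quad_form_def by (simp, intro sum.cong refl sum.remove[OF finite_I])
    then show ?thesis by (simp add: VS_def offdiag_def sum.distrib G_diag)
  qed
  define w where "w = (\<lambda>j. fcov ?o ?z (xi_y j) (xi_n j))"
  define b0 c0 where "b0 = (\<lambda>i. 1 - 1 * (\<Sum>j\<in>I. w j * xi_y j i))" and "c0 = (\<lambda>i. 0 - 1 * (\<Sum>j\<in>I. w j * xi_n j i))"
  have rho: "form b0 c0 \<omega> = (\<Sum>i\<in>I. y i \<omega>) - (\<Sum>j\<in>I. w j * xi j \<omega>)" for \<omega>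
    unfolding b0_def c0_def form_diff form_sum[OF finite_I] S by (simp add: xi_def)
  have cov: "fcov b0 c0 e d = fcov ?o ?z e d - (\<Sum>j\<in>I. w j * fcov (xi_y j) (xi_n j) e d)" for e d
    unfolding b0_def c0_def fcov_diff fcov_sum[OF finite_I] by simp
  have cov0: "fcov b0 c0 (xi_y l) (xi_n l) = 0" if "l \<in> I" for l
    unfolding cov using that finite_I by (simp add: fcov_xi w_def cong: sum.cong)
  have cov0': "fcov (xi_y l) (xi_n l) b0 c0 = 0" if "l \<in> I" for l
    using cov0[OF that] by (subst fcov_sym)
  have varrho: "fcov b0 c0 b0 c0 = VS - (\<Sum>j\<in>I. (w j)\<^sup>2)"
  proof -
    have "fcov b0 c0 b0 c0 = fcov ?o ?z b0 c0" unfolding cov[of b0 c0] by (simp add: cov0')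
    also have "\<dots> = fcov b0 c0 ?o ?z" by (rule fcov_sym)
    also have "\<dots> = VS - (\<Sum>j\<in>I. w j * w j)"
      unfolding cov VS w_def fcov_sym[of "xi_y _" "xi_n _" ?o ?z] ..
    finally show ?thesis by (simp add: power2_eq_square)
  qed
  \<comment> \<open>The index \<open>k0\<close> stands for the remainder\<close>
  obtain k0 where k0: "k0 \<notin> I" using ex_new_if_finite[OF infinite_UNIV_nat finite_I] by blast
  define L where "L = insert k0 I"
  define B Cf where "B = (\<lambda>k. if k = k0 then b0 else xi_y k)" and "Cf = (\<lambda>k. if k = k0 then c0 else xi_n k)"
  define Z where "Z = case_sum (\<lambda>i \<omega>. of_bool (h i \<omega>)) (\<lambda>k :: nat. form (B k) (Cf k))"
  have ind: "indep_vars (\<lambda>_. borel) Z (Inl ` I \<union> Inr ` L)"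
    unfolding Z_def
  proof (rule indep_forms)
    show "finite L" using finite_I by (simp add: L_def)
    show "fcov (B k) (Cf k) (B l) (Cf l) = 0" if "k \<in> L" "l \<in> L" "k \<noteq> l" for k l
      using that cov0 cov0' by (auto simp: B_def Cf_def L_def fcov_xi)
  qed
  define K where "K = (\<lambda>k. if k = k0 then {Inr k0} else {Inl k, Inr k} :: (nat + nat) set)"
  have ind2: "indep_vars (\<lambda>k. PiM (K k) (\<lambda>_. borel)) (\<lambda>k \<omega>. restrict (\<lambda>s. Z s \<omega>) (K k)) L"
    by (rule indep_vars_restrict[OF ind]) (auto simp: K_def L_def disjoint_family_on_def k0)
  define Yf where "Yf = (\<lambda>k (g :: nat + nat \<Rightarrow> real). if k = k0 then iexp (c * g (Inr k0))
      else iexp (c * w k * g (Inr k) + \<beta> * resid z (g (Inl k) = 1) (g (Inr k))))"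
  have Yf: "Yf k \<in> borel_measurable (PiM (K k) (\<lambda>_. borel))" for k
  proof (cases "k = k0")
    case True
    have [measurable]: "(\<lambda>g. g (Inr k0)) \<in> borel_measurable (PiM (K k0) (\<lambda>_. borel :: real measure))"
      by (rule measurable_component_singleton) (simp add: K_def)
    show ?thesis unfolding Yf_def True by simp
  next
    case False
    have [measurable]: "(\<lambda>g. g (Inr k)) \<in> borel_measurable (PiM (K k) (\<lambda>_. borel :: real measure))"
        "(\<lambda>g. g (Inl k)) \<in> borel_measurable (PiM (K k) (\<lambda>_. borel :: real measure))"
      by (rule measurable_component_singleton; simp add: K_def False)+
    show ?thesis unfolding Yf_def resid_def using False by simp
  qed
  define X where "X = (\<lambda>k \<omega>. Yf k (restrict (\<lambda>s. Z s \<omega>) (K k)))"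
  have indX: "indep_vars (\<lambda>_. borel) X L"
    unfolding X_def by (rule indep_vars_compose2[OF ind2 Yf])
  have X0: "X k0 \<omega> = iexp (c * form b0 c0 \<omega>)" for \<omega>
    by (simp add: X_def Yf_def K_def Z_def B_def Cf_def)
  have Xj: "X j \<omega> = iexp (c * w j * xi j \<omega> + \<beta> * resid z (h j \<omega>) (xi j \<omega>))" if "j \<in> I" for j \<omega>
  proof -
    have "j \<noteq> k0" using that k0 by auto
    then show ?thesis by (simp add: X_def Yf_def K_def Z_def B_def Cf_def xi_def)
  qed
  have finL: "finite L" using finite_I by (simp add: L_def)
  have Xn: "norm (X k \<omega>) = 1" for k \<omega> by (simp add: X_def Yf_def)
  have Xrv: "X k \<in> borel_measurable P" if "k \<in> L" for k
    using indX that unfolding indep_vars_def by auto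
  have Xint: "integrable P (X k)" if "k \<in> L" for k
    by (rule integrable_const_bound[of _ 1]) (use Xn Xrv[OF that] in auto)
  have "(CLINT \<omega>|P. iexp (c * (\<Sum>i\<in>I. y i \<omega>) + \<beta> * (\<Sum>i\<in>I. resid z (h i \<omega>) (xi i \<omega>)))) =
      (CLINT \<omega>|P. (\<Prod>k\<in>L. X k \<omega>))"
  proof (rule Bochner_Integration.integral_cong[OF refl])
    fix \<omega>
    have "(\<Prod>k\<in>L. X k \<omega>) = iexp (c * form b0 c0 \<omega>) * (\<Prod>j\<in>I. iexp (c * w j * xi j \<omega> + \<beta> * resid z (h j \<omega>) (xi j \<omega>)))"
      unfolding L_def using k0 finite_I by (simp add: X0 Xj)
    also have "(\<Prod>j\<in>I. iexp (c * w j * xi j \<omega> + \<beta> * resid z (h j \<omega>) (xi j \<omega>))) =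
        iexp (\<Sum>j\<in>I. c * w j * xi j \<omega> + \<beta> * resid z (h j \<omega>) (xi j \<omega>))"
      using finite_I by (simp only: of_real_sum sum_distrib_left exp_sum)
    also have "iexp (c * form b0 c0 \<omega>) * \<dots> = iexp (c * form b0 c0 \<omega> + (\<Sum>j\<in>I. c * w j * xi j \<omega> + \<beta> * resid z (h j \<omega>) (xi j \<omega>)))"
      by (simp only: of_real_add distrib_left exp_add)
    also have "c * form b0 c0 \<omega> + (\<Sum>j\<in>I. c * w j * xi j \<omega> + \<beta> * resid z (h j \<omega>) (xi j \<omega>)) =
        c * (\<Sum>i\<in>I. y i \<omega>) + \<beta> * (\<Sum>i\<in>I. resid z (h i \<omega>) (xi i \<omega>))"
      unfolding rho by (simp add: sum.distrib sum_distrib_left right_diff_distrib mult.assoc)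
    finally show "iexp (c * (\<Sum>i\<in>I. y i \<omega>) + \<beta> * (\<Sum>i\<in>I. resid z (h i \<omega>) (xi i \<omega>))) = (\<Prod>k\<in>L. X k \<omega>)" by simp
  qed
  also have "\<dots> = (\<Prod>k\<in>L. CLINT \<omega>|P. X k \<omega>)"
    by (rule indep_vars_lebesgue_integral[OF finL indX Xint])
  also have "\<dots> = (CLINT \<omega>|P. X k0 \<omega>) * (\<Prod>j\<in>I. CLINT \<omega>|P. X j \<omega>)"
    unfolding L_def using k0 finite_I by simp
  also have "(CLINT \<omega>|P. X k0 \<omega>) = exp (- c\<^sup>2 * (VS - (\<Sum>j\<in>I. (w j)\<^sup>2)) / 2)"
  proof -
    have "(CLINT \<omega>|P. X k0 \<omega>) = char (distr P borel (form b0 c0)) c"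
      unfolding char_def X0 by (subst integral_distr) auto
    then show ?thesis unfolding char_form varrho .
  qed
  finally have char: "(CLINT \<omega>|P. iexp (c * (\<Sum>i\<in>I. y i \<omega>) + \<beta> * (\<Sum>i\<in>I. resid z (h i \<omega>) (xi i \<omega>)))) =
    exp (- c\<^sup>2 * (VS - (\<Sum>j\<in>I. (w j)\<^sup>2)) / 2) * (\<Prod>j\<in>I. CLINT \<omega>|P. X j \<omega>)" .
  define A where "A = exp (- c\<^sup>2 * (VS - (\<Sum>j\<in>I. (w j)\<^sup>2)) / 2)"
  have W: "0 \<le> VS - (\<Sum>j\<in>I. (w j)\<^sup>2)" using fcov_nonneg[of b0 c0] varrho by simp
  have A: "0 \<le> A" "A \<le> 1" using W by (auto simp: A_def)
  define b where "b = (\<lambda>j. complex_of_real (exp (- ((c * w j)\<^sup>2 + \<beta>\<^sup>2 * v) / 2)))"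
  have v0: "0 \<le> v" unfolding v_def by (rule resid_variance_nonneg)
  have factor: "cmod ((CLINT \<omega>|P. X j \<omega>) - b j) \<le> 4 * (C + C\<^sup>2) * \<bar>\<beta>\<bar> * (\<beta>\<^sup>2 + (c * w j)\<^sup>2)" if j: "j \<in> I" for j
    unfolding Xj[OF j] b_def C_def
  proof (rule char_gaussian_plus_small)
    show "xi j \<in> borel_measurable P" by (simp add: xi_def)
    show "(\<lambda>\<omega>. resid z (h j \<omega>) (xi j \<omega>)) \<in> borel_measurable P" unfolding xi_def by (rule resid_meas[OF j])
    show "distr P borel (xi j) = std_normal_distribution"
      unfolding xi_def using fcov_xi_self[OF j] distr_form[of "xi_y j" "xi_n j"] by (simp add: eta_contract_eq)
  qed (use resid_moments[OF j fcov_xi_self[OF j], of z, folded xi_def] resid_abs_le \<beta> in \<open>auto simp: v_def\<close>)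
  have prod_diff: "cmod ((\<Prod>j\<in>I. CLINT \<omega>|P. X j \<omega>) - (\<Prod>j\<in>I. b j)) \<le> (\<Sum>j\<in>I. cmod ((CLINT \<omega>|P. X j \<omega>) - b j))"
  proof (rule norm_prod_diff)
    fix j assume "j \<in> I"
    have "cmod (CLINT \<omega>|P. X j \<omega>) \<le> (\<integral>\<omega>. cmod (X j \<omega>) \<partial>P)" by (rule integral_norm_bound)
    then show "cmod (CLINT \<omega>|P. X j \<omega>) \<le> 1" by (simp add: Xn prob_space)
    have "0 \<le> (c * w j)\<^sup>2 + \<beta>\<^sup>2 * v" using v0 by (intro add_nonneg_nonneg mult_nonneg_nonneg) auto
    moreover have "exp (- r / 2) \<le> 1" if "0 \<le> r" for r :: real using that by simp
    ultimately have "exp (- ((c * w j)\<^sup>2 + \<beta>\<^sup>2 * v) / 2) \<le> 1" by blast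
    then show "cmod (b j) \<le> 1" unfolding b_def norm_of_real by simp
  qed
  have target: "complex_of_real (exp (- (c\<^sup>2 * VS + real (card I) * (\<beta>\<^sup>2 * v)) / 2)) = A * (\<Prod>j\<in>I. b j)"
  proof -
    have "(\<Prod>j\<in>I. exp (- ((c * w j)\<^sup>2 + \<beta>\<^sup>2 * v) / 2)) = exp (\<Sum>j\<in>I. - ((c * w j)\<^sup>2 + \<beta>\<^sup>2 * v) / 2)"
      using finite_I by (simp add: exp_sum)
    also have "(\<Sum>j\<in>I. - ((c * w j)\<^sup>2 + \<beta>\<^sup>2 * v) / 2) = - (c\<^sup>2 * (\<Sum>j\<in>I. (w j)\<^sup>2) + real (card I) * (\<beta>\<^sup>2 * v)) / 2"
      by (simp add: sum_divide_distrib[symmetric] sum_negf sum_subtractf sum.distrib sum_distrib_left power_mult_distrib)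
    finally have "A * (\<Prod>j\<in>I. exp (- ((c * w j)\<^sup>2 + \<beta>\<^sup>2 * v) / 2)) = exp (- (c\<^sup>2 * VS + real (card I) * (\<beta>\<^sup>2 * v)) / 2)"
      unfolding A_def by (simp add: exp_add[symmetric] field_simps)
    then show ?thesis unfolding b_def by (simp flip: of_real_prod of_real_mult)
  qed
  have "cmod (complex_of_real A * (\<Prod>j\<in>I. CLINT \<omega>|P. X j \<omega>) - complex_of_real A * (\<Prod>j\<in>I. b j)) =
      A * cmod ((\<Prod>j\<in>I. CLINT \<omega>|P. X j \<omega>) - (\<Prod>j\<in>I. b j))"
    using A by (simp add: right_diff_distrib[symmetric] norm_mult)
  also have "\<dots> \<le> 1 * (\<Sum>j\<in>I. 4 * (C + C\<^sup>2) * \<bar>\<beta>\<bar> * (\<beta>\<^sup>2 + (c * w j)\<^sup>2))"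
    using A by (intro mult_mono order_trans[OF prod_diff] sum_mono factor) auto
  also have "\<dots> = 4 * (C + C\<^sup>2) * \<bar>\<beta>\<bar> * (real (card I) * \<beta>\<^sup>2 + c\<^sup>2 * (\<Sum>j\<in>I. (w j)\<^sup>2))"
    by (simp add: sum_distrib_left[symmetric] sum.distrib power_mult_distrib)
  also have "\<dots> \<le> 4 * (C + C\<^sup>2) * \<bar>\<beta>\<bar> * (real (card I) * \<beta>\<^sup>2 + c\<^sup>2 * VS)"
  proof -
    have "0 \<le> C" unfolding C_def by (intro Bochner_Integration.integral_nonneg) auto
    then show ?thesis using W by (intro mult_left_mono add_left_mono) auto
  qed
  finally show ?thesis unfolding char target A_def[symmetric] .
qed

text \<open>The number \<open>\<sigma>2\<close> is the variance of the count up to the contribution of the squared covariances. The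
  second error term is the price of the coupling; the first is a third absolute moment, as in the Berry--Esseen
  bound.\<close>

theorem null_count_char_bound:
  fixes z \<beta> \<eta> :: real
  assumes \<beta>: "\<bar>\<beta>\<bar> \<le> 1" and \<eta>: "0 < \<eta>"
  defines "C \<equiv> LINT x|std_normal_distribution. (1 + \<bar>x\<bar>) ^ 3"
    and "\<kappa> \<equiv> LINT x|std_normal_distribution. indicator {z..} x * (1 + \<bar>z\<bar> + \<bar>x\<bar>)\<^sup>2"
    and "\<sigma>2 \<equiv> real (card I) * (p0 * normal_tail z - p0\<^sup>2 * (normal_tail z)\<^sup>2)
      + p0\<^sup>2 * (std_normal_density z)\<^sup>2 * offdiag G"
  shows "cmod ((CLINT \<omega>|P. iexp (\<beta> * (\<Sum>i\<in>I. of_bool (\<not> h i \<omega>) * indicator {z..} (y i \<omega>) - p0 * normal_tail z)))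
      - exp (- (\<beta>\<^sup>2 * \<sigma>2) / 2))
    \<le> 4 * (C + C\<^sup>2) * \<bar>\<beta>\<bar> * (\<beta>\<^sup>2 * (2 * real (card I) + \<bar>offdiag G\<bar>))
      + \<bar>\<beta>\<bar> * sqrt (4 * \<eta> * real (card I) + (30 * \<kappa> + 2 + 2 / \<eta>\<^sup>2) * offdiag (\<lambda>i j. (G i j)\<^sup>2))"
proof -
  define c where "c = \<beta> * (p0 * std_normal_density z)"
  define v where "v = p0 * normal_tail z - p0\<^sup>2 * ((normal_tail z)\<^sup>2 + (std_normal_density z)\<^sup>2)"
  define VS where "VS = real (card I) + offdiag G"
  define T where "T = (\<lambda>\<omega>. \<beta> * (\<Sum>i\<in>I. of_bool (\<not> h i \<omega>) * indicator {z..} (y i \<omega>) - p0 * normal_tail z))"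
  define T' where "T' = (\<lambda>\<omega>. c * (\<Sum>i\<in>I. y i \<omega>) + \<beta> * (\<Sum>i\<in>I. resid z (h i \<omega>) (xi i \<omega>)))"
  define g where "g = (\<lambda>\<omega>. \<Sum>i\<in>I. resid_gap z i \<omega>)"
  have [measurable]: "xi i \<in> borel_measurable P" for i by (simp add: xi_def)
  have rm [measurable]: "(\<lambda>\<omega>. resid z (h i \<omega>) (xi i \<omega>)) \<in> borel_measurable P"
    "(\<lambda>\<omega>. resid z (h i \<omega>) (y i \<omega>)) \<in> borel_measurable P"  "y i \<in> borel_measurable P" if "i \<in> I" for i
    using resid_meas[OF that, of z "xi_y i" "xi_n i"] resid_meas[OF that, of z "\<lambda>k. of_bool (k = i)" "\<lambda>_. 0"] y_meas[OF that]
    by (simp_all add: xi_def form_unit[OF that])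
  have gm [measurable]: "g \<in> borel_measurable P"
    unfolding g_def resid_gap_def by measurable
  have T'm [measurable]: "T' \<in> borel_measurable P" unfolding T'_def by measurable
  have TT: "T \<omega> = T' \<omega> + \<beta> * g \<omega>" for \<omega>
  proof -
    have "T \<omega> = (\<Sum>i\<in>I. c * y i \<omega> + \<beta> * resid z (h i \<omega>) (y i \<omega>))"
      unfolding T_def sum_distrib_left by (intro sum.cong refl) (simp add: resid_def c_def algebra_simps)
    also have "\<dots> = T' \<omega> + \<beta> * g \<omega>"
      by (simp add: T'_def g_def resid_gap_def sum.distrib sum_distrib_left sum_subtractf right_diff_distrib)
    finally show ?thesis .
  qed
  have Tm [measurable]: "T \<in> borel_measurable P" unfolding TT by measurable
  have gs: "(\<Sum>i\<in>I. resid_gap z i \<omega>) = g \<omega>" for \<omega> by (simp add: g_def)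
  note ce = coupling_error[OF \<eta>, of z, unfolded gs, folded \<kappa>_def]
  have ig: "integrable P g" and eg: "(\<integral>\<omega>. \<bar>g \<omega>\<bar> \<partial>P) \<le> sqrt (\<integral>\<omega>. (g \<omega>)\<^sup>2 \<partial>P)"
    using expectation_abs_le_sqrt[OF gm ce(2)] by auto
  have intT: "integrable P (\<lambda>\<omega>. iexp (T \<omega>))" "integrable P (\<lambda>\<omega>. iexp (T' \<omega>))"
    by (rule integrable_const_bound[of _ 1]; simp)+
  have "cmod ((CLINT \<omega>|P. iexp (T \<omega>)) - (CLINT \<omega>|P. iexp (T' \<omega>))) = cmod (CLINT \<omega>|P. iexp (T \<omega>) - iexp (T' \<omega>))"
    using intT by simp
  also have "\<dots> \<le> (\<integral>\<omega>. cmod (iexp (T \<omega>) - iexp (T' \<omega>)) \<partial>P)" by (rule integral_norm_bound)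
  also have "\<dots> \<le> (\<integral>\<omega>. \<bar>\<beta>\<bar> * \<bar>g \<omega>\<bar> \<partial>P)"
  proof (rule integral_mono)
    show "cmod (iexp (T \<omega>) - iexp (T' \<omega>)) \<le> \<bar>\<beta>\<bar> * \<bar>g \<omega>\<bar>" for \<omega>
      using cmod_iexp_diff_le[of "T \<omega>" "T' \<omega>"] by (simp add: TT abs_mult)
  qed (use ig intT in auto)
  also have "\<dots> \<le> \<bar>\<beta>\<bar> * sqrt (4 * \<eta> * real (card I) + (30 * \<kappa> + 2 + 2 / \<eta>\<^sup>2) * offdiag (\<lambda>i j. (G i j)\<^sup>2))"
    using order_trans[OF eg real_sqrt_le_mono[OF ce(1)]] by (simp add: mult_left_mono)
  finally have 1: "cmod ((CLINT \<omega>|P. iexp (T \<omega>)) - (CLINT \<omega>|P. iexp (T' \<omega>))) \<le> \<dots>" .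
  have 2: "cmod ((CLINT \<omega>|P. iexp (T' \<omega>)) - exp (- (c\<^sup>2 * VS + real (card I) * (\<beta>\<^sup>2 * v)) / 2))
      \<le> 4 * (C + C\<^sup>2) * \<bar>\<beta>\<bar> * (real (card I) * \<beta>\<^sup>2 + c\<^sup>2 * VS)"
    using char_linear_plus_resid[OF \<beta>, of c z] unfolding T'_def C_def VS_def v_def .
  have var: "c\<^sup>2 * VS + real (card I) * (\<beta>\<^sup>2 * v) = \<beta>\<^sup>2 * \<sigma>2"
    by (simp add: c_def VS_def v_def \<sigma>2_def power_mult_distrib algebra_simps)
  have "real (card I) * \<beta>\<^sup>2 + c\<^sup>2 * VS \<le> \<beta>\<^sup>2 * (2 * real (card I) + \<bar>offdiag G\<bar>)"
  proof -
    have "(p0 * std_normal_density z)\<^sup>2 \<le> 1"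
      using p0 std_normal_density_le[of z] by (intro power_le_one mult_nonneg_nonneg mult_le_one) auto
    then have "c\<^sup>2 \<le> \<beta>\<^sup>2 * 1" unfolding c_def power_mult_distrib[of \<beta>] by (intro mult_left_mono) auto
    then have "c\<^sup>2 * VS \<le> \<beta>\<^sup>2 * (real (card I) + \<bar>offdiag G\<bar>)"
      unfolding VS_def by (intro order_trans[OF mult_left_mono mult_right_mono]) auto
    then show ?thesis by (simp add: algebra_simps)
  qed
  moreover have "0 \<le> C" unfolding C_def by (intro Bochner_Integration.integral_nonneg) auto
  ultimately have "4 * (C + C\<^sup>2) * \<bar>\<beta>\<bar> * (real (card I) * \<beta>\<^sup>2 + c\<^sup>2 * VS)
      \<le> 4 * (C + C\<^sup>2) * \<bar>\<beta>\<bar> * (\<beta>\<^sup>2 * (2 * real (card I) + \<bar>offdiag G\<bar>))"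
    by (intro mult_left_mono) auto
  then have 3: "cmod ((CLINT \<omega>|P. iexp (T' \<omega>)) - exp (- (\<beta>\<^sup>2 * \<sigma>2) / 2)) \<le> \<dots>"
    using 2 unfolding var by linarith
  have "cmod ((CLINT \<omega>|P. iexp (T \<omega>)) - exp (- (\<beta>\<^sup>2 * \<sigma>2) / 2)) \<le>
     cmod ((CLINT \<omega>|P. iexp (T \<omega>)) - (CLINT \<omega>|P. iexp (T' \<omega>))) + cmod ((CLINT \<omega>|P. iexp (T' \<omega>)) - exp (- (\<beta>\<^sup>2 * \<sigma>2) / 2))"
    using norm_triangle_ineq[of "(CLINT \<omega>|P. iexp (T \<omega>)) - (CLINT \<omega>|P. iexp (T' \<omega>))"
        "(CLINT \<omega>|P. iexp (T' \<omega>)) - exp (- (\<beta>\<^sup>2 * \<sigma>2) / 2)"] by simp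
  then show ?thesis using 1 3 unfolding T_def by linarith
qed

end

section \<open>The crossing point of the mixture distribution function\<close>

definition mixture_tail :: "real \<Rightarrow> real \<Rightarrow> real \<Rightarrow> real" where
  "mixture_tail \<delta> p0 z = p0 * normal_tail z + (1 - p0) * normal_tail (z - \<delta>)"

lemma mixture_G_normal_tail: "mixture_G \<delta> p0 (normal_tail z) = mixture_tail \<delta> p0 z"
proof -
  have "ereal z - ereal \<delta> = ereal (z - \<delta>)" by simp
  then show ?thesis by (simp add: mixture_G_def mixture_tail_def Phi_ereal del: ereal_minus(1))
qed

text \<open>The quotient \<open>tail_ratio\<close> below has the sign of the mixture tail minus the line of slope \<open>1/\<alpha>\<close>, and it is
  strictly increasing by the monotone likelihood ratio property; hence the crossing point exists and is unique.\<close>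

locale crossing =
  fixes \<delta> p0 \<alpha> :: real
  assumes \<delta>: "0 < \<delta>" and p0: "0 < p0" "p0 < 1" and \<alpha>: "0 < \<alpha>" "\<alpha> < 1"
begin

definition tail_ratio :: "real \<Rightarrow> real" where
  "tail_ratio z = p0 - 1 / \<alpha> + (1 - p0) * (normal_tail (z - \<delta>) / normal_tail z)"

definition tail_ratio' :: "real \<Rightarrow> real" where
  "tail_ratio' z = (1 - p0) * ((std_normal_density z * normal_tail (z - \<delta>)
      - std_normal_density (z - \<delta>) * normal_tail z) / (normal_tail z * normal_tail z))"

lemma normal_tail_nz [simp]: "normal_tail z \<noteq> 0"
  using normal_tail_pos[of z] by linarith

lemma excess_eq: "mixture_tail \<delta> p0 z - normal_tail z / \<alpha> = normal_tail z * tail_ratio z"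
  by (simp add: mixture_tail_def tail_ratio_def field_simps)

lemma tail_ratio_DERIV: "(tail_ratio has_real_derivative tail_ratio' z) (at z)"
  unfolding tail_ratio_def tail_ratio'_def
  by (auto intro!: derivative_eq_intros simp: algebra_simps)

lemma tail_ratio'_pos: "0 < tail_ratio' z"
proof -
  have "std_normal_density (z - \<delta>) = exp (\<delta> * z - \<delta>\<^sup>2 / 2) * std_normal_density z"
    unfolding std_normal_density_def
    by (simp add: exp_add[symmetric] power2_eq_square field_simps)
  then have "std_normal_density (z - \<delta>) * normal_tail z =
      std_normal_density z * (exp (\<delta> * z - \<delta>\<^sup>2 / 2) * normal_tail z)" by simp
  also have "\<dots> < std_normal_density z * normal_tail (z - \<delta>)"
    using normal_tail_shift_lower[OF \<delta>] normal_density_pos[of 1 0 z] by (intro mult_strict_left_mono) auto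
  finally show ?thesis using p0 unfolding tail_ratio'_def by (intro mult_pos_pos divide_pos_pos) auto
qed

lemma tail_ratio_strict_mono: "a < b \<Longrightarrow> tail_ratio a < tail_ratio b"
  by (rule DERIV_pos_imp_increasing) (auto intro: tail_ratio_DERIV tail_ratio'_pos)

lemma crossing_exists: "\<exists>z. tail_ratio z = 0"
proof -
  have "filterlim (\<lambda>z. z - \<delta>) at_bot (at_bot :: real filter)"
    unfolding filterlim_at_bot eventually_at_bot_linorder
    by (metis add_le_imp_le_right diff_add_cancel le_diff_eq order_trans)
  then have "((\<lambda>z. normal_tail (z - \<delta>)) \<longlongrightarrow> 1) at_bot"
    by (rule filterlim_compose[OF normal_tail_at_bot])
  then have "(tail_ratio \<longlongrightarrow> p0 - 1 / \<alpha> + (1 - p0) * (1 / 1)) at_bot"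
    unfolding tail_ratio_def by (intro tendsto_intros normal_tail_at_bot) auto
  moreover have "p0 - 1 / \<alpha> + (1 - p0) * (1 / 1) < 0" using \<alpha> by simp
  ultimately have "\<forall>\<^sub>F z in at_bot. tail_ratio z < 0" by (rule order_tendstoD)
  then obtain a where a: "tail_ratio a < 0" using eventually_happens'[OF trivial_limit_at_bot_linorder] by blast
  \<comment> \<open>The likelihood ratio bound \<open>exp (\<delta>z - \<delta>\<^sup>2/2)\<close> makes the ratio exceed any level\<close>
  define M where "M = 1 / (\<alpha> * (1 - p0))"
  have M: "0 < M" using \<alpha> p0 by (simp add: M_def)
  define b where "b = (ln M + \<delta>\<^sup>2 / 2) / \<delta>"
  have "exp (\<delta> * b - \<delta>\<^sup>2 / 2) = M" using \<delta> M by (simp add: b_def)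
  then have "M < normal_tail (b - \<delta>) / normal_tail b"
    using normal_tail_shift_lower[OF \<delta>, of b] by (simp add: pos_less_divide_eq)
  then have "(1 - p0) * M < (1 - p0) * (normal_tail (b - \<delta>) / normal_tail b)"
    using p0 by (intro mult_strict_left_mono) auto
  moreover have "(1 - p0) * M = 1 / \<alpha>" using \<alpha> p0 by (simp add: M_def field_simps)
  ultimately have b: "0 < tail_ratio b" using p0 by (simp add: tail_ratio_def)
  have "a < b"
    using a b tail_ratio_strict_mono[of b a] by (cases "a < b"; cases "a = b") auto
  then show ?thesis
    using IVT'[of tail_ratio a 0 b] a b
    by (auto intro!: continuous_at_imp_continuous_on DERIV_isCont[OF tail_ratio_DERIV])
qed

definition z_star :: real where "z_star = (SOME z. tail_ratio z = 0)"

lemma tail_ratio_z_star: "tail_ratio z_star = 0"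
  unfolding z_star_def using crossing_exists by (rule someI_ex)

lemma mixture_tail_z_star: "mixture_tail \<delta> p0 z_star = normal_tail z_star / \<alpha>"
  using excess_eq[of z_star] tail_ratio_z_star by simp

lemma t_star_eq: "t_star \<delta> p0 \<alpha> = normal_tail z_star"
  unfolding t_star_def
proof (rule the_equality)
  show "0 < normal_tail z_star \<and> normal_tail z_star < 1 \<and> mixture_G \<delta> p0 (normal_tail z_star) = normal_tail z_star / \<alpha>"
    by (simp add: mixture_G_normal_tail mixture_tail_z_star)
next
  fix t assume t: "0 < t \<and> t < 1 \<and> mixture_G \<delta> p0 t = t / \<alpha>"
  then obtain z where z: "normal_tail z = t" using normal_tail_surj by blast
  then have "tail_ratio z = 0"
    using t excess_eq[of z] by (auto simp: mixture_G_normal_tail)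
  then have "z = z_star"
    using tail_ratio_z_star tail_ratio_strict_mono[of z z_star] tail_ratio_strict_mono[of z_star z]
    by (cases z z_star rule: linorder_cases) auto
  then show "t = normal_tail z_star" using z by simp
qed

text \<open>Since the derivative of \<open>tail_ratio\<close> is continuous and positive, the mixture tail leaves the line of
  slope \<open>1/\<alpha>\<close> at a linear rate on both sides of the crossing point, uniformly on compact sets.\<close>

lemma linear_margin:
  assumes "0 \<le> R"
  obtains c where "0 < c" "c \<le> 1"
    "\<And>z. z_star \<le> z \<Longrightarrow> z \<le> z_star + 1 \<Longrightarrow> normal_tail z / \<alpha> + c * (z - z_star) \<le> mixture_tail \<delta> p0 z"
    "\<And>z. z \<le> z_star \<Longrightarrow> z_star - R \<le> z \<Longrightarrow> mixture_tail \<delta> p0 z \<le> normal_tail z / \<alpha> - c * (z_star - z)"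
proof -
  have "continuous_on {z_star - R..z_star + 1} tail_ratio'"
    unfolding tail_ratio'_def by (intro continuous_intros) auto
  moreover have "{z_star - R..z_star + 1} \<noteq> {}" using assms by simp
  ultimately obtain x0 where x0: "\<And>x. x \<in> {z_star - R..z_star + 1} \<Longrightarrow> tail_ratio' x0 \<le> tail_ratio' x"
    using continuous_attains_inf[OF compact_Icc] by metis
  define d where "d = tail_ratio' x0"
  have d: "0 < d" unfolding d_def by (rule tail_ratio'_pos)
  have incr: "d * (b - a) \<le> tail_ratio b - tail_ratio a" if "z_star - R \<le> a" "a \<le> b" "b \<le> z_star + 1" for a b
  proof (cases "a = b")
    case False
    then have "a < b" using that by simp
    from MVT2[OF this, of tail_ratio tail_ratio'] obtain x where x: "a < x" "x < b"
      "tail_ratio b - tail_ratio a = (b - a) * tail_ratio' x" using tail_ratio_DERIV by blast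
    have "d \<le> tail_ratio' x" unfolding d_def using x that by (intro x0) auto
    then show ?thesis using x that mult_left_mono[of d "tail_ratio' x" "b - a"] by (simp add: mult.commute)
  qed simp
  define c where "c = min 1 (normal_tail (z_star + 1) * d)"
  have c: "0 < c" "c \<le> 1" "c \<le> normal_tail (z_star + 1) * d" using d by (auto simp: c_def)
  show ?thesis
  proof (rule that[OF c(1,2)])
    fix z assume z: "z_star \<le> z" "z \<le> z_star + 1"
    have "c * (z - z_star) \<le> normal_tail (z_star + 1) * d * (z - z_star)"
      using c z by (intro mult_right_mono) auto
    also have "\<dots> \<le> normal_tail z * (d * (z - z_star))"
      using z d by (simp add: mult.assoc mult_right_mono)
    also have "\<dots> \<le> normal_tail z * tail_ratio z"
      using incr[of z_star z] z assms tail_ratio_z_star by (intro mult_left_mono) auto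
    finally show "normal_tail z / \<alpha> + c * (z - z_star) \<le> mixture_tail \<delta> p0 z"
      unfolding excess_eq[symmetric] by simp
  next
    fix z assume z: "z \<le> z_star" "z_star - R \<le> z"
    have "c * (z_star - z) \<le> normal_tail (z_star + 1) * d * (z_star - z)"
      using c z by (intro mult_right_mono) auto
    also have "\<dots> \<le> normal_tail z * (d * (z_star - z))"
      using z d by (simp add: mult.assoc mult_right_mono)
    also have "\<dots> \<le> normal_tail z * (- tail_ratio z)"
      using incr[of z z_star] z assms tail_ratio_z_star by (intro mult_left_mono) auto
    finally show "mixture_tail \<delta> p0 z \<le> normal_tail z / \<alpha> - c * (z_star - z)"
      using excess_eq[of z] by simp
  qed
qed

end

section \<open>The Benjamini--Hochberg threshold\<close>

lemma emp_cdf_mono: "s \<le> t \<Longrightarrow> emp_cdf m p s \<le> emp_cdf m p t"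
  unfolding emp_cdf_def by (intro divide_right_mono sum_mono) auto

lemma emp_cdf_bounds: "0 \<le> emp_cdf m p t" "emp_cdf m p t \<le> 1"
proof -
  show "0 \<le> emp_cdf m p t" unfolding emp_cdf_def by (intro divide_nonneg_nonneg sum_nonneg) auto
  have "(\<Sum>i\<in>{1..m}. of_bool (p i \<le> t) :: real) \<le> (\<Sum>i\<in>{1..m}. 1)" by (intro sum_mono) auto
  then show "emp_cdf m p t \<le> 1" unfolding emp_cdf_def by (cases "m = 0") (auto simp: divide_le_eq)
qed

context
  fixes \<alpha> :: real and m :: nat and p :: "nat \<Rightarrow> real"
  assumes \<alpha>: "0 < \<alpha>" "\<alpha> < 1"
begin

abbreviation (input) "BH_set \<equiv> {t \<in> {0..1}. emp_cdf m p t \<ge> t / \<alpha>}"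

lemma BH_threshold_upper:
  assumes "0 \<le> t" "t \<le> 1" "t / \<alpha> \<le> emp_cdf m p t"
  shows "t \<le> BH_threshold \<alpha> m p"
  unfolding BH_threshold_def using assms by (intro cSup_upper) (auto intro: bdd_aboveI[of _ 1])

text \<open>This holds because the empirical distribution function is monotone: \<open>\<alpha>\<close> times the empirical distribution function at the supremum is again
  in the set.\<close>

lemma BH_threshold_fixpoint: "BH_threshold \<alpha> m p = \<alpha> * emp_cdf m p (BH_threshold \<alpha> m p)"
proof -
  define T where "T = BH_threshold \<alpha> m p"
  have ne: "BH_set \<noteq> {}" using emp_cdf_bounds[of m p 0] by (auto intro!: exI[of _ 0])
  have "T \<le> \<alpha> * emp_cdf m p T"
    unfolding T_def BH_threshold_def
  proof (rule cSup_least[OF ne])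
    fix t assume t: "t \<in> BH_set"
    then have "t \<le> T" unfolding T_def by (intro BH_threshold_upper) auto
    then have "emp_cdf m p t \<le> emp_cdf m p T" by (rule emp_cdf_mono)
    then have "t / \<alpha> \<le> emp_cdf m p T" using t by simp
    then show "t \<le> \<alpha> * emp_cdf m p (Sup BH_set)"
      using \<alpha> unfolding T_def BH_threshold_def by (simp add: pos_divide_le_eq mult.commute)
  qed
  moreover have "\<alpha> * emp_cdf m p T \<le> T"
    unfolding T_def
  proof (rule BH_threshold_upper, unfold T_def[symmetric])
    show "0 \<le> \<alpha> * emp_cdf m p T" using \<alpha> emp_cdf_bounds by simp
    show "\<alpha> * emp_cdf m p T \<le> 1" using \<alpha> emp_cdf_bounds by (intro mult_le_one) auto
    show "\<alpha> * emp_cdf m p T / \<alpha> \<le> emp_cdf m p (\<alpha> * emp_cdf m p T)"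
      using \<alpha> emp_cdf_mono[OF \<open>T \<le> \<alpha> * emp_cdf m p T\<close>] by simp
  qed
  ultimately show ?thesis unfolding T_def by simp
qed

lemma BH_threshold_bounds: "0 \<le> BH_threshold \<alpha> m p" "BH_threshold \<alpha> m p \<le> \<alpha>"
  using BH_threshold_fixpoint emp_cdf_bounds[of m p "BH_threshold \<alpha> m p"] \<alpha>
  by (metis mult_nonneg_nonneg less_imp_le, metis mult_left_le less_imp_le)

text \<open>Only the levels \<open>\<alpha>j/m\<close> compete, which makes the threshold a finite maximum and hence measurable.\<close>

lemma BH_threshold_Max:
  assumes m: "0 < m"
  shows "BH_threshold \<alpha> m p =
    Max ((\<lambda>j. if real j / real m \<le> emp_cdf m p (\<alpha> * real j / real m) then \<alpha> * real j / real m else 0) ` {0..m})"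
    (is "_ = Max (?g ` _)")
proof (rule Max_eqI[symmetric])
  define T where "T = BH_threshold \<alpha> m p"
  define j where "j = card {i \<in> {1..m}. p i \<le> T}"
  have j: "emp_cdf m p T = real j / real m"
    unfolding emp_cdf_def j_def by (simp add: of_bool_def sum.If_cases Int_def conj_commute)
  have jm: "j \<le> m" unfolding j_def by (rule order_trans[OF card_mono[of "{1..m}"]]) auto
  have T: "T = \<alpha> * real j / real m" using BH_threshold_fixpoint j unfolding T_def by simp
  show "BH_threshold \<alpha> m p \<in> ?g ` {0..m}"
    using jm j T unfolding T_def[symmetric] by (intro image_eqI[of _ _ j]) auto
  fix x assume "x \<in> ?g ` {0..m}"
  then obtain i where i: "i \<le> m" "x = ?g i" by auto
  show "x \<le> BH_threshold \<alpha> m p"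
  proof (cases "real i / real m \<le> emp_cdf m p (\<alpha> * real i / real m)")
    case True
    have "\<alpha> * real i / real m \<le> 1"
      using \<alpha> i m mult_le_one[of \<alpha> "real i / real m"] by (simp add: divide_le_eq)
    then show ?thesis
      using True i \<alpha> by (auto intro!: BH_threshold_upper)
  qed (use i BH_threshold_bounds in simp)
qed simp

end

section \<open>Localising the threshold on finite grids\<close>

context crossing
begin

text \<open>To the left of the crossing point the empirical tail has to stay below the line of slope \<open>1/\<alpha>\<close> on
  a whole interval. A grid of mesh proportional to the margin \<open>c w\<close> is enough, because both functions are
  monotone. No threshold exceeds \<open>\<alpha>\<close>, so the interval is bounded.\<close>

lemma BH_threshold_localised:
  fixes x :: "nat \<Rightarrow> real" and m :: nat
  defines "p \<equiv> \<lambda>i. normal_tail (x i)"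
  defines "E \<equiv> \<lambda>z. emp_cdf m p (normal_tail z)"
  assumes margin_right: "\<And>z. z_star \<le> z \<Longrightarrow> z \<le> z_star + 1 \<Longrightarrow> normal_tail z / \<alpha> + c * (z - z_star) \<le> mixture_tail \<delta> p0 z"
    and margin_left: "\<And>z. z \<le> z_star \<Longrightarrow> z_star - R \<le> z \<Longrightarrow> mixture_tail \<delta> p0 z \<le> normal_tail z / \<alpha> - c * (z_star - z)"
    and c: "0 < c" and w: "0 < w" "w \<le> 1" and \<zeta>: "0 < \<zeta>" "\<zeta> \<le> c * \<alpha> * w / 2"
    and L: "\<alpha> \<le> normal_tail (z_star - L)" and N: "L \<le> real N * \<zeta>" "w + real N * \<zeta> \<le> R"
    and right: "mixture_tail \<delta> p0 (z_star + w) - c * w < E (z_star + w)"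
    and left: "\<And>k. 1 \<le> k \<Longrightarrow> k \<le> N \<Longrightarrow> E (z_star - w - real k * \<zeta>) < mixture_tail \<delta> p0 (z_star - w - real k * \<zeta>) + c * w / 2"
  obtains z where "BH_threshold \<alpha> m p = normal_tail z" "\<bar>z - z_star\<bar> \<le> w"
proof -
  define T where "T = BH_threshold \<alpha> m p"
  have "normal_tail (z_star + w) / \<alpha> \<le> E (z_star + w)"
    using margin_right[of "z_star + w"] w right by simp
  then have T1: "normal_tail (z_star + w) \<le> T"
    unfolding T_def E_def by (intro BH_threshold_upper \<alpha>) auto
  then have T0: "0 < T" using normal_tail_pos[of "z_star + w"] by linarith
  have T\<alpha>: "T \<le> \<alpha>" unfolding T_def by (rule BH_threshold_bounds[OF \<alpha>])
  obtain z where z: "normal_tail z = T" using normal_tail_surj[of T] T0 T\<alpha> \<alpha> by auto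
  have z_up: "z \<le> z_star + w" using T1 unfolding z[symmetric] by simp
  have fixpt: "normal_tail z = \<alpha> * E z"
    using BH_threshold_fixpoint[OF \<alpha>, of m p] unfolding E_def z T_def .
  have "z_star - w \<le> z"
  proof (rule ccontr)
    assume "\<not> z_star - w \<le> z"
    then have zl: "z < z_star - w" by simp
    have "normal_tail z \<le> normal_tail (z_star - L)" using T\<alpha> L z by linarith
    then have zL: "z_star - L \<le> z" by simp
    define q where "q = (z_star - w - z) / \<zeta>"
    define k where "k = nat \<lceil>q\<rceil>"
    have q0: "0 < q" using zl \<zeta> by (simp add: q_def)
    have k: "1 \<le> k" "q \<le> real k" "real k < q + 1"
      unfolding k_def using q0 by linarith+
    have qz: "q * \<zeta> = z_star - w - z" using \<zeta> by (simp add: q_def)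
    have "q * \<zeta> \<le> real N * \<zeta>" using qz zL N w by linarith
    then have "q \<le> real N" using \<zeta> by simp
    then have "real k < real N + 1" using k by linarith
    then have kN: "k \<le> N" by linarith
    define u where "u = z_star - w - real k * \<zeta>"
    have "q * \<zeta> \<le> real k * \<zeta>" "real k * \<zeta> \<le> (q + 1) * \<zeta>" "real k * \<zeta> \<le> real N * \<zeta>" "0 \<le> real k * \<zeta>"
      using k kN \<zeta> by (auto intro!: mult_right_mono)
    then have u: "u \<le> z" "z \<le> u + \<zeta>" "z_star - R \<le> u" "w \<le> z_star - u"
      using qz N \<zeta> unfolding u_def distrib_right by linarith+
    have "E z \<le> E u" unfolding E_def using u by (intro emp_cdf_mono) simp
    moreover have "normal_tail u - \<zeta> \<le> normal_tail z"
      using normal_tail_Lipschitz[of u z] u by linarith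
    then have "(normal_tail u - \<zeta>) / \<alpha> \<le> normal_tail z / \<alpha>" using \<alpha> by (intro divide_right_mono) auto
    moreover have "normal_tail z / \<alpha> = E z" using fixpt \<alpha> by simp
    moreover have "\<zeta> / \<alpha> \<le> c * w / 2" using \<zeta>(2) \<alpha> by (simp add: pos_divide_le_eq mult_ac)
    moreover have "mixture_tail \<delta> p0 u \<le> normal_tail u / \<alpha> - c * (z_star - u)"
      using u w by (intro margin_left) auto
    moreover have "c * w \<le> c * (z_star - u)" using c u by (intro mult_left_mono) auto
    moreover have "E u < mixture_tail \<delta> p0 u + c * w / 2" unfolding u_def by (rule left[OF k(1) kN])
    ultimately show False by (simp add: diff_divide_distrib)
  qed
  then show ?thesis using that[of z] z z_up unfolding T_def by (simp add: abs_le_iff)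
qed

text \<open>A monotone function minus a Lipschitz one oscillates between two neighbouring grid points by at most the
  mesh more than at the grid points themselves.\<close>

lemma fine_grid_bound:
  fixes E0 :: "real \<Rightarrow> real"
  assumes mono: "\<And>a b. a \<le> b \<Longrightarrow> E0 b \<le> E0 a"
    and \<zeta>: "0 < \<zeta>" and N: "2 * w \<le> real N * \<zeta>" and z: "\<bar>z - z0\<bar> \<le> w"
    and grid: "\<And>k. k \<le> N \<Longrightarrow> \<bar>(E0 (z0 - w + real k * \<zeta>) - p0 * normal_tail (z0 - w + real k * \<zeta>))
        - (E0 z0 - p0 * normal_tail z0)\<bar> \<le> \<epsilon>"
  shows "\<bar>(E0 z - p0 * normal_tail z) - (E0 z0 - p0 * normal_tail z0)\<bar> \<le> \<epsilon> + \<zeta>"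
proof -
  define q where "q = (z - (z0 - w)) / \<zeta>"
  have qz: "q * \<zeta> = z - (z0 - w)" using \<zeta> by (simp add: q_def)
  have q0: "0 \<le> q" using z \<zeta> by (simp add: q_def)
  have "q * \<zeta> \<le> real N * \<zeta>" using qz z N by linarith
  then have qN: "q \<le> real N" using \<zeta> by simp
  define k where "k = nat \<lfloor>q\<rfloor>"
  define l where "l = nat \<lceil>q\<rceil>"
  have kl: "real k \<le> q" "q \<le> real k + 1" "q \<le> real l" "real l \<le> q + 1" "k \<le> N" "l \<le> N"
    unfolding k_def l_def using q0 qN by linarith+
  define a b where "a = z0 - w + real k * \<zeta>" and "b = z0 - w + real l * \<zeta>"
  have m1: "real k * \<zeta> \<le> q * \<zeta>" "q * \<zeta> \<le> (real k + 1) * \<zeta>" "q * \<zeta> \<le> real l * \<zeta>" "real l * \<zeta> \<le> (q + 1) * \<zeta>"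
    using kl \<zeta> by (auto intro!: mult_right_mono)
  then have ab: "a \<le> z" "z \<le> a + \<zeta>" "z \<le> b" "b \<le> z + \<zeta>"
    using qz by (auto simp: a_def b_def algebra_simps)
  have "\<bar>p0 * normal_tail a - p0 * normal_tail z\<bar> \<le> \<zeta>"
    using normal_tail_Lipschitz[of a z] ab p0 mult_mono[of p0 1 "\<bar>normal_tail a - normal_tail z\<bar>" \<zeta>]
    by (simp add: right_diff_distrib[symmetric] abs_mult)
  moreover have "\<bar>p0 * normal_tail b - p0 * normal_tail z\<bar> \<le> \<zeta>"
    using normal_tail_Lipschitz[of b z] ab p0 mult_mono[of p0 1 "\<bar>normal_tail b - normal_tail z\<bar>" \<zeta>]
    by (simp add: right_diff_distrib[symmetric] abs_mult)
  ultimately show ?thesis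
    using grid[OF kl(5)] grid[OF kl(6)] mono[OF ab(1)] mono[OF ab(3)]
    unfolding a_def[symmetric] b_def[symmetric] by linarith
qed

text \<open>Null p-values depend on the noise only, and the denominator \<open>emp_cdf\<close> is \<open>1/\<alpha>\<close> times the threshold.\<close>

lemma FDP_at_threshold:
  fixes \<theta> :: "nat \<Rightarrow> bool" and y :: "nat \<Rightarrow> real"
  defines "p \<equiv> \<lambda>i. normal_tail (\<delta> * of_bool (\<theta> i) + y i)"
  assumes z: "BH_threshold \<alpha> m p = normal_tail z"
  shows "BH_FDP \<alpha> m \<theta> p - p0 * \<alpha> =
    \<alpha> * ((\<Sum>i\<in>{1..m}. of_bool (\<not> \<theta> i) * indicator {z..} (y i)) / real m - p0 * normal_tail z) / normal_tail z"
proof -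
  have "normal_tail z = \<alpha> * emp_cdf m p (normal_tail z)"
    using BH_threshold_fixpoint[OF \<alpha>, of m p] unfolding z .
  then have emp: "emp_cdf m p (normal_tail z) = normal_tail z / \<alpha>" using \<alpha> by (simp add: field_simps)
  have "(\<Sum>i\<in>{1..m}. (1 - of_bool (\<theta> i)) * of_bool (p i \<le> normal_tail z) :: real) =
      (\<Sum>i\<in>{1..m}. of_bool (\<not> \<theta> i) * indicator {z..} (y i))"
    by (intro sum.cong refl) (auto simp: p_def indicator_def)
  then show ?thesis
    unfolding BH_FDP_def z emp using \<alpha> by (simp add: field_simps)
qed

end

section \<open>Deviation bounds\<close>

locale mixture_sample = coupled_mixture P I p0 h y n G D + cr: crossing \<delta> p0 \<alpha>
  for P :: "'b measure" and I p0 h y n G D and \<delta> \<alpha> :: real +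
  fixes m :: nat
  assumes I_eq: "I = {1..m}" and m_pos: "0 < m"
begin

lemma card_I [simp]: "card I = m" by (simp add: I_eq)

definition rate2 :: real where "rate2 = 1 / real m + \<bar>offdiag G\<bar> / (real m)\<^sup>2"
definition corr2 :: real where "corr2 = offdiag (\<lambda>i j. (G i j)\<^sup>2) / (real m)\<^sup>2"

definition null_dev :: "real \<Rightarrow> 'b \<Rightarrow> real" where
  "null_dev z \<omega> = (\<Sum>i\<in>I. of_bool (\<not> h i \<omega>) * indicator {z..} (y i \<omega>)) / real m - p0 * normal_tail z"

definition alt_dev :: "real \<Rightarrow> 'b \<Rightarrow> real" where
  "alt_dev z \<omega> = (\<Sum>i\<in>I. of_bool (h i \<omega>) * indicator {z - \<delta>..} (y i \<omega>)) / real m - (1 - p0) * normal_tail (z - \<delta>)"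

text \<open>The first summand serves half-lines; the second serves intervals inside \<open>[-B, B]\<close>, where \<open>|x| \<le> B\<close>.\<close>

definition weight_const :: "real \<Rightarrow> real" where
  "weight_const B = (LINT x|std_normal_distribution. (1 + B + \<bar>x\<bar>)\<^sup>2) + (1 + 2 * B)\<^sup>2"

definition var_bound :: "real \<Rightarrow> real" where
  "var_bound B = rate2 + 20 * weight_const B * corr2"

lemma offdiag_sq_nonneg: "0 \<le> offdiag (\<lambda>i j. (G i j)\<^sup>2)"
  unfolding offdiag_def by (intro sum_nonneg) auto

lemma corr2_nonneg: "0 \<le> corr2" unfolding corr2_def using offdiag_sq_nonneg by simp

lemma rate2_pos: "0 < rate2"
  unfolding rate2_def using m_pos by (intro add_pos_nonneg) auto

lemma weight_const_nonneg: "0 \<le> weight_const B"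
  unfolding weight_const_def by (intro add_nonneg_nonneg Bochner_Integration.integral_nonneg) auto

lemma var_bound_nonneg: "0 \<le> var_bound B"
  unfolding var_bound_def using rate2_pos weight_const_nonneg[of B] corr2_nonneg
  by (intro add_nonneg_nonneg mult_nonneg_nonneg) auto

lemma scaled_count:
  assumes f: "\<And>x. f x = (0::real) \<or> f x = 1"
    and \<tau>: "\<tau> = 0 \<or> \<tau> = 1 \<and> a \<le> b \<and> \<bar>b\<bar> \<le> B" and a: "\<bar>a\<bar> \<le> B"
    and X: "\<And>\<omega>. X \<omega> = (\<Sum>i\<in>I. f (h i \<omega>) * (indicator {a..} (y i \<omega>) - \<tau> * indicator {b..} (y i \<omega>))) / real m
      - label_mean f * (normal_tail a - \<tau> * normal_tail b)"
  shows "(\<integral>\<omega>. (X \<omega>)\<^sup>2 \<partial>P) \<le> (real m * (normal_tail a - \<tau> * normal_tail b)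
      + (std_normal_density a - \<tau> * std_normal_density b)\<^sup>2 * \<bar>offdiag G\<bar>
      + 20 * (LINT x|std_normal_distribution. (indicator {a..} x - \<tau> * indicator {b..} x) * (1 + B + \<bar>x\<bar>)\<^sup>2)
        * offdiag (\<lambda>i j. (G i j)\<^sup>2)) / (real m)\<^sup>2" (is "_ \<le> ?R / _")
    and "integrable P (\<lambda>\<omega>. (X \<omega>)\<^sup>2)"
proof -
  define S where "S = (\<lambda>\<omega>. \<Sum>i\<in>I. f (h i \<omega>) * (indicator {a..} (y i \<omega>) - \<tau> * indicator {b..} (y i \<omega>))
      - label_mean f * (normal_tail a - \<tau> * normal_tail b))"
  have X': "(X \<omega>)\<^sup>2 = (S \<omega>)\<^sup>2 / (real m)\<^sup>2" for \<omega>
  proof -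
    have "X \<omega> = S \<omega> / real m"
      unfolding X S_def using m_pos by (simp add: sum_subtractf diff_divide_distrib)
    then show ?thesis by (simp add: power_divide)
  qed
  note tv = threshold_count_variance[of \<tau> a b B f, OF \<tau> a f]
  show "(\<integral>\<omega>. (X \<omega>)\<^sup>2 \<partial>P) \<le> ?R / (real m)\<^sup>2"
    unfolding X' using tv(1) by (simp add: divide_right_mono S_def)
  show "integrable P (\<lambda>\<omega>. (X \<omega>)\<^sup>2)"
    unfolding X' using tv(2) by (simp add: S_def)
qed

lemma half_line_dev:
  assumes f: "\<And>x. f x = (0::real) \<or> f x = 1" and a: "\<bar>a\<bar> \<le> B"
    and X: "\<And>\<omega>. X \<omega> = (\<Sum>i\<in>I. f (h i \<omega>) * indicator {a..} (y i \<omega>)) / real m - label_mean f * normal_tail a"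
  shows "(\<integral>\<omega>. (X \<omega>)\<^sup>2 \<partial>P) \<le> var_bound B" and "integrable P (\<lambda>\<omega>. (X \<omega>)\<^sup>2)"
proof -
  have B: "0 \<le> B" using a by linarith
  have X': "X \<omega> = (\<Sum>i\<in>I. f (h i \<omega>) * (indicator {a..} (y i \<omega>) - 0 * indicator {0..} (y i \<omega>))) / real m
      - label_mean f * (normal_tail a - 0 * normal_tail 0)" for \<omega> by (simp add: X)
  note sc = scaled_count[OF f _ a X', simplified]
  show "integrable P (\<lambda>\<omega>. (X \<omega>)\<^sup>2)" by (rule sc(2))
  define \<kappa> where "\<kappa> = (LINT x|std_normal_distribution. indicator {a..} x * (1 + B + \<bar>x\<bar>)\<^sup>2)"
  have "\<kappa> \<le> (LINT x|std_normal_distribution. (1 + B + \<bar>x\<bar>)\<^sup>2)"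
    unfolding \<kappa>_def using integrable_indicator_weight[OF B] integrable_std_normal_poly[of "1 + B" 2]
    by (intro integral_mono) (auto simp: indicator_def)
  then have kappa: "\<kappa> \<le> weight_const B" unfolding weight_const_def by (smt (verit) zero_le_power2)
  have "(\<integral>\<omega>. (X \<omega>)\<^sup>2 \<partial>P) \<le> (real m * normal_tail a + (std_normal_density a)\<^sup>2 * \<bar>offdiag G\<bar>
      + 20 * \<kappa> * offdiag (\<lambda>i j. (G i j)\<^sup>2)) / (real m)\<^sup>2"
    using sc(1) unfolding \<kappa>_def .
  also have "\<dots> \<le> (real m * 1 + 1 * \<bar>offdiag G\<bar> + 20 * weight_const B * offdiag (\<lambda>i j. (G i j)\<^sup>2)) / (real m)\<^sup>2"
    using kappa offdiag_sq_nonneg std_normal_density_le[of a]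
    by (intro divide_right_mono add_mono mult_mono mult_left_mono mult_right_mono power_le_one) auto
  also have "\<dots> = var_bound B"
    unfolding var_bound_def rate2_def corr2_def using m_pos by (simp add: add_divide_distrib power2_eq_square)
  finally show "(\<integral>\<omega>. (X \<omega>)\<^sup>2 \<partial>P) \<le> var_bound B" .
qed

lemma null_dev_var:
  assumes "\<bar>z\<bar> \<le> B"
  shows "(\<integral>\<omega>. (null_dev z \<omega>)\<^sup>2 \<partial>P) \<le> var_bound B" "integrable P (\<lambda>\<omega>. (null_dev z \<omega>)\<^sup>2)"
  by (rule half_line_dev[of "\<lambda>l. of_bool (\<not> l)", OF _ assms]; simp add: null_dev_def label_mean_def)+

lemma alt_dev_var:
  assumes "\<bar>z - \<delta>\<bar> \<le> B"
  shows "(\<integral>\<omega>. (alt_dev z \<omega>)\<^sup>2 \<partial>P) \<le> var_bound B" "integrable P (\<lambda>\<omega>. (alt_dev z \<omega>)\<^sup>2)"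
  by (rule half_line_dev[of "\<lambda>l. of_bool l", OF _ assms]; simp add: alt_dev_def label_mean_def)+

lemma null_dev_meas [measurable]: "null_dev z \<in> borel_measurable P"
  and alt_dev_meas [measurable]: "alt_dev z \<in> borel_measurable P"
proof -
  have [measurable]: "Measurable.pred P (h i)" "y i \<in> borel_measurable P" if "i \<in> I" for i
    using that h_meas y_meas by auto
  show "null_dev z \<in> borel_measurable P" unfolding null_dev_def by measurable
  show "alt_dev z \<in> borel_measurable P" unfolding alt_dev_def by measurable
qed

text \<open>On an interval of length \<open>w\<close> the mass and the squared increment of the density are both at most \<open>w\<close>, hence
  so is each of the three contributions to the variance.\<close>

lemma null_dev_increment:
  assumes ab: "\<bar>a\<bar> \<le> B" "\<bar>b\<bar> \<le> B" "\<bar>a - b\<bar> \<le> w" and w: "w \<le> 1"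
  shows "(\<integral>\<omega>. (null_dev a \<omega> - null_dev b \<omega>)\<^sup>2 \<partial>P) \<le> w * var_bound B"
    and "integrable P (\<lambda>\<omega>. (null_dev a \<omega> - null_dev b \<omega>)\<^sup>2)"
  using ab
proof (induction a b rule: linorder_wlog)
  case (sym a b)
  { case 1 then show ?case using sym by (simp add: power2_commute abs_minus_commute) }
  { case 2 then show ?case using sym by (simp add: power2_commute abs_minus_commute) }
next
  case (le a b)
  have main: "(\<integral>\<omega>. (null_dev a \<omega> - null_dev b \<omega>)\<^sup>2 \<partial>P) \<le> w * var_bound B \<and>
      integrable P (\<lambda>\<omega>. (null_dev a \<omega> - null_dev b \<omega>)\<^sup>2)"
    if ab: "\<bar>a\<bar> \<le> B" "\<bar>b\<bar> \<le> B" "\<bar>a - b\<bar> \<le> w"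
  proof -
    have B: "0 \<le> B" using ab by linarith
    have w0: "0 \<le> w" using ab by linarith
    define d where "d = normal_tail a - normal_tail b"
    have d: "0 \<le> d" "d \<le> w" using normal_tail_Lipschitz[of a b] le ab unfolding d_def by auto
    have X: "null_dev a \<omega> - null_dev b \<omega> =
      (\<Sum>i\<in>I. (of_bool (\<not> h i \<omega>)) * (indicator {a..} (y i \<omega>) - 1 * indicator {b..} (y i \<omega>))) / real m
      - label_mean (\<lambda>l. of_bool (\<not> l)) * (normal_tail a - 1 * normal_tail b)" for \<omega>
      by (simp add: null_dev_def label_mean_def right_diff_distrib sum_subtractf diff_divide_distrib)
    define \<kappa> where "\<kappa> = (LINT x|std_normal_distribution. (indicator {a..} x - 1 * indicator {b..} x) * (1 + B + \<bar>x\<bar>)\<^sup>2)"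
    have sc: "(\<integral>\<omega>. (null_dev a \<omega> - null_dev b \<omega>)\<^sup>2 \<partial>P) \<le> (real m * (normal_tail a - 1 * normal_tail b)
      + (std_normal_density a - 1 * std_normal_density b)\<^sup>2 * \<bar>offdiag G\<bar> + 20 * \<kappa> * offdiag (\<lambda>i j. (G i j)\<^sup>2)) / (real m)\<^sup>2"
      "integrable P (\<lambda>\<omega>. (null_dev a \<omega> - null_dev b \<omega>)\<^sup>2)"
      unfolding \<kappa>_def
      by (rule scaled_count[of "\<lambda>l. of_bool (\<not> l)" 1 a b B, OF _ _ ab(1) X]; use le ab in auto)+
    have int: "integrable std_normal_distribution (\<lambda>x. indicator {z..} x :: real)" for z
      by (rule std_normal.integrable_const_bound[of _ 1]) (auto simp: indicator_def)
    have "\<kappa> \<le> (LINT x|std_normal_distribution. (1 + 2 * B)\<^sup>2 * (indicator {a..} x - indicator {b..} x))"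
      unfolding \<kappa>_def
    proof (rule integral_mono)
      have "(indicator {a..} x - 1 * indicator {b..} x) * (1 + B + \<bar>x\<bar>)\<^sup>2 =
          indicator {a..} x * (1 + B + \<bar>x\<bar>)\<^sup>2 - indicator {b..} x * (1 + B + \<bar>x\<bar>)\<^sup>2" for x :: real
        by (simp add: left_diff_distrib)
      then show "integrable std_normal_distribution (\<lambda>x. (indicator {a..} x - 1 * indicator {b..} x) * (1 + B + \<bar>x\<bar>)\<^sup>2)"
        using integrable_indicator_weight[OF B] by simp
      show "integrable std_normal_distribution (\<lambda>x. (1 + 2 * B)\<^sup>2 * (indicator {a..} x - indicator {b..} x))"
        using int by simp
      fix x :: real
      show "(indicator {a..} x - 1 * indicator {b..} x) * (1 + B + \<bar>x\<bar>)\<^sup>2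
          \<le> (1 + 2 * B)\<^sup>2 * (indicator {a..} x - indicator {b..} x)"
      proof (cases "a \<le> x \<and> x < b")
        case True
        then have "\<bar>x\<bar> \<le> B" using ab by (auto simp: abs_le_iff)
        then have "(1 + B + \<bar>x\<bar>)\<^sup>2 \<le> (1 + 2 * B)\<^sup>2" using B by (intro power_mono) auto
        then show ?thesis using True by simp
      qed (use le in \<open>auto simp: indicator_def\<close>)
    qed
    also have "\<dots> = (1 + 2 * B)\<^sup>2 * d"
      using int by (simp add: d_def normal_tail_def)
    also have "\<dots> \<le> weight_const B * w"
    proof (intro mult_mono)
      show "(1 + 2 * B)\<^sup>2 \<le> weight_const B" unfolding weight_const_def
        using Bochner_Integration.integral_nonneg[of std_normal_distribution "\<lambda>x. (1 + B + \<bar>x\<bar>)\<^sup>2"] by simp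
    qed (use d weight_const_nonneg in auto)
    finally have kappa: "\<kappa> \<le> weight_const B * w" .
    have "\<bar>std_normal_density a - std_normal_density b\<bar> \<le> w"
      using std_normal_density_Lipschitz[of a b] ab by linarith
    then have "(std_normal_density a - std_normal_density b)\<^sup>2 \<le> w\<^sup>2"
      by (metis abs_ge_zero power2_abs power_mono)
    also have "\<dots> \<le> w" using w w0 by (simp add: power2_eq_square mult_left_le)
    finally have dens: "(std_normal_density a - 1 * std_normal_density b)\<^sup>2 \<le> w" by simp
    have "(\<integral>\<omega>. (null_dev a \<omega> - null_dev b \<omega>)\<^sup>2 \<partial>P) \<le>
        (real m * w + w * \<bar>offdiag G\<bar> + 20 * (weight_const B * w) * offdiag (\<lambda>i j. (G i j)\<^sup>2)) / (real m)\<^sup>2"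
      using kappa offdiag_sq_nonneg d dens
      by (intro order_trans[OF sc(1)] divide_right_mono add_mono mult_right_mono mult_left_mono) (auto simp: d_def)
    also have "\<dots> = w * var_bound B"
      unfolding var_bound_def rate2_def corr2_def using m_pos
      by (simp add: add_divide_distrib power2_eq_square distrib_left mult_ac)
    finally show ?thesis using sc(2) by simp
  qed
  { case 1 then show ?case using main by simp }
  { case 2 then show ?case using main by simp }
qed

lemma Chebyshev_zero_mean:
  assumes [measurable]: "X \<in> borel_measurable P" and "integrable P (\<lambda>\<omega>. (X \<omega> :: real)\<^sup>2)" "(\<integral>\<omega>. (X \<omega>)\<^sup>2 \<partial>P) \<le> V" "0 < s"
  shows "prob {\<omega> \<in> space P. s \<le> \<bar>X \<omega>\<bar>} \<le> V / s\<^sup>2"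
proof -
  have "prob {\<omega> \<in> space P. s \<le> \<bar>X \<omega>\<bar>} \<le> (\<integral>\<omega>. (X \<omega>)\<^sup>2 \<partial>P) / s\<^sup>2"
    using assms by (intro second_moment_method) auto
  also have "\<dots> \<le> V / s\<^sup>2" using assms by (intro divide_right_mono) auto
  finally show ?thesis .
qed

lemma emp_cdf_dev:
  "emp_cdf m (\<lambda>i. normal_tail (\<delta> * of_bool (h i \<omega>) + y i \<omega>)) (normal_tail z) - mixture_tail \<delta> p0 z
    = null_dev z \<omega> + alt_dev z \<omega>"
proof -
  have pw: "of_bool (z \<le> \<delta> * of_bool (h i \<omega>) + y i \<omega>) =
      of_bool (\<not> h i \<omega>) * indicator {z..} (y i \<omega>) + of_bool (h i \<omega>) * (indicator {z - \<delta>..} (y i \<omega>) :: real)" for i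
    by (auto simp: indicator_def)
  show ?thesis
    unfolding emp_cdf_def null_dev_def alt_dev_def mixture_tail_def I_eq[symmetric] normal_tail_le_iff pw
      sum.distrib add_divide_distrib
    by linarith
qed

lemma emp_dev_tail:
  assumes "\<bar>z\<bar> \<le> B" "\<bar>z - \<delta>\<bar> \<le> B" "0 < s"
  shows "prob {\<omega> \<in> space P. s \<le> \<bar>null_dev z \<omega> + alt_dev z \<omega>\<bar>} \<le> 4 * var_bound B / s\<^sup>2"
proof (rule Chebyshev_zero_mean[OF _ _ _ assms(3)])
  note N = null_dev_var[OF assms(1)] and A = alt_dev_var[OF assms(2)]
  have le: "(null_dev z \<omega> + alt_dev z \<omega>)\<^sup>2 \<le> 2 * (null_dev z \<omega>)\<^sup>2 + 2 * (alt_dev z \<omega>)\<^sup>2" for \<omega>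
    using zero_le_power2[of "null_dev z \<omega> - alt_dev z \<omega>"] by (simp add: power2_sum power2_diff)
  show int: "integrable P (\<lambda>\<omega>. (null_dev z \<omega> + alt_dev z \<omega>)\<^sup>2)"
  proof (rule Bochner_Integration.integrable_bound)
    show "integrable P (\<lambda>\<omega>. 2 * (null_dev z \<omega>)\<^sup>2 + 2 * (alt_dev z \<omega>)\<^sup>2)" using N A by simp
    show "AE \<omega> in P. norm ((null_dev z \<omega> + alt_dev z \<omega>)\<^sup>2) \<le> norm (2 * (null_dev z \<omega>)\<^sup>2 + 2 * (alt_dev z \<omega>)\<^sup>2)"
      using le by (intro AE_I2) (auto intro: order_trans[OF _ abs_ge_self])
  qed simp
  have "(\<integral>\<omega>. (null_dev z \<omega> + alt_dev z \<omega>)\<^sup>2 \<partial>P) \<le> (\<integral>\<omega>. 2 * (null_dev z \<omega>)\<^sup>2 + 2 * (alt_dev z \<omega>)\<^sup>2 \<partial>P)"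
    using int N A le by (intro integral_mono) auto
  also have "\<dots> \<le> 4 * var_bound B" using N A by simp
  finally show "(\<integral>\<omega>. (null_dev z \<omega> + alt_dev z \<omega>)\<^sup>2 \<partial>P) \<le> 4 * var_bound B" .
qed simp

text \<open>The union bound over Chebyshev's inequality on two grids. The coarse grid has about \<open>1/w\<close> points at which
  deviations of order \<open>w\<close> are excluded, the fine one about \<open>w/\<epsilon>\<close> points at which increments of size
  \<open>\<epsilon>\<close> are excluded.\<close>

lemma threshold_event:
  fixes c L R B w \<epsilon> M :: real
  assumes margin_right: "\<And>z. cr.z_star \<le> z \<Longrightarrow> z \<le> cr.z_star + 1 \<Longrightarrow> normal_tail z / \<alpha> + c * (z - cr.z_star) \<le> mixture_tail \<delta> p0 z"
    and margin_left: "\<And>z. z \<le> cr.z_star \<Longrightarrow> cr.z_star - R \<le> z \<Longrightarrow> mixture_tail \<delta> p0 z \<le> normal_tail z / \<alpha> - c * (cr.z_star - z)"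
    and c: "0 < c" "c \<le> 1" and L: "\<alpha> \<le> normal_tail (cr.z_star - L)" "0 \<le> L"
    and R: "R = L + 2" and B: "B = \<bar>cr.z_star\<bar> + R + \<delta> + 1"
    and w: "0 < w" "w \<le> 1 / 2" and \<epsilon>: "0 < \<epsilon>" "\<epsilon> \<le> w" and M: "0 < M"
  obtains bad where "bad \<in> events"
    "prob bad \<le> var_bound B * (4 / (c * w)\<^sup>2 + (2 * L / (c * \<alpha> * w) + 1) * (16 / (c * w)\<^sup>2) + (2 * w / \<epsilon> + 2) * (2 * w / \<epsilon>\<^sup>2) + 1 / M\<^sup>2)"
    "\<And>\<omega>. \<omega> \<in> space P \<Longrightarrow> \<omega> \<notin> bad \<Longrightarrow> \<exists>z. BH_threshold \<alpha> m (\<lambda>i. normal_tail (\<delta> * of_bool (h i \<omega>) + y i \<omega>)) = normal_tail z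
      \<and> \<bar>z - cr.z_star\<bar> \<le> w \<and> \<bar>null_dev z \<omega> - null_dev cr.z_star \<omega>\<bar> \<le> 2 * \<epsilon> \<and> \<bar>null_dev cr.z_star \<omega>\<bar> \<le> M"
proof -
  define V where "V = var_bound B"
  have V0: "0 \<le> V" unfolding V_def by (rule var_bound_nonneg)
  \<comment> \<open>The mesh of the coarse grid, proportional to the margin \<open>c w\<close> divided by the slope \<open>1/\<alpha>\<close>\<close>
  define \<zeta> where "\<zeta> = c * \<alpha> * w / 2"
  have caw: "c * \<alpha> * w \<le> 1" "0 < c * \<alpha> * w"
    using c w cr.\<alpha> by (auto intro!: mult_le_one mult_pos_pos)
  have \<zeta>: "0 < \<zeta>" "\<zeta> \<le> 1" using caw by (auto simp: \<zeta>_def)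
  define N where "N = nat \<lceil>L / \<zeta>\<rceil>"
  have Lz: "0 \<le> L / \<zeta>" using L \<zeta> by simp
  have N: "L / \<zeta> \<le> real N" "real N \<le> L / \<zeta> + 1" unfolding N_def using Lz by linarith+
  have N1: "L \<le> real N * \<zeta>" "real N * \<zeta> \<le> L + \<zeta>"
    using N \<zeta> mult_right_mono[OF N(1), of \<zeta>] mult_right_mono[OF N(2), of \<zeta>] by (auto simp: distrib_right)
  define N' where "N' = nat \<lceil>2 * w / \<epsilon>\<rceil>"
  have we: "0 \<le> 2 * w / \<epsilon>" using w \<epsilon> by simp
  have N': "2 * w / \<epsilon> \<le> real N'" "real N' \<le> 2 * w / \<epsilon> + 1" unfolding N'_def using we by linarith+
  have N'1: "2 * w \<le> real N' * \<epsilon>" using mult_right_mono[OF N'(1), of \<epsilon>] \<epsilon> by simp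
  define zs where "zs = cr.z_star"
  define B1 where "B1 = {\<omega> \<in> space P. c * w \<le> \<bar>null_dev (zs + w) \<omega> + alt_dev (zs + w) \<omega>\<bar>}"
  define B2 where "B2 = (\<lambda>k. {\<omega> \<in> space P. c * w / 2 \<le> \<bar>null_dev (zs - w - real k * \<zeta>) \<omega> + alt_dev (zs - w - real k * \<zeta>) \<omega>\<bar>})"
  define B3 where "B3 = (\<lambda>k. {\<omega> \<in> space P. \<epsilon> \<le> \<bar>null_dev (zs - w + real k * \<epsilon>) \<omega> - null_dev zs \<omega>\<bar>})"
  define B4 where "B4 = {\<omega> \<in> space P. M \<le> \<bar>null_dev zs \<omega>\<bar>}"
  define bad where "bad = B1 \<union> (\<Union>k\<in>{1..N}. B2 k) \<union> (\<Union>k\<in>{0..N'}. B3 k) \<union> B4"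
  have ev: "B1 \<in> events" "B2 k \<in> events" "B3 k \<in> events" "B4 \<in> events" for k
    unfolding B1_def B2_def B3_def B4_def by measurable
  have ev_bad: "bad \<in> events" unfolding bad_def using ev by auto
  have cw: "0 < c * w" using c w by simp
  have zs_abs: "\<bar>zs + r\<bar> \<le> B" "\<bar>zs + r - \<delta>\<bar> \<le> B" if "\<bar>r\<bar> \<le> R + 1" for r
    using that cr.\<delta> unfolding B zs_def by linarith+
  have R0: "2 \<le> R" using R L by simp
  have p1: "prob B1 \<le> V * (4 / (c * w)\<^sup>2)"
    unfolding B1_def V_def using emp_dev_tail[of "zs + w" B "c * w"] zs_abs[of w] cw w R0 by (simp add: mult.commute)
  have p2: "prob (B2 k) \<le> V * (16 / (c * w)\<^sup>2)" if k: "k \<in> {1..N}" for k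
  proof -
    have "real k * \<zeta> \<le> real N * \<zeta>" "0 \<le> real k * \<zeta>" using k \<zeta> by (auto intro!: mult_right_mono)
    then have "\<bar>- w - real k * \<zeta>\<bar> \<le> R + 1" using N1 w \<zeta> R by linarith
    from zs_abs[OF this] have "prob (B2 k) \<le> 4 * var_bound B / (c * w / 2)\<^sup>2"
      unfolding B2_def using cw by (intro emp_dev_tail) (auto simp: algebra_simps)
    also have "\<dots> = V * (16 / (c * w)\<^sup>2)" by (simp add: V_def power_divide)
    finally show ?thesis .
  qed
  have p3: "prob (B3 k) \<le> V * (2 * w / \<epsilon>\<^sup>2)" if k: "k \<in> {0..N'}" for k
  proof -
    have "real k * \<epsilon> \<le> real N' * \<epsilon>" "0 \<le> real k * \<epsilon>" using k \<epsilon> by (auto intro!: mult_right_mono)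
    moreover have "real N' * \<epsilon> \<le> (2 * w / \<epsilon> + 1) * \<epsilon>" using N' \<epsilon> by (intro mult_right_mono) auto
    moreover have "(2 * w / \<epsilon> + 1) * \<epsilon> = 2 * w + \<epsilon>" using \<epsilon> by (simp add: distrib_right)
    ultimately have dist: "\<bar>- w + real k * \<epsilon>\<bar> \<le> 2 * w" using \<epsilon> w by linarith
    have in_B: "\<bar>zs - w + real k * \<epsilon>\<bar> \<le> B" "\<bar>zs\<bar> \<le> B"
      using zs_abs(1)[of "- w + real k * \<epsilon>"] zs_abs(1)[of 0] dist w R0 by (auto simp: algebra_simps)
    have incr: "(\<integral>\<omega>. (null_dev (zs - w + real k * \<epsilon>) \<omega> - null_dev zs \<omega>)\<^sup>2 \<partial>P) \<le> 2 * w * var_bound B"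
      "integrable P (\<lambda>\<omega>. (null_dev (zs - w + real k * \<epsilon>) \<omega> - null_dev zs \<omega>)\<^sup>2)"
      using null_dev_increment[of "zs - w + real k * \<epsilon>" B zs "2 * w"] in_B dist w by (auto simp: algebra_simps)
    have "prob (B3 k) \<le> 2 * w * var_bound B / \<epsilon>\<^sup>2"
      unfolding B3_def by (rule Chebyshev_zero_mean[OF _ incr(2,1) \<epsilon>(1)]) measurable
    then show ?thesis by (simp add: V_def mult_ac)
  qed
  have p4: "prob B4 \<le> V * (1 / M\<^sup>2)"
    unfolding B4_def V_def using Chebyshev_zero_mean[OF null_dev_meas null_dev_var(2,1) M, of zs B] zs_abs(1)[of 0] R0 by simp
  have "prob bad \<le> prob B1 + prob (\<Union>k\<in>{1..N}. B2 k) + prob (\<Union>k\<in>{0..N'}. B3 k) + prob B4"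
    unfolding bad_def using ev
    by (intro order_trans[OF measure_Un_le] add_mono order_refl) auto
  also have "prob (\<Union>k\<in>{1..N}. B2 k) \<le> (\<Sum>k\<in>{1..N}. V * (16 / (c * w)\<^sup>2))"
    using ev p2 by (intro order_trans[OF finite_measure_subadditive_finite] sum_mono) auto
  also have "(\<Sum>k\<in>{1..N}. V * (16 / (c * w)\<^sup>2)) \<le> (2 * L / (c * \<alpha> * w) + 1) * (V * (16 / (c * w)\<^sup>2))"
  proof -
    have "L / \<zeta> = 2 * L / (c * \<alpha> * w)" by (simp add: \<zeta>_def)
    then have "real (card {1..N}) \<le> 2 * L / (c * \<alpha> * w) + 1" using N(2) by simp
    then show ?thesis using V0 by (simp only: sum_constant) (intro mult_right_mono mult_nonneg_nonneg, auto)
  qed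
  also have "prob (\<Union>k\<in>{0..N'}. B3 k) \<le> (\<Sum>k\<in>{0..N'}. V * (2 * w / \<epsilon>\<^sup>2))"
    using ev p3 by (intro order_trans[OF finite_measure_subadditive_finite] sum_mono) auto
  also have "(\<Sum>k\<in>{0..N'}. V * (2 * w / \<epsilon>\<^sup>2)) \<le> (2 * w / \<epsilon> + 2) * (V * (2 * w / \<epsilon>\<^sup>2))"
  proof -
    have "real (card {0..N'}) \<le> 2 * w / \<epsilon> + 2" using N'(2) by simp
    then show ?thesis using V0 w by (simp only: sum_constant) (intro mult_right_mono mult_nonneg_nonneg divide_nonneg_nonneg, auto)
  qed
  finally have prob_bad: "prob bad \<le> prob B1 + (2 * L / (c * \<alpha> * w) + 1) * (V * (16 / (c * w)\<^sup>2))
      + (2 * w / \<epsilon> + 2) * (V * (2 * w / \<epsilon>\<^sup>2)) + prob B4" by simp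
  show ?thesis
  proof (rule that[OF ev_bad])
    have expand: "V * (a + b * a2 + d * d2 + e) = V * a + b * (V * a2) + d * (V * d2) + V * e" for a b a2 d d2 e
      by (simp add: algebra_simps)
    show "prob bad \<le> var_bound B * (4 / (c * w)\<^sup>2 + (2 * L / (c * \<alpha> * w) + 1) * (16 / (c * w)\<^sup>2)
        + (2 * w / \<epsilon> + 2) * (2 * w / \<epsilon>\<^sup>2) + 1 / M\<^sup>2)"
      using prob_bad p1 p4 unfolding V_def[symmetric] expand by linarith
  next
    fix \<omega> assume om: "\<omega> \<in> space P" "\<omega> \<notin> bad"
    let ?p = "\<lambda>i. normal_tail (\<delta> * of_bool (h i \<omega>) + y i \<omega>)"
    obtain z where z: "BH_threshold \<alpha> m ?p = normal_tail z" "\<bar>z - cr.z_star\<bar> \<le> w"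
    proof (rule cr.BH_threshold_localised[of c R w \<zeta> L N m "\<lambda>i. \<delta> * of_bool (h i \<omega>) + y i \<omega>"])
      show "mixture_tail \<delta> p0 (cr.z_star + w) - c * w < emp_cdf m ?p (normal_tail (cr.z_star + w))"
        using om emp_cdf_dev[of \<omega> "zs + w"] unfolding bad_def B1_def zs_def by auto
      show "emp_cdf m ?p (normal_tail (cr.z_star - w - real k * \<zeta>)) < mixture_tail \<delta> p0 (cr.z_star - w - real k * \<zeta>) + c * w / 2"
        if "1 \<le> k" "k \<le> N" for k
      proof -
        have "\<omega> \<notin> B2 k" using om that unfolding bad_def by auto
        then have "\<bar>null_dev (zs - w - real k * \<zeta>) \<omega> + alt_dev (zs - w - real k * \<zeta>) \<omega>\<bar> < c * w / 2"
          using om unfolding B2_def by simp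
        then show ?thesis
          using emp_cdf_dev[of \<omega> "zs - w - real k * \<zeta>"] unfolding zs_def by linarith
      qed
      show "w + real N * \<zeta> \<le> R" using N1 w \<zeta> R by linarith
    qed (use margin_right margin_left c w \<zeta> L N1 in \<open>auto simp: \<zeta>_def\<close>)
    define E0 where "E0 = (\<lambda>z. (\<Sum>i\<in>I. of_bool (\<not> h i \<omega>) * indicator {z..} (y i \<omega>)) / real m :: real)"
    have nd: "null_dev z \<omega> = E0 z - p0 * normal_tail z" for z by (simp add: null_dev_def E0_def)
    have "\<bar>(E0 z - p0 * normal_tail z) - (E0 zs - p0 * normal_tail zs)\<bar> \<le> \<epsilon> + \<epsilon>"
    proof (rule cr.fine_grid_bound[OF _ \<epsilon>(1) N'1])
      show "E0 b \<le> E0 a" if "a \<le> b" for a b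
        unfolding E0_def using that
        by (intro divide_right_mono sum_mono mult_left_mono) (auto simp: indicator_def)
      show "\<bar>E0 (zs - w + real k * \<epsilon>) - p0 * normal_tail (zs - w + real k * \<epsilon>) - (E0 zs - p0 * normal_tail zs)\<bar> \<le> \<epsilon>"
        if "k \<le> N'" for k
      proof -
        have "\<omega> \<notin> B3 k" using om that unfolding bad_def by auto
        then have "\<bar>null_dev (zs - w + real k * \<epsilon>) \<omega> - null_dev zs \<omega>\<bar> < \<epsilon>"
          using om unfolding B3_def by simp
        then show ?thesis unfolding nd by simp
      qed
    qed (use z in \<open>simp add: zs_def\<close>)
    moreover have "\<bar>null_dev zs \<omega>\<bar> \<le> M" using om unfolding bad_def B4_def by auto
    ultimately show "\<exists>z. BH_threshold \<alpha> m ?p = normal_tail z \<and> \<bar>z - cr.z_star\<bar> \<le> w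
        \<and> \<bar>null_dev z \<omega> - null_dev cr.z_star \<omega>\<bar> \<le> 2 * \<epsilon> \<and> \<bar>null_dev cr.z_star \<omega>\<bar> \<le> M"
      using z unfolding nd[symmetric] zs_def by (intro exI[of _ z]) auto
  qed
qed

end

section \<open>The normalised false discovery proportion\<close>

lemma BH_FDP_measurable:
  fixes H :: "nat \<Rightarrow> 'a \<Rightarrow> bool" and p :: "nat \<Rightarrow> 'a \<Rightarrow> real"
  assumes \<alpha>: "0 < \<alpha>" "\<alpha> < 1" and m: "0 < m"
    and H [measurable]: "\<And>i. i \<in> {1..m} \<Longrightarrow> Measurable.pred M (H i)"
    and p [measurable]: "\<And>i. i \<in> {1..m} \<Longrightarrow> p i \<in> borel_measurable M"
  shows "(\<lambda>\<omega>. BH_FDP \<alpha> m (\<lambda>i. H i \<omega>) (\<lambda>i. p i \<omega>)) \<in> borel_measurable M"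
proof -
  have emp [measurable]: "(\<lambda>\<omega>. emp_cdf m (\<lambda>i. p i \<omega>) (t \<omega>)) \<in> borel_measurable M"
    if [measurable]: "t \<in> borel_measurable M" for t
    unfolding emp_cdf_def by measurable
  have [measurable]: "(\<lambda>\<omega>. BH_threshold \<alpha> m (\<lambda>i. p i \<omega>)) \<in> borel_measurable M"
    unfolding BH_threshold_Max[OF \<alpha> m] by measurable
  show ?thesis unfolding BH_FDP_def by measurable
qed

context mixture_sample
begin

abbreviation "zs \<equiv> cr.z_star"
abbreviation "ts \<equiv> normal_tail cr.z_star"

text \<open>The leading part of the variance of \<open>m * null_dev zs\<close>; \<open>sd_const\<close> is the constant in its lower bound.\<close>

definition sigma2 :: real where
  "sigma2 = real m * (p0 * ts - p0\<^sup>2 * ts\<^sup>2) + p0\<^sup>2 * (std_normal_density zs)\<^sup>2 * offdiag G"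

definition sd_const :: real where
  "sd_const = min (p0\<^sup>2 * (std_normal_density zs)\<^sup>2) (p0 * (1 - p0) * ts / 2)"

lemma sd_const_pos: "0 < sd_const"
  using cr.p0 normal_density_pos[of 1 0 zs] unfolding sd_const_def by simp

lemma rate2_eq: "(real m)\<^sup>2 * rate2 = real m + \<bar>offdiag G\<bar>"
  unfolding rate2_def using m_pos by (simp add: distrib_left power2_eq_square)

lemma offdiag_ge: "- real m \<le> offdiag G"
proof -
  have "0 \<le> quad_form I G (\<lambda>_. 1) (\<lambda>_. 1)" by (rule gaussian_mixture.G_psd) unfold_locales
  also have "quad_form I G (\<lambda>_. 1) (\<lambda>_. 1) = (\<Sum>i\<in>I. G i i + (\<Sum>j\<in>I - {i}. G i j))"
    unfolding quad_form_def by (simp, intro sum.cong refl sum.remove) (simp add: I_eq)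
  also have "\<dots> = real m + offdiag G"
    by (simp add: sum.distrib offdiag_def G_diag)
  finally show ?thesis by simp
qed

text \<open>If the mean correlation is negative it is at least \<open>-1/m\<close>, and \<open>\<phi>(z)\<^sup>2 \<le> t (1 - t)\<close> leaves a variance
  of order \<open>1/m\<close>.\<close>

lemma sigma2_lower: "sd_const * ((real m)\<^sup>2 * rate2) \<le> sigma2"
proof -
  define d where "d = (std_normal_density zs)\<^sup>2"
  have p: "0 < p0" "p0 < 1" using cr.p0 by auto
  have dt: "d \<le> ts * (1 - ts)" unfolding d_def by (rule std_normal_density_sq_le)
  have pp: "p0\<^sup>2 * (ts\<^sup>2 + d) \<le> p0\<^sup>2 * ts"
    using dt by (intro mult_left_mono) (auto simp: power2_eq_square algebra_simps)
  have pv: "p0 * (1 - p0) * ts \<le> p0 * ts - p0\<^sup>2 * ts\<^sup>2 - p0\<^sup>2 * d"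
    using pp by (simp add: power2_eq_square algebra_simps)
  have d0: "0 \<le> p0\<^sup>2 * d" unfolding d_def by simp
  have t0: "0 \<le> p0 * (1 - p0) * ts" using p by simp
  show ?thesis
  proof (cases "0 \<le> offdiag G")
    case True
    have "sd_const * (real m + offdiag G) = real m * sd_const + sd_const * offdiag G" by (simp add: algebra_simps)
    also have "\<dots> \<le> real m * (p0 * ts - p0\<^sup>2 * ts\<^sup>2) + p0\<^sup>2 * d * offdiag G"
      using pv d0 t0 True unfolding sd_const_def d_def[symmetric]
      by (intro add_mono mult_left_mono mult_right_mono) auto
    finally show ?thesis unfolding rate2_eq sigma2_def d_def[symmetric] using True by simp
  next
    case False
    have "sd_const * (real m + \<bar>offdiag G\<bar>) \<le> p0 * (1 - p0) * ts / 2 * (2 * real m)"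
      using False offdiag_ge t0 sd_const_pos unfolding sd_const_def by (intro mult_mono) auto
    also have "\<dots> = real m * (p0 * (1 - p0) * ts)" by simp
    also have "\<dots> \<le> real m * (p0 * ts - p0\<^sup>2 * ts\<^sup>2 - p0\<^sup>2 * d)" using pv by (intro mult_left_mono) auto
    also have "\<dots> = real m * (p0 * ts - p0\<^sup>2 * ts\<^sup>2) + p0\<^sup>2 * d * (- real m)" by (simp add: algebra_simps)
    also have "\<dots> \<le> real m * (p0 * ts - p0\<^sup>2 * ts\<^sup>2) + p0\<^sup>2 * d * offdiag G"
      using d0 offdiag_ge by (intro add_left_mono mult_left_mono) auto
    finally show ?thesis unfolding rate2_eq sigma2_def d_def[symmetric] .
  qed
qed

definition sd :: real where
  "sd = sqrt ((1 / ts - p0) / (p0 * real m) + (std_normal_density zs / ts)\<^sup>2 * (offdiag G / (real m)\<^sup>2))"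

lemma sigma2_eq_sd: "(p0 * ts * real m)\<^sup>2 * ((1 / ts - p0) / (p0 * real m) + (std_normal_density zs / ts)\<^sup>2 * (offdiag G / (real m)\<^sup>2)) = sigma2"
  using m_pos cr.p0 normal_tail_pos[of zs]
  by (simp add: sigma2_def field_simps power2_eq_square)

lemma sigma2_pos: "0 < sigma2"
  using sigma2_lower mult_pos_pos[OF sd_const_pos mult_pos_pos[OF _ rate2_pos], of "(real m)\<^sup>2"] m_pos by simp

lemma sd_eq: "p0 * ts * real m * sd = sqrt sigma2" and sd_pos: "0 < sd"
proof -
  have "sqrt sigma2 = \<bar>p0 * ts * real m\<bar> * sd"
    unfolding sigma2_eq_sd[symmetric] sd_def real_sqrt_mult by simp
  then show eq: "p0 * ts * real m * sd = sqrt sigma2" using cr.p0 by simp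
  have "0 < p0 * ts * real m * sd" unfolding eq using sigma2_pos by simp
  moreover have "0 < p0 * ts * real m" using cr.p0 m_pos by simp
  ultimately show "0 < sd" by (simp add: zero_less_mult_iff)
qed

definition FDP_stat :: "'b \<Rightarrow> real" where
  "FDP_stat \<omega> = (BH_FDP \<alpha> m (\<lambda>i. h i \<omega>) (\<lambda>i. normal_tail (\<delta> * of_bool (h i \<omega>) + y i \<omega>)) - p0 * \<alpha>) / (p0 * \<alpha> * sd)"

definition lin_stat :: "'b \<Rightarrow> real" where
  "lin_stat \<omega> = null_dev zs \<omega> / (p0 * ts * sd)"

lemma FDP_stat_meas [measurable]: "FDP_stat \<in> borel_measurable P"
proof -
  have [measurable]: "Measurable.pred P (h i)" "y i \<in> borel_measurable P" if "i \<in> {1..m}" for i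
    using that h_meas y_meas I_eq by auto
  have [measurable]: "(\<lambda>\<omega>. BH_FDP \<alpha> m (\<lambda>i. h i \<omega>) (\<lambda>i. normal_tail (\<delta> * of_bool (h i \<omega>) + y i \<omega>))) \<in> borel_measurable P"
    by (rule BH_FDP_measurable[OF cr.\<alpha> m_pos]) auto
  show ?thesis unfolding FDP_stat_def by measurable
qed

lemma lin_stat_meas [measurable]: "lin_stat \<in> borel_measurable P"
  unfolding lin_stat_def by measurable

lemma sd_lower: "sqrt (sd_const * rate2) \<le> p0 * sd"
proof -
  have "sqrt (sd_const * rate2) * real m = sqrt (sd_const * ((real m)\<^sup>2 * rate2))"
    by (simp add: real_sqrt_mult)
  also have "\<dots> \<le> sqrt sigma2" using sigma2_lower by (rule real_sqrt_le_mono)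
  also have "\<dots> = ts * (p0 * sd) * real m" unfolding sd_eq[symmetric] by simp
  also have "\<dots> \<le> 1 * (p0 * sd) * real m"
    using sd_pos cr.p0 by (intro mult_right_mono) auto
  finally show ?thesis using m_pos by simp
qed

text \<open>Both statistics are quotients of a null deviation by a tail, taken at the random and at the deterministic
  point; numerators differ by the oscillation, denominators by the width of the window.\<close>

lemma stat_difference:
  assumes z: "BH_threshold \<alpha> m (\<lambda>i. normal_tail (\<delta> * of_bool (h i \<omega>) + y i \<omega>)) = normal_tail z"
    and w: "\<bar>z - zs\<bar> \<le> w" "w \<le> 1" and d: "\<bar>null_dev z \<omega> - null_dev zs \<omega>\<bar> \<le> 2 * \<epsilon>" and M: "\<bar>null_dev zs \<omega>\<bar> \<le> M"
  defines "q \<equiv> normal_tail (zs + 1)"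
  shows "\<bar>FDP_stat \<omega> - lin_stat \<omega>\<bar> \<le> (2 * \<epsilon> / q + M * w / q\<^sup>2) / sqrt (sd_const * rate2)"
proof -
  have q: "0 < q" "q \<le> normal_tail z" "q \<le> ts" using w by (auto simp: q_def)
  define A A0 where "A = null_dev z \<omega>" and "A0 = null_dev zs \<omega>"
  have alg: "a / (k * x) - b / (k * t) = ((a - b) / x + b * ((t - x) / (x * t))) / k"
    if "x \<noteq> 0" "t \<noteq> 0" "k \<noteq> 0" for a b x t k :: real
    using that by (simp add: field_simps)
  have e1: "FDP_stat \<omega> = A / (p0 * sd * normal_tail z)"
    unfolding FDP_stat_def cr.FDP_at_threshold[OF z, folded I_eq] A_def null_dev_def
    using cr.\<alpha> by (simp add: mult_ac)
  have e2: "lin_stat \<omega> = A0 / (p0 * sd * ts)" by (simp add: lin_stat_def A0_def mult_ac)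
  have eq: "FDP_stat \<omega> - lin_stat \<omega> = ((A - A0) / normal_tail z + A0 * ((ts - normal_tail z) / (normal_tail z * ts))) / (p0 * sd)"
    unfolding e1 e2 by (rule alg) (use sd_pos cr.p0 in auto)
  have e0: "0 \<le> \<epsilon>" "0 \<le> M" "0 \<le> w" using d M w by linarith+
  have "\<bar>(A - A0) / normal_tail z\<bar> \<le> 2 * \<epsilon> / q"
    unfolding abs_divide using d q e0 by (intro frac_le) (auto simp: A_def A0_def)
  moreover have "\<bar>A0 * ((ts - normal_tail z) / (normal_tail z * ts))\<bar> \<le> M * (w / (q * q))"
  proof -
    have "\<bar>(ts - normal_tail z) / (normal_tail z * ts)\<bar> \<le> w / (q * q)"
      unfolding abs_divide abs_mult using normal_tail_Lipschitz[of zs z] w q e0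
      by (intro frac_le) (auto intro!: mult_mono simp: abs_minus_commute)
    then show ?thesis unfolding abs_mult[of A0] using M e0 by (intro mult_mono) (auto simp: A0_def)
  qed
  moreover have "M * w / q\<^sup>2 = M * (w / (q * q))" by (simp add: power2_eq_square)
  ultimately have num: "\<bar>(A - A0) / normal_tail z + A0 * ((ts - normal_tail z) / (normal_tail z * ts))\<bar> \<le> 2 * \<epsilon> / q + M * w / q\<^sup>2"
    by linarith
  have s0: "0 < sqrt (sd_const * rate2)" using sd_const_pos rate2_pos by simp
  show ?thesis
    unfolding eq abs_divide using num sd_lower s0 sd_pos cr.p0 q e0
    by (intro frac_le) auto
qed

lemma char_stat_difference:
  fixes Bd s :: real
  assumes bad: "bad \<in> events" and Bd: "\<And>\<omega>. \<omega> \<in> space P \<Longrightarrow> \<omega> \<notin> bad \<Longrightarrow> \<bar>FDP_stat \<omega> - lin_stat \<omega>\<bar> \<le> Bd"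
    and Bd0: "0 \<le> Bd"
  shows "cmod ((CLINT \<omega>|P. iexp (s * FDP_stat \<omega>)) - (CLINT \<omega>|P. iexp (s * lin_stat \<omega>))) \<le> 2 * prob bad + \<bar>s\<bar> * Bd"
proof -
  have int: "integrable P (\<lambda>\<omega>. iexp (s * FDP_stat \<omega>))" "integrable P (\<lambda>\<omega>. iexp (s * lin_stat \<omega>))"
    by (rule integrable_const_bound[of _ 1]; simp)+
  have ib: "integrable P (indicator bad :: 'b \<Rightarrow> real)"
    by (rule integrable_const_bound[of _ 1]) (use bad in \<open>auto simp: indicator_def\<close>)
  have "cmod ((CLINT \<omega>|P. iexp (s * FDP_stat \<omega>)) - (CLINT \<omega>|P. iexp (s * lin_stat \<omega>))) =
      cmod (CLINT \<omega>|P. iexp (s * FDP_stat \<omega>) - iexp (s * lin_stat \<omega>))" using int by simp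
  also have "\<dots> \<le> (\<integral>\<omega>. cmod (iexp (s * FDP_stat \<omega>) - iexp (s * lin_stat \<omega>)) \<partial>P)" by (rule integral_norm_bound)
  also have "\<dots> \<le> (\<integral>\<omega>. 2 * indicator bad \<omega> + \<bar>s\<bar> * Bd \<partial>P)"
  proof (rule integral_mono)
    show "integrable P (\<lambda>\<omega>. 2 * indicator bad \<omega> + \<bar>s\<bar> * Bd :: real)" using ib by simp
    fix \<omega> assume om: "\<omega> \<in> space P"
    show "cmod (iexp (s * FDP_stat \<omega>) - iexp (s * lin_stat \<omega>)) \<le> 2 * indicator bad \<omega> + \<bar>s\<bar> * Bd"
    proof (cases "\<omega> \<in> bad")
      case True
      have "cmod (iexp (s * FDP_stat \<omega>) - iexp (s * lin_stat \<omega>)) \<le> 1 + 1"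
        using norm_triangle_ineq4[of "iexp (s * FDP_stat \<omega>)" "iexp (s * lin_stat \<omega>)"] by simp
      moreover have "0 \<le> \<bar>s\<bar> * Bd" using Bd0 by (intro mult_nonneg_nonneg) auto
      moreover have "indicator bad \<omega> = (1 :: real)" using True by simp
      ultimately show ?thesis by linarith
    next
      case False
      have "cmod (iexp (s * FDP_stat \<omega>) - iexp (s * lin_stat \<omega>)) \<le> \<bar>s * FDP_stat \<omega> - s * lin_stat \<omega>\<bar>"
        by (rule cmod_iexp_diff_le)
      also have "\<dots> = \<bar>s\<bar> * \<bar>FDP_stat \<omega> - lin_stat \<omega>\<bar>" by (simp add: right_diff_distrib[symmetric] abs_mult)
      also have "\<dots> \<le> \<bar>s\<bar> * Bd" using Bd[OF om False] by (intro mult_left_mono) auto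
      finally show ?thesis using False by simp
    qed
  qed (use int in auto)
  also have "\<dots> = 2 * prob bad + \<bar>s\<bar> * Bd" using bad ib by (simp add: prob_space)
  finally show ?thesis .
qed

text \<open>The constant \<open>sd_const\<close> turns the errors relative to \<open>sigma2\<close> into errors relative to \<open>rate2\<close>. The
  hypothesis on \<open>s\<close> keeps the coefficient of each summand below \<open>1\<close>.\<close>

lemma char_lin_stat:
  fixes s \<eta> :: real
  assumes s: "s\<^sup>2 \<le> sd_const * real m" and \<eta>: "0 < \<eta>"
  defines "C \<equiv> LINT x|std_normal_distribution. (1 + \<bar>x\<bar>) ^ 3"
    and "\<kappa> \<equiv> LINT x|std_normal_distribution. indicator {zs..} x * (1 + \<bar>zs\<bar> + \<bar>x\<bar>)\<^sup>2"
  shows "cmod ((CLINT \<omega>|P. iexp (s * lin_stat \<omega>)) - exp (- s\<^sup>2 / 2)) \<le>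
     8 * (C + C\<^sup>2) * (\<bar>s\<bar> / sqrt (sd_const * real m)) * (s\<^sup>2 / sd_const)
     + sqrt (s\<^sup>2 / sd_const * (4 * \<eta> + (30 * \<kappa> + 2 + 2 / \<eta>\<^sup>2) * (corr2 / rate2)))"
proof -
  define \<beta> where "\<beta> = s / sqrt sigma2"
  define Q where "Q = (real m)\<^sup>2 * rate2"
  have Qm: "real m \<le> Q" unfolding Q_def rate2_eq by simp
  have Q0: "0 < Q" using Qm m_pos by linarith
  have sQ: "sd_const * Q \<le> sigma2" unfolding Q_def by (rule sigma2_lower)
  have \<beta>2: "\<beta>\<^sup>2 = s\<^sup>2 / sigma2" unfolding \<beta>_def power_divide using sigma2_pos by simp
  have \<beta>Q: "\<beta>\<^sup>2 \<le> s\<^sup>2 / (sd_const * Q)"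
    unfolding \<beta>2 using sQ sd_const_pos Q0 by (intro divide_left_mono) (auto intro: mult_pos_pos sigma2_pos)
  also have "\<dots> \<le> s\<^sup>2 / (sd_const * real m)"
    using Qm sd_const_pos m_pos Q0 by (intro divide_left_mono mult_left_mono mult_pos_pos) auto
  finally have \<beta>m: "\<beta>\<^sup>2 \<le> s\<^sup>2 / (sd_const * real m)" .
  have sm0: "0 < sd_const * real m" using sd_const_pos m_pos by simp
  have "s\<^sup>2 / (sd_const * real m) \<le> 1" using s sm0 by simp
  then have "\<beta>\<^sup>2 \<le> 1" using \<beta>m by linarith
  then have \<beta>1: "\<bar>\<beta>\<bar> \<le> 1" using abs_square_le_1 by blast
  have \<beta>a: "\<bar>\<beta>\<bar> \<le> \<bar>s\<bar> / sqrt (sd_const * real m)"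
    using real_sqrt_le_mono[OF \<beta>m] by (simp add: real_sqrt_divide)
  have lin: "s * lin_stat \<omega> = \<beta> * (\<Sum>i\<in>I. of_bool (\<not> h i \<omega>) * indicator {zs..} (y i \<omega>) - p0 * ts)" for \<omega>
  proof -
    have "(\<Sum>i\<in>I. of_bool (\<not> h i \<omega>) * indicator {zs..} (y i \<omega>) - p0 * ts) = real m * null_dev zs \<omega>"
      using m_pos by (simp add: null_dev_def sum_subtractf right_diff_distrib)
    then show ?thesis
      unfolding \<beta>_def sd_eq[symmetric] lin_stat_def using m_pos by simp
  qed
  have \<beta>\<sigma>: "\<beta>\<^sup>2 * sigma2 = s\<^sup>2" unfolding \<beta>2 using sigma2_pos by simp
  have C0: "0 \<le> C" unfolding C_def by (intro Bochner_Integration.integral_nonneg) auto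
  have kappa0: "0 \<le> \<kappa>" unfolding \<kappa>_def by (intro Bochner_Integration.integral_nonneg) auto
  define F where "F = offdiag (\<lambda>i j. (G i j)\<^sup>2)"
  define U where "U = 30 * \<kappa> + 2 + 2 / \<eta>\<^sup>2"
  have U0: "0 \<le> U" unfolding U_def using kappa0 by simp
  have "cmod ((CLINT \<omega>|P. iexp (s * lin_stat \<omega>)) - exp (- s\<^sup>2 / 2)) \<le>
      4 * (C + C\<^sup>2) * \<bar>\<beta>\<bar> * (\<beta>\<^sup>2 * (2 * real m + \<bar>offdiag G\<bar>)) + \<bar>\<beta>\<bar> * sqrt (4 * \<eta> * real m + U * F)"
    using null_count_char_bound[OF \<beta>1 \<eta>, of zs] unfolding lin[symmetric] sigma2_def[symmetric, unfolded] C_def \<kappa>_def F_def U_def card_I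
      sigma2_def[symmetric] \<beta>\<sigma> by simp
  also have "\<dots> \<le> 8 * (C + C\<^sup>2) * (\<bar>s\<bar> / sqrt (sd_const * real m)) * (s\<^sup>2 / sd_const)
     + sqrt (s\<^sup>2 / sd_const * (4 * \<eta> + U * (corr2 / rate2)))"
  proof (intro add_mono)
    have "2 * real m + \<bar>offdiag G\<bar> \<le> 2 * Q" unfolding Q_def rate2_eq by simp
    then have "\<beta>\<^sup>2 * (2 * real m + \<bar>offdiag G\<bar>) \<le> s\<^sup>2 / (sd_const * Q) * (2 * Q)"
      using \<beta>Q sd_const_pos Q0 by (intro mult_mono) auto
    also have "\<dots> = 2 * (s\<^sup>2 / sd_const)" using Q0 by simp
    finally have 1: "\<beta>\<^sup>2 * (2 * real m + \<bar>offdiag G\<bar>) \<le> 2 * (s\<^sup>2 / sd_const)" .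
    have 2: "4 * (C + C\<^sup>2) * \<bar>\<beta>\<bar> \<le> 4 * (C + C\<^sup>2) * (\<bar>s\<bar> / sqrt (sd_const * real m))"
      using \<beta>a C0 by (intro mult_left_mono) auto
    have "4 * (C + C\<^sup>2) * \<bar>\<beta>\<bar> * (\<beta>\<^sup>2 * (2 * real m + \<bar>offdiag G\<bar>)) \<le>
        4 * (C + C\<^sup>2) * (\<bar>s\<bar> / sqrt (sd_const * real m)) * (2 * (s\<^sup>2 / sd_const))"
      by (rule mult_mono[OF 2 1]) (use C0 sd_const_pos in auto)
    moreover have "4 * k * a * (2 * b) = 8 * k * a * b" for k a b :: real by simp
    ultimately show "4 * (C + C\<^sup>2) * \<bar>\<beta>\<bar> * (\<beta>\<^sup>2 * (2 * real m + \<bar>offdiag G\<bar>)) \<le>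
        8 * (C + C\<^sup>2) * (\<bar>s\<bar> / sqrt (sd_const * real m)) * (s\<^sup>2 / sd_const)" by (simp only:)
    have "\<bar>\<beta>\<bar> * sqrt (4 * \<eta> * real m + U * F) = sqrt (\<beta>\<^sup>2 * (4 * \<eta> * real m + U * F))"
      by (simp add: real_sqrt_mult)
    also have "\<beta>\<^sup>2 * (4 * \<eta> * real m + U * F) \<le> s\<^sup>2 / (sd_const * Q) * (4 * \<eta> * Q + U * F)"
      using \<beta>Q Qm \<eta> U0 offdiag_sq_nonneg Q0 sd_const_pos unfolding F_def[symmetric]
      by (intro mult_mono add_mono) auto
    also have "\<dots> = s\<^sup>2 / sd_const * (4 * \<eta> + U * (F / Q))" using Q0 by (simp add: field_simps)
    also have "F / Q = corr2 / rate2" by (simp add: F_def Q_def corr2_def)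
    finally show "\<bar>\<beta>\<bar> * sqrt (4 * \<eta> * real m + U * F) \<le> sqrt (s\<^sup>2 / sd_const * (4 * \<eta> + U * (corr2 / rate2)))" by simp
  qed
  finally show ?thesis unfolding U_def .
qed

end

section \<open>The two-group model on an enlarged space\<close>

lemma centered_gaussian_law_char:
  assumes N: "gaussian_law N" and mean: "(LINT x|N. x) = 0"
  shows "char N 1 = exp (- (LINT x|N. x\<^sup>2) / 2)"
  using N unfolding gaussian_law_def
proof (elim disjE exE conjE)
  fix \<mu> assume "N = return borel \<mu>"
  then show ?thesis using mean by (simp add: char_def integral_return)
next
  fix \<mu> \<sigma> :: real assume \<sigma>: "\<sigma> > 0" and Neq: "N = density lborel (normal_density \<mu> \<sigma>)"
  interpret N: prob_space N unfolding Neq by (rule prob_space_normal_density[OF \<sigma>])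
  have [measurable_cong]: "sets N = sets borel" by (simp add: Neq)
  have "distributed N lborel (\<lambda>x. x) (normal_density \<mu> \<sigma>)"
    unfolding distributed_def Neq by (auto simp: normal_density_nonneg intro!: distr_id2)
  then have "distributed N lborel (\<lambda>x. (x - \<mu>) / \<sigma>) std_normal_density"
    using N.normal_standard_normal_convert[OF \<sigma>, of "\<lambda>x. x" \<mu>] by simp
  then have std: "distr N borel (\<lambda>x. (x - \<mu>) / \<sigma>) = std_normal_distribution"
    by (auto simp: distributed_def cong: distr_cong)
  have tr: "(LINT x|N. f ((x - \<mu>) / \<sigma>)) = (LINT x|std_normal_distribution. f x)"
    if "f \<in> borel_measurable borel" for f :: "real \<Rightarrow> 'z :: {banach, second_countable_topology}"
    unfolding std[symmetric] using that by (subst integral_distr) auto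
  have x: "x = \<mu> + \<sigma> * ((x - \<mu>) / \<sigma>)" for x using \<sigma> by simp
  have i1: "integrable std_normal_distribution (\<lambda>x. x)" "(LINT x|std_normal_distribution. x) = 0"
    "(LINT x|std_normal_distribution. x\<^sup>2) = 1"
    using integrable_std_normal_distribution_moment[of 1]
      integral_std_normal_distribution_moment_odd[of 1] std_normal_distribution_even_moments[of 1] by simp_all
  have "(LINT x|N. x) = (LINT x|std_normal_distribution. \<mu> + \<sigma> * x)"
    using tr[of "\<lambda>x. \<mu> + \<sigma> * x"] \<sigma> by simp
  also have "\<dots> = \<mu>" using i1 std_normal.prob_space by simp
  finally have \<mu>: "\<mu> = 0" using mean by simp
  have "(LINT x|N. x\<^sup>2) = (LINT x|std_normal_distribution. (\<sigma> * x)\<^sup>2)"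
    using tr[of "\<lambda>x. (\<sigma> * x)\<^sup>2"] \<sigma> \<mu> by simp
  also have "\<dots> = \<sigma>\<^sup>2" using i1 by (simp add: power_mult_distrib)
  finally have sq: "(LINT x|N. x\<^sup>2) = \<sigma>\<^sup>2" .
  have "char N 1 = (CLINT x|std_normal_distribution. iexp (\<sigma> * x))"
    using tr[of "\<lambda>x. iexp (\<sigma> * x)"] \<sigma> \<mu> by (simp add: char_def)
  also have "\<dots> = char std_normal_distribution \<sigma>" by (simp add: char_def)
  finally show ?thesis by (simp add: sq char_std_normal_distribution)
qed

text \<open>Integrability is not part of the definition of a Gaussian vector; a nonzero variance implies it, since the
  integral of a non-integrable function is \<open>0\<close>.\<close>

lemma (in prob_space) gaussian_vector_facts:
  assumes Y: "centered_gaussian_vector M I Y C" and fin: "finite I" and diag: "\<And>i. i \<in> I \<Longrightarrow> C i i = 1"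
  shows "i \<in> I \<Longrightarrow> j \<in> I \<Longrightarrow> C i j = C j i"
    and "0 \<le> quad_form I C a a"
    and "(CLINT \<omega>|M. iexp (\<Sum>i\<in>I. a i * Y i \<omega>)) = exp (- quad_form I C a a / 2)"
proof -
  have Ym [measurable]: "\<And>i. i \<in> I \<Longrightarrow> Y i \<in> borel_measurable M"
    and law: "\<And>a. gaussian_law (distr M borel (\<lambda>\<omega>. \<Sum>i\<in>I. a i * Y i \<omega>))"
    and Y0: "\<And>i. i \<in> I \<Longrightarrow> (\<integral>\<omega>. Y i \<omega> \<partial>M) = 0"
    and YY: "\<And>i j. i \<in> I \<Longrightarrow> j \<in> I \<Longrightarrow> (\<integral>\<omega>. Y i \<omega> * Y j \<omega> \<partial>M) = C i j"
    using Y unfolding centered_gaussian_vector_def by auto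
  show "i \<in> I \<Longrightarrow> j \<in> I \<Longrightarrow> C i j = C j i"
    using YY[of i j] YY[of j i] by (simp add: mult.commute)
  have sq: "integrable M (\<lambda>\<omega>. (Y i \<omega>)\<^sup>2)" if "i \<in> I" for i
    using YY[OF that that] diag[OF that] not_integrable_integral_eq[of M "\<lambda>\<omega>. (Y i \<omega>)\<^sup>2"]
    by (auto simp: power2_eq_square)
  have int: "integrable M (\<lambda>\<omega>. Y i \<omega> * Y j \<omega>)" if "i \<in> I" "j \<in> I" for i j
  proof (rule Bochner_Integration.integrable_bound)
    show "integrable M (\<lambda>\<omega>. (Y i \<omega>)\<^sup>2 + (Y j \<omega>)\<^sup>2)" using sq that by simp
    have "\<bar>x * y\<bar> \<le> \<bar>x\<^sup>2 + y\<^sup>2\<bar>" for x y :: real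
    proof -
      have "0 \<le> \<bar>x\<bar> * \<bar>y\<bar>" by simp
      moreover have "2 * (\<bar>x\<bar> * \<bar>y\<bar>) \<le> x\<^sup>2 + y\<^sup>2"
        using zero_le_power2[of "\<bar>x\<bar> - \<bar>y\<bar>"] by (simp add: power2_diff)
      ultimately show ?thesis unfolding abs_mult by linarith
    qed
    then show "AE \<omega> in M. norm (Y i \<omega> * Y j \<omega>) \<le> norm ((Y i \<omega>)\<^sup>2 + (Y j \<omega>)\<^sup>2)" by simp
  qed (use that in auto)
  have int1: "integrable M (Y i)" if "i \<in> I" for i
    using sq[OF that] Ym[OF that] by (rule square_integrable_imp_integrable[rotated])
  define L where "L = (\<lambda>\<omega>. \<Sum>i\<in>I. a i * Y i \<omega>)"
  have [measurable]: "L \<in> borel_measurable M" unfolding L_def by measurable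
  have L2: "(L \<omega>)\<^sup>2 = (\<Sum>i\<in>I. \<Sum>j\<in>I. a i * a j * (Y i \<omega> * Y j \<omega>))" for \<omega>
    by (simp add: L_def power2_eq_square sum_product mult_ac)
  have EL2: "(\<integral>\<omega>. (L \<omega>)\<^sup>2 \<partial>M) = quad_form I C a a"
    unfolding L2 quad_form_def using int YY
    by (simp add: Bochner_Integration.integral_sum Bochner_Integration.integrable_sum cong: sum.cong)
  have EL: "(\<integral>\<omega>. L \<omega> \<partial>M) = 0"
    unfolding L_def using int1 Y0 by (simp add: Bochner_Integration.integral_sum)
  have "0 \<le> (\<integral>\<omega>. (L \<omega>)\<^sup>2 \<partial>M)" by simp
  then show "0 \<le> quad_form I C a a" unfolding EL2 .
  have "(CLINT \<omega>|M. iexp (L \<omega>)) = char (distr M borel L) 1"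
    unfolding char_def by (subst integral_distr) auto
  also have "\<dots> = exp (- (LINT x|distr M borel L. x\<^sup>2) / 2)"
    using law[of a] EL unfolding L_def[symmetric] by (intro centered_gaussian_law_char) (auto simp: integral_distr)
  also have "(LINT x|distr M borel L. x\<^sup>2) = quad_form I C a a" unfolding EL2[symmetric] by (subst integral_distr) auto
  finally show "(CLINT \<omega>|M. iexp (\<Sum>i\<in>I. a i * Y i \<omega>)) = exp (- quad_form I C a a / 2)" unfolding L_def .
qed

lemma integral_pair_mult:
  fixes f :: "'a \<Rightarrow> complex" and g :: "'b \<Rightarrow> complex"
  assumes "prob_space M" "prob_space N" and [measurable]: "f \<in> borel_measurable M" "g \<in> borel_measurable N"
    and bnd: "\<And>x. norm (f x) \<le> 1" "\<And>x. norm (g x) \<le> 1"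
  shows "(CLINT \<omega>|M \<Otimes>\<^sub>M N. f (fst \<omega>) * g (snd \<omega>)) = (CLINT x|M. f x) * (CLINT y|N. g y)"
proof -
  interpret M: prob_space M by fact
  interpret N: prob_space N by fact
  interpret MN: pair_prob_space M N ..
  have int: "integrable (M \<Otimes>\<^sub>M N) (\<lambda>\<omega>. f (fst \<omega>) * g (snd \<omega>))"
    by (rule MN.P.integrable_const_bound[of _ 1]) (use bnd in \<open>auto simp: norm_mult intro!: mult_le_one\<close>)
  have "(CLINT \<omega>|M \<Otimes>\<^sub>M N. f (fst \<omega>) * g (snd \<omega>)) = (CLINT x|M. CLINT y|N. f x * g y)"
    using MN.integral_fst'[OF int] by simp
  then show ?thesis by simp
qed

context two_group_mixture
begin

lemma H_measurable: "1 \<le> i \<Longrightarrow> Measurable.pred M (H i)"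
  using H_indep unfolding indep_vars_def by auto

lemma label_char:
  assumes p: "0 \<le> \<pi>0" "\<pi>0 \<le> 1"
  shows "(CLINT \<omega>|M. iexp (\<Sum>i\<in>{1..m}. a i * of_bool (H i \<omega>))) =
    (\<Prod>i\<in>{1..m}. complex_of_real \<pi>0 + complex_of_real (1 - \<pi>0) * iexp (a i))"
proof -
  have ind: "indep_vars (\<lambda>_. borel) (\<lambda>i \<omega>. iexp (a i * of_bool (H i \<omega>))) {1..m}"
    by (rule indep_vars_compose2[where Y = "\<lambda>i b. iexp (a i * of_bool b)", OF indep_vars_subset[OF H_indep]]) auto
  have int: "integrable M (\<lambda>\<omega>. iexp (a i * of_bool (H i \<omega>)))" if "i \<in> {1..m}" for i
  proof -
    have [measurable]: "Measurable.pred M (H i)" using that by (intro H_measurable) auto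
    show ?thesis by (rule integrable_const_bound[of _ 1]) auto
  qed
  have "(CLINT \<omega>|M. iexp (\<Sum>i\<in>{1..m}. a i * of_bool (H i \<omega>))) =
      (CLINT \<omega>|M. \<Prod>i\<in>{1..m}. iexp (a i * of_bool (H i \<omega>)))"
    by (simp only: of_real_sum sum_distrib_left exp_sum[OF finite_atLeastAtMost])
  also have "\<dots> = (\<Prod>i\<in>{1..m}. CLINT \<omega>|M. iexp (a i * of_bool (H i \<omega>)))"
    by (rule indep_vars_lebesgue_integral[OF _ ind int]) simp
  also have "\<dots> = (\<Prod>i\<in>{1..m}. complex_of_real \<pi>0 + complex_of_real (1 - \<pi>0) * iexp (a i))"
  proof (rule prod.cong[OF refl])
    fix i assume i: "i \<in> {1..m}"
    have [measurable]: "Measurable.pred M (H i)" using i by (intro H_measurable) auto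
    have "prob {\<omega> \<in> space M. H i \<omega>} = measure (distr M (count_space UNIV) (H i)) {True}"
      by (subst measure_distr) (auto intro!: arg_cong[of _ _ prob])
    also have "\<dots> = 1 - \<pi>0" using H_law[of i] i p by (simp add: measure_pmf_single)
    finally have pH: "prob {\<omega> \<in> space M. H i \<omega>} = 1 - \<pi>0" .
    define b where "b = (indicator {\<omega> \<in> space M. H i \<omega>} :: 'a \<Rightarrow> real)"
    have ib: "integrable M b" unfolding b_def
      by (rule integrable_const_bound[of _ 1]) (auto simp: indicator_def)
    have ibc: "integrable M (\<lambda>\<omega>. complex_of_real (b \<omega>))" using ib by (rule integrable_of_real)
    have Eb: "(\<integral>\<omega>. b \<omega> \<partial>M) = 1 - \<pi>0" unfolding b_def pH[symmetric] by simp
    have "(CLINT \<omega>|M. iexp (a i * of_bool (H i \<omega>))) = (CLINT \<omega>|M. 1 + (iexp (a i) - 1) * complex_of_real (b \<omega>))"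
      by (rule Bochner_Integration.integral_cong) (auto simp: b_def)
    also have "\<dots> = 1 + (iexp (a i) - 1) * complex_of_real (\<integral>\<omega>. b \<omega> \<partial>M)"
      using ibc by (simp add: prob_space integral_complex_of_real)
    also have "\<dots> = complex_of_real \<pi>0 + complex_of_real (1 - \<pi>0) * iexp (a i)"
      unfolding Eb by (simp add: algebra_simps)
    finally show "(CLINT \<omega>|M. iexp (a i * of_bool (H i \<omega>))) = complex_of_real \<pi>0 + complex_of_real (1 - \<pi>0) * iexp (a i)" .
  qed
  finally show ?thesis .
qed

lemma label_noise_char:
  assumes p: "0 \<le> \<pi>0" "\<pi>0 \<le> 1" and m: "1 \<le> m"
  shows "(CLINT \<omega>|M. iexp ((\<Sum>i\<in>{1..m}. a i * of_bool (H i \<omega>)) + (\<Sum>i\<in>{1..m}. b i * Y m i \<omega>))) =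
    (\<Prod>i\<in>{1..m}. complex_of_real \<pi>0 + complex_of_real (1 - \<pi>0) * iexp (a i)) *
    exp (- quad_form {1..m} (\<Gamma> m) b b / 2)"
proof -
  let ?B = "PiM {1..m} (\<lambda>_. borel) :: (nat \<Rightarrow> real) measure"
  have gm: "(\<lambda>x. iexp (\<Sum>i\<in>{1..m}. c i * x i)) \<in> borel_measurable ?B" for c :: "nat \<Rightarrow> real"
  proof -
    have [measurable]: "(\<lambda>x. x i) \<in> borel_measurable ?B" if "i \<in> {1..m}" for i
      using that by (rule measurable_component_singleton)
    show ?thesis by measurable
  qed
  have ind: "indep_var borel (\<lambda>\<omega>. iexp (\<Sum>i\<in>{1..m}. a i * of_bool (H i \<omega>))) borel (\<lambda>\<omega>. iexp (\<Sum>i\<in>{1..m}. b i * Y m i \<omega>))"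
  proof -
    have restr: "(\<Sum>i\<in>{1..m}. c i * restrict f {1..m} i) = (\<Sum>i\<in>{1..m}. c i * f i)" for c f :: "nat \<Rightarrow> real"
      by (intro sum.cong refl) simp
    show ?thesis
      using indep_var_compose[OF H_Y_indep[OF m] gm[of a] gm[of b]] unfolding comp_def restr .
  qed
  have int: "integrable M (\<lambda>\<omega>. iexp (\<Sum>i\<in>{1..m}. a i * of_bool (H i \<omega>)))" "integrable M (\<lambda>\<omega>. iexp (\<Sum>i\<in>{1..m}. b i * Y m i \<omega>))"
    by (rule integrable_const_bound[of _ 1]; use indep_var_rv1[OF ind] indep_var_rv2[OF ind] in simp)+
  have "(CLINT \<omega>|M. iexp ((\<Sum>i\<in>{1..m}. a i * of_bool (H i \<omega>)) + (\<Sum>i\<in>{1..m}. b i * Y m i \<omega>))) =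
      (CLINT \<omega>|M. iexp (\<Sum>i\<in>{1..m}. a i * of_bool (H i \<omega>)) * iexp (\<Sum>i\<in>{1..m}. b i * Y m i \<omega>))"
    by (simp only: of_real_add distrib_left exp_add)
  also have "\<dots> = (CLINT \<omega>|M. iexp (\<Sum>i\<in>{1..m}. a i * of_bool (H i \<omega>))) * (CLINT \<omega>|M. iexp (\<Sum>i\<in>{1..m}. b i * Y m i \<omega>))"
    by (rule indep_var_lebesgue_integral[OF ind int])
  also have "(CLINT \<omega>|M. iexp (\<Sum>i\<in>{1..m}. b i * Y m i \<omega>)) = exp (- quad_form {1..m} (\<Gamma> m) b b / 2)"
    using unit_diag by (intro gaussian_vector_facts(3)[OF Y_gaussian[OF m]]) auto
  finally show ?thesis unfolding label_char[OF p] .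
qed

text \<open>The second factor carries the auxiliary standard Gaussian vector of the coupling.\<close>

definition extended :: "nat \<Rightarrow> ('a \<times> (nat \<Rightarrow> real)) measure" where
  "extended m = M \<Otimes>\<^sub>M PiM {1..m} (\<lambda>_. std_normal_distribution)"

lemma extended_gaussian_mixture:
  assumes p: "0 \<le> \<pi>0" "\<pi>0 \<le> 1" and m: "1 \<le> m"
  shows "gaussian_mixture (extended m) {1..m} \<pi>0 (\<lambda>i \<omega>. H i (fst \<omega>)) (\<lambda>i \<omega>. Y m i (fst \<omega>)) (\<lambda>i \<omega>. snd \<omega> i) (\<Gamma> m)"
proof -
  let ?N = "PiM {1..m} (\<lambda>_. std_normal_distribution) :: (nat \<Rightarrow> real) measure"
  interpret prod: product_prob_space "\<lambda>_ :: nat. std_normal_distribution" "{1..m}"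
    by unfold_locales
  have N: "prob_space ?N" by unfold_locales
  interpret N: prob_space ?N by fact
  interpret MN: pair_prob_space M ?N ..
  note Yv = Y_gaussian[OF m] and facts = gaussian_vector_facts[OF Y_gaussian[OF m] finite_atLeastAtMost unit_diag]
  have Ym [measurable]: "Y m i \<in> borel_measurable M" if "i \<in> {1..m}" for i
    using Yv that unfolding centered_gaussian_vector_def by auto
  have Hm [measurable]: "Measurable.pred M (H i)" if "i \<in> {1..m}" for i using that by (intro H_measurable) auto
  have Nm [measurable]: "(\<lambda>x. x i) \<in> borel_measurable ?N" if "i \<in> {1..m}" for i
    using measurable_component_singleton[OF that, of "\<lambda>_. std_normal_distribution"] by simp
  have noise: "(CLINT x|?N. iexp (\<Sum>i\<in>{1..m}. c i * x i)) = exp (- (\<Sum>i\<in>{1..m}. c i * c i) / 2)" for c :: "nat \<Rightarrow> real"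
  proof -
    have "(CLINT x|?N. iexp (\<Sum>i\<in>{1..m}. c i * x i)) = (CLINT x|?N. \<Prod>i\<in>{1..m}. iexp (c i * x i))"
      by (simp only: of_real_sum sum_distrib_left exp_sum[OF finite_atLeastAtMost])
    also have "\<dots> = (\<Prod>i\<in>{1..m}. CLINT x|std_normal_distribution. iexp (c i * x))"
    proof (rule prod.product_integral_prod)
      show "integrable std_normal_distribution (\<lambda>x. iexp (c i * x))" for i
        by (rule std_normal.integrable_const_bound[of _ 1]) auto
    qed simp
    also have "\<dots> = (\<Prod>i\<in>{1..m}. complex_of_real (exp (- (c i)\<^sup>2 / 2)))"
    proof (intro prod.cong refl)
      fix i
      have "(CLINT x|std_normal_distribution. iexp (c i * x)) = char std_normal_distribution (c i)"
        by (simp add: char_def)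
      then show "(CLINT x|std_normal_distribution. iexp (c i * x)) = complex_of_real (exp (- (c i)\<^sup>2 / 2))"
        by (simp add: char_std_normal_distribution)
    qed
    also have "\<dots> = exp (\<Sum>i\<in>{1..m}. - (c i)\<^sup>2 / 2)"
      by (simp only: exp_sum[OF finite_atLeastAtMost] of_real_prod)
    also have "(\<Sum>i\<in>{1..m}. - (c i)\<^sup>2 / 2) = - (\<Sum>i\<in>{1..m}. c i * c i) / 2"
      by (simp add: sum_divide_distrib sum_negf power2_eq_square)
    finally show ?thesis .
  qed
  show ?thesis
  proof (rule gaussian_mixture.intro)
    show "prob_space (extended m)" unfolding extended_def by unfold_locales
    show "gaussian_mixture_axioms (extended m) {1..m} \<pi>0 (\<lambda>i \<omega>. H i (fst \<omega>)) (\<lambda>i \<omega>. Y m i (fst \<omega>)) (\<lambda>i \<omega>. snd \<omega> i) (\<Gamma> m)"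
    proof (rule gaussian_mixture_axioms.intro)
    fix a b c :: "nat \<Rightarrow> real"
    have mf: "(\<lambda>\<omega>. iexp ((\<Sum>i\<in>{1..m}. a i * of_bool (H i \<omega>)) + (\<Sum>i\<in>{1..m}. b i * Y m i \<omega>))) \<in> borel_measurable M"
      by measurable
    have mg: "(\<lambda>x. iexp (\<Sum>i\<in>{1..m}. c i * x i)) \<in> borel_measurable ?N"
      by measurable
    have "(CLINT \<omega>|M \<Otimes>\<^sub>M ?N. iexp ((\<Sum>i\<in>{1..m}. a i * of_bool (H i (fst \<omega>))) + (\<Sum>i\<in>{1..m}. b i * Y m i (fst \<omega>)))
          * iexp (\<Sum>i\<in>{1..m}. c i * snd \<omega> i)) =
      (CLINT \<omega>|M. iexp ((\<Sum>i\<in>{1..m}. a i * of_bool (H i \<omega>)) + (\<Sum>i\<in>{1..m}. b i * Y m i \<omega>)))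
        * (CLINT x|?N. iexp (\<Sum>i\<in>{1..m}. c i * x i))"
      by (rule integral_pair_mult[OF prob_space_axioms N mf mg]) simp_all
    also have "\<dots> = (\<Prod>i\<in>{1..m}. complex_of_real \<pi>0 + complex_of_real (1 - \<pi>0) * iexp (a i)) *
        (complex_of_real (exp (- quad_form {1..m} (\<Gamma> m) b b / 2)) * complex_of_real (exp (- (\<Sum>i\<in>{1..m}. c i * c i) / 2)))"
      unfolding label_noise_char[OF p m] noise by (simp only: mult.assoc)
    also have "complex_of_real (exp (- quad_form {1..m} (\<Gamma> m) b b / 2)) * complex_of_real (exp (- (\<Sum>i\<in>{1..m}. c i * c i) / 2))
        = complex_of_real (exp (- (quad_form {1..m} (\<Gamma> m) b b + (\<Sum>i\<in>{1..m}. c i * c i)) / 2))"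
      unfolding of_real_mult[symmetric] exp_add[symmetric] by (simp add: diff_divide_distrib add_divide_distrib)
    finally show "(CLINT \<omega>|extended m. iexp ((\<Sum>i\<in>{1..m}. a i * of_bool (H i (fst \<omega>)))
        + ((\<Sum>i\<in>{1..m}. b i * Y m i (fst \<omega>)) + (\<Sum>i\<in>{1..m}. c i * snd \<omega> i)))) =
      (\<Prod>i\<in>{1..m}. complex_of_real \<pi>0 + complex_of_real (1 - \<pi>0) * iexp (a i)) *
      complex_of_real (exp (- (quad_form {1..m} (\<Gamma> m) b b + (\<Sum>i\<in>{1..m}. c i * c i)) / 2))"
      unfolding extended_def by (simp only: of_real_add distrib_left exp_add mult.assoc)
    qed (use p facts unit_diag in \<open>auto simp: extended_def\<close>)
  qed
qed

end

section \<open>Convergence of the characteristic functions\<close>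

lemma exponent_balance:
  fixes \<tau> c \<alpha> L :: real
  assumes "0 < \<tau>" "0 < c" "0 < \<alpha>"
  shows "\<tau> ^ 40 * (4 / (c * \<tau> ^ 12)\<^sup>2 + (2 * L / (c * \<alpha> * \<tau> ^ 12) + 1) * (16 / (c * \<tau> ^ 12)\<^sup>2)
      + (2 * \<tau> ^ 12 / \<tau> ^ 21 + 2) * (2 * \<tau> ^ 12 / (\<tau> ^ 21)\<^sup>2) + 1 / (\<tau> ^ 19)\<^sup>2)
    = 20 / c\<^sup>2 * \<tau> ^ 16 + 32 * L / (c ^ 3 * \<alpha>) * \<tau> ^ 4 + 4 * \<tau> + 4 * \<tau> ^ 10 + \<tau>\<^sup>2"
proof -
  have nz: "\<tau> \<noteq> 0" using assms by simp
  have e: "\<tau> ^ 40 / \<tau> ^ 24 = \<tau> ^ 16" "\<tau> ^ 40 / \<tau> ^ 36 = \<tau> ^ 4" "\<tau> ^ 40 / \<tau> ^ 30 = \<tau> ^ 10" "\<tau> ^ 40 / \<tau> ^ 38 = \<tau>\<^sup>2"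
    "\<tau> ^ 40 / \<tau> ^ 39 = \<tau>"
    using nz by (simp_all add: divide_eq_eq power_Suc[symmetric])
  have e': "\<tau> ^ 12 / \<tau> ^ 21 = 1 / \<tau> ^ 9" "\<tau> ^ 12 / \<tau> ^ 42 = 1 / \<tau> ^ 30"
    by (subst frac_eq_eq, use nz in simp, use nz in simp, simp)+
  have sq: "(c * \<tau> ^ 12)\<^sup>2 = c\<^sup>2 * \<tau> ^ 24" "(\<tau> ^ 21)\<^sup>2 = \<tau> ^ 42" "(\<tau> ^ 19)\<^sup>2 = \<tau> ^ 38"
    by (simp_all add: power_mult_distrib flip: power_mult)
  have 1: "x * (k / (c\<^sup>2 * y)) = k / c\<^sup>2 * (x / y)" for x k y :: real by (simp add: mult_ac)
  have 3: "x * (2 * L / (c * \<alpha> * y) * (16 / (c\<^sup>2 * z))) = 32 * L / (c ^ 3 * \<alpha>) * (x / (y * z))" for x y z :: real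
    by (simp add: power2_eq_square power3_eq_cube mult_ac)
  have 4: "x * ((2 * y / z) * (2 * y / u)) = 4 * (x * ((y / z) * (y / u)))" "x * (2 * (2 * y / u)) = 4 * (x * (y / u))"
    for x y z u :: real by (simp_all add: mult_ac)
  have 5: "\<tau> ^ 40 * (1 / \<tau> ^ 9 * (1 / \<tau> ^ 30)) = \<tau> ^ 40 / \<tau> ^ 39" "\<tau> ^ 40 * (1 / \<tau> ^ 30) = \<tau> ^ 40 / \<tau> ^ 30"
    "\<tau> ^ 40 * (1 / \<tau> ^ 38) = \<tau> ^ 40 / \<tau> ^ 38" by simp_all
  have 6: "\<tau> ^ 12 * \<tau> ^ 24 = \<tau> ^ 36" by simp
  show ?thesis
    unfolding sq distrib_left distrib_right mult_1 unfolding 3 unfolding 1 4 6 e' 5 e by simp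
qed

context two_group_mixture
begin

lemma integral_extended_fst:
  fixes f :: "'a \<Rightarrow> complex"
  assumes "f \<in> borel_measurable M"
  shows "(CLINT \<omega>|extended m. f (fst \<omega>)) = (CLINT \<omega>|M. f \<omega>)"
proof -
  let ?N = "PiM {1..m} (\<lambda>_. std_normal_distribution) :: (nat \<Rightarrow> real) measure"
  interpret prod: product_prob_space "\<lambda>_ :: nat. std_normal_distribution" "{1..m}"
    by unfold_locales
  have N: "prob_space ?N" by unfold_locales
  have "(CLINT \<omega>|M. f \<omega>) = (CLINT \<omega>|distr (M \<Otimes>\<^sub>M ?N) M fst. f \<omega>)" unfolding prob_space.distr_pair_fst[OF N] ..
  also have "\<dots> = (CLINT \<omega>|M \<Otimes>\<^sub>M ?N. f (fst \<omega>))" using assms by (subst integral_distr) auto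
  finally show ?thesis by (simp add: extended_def)
qed

definition normalised_FDP :: "real \<Rightarrow> real \<Rightarrow> nat \<Rightarrow> 'a \<Rightarrow> real" where
  "normalised_FDP \<alpha> \<delta> m \<omega> = (FDP \<alpha> \<delta> H Y m \<omega> - \<pi>0 * \<alpha>) /
       (\<pi>0 * \<alpha> * sqrt ((1 / t_star \<delta> \<pi>0 \<alpha> - \<pi>0) / (\<pi>0 * real m)
                        + h_fun (t_star \<delta> \<pi>0 \<alpha>) * gamma_m \<Gamma> m))"

lemma FDP_measurable:
  assumes "0 < \<alpha>" "\<alpha> < 1"
  shows "FDP \<alpha> \<delta> H Y m \<in> borel_measurable M"
proof (cases "m = 0")
  case True
  then have "FDP \<alpha> \<delta> H Y m = (\<lambda>_. 0)" by (simp add: fun_eq_iff FDP_def BH_FDP_def)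
  then show ?thesis by simp
next
  case False
  then have m: "0 < m" by simp
  have Ym [measurable]: "Y m i \<in> borel_measurable M" if "i \<in> {1..m}" for i
    using Y_gaussian[of m] m that unfolding centered_gaussian_vector_def by auto
  have Hm [measurable]: "Measurable.pred M (H i)" if "i \<in> {1..m}" for i using that by (intro H_measurable) auto
  show ?thesis
    unfolding FDP_def Phi_ereal obs_def by (rule BH_FDP_measurable[OF assms m]) measurable
qed

text \<open>The first bound is the Cauchy--Schwarz inequality. The second follows from \<open>|\<Gamma>\<^sub>i\<^sub>j| \<le> 1\<close>, which is the positivity
  of the variances of \<open>Y\<^sub>i + Y\<^sub>j\<close> and \<open>Y\<^sub>i - Y\<^sub>j\<close>.\<close>

lemma gamma_m_bounds:
  assumes m: "1 \<le> m"
  shows "(gamma_m \<Gamma> m)\<^sup>2 \<le> offdiag_sum m (\<lambda>i j. (\<Gamma> m i j)\<^sup>2) / (real m)\<^sup>2" and "\<bar>gamma_m \<Gamma> m\<bar> \<le> 1"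
proof -
  note facts = gaussian_vector_facts[OF Y_gaussian[OF m] finite_atLeastAtMost unit_diag]
  have G1: "\<bar>\<Gamma> m i j\<bar> \<le> 1" if ij: "i \<in> {1..m}" "j \<in> {1..m}" "i \<noteq> j" for i j
  proof -
    have q: "quad_form {1..m} (\<Gamma> m) v v = (v i)\<^sup>2 + (v j)\<^sup>2 + 2 * (v i * v j * \<Gamma> m i j)"
      if v: "\<And>k. k \<noteq> i \<Longrightarrow> k \<noteq> j \<Longrightarrow> v k = 0" for v
    proof -
      have sub: "(\<Sum>k\<in>{1..m}. f k) = f i + f j" if "\<And>k. k \<noteq> i \<Longrightarrow> k \<noteq> j \<Longrightarrow> f k = 0" for f :: "nat \<Rightarrow> real"
      proof -
        have "(\<Sum>k\<in>{1..m}. f k) = (\<Sum>k\<in>{i, j}. f k)"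
          using that ij by (intro sum.mono_neutral_right) auto
        then show ?thesis using ij by simp
      qed
      show ?thesis
        unfolding quad_form_def
        by (subst sub, use v in simp, subst (1 2) sub, use v in simp, use v in simp)
           (use ij unit_diag facts(1) in \<open>simp add: power2_eq_square algebra_simps\<close>)
    qed
    have "0 \<le> quad_form {1..m} (\<Gamma> m) (\<lambda>k. of_bool (k = i) + r * of_bool (k = j)) (\<lambda>k. of_bool (k = i) + r * of_bool (k = j))" for r
      by (rule facts(2))
    then have "0 \<le> 1 + r\<^sup>2 + 2 * (r * \<Gamma> m i j)" for r using ij by (subst (asm) q) auto
    from this[of 1] this[of "-1"] show ?thesis by (simp add: abs_le_iff)
  qed
  define g2 where "g2 = offdiag_sum m (\<lambda>i j. (\<Gamma> m i j)\<^sup>2)"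
  define A where "A = (SIGMA i:{1..m}. {1..m} - {i})"
  have finA: "finite A" by (simp add: A_def)
  have cardA: "real (card A) \<le> (real m)\<^sup>2"
  proof -
    have "card A \<le> card ({1..m} \<times> {1..m})" by (rule card_mono) (auto simp: A_def)
    then show ?thesis by (simp add: power2_eq_square flip: of_nat_mult)
  qed
  have off: "offdiag_sum m f = (\<Sum>(i, j)\<in>A. f i j)" for f
    unfolding offdiag_sum_def A_def by (rule sum.Sigma) auto
  have g0: "0 \<le> g2" unfolding g2_def off by (intro sum_nonneg) auto
  have "(offdiag_sum m (\<Gamma> m))\<^sup>2 \<le> real (card A) * g2"
    using sum_squared_le_sum_of_squares[of "\<lambda>(i, j). \<Gamma> m i j" A] finA
    unfolding g2_def off by (simp add: case_prod_beta' mult.commute)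
  also have "\<dots> \<le> (real m)\<^sup>2 * g2" using cardA g0 by (rule mult_right_mono)
  finally have "(offdiag_sum m (\<Gamma> m))\<^sup>2 / ((real m)\<^sup>2)\<^sup>2 \<le> (real m)\<^sup>2 * g2 / ((real m)\<^sup>2)\<^sup>2"
    by (intro divide_right_mono) auto
  then show "(gamma_m \<Gamma> m)\<^sup>2 \<le> offdiag_sum m (\<lambda>i j. (\<Gamma> m i j)\<^sup>2) / (real m)\<^sup>2"
    using m unfolding gamma_m_def power_divide g2_def by (simp add: power2_eq_square)
  have "\<bar>offdiag_sum m (\<Gamma> m)\<bar> \<le> (\<Sum>(i, j)\<in>A. \<bar>\<Gamma> m i j\<bar>)"
    unfolding off by (rule order_trans[OF sum_abs]) (simp add: case_prod_beta')
  also have "\<dots> \<le> (\<Sum>(i, j)\<in>A. 1)" 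
  proof (rule sum_mono)
    show "(case p of (i, j) \<Rightarrow> \<bar>\<Gamma> m i j\<bar>) \<le> (case p of (i, j) \<Rightarrow> 1)" if "p \<in> A" for p
    proof -
      have "fst p \<in> {1..m}" "snd p \<in> {1..m}" "fst p \<noteq> snd p" using that by (auto simp: A_def)
      from G1[OF this] show ?thesis by (simp add: case_prod_beta')
    qed
  qed
  also have "\<dots> \<le> (real m)\<^sup>2" using cardA by (simp add: case_prod_beta')
  finally show "\<bar>gamma_m \<Gamma> m\<bar> \<le> 1" using m unfolding gamma_m_def by (simp add: abs_divide divide_le_eq)
qed

text \<open>With \<open>\<tau>\<^sup>4\<^sup>0 = 1/m + |\<gamma>\<^sub>m|\<close>, the scales \<open>w = \<tau>\<^sup>1\<^sup>2\<close>, \<open>\<epsilon> = \<tau>\<^sup>2\<^sup>1\<close> and \<open>M = \<tau>\<^sup>1\<^sup>9\<close> make every term of the deviation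
  bound a positive power of \<open>\<tau>\<close>.\<close>

lemma FDP_char_bound:
  fixes \<delta> \<alpha> s \<eta> \<tau> c L R B :: real
  assumes cr: "crossing \<delta> \<pi>0 \<alpha>" and m: "1 \<le> m" and \<eta>: "0 < \<eta>"
    and \<tau>: "0 < \<tau>" "\<tau> ^ 12 \<le> 1 / 2" "1 / real m + \<bar>gamma_m \<Gamma> m\<bar> = \<tau> ^ 40"
  defines "zs \<equiv> crossing.z_star \<delta> \<pi>0 \<alpha>"
  assumes margin_right: "\<And>z. zs \<le> z \<Longrightarrow> z \<le> zs + 1 \<Longrightarrow> normal_tail z / \<alpha> + c * (z - zs) \<le> mixture_tail \<delta> \<pi>0 z"
    and margin_left: "\<And>z. z \<le> zs \<Longrightarrow> zs - R \<le> z \<Longrightarrow> mixture_tail \<delta> \<pi>0 z \<le> normal_tail z / \<alpha> - c * (zs - z)"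
    and c: "0 < c" "c \<le> 1" and L: "\<alpha> \<le> normal_tail (zs - L)" "0 \<le> L"
    and R: "R = L + 2" and B: "B = \<bar>zs\<bar> + R + \<delta> + 1"
  defines "sdc \<equiv> min (\<pi>0\<^sup>2 * (std_normal_density zs)\<^sup>2) (\<pi>0 * (1 - \<pi>0) * normal_tail zs / 2)"
    and "q \<equiv> normal_tail (zs + 1)"
    and "K \<equiv> (LINT x|std_normal_distribution. (1 + B + \<bar>x\<bar>)\<^sup>2) + (1 + 2 * B)\<^sup>2"
    and "C \<equiv> LINT x|std_normal_distribution. (1 + \<bar>x\<bar>) ^ 3"
    and "\<kappa> \<equiv> LINT x|std_normal_distribution. indicator {zs..} x * (1 + \<bar>zs\<bar> + \<bar>x\<bar>)\<^sup>2"
    and "\<theta> \<equiv> offdiag_sum m (\<lambda>i j. (\<Gamma> m i j)\<^sup>2) / (real m)\<^sup>2 / \<tau> ^ 40"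
  assumes s: "s\<^sup>2 \<le> sdc * real m"
  shows "cmod (char (distr M borel (normalised_FDP \<alpha> \<delta> m)) s - exp (- s\<^sup>2 / 2)) \<le>
    2 * ((1 + 20 * K * \<theta>) * (20 / c\<^sup>2 * \<tau> ^ 16 + 32 * L / (c ^ 3 * \<alpha>) * \<tau> ^ 4 + 4 * \<tau> + 4 * \<tau> ^ 10 + \<tau>\<^sup>2))
    + \<bar>s\<bar> * ((2 * \<tau> / q + \<tau> ^ 11 / q\<^sup>2) / sqrt sdc)
    + 8 * (C + C\<^sup>2) * (\<bar>s\<bar> / sqrt (sdc * real m)) * (s\<^sup>2 / sdc)
    + sqrt (s\<^sup>2 / sdc * (4 * \<eta> + (30 * \<kappa> + 2 + 2 / \<eta>\<^sup>2) * \<theta>))"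
proof -
  interpret cr: crossing \<delta> \<pi>0 \<alpha> by fact
  have p: "0 \<le> \<pi>0" "\<pi>0 \<le> 1" using cr.p0 by auto
  have m0: "0 < m" using m by simp
  have gm: "gaussian_mixture (extended m) {1..m} \<pi>0 (\<lambda>i \<omega>. H i (fst \<omega>)) (\<lambda>i \<omega>. Y m i (fst \<omega>)) (\<lambda>i \<omega>. snd \<omega> i) (\<Gamma> m)"
    by (rule extended_gaussian_mixture[OF p m])
  obtain D where D: "cayley {1..m} (\<Gamma> m) D"
    by (rule cayley_exists[OF gaussian_mixture.finite_I[OF gm] gaussian_mixture.G_sym[OF gm]
          gaussian_mixture.G_psd[OF gm] gaussian_mixture.G_diag[OF gm]])
  have S: "mixture_sample (extended m) {1..m} \<pi>0 (\<lambda>i \<omega>. H i (fst \<omega>)) (\<lambda>i \<omega>. Y m i (fst \<omega>)) (\<lambda>i \<omega>. snd \<omega> i) (\<Gamma> m) D \<delta> \<alpha> m"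
    by (intro mixture_sample.intro coupled_mixture.intro coupled_mixture_axioms.intro mixture_sample_axioms.intro gm D cr refl m0)
  interpret S: mixture_sample "extended m" "{1..m}" \<pi>0 "\<lambda>i \<omega>. H i (fst \<omega>)" "\<lambda>i \<omega>. Y m i (fst \<omega>)" "\<lambda>i \<omega>. snd \<omega> i" "\<Gamma> m" D \<delta> \<alpha> m
    by (rule S)
  note [simp del] = One_nat_def
  have off: "S.offdiag C = offdiag_sum m C" for C unfolding S.offdiag_def offdiag_sum_def ..
  have rate: "S.rate2 = \<tau> ^ 40"
    unfolding \<tau>(3)[symmetric] S.rate2_def off gamma_m_def by (simp add: abs_divide)
  have corr: "S.corr2 / S.rate2 = \<theta>" "S.corr2 = \<tau> ^ 40 * \<theta>"
    unfolding S.corr2_def rate off \<theta>_def using \<tau>(1) by simp_all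
  have sdc: "S.sd_const = sdc" unfolding S.sd_const_def sdc_def zs_def ..
  have sdc0: "0 < sdc" using S.sd_const_pos sdc by simp
  have Xm: "normalised_FDP \<alpha> \<delta> m \<in> borel_measurable M"
    using FDP_measurable[OF cr.\<alpha>] unfolding normalised_FDP_def by simp
  have stat: "S.FDP_stat \<omega> = normalised_FDP \<alpha> \<delta> m (fst \<omega>)" for \<omega>
    by (simp add: S.FDP_stat_def normalised_FDP_def FDP_def Phi_ereal obs_def S.sd_def cr.t_star_eq h_fun_def off gamma_m_def)
  have char: "char (distr M borel (normalised_FDP \<alpha> \<delta> m)) s = (CLINT \<omega>|extended m. iexp (s * S.FDP_stat \<omega>))"
  proof -
    have "char (distr M borel (normalised_FDP \<alpha> \<delta> m)) s = (CLINT \<omega>|M. iexp (s * normalised_FDP \<alpha> \<delta> m \<omega>))"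
      unfolding char_def using Xm by (subst integral_distr) auto
    also have "\<dots> = (CLINT \<omega>|extended m. iexp (s * normalised_FDP \<alpha> \<delta> m (fst \<omega>)))"
      using Xm by (intro integral_extended_fst[symmetric]) simp
    finally show ?thesis unfolding stat .
  qed
  have \<tau>1: "\<tau> \<le> 1"
  proof (rule ccontr)
    assume "\<not> \<tau> \<le> 1"
    then have "1 \<le> \<tau> ^ 12" by (intro one_le_power) simp
    then show False using \<tau>(2) by linarith
  qed
  obtain bad where bad: "bad \<in> S.events"
    "S.prob bad \<le> S.var_bound B * (4 / (c * \<tau> ^ 12)\<^sup>2 + (2 * L / (c * \<alpha> * \<tau> ^ 12) + 1) * (16 / (c * \<tau> ^ 12)\<^sup>2)
      + (2 * \<tau> ^ 12 / \<tau> ^ 21 + 2) * (2 * \<tau> ^ 12 / (\<tau> ^ 21)\<^sup>2) + 1 / (\<tau> ^ 19)\<^sup>2)"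
    "\<And>\<omega>. \<omega> \<in> space (extended m) \<Longrightarrow> \<omega> \<notin> bad \<Longrightarrow> \<exists>z. BH_threshold \<alpha> m (\<lambda>i. normal_tail (\<delta> * of_bool (H i (fst \<omega>)) + Y m i (fst \<omega>))) = normal_tail z
      \<and> \<bar>z - zs\<bar> \<le> \<tau> ^ 12 \<and> \<bar>S.null_dev z \<omega> - S.null_dev zs \<omega>\<bar> \<le> 2 * \<tau> ^ 21 \<and> \<bar>S.null_dev zs \<omega>\<bar> \<le> \<tau> ^ 19"
  proof (rule S.threshold_event[of c R L B "\<tau> ^ 12" "\<tau> ^ 21" "\<tau> ^ 19", folded zs_def])
    show "\<tau> ^ 21 \<le> \<tau> ^ 12" using \<tau>(1) \<tau>1 by (intro power_decreasing) auto
  qed (use margin_right margin_left c L R B \<tau> in auto)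
  have prob_bad: "S.prob bad \<le> (1 + 20 * K * \<theta>) * (20 / c\<^sup>2 * \<tau> ^ 16 + 32 * L / (c ^ 3 * \<alpha>) * \<tau> ^ 4 + 4 * \<tau> + 4 * \<tau> ^ 10 + \<tau>\<^sup>2)"
  proof -
    have "S.var_bound B = (1 + 20 * K * \<theta>) * \<tau> ^ 40"
      unfolding S.var_bound_def rate corr(2) S.weight_const_def K_def by (simp add: algebra_simps)
    then show ?thesis
      using bad(2) by (simp only: mult.assoc[of "1 + 20 * K * \<theta>" "\<tau> ^ 40"] exponent_balance[OF \<tau>(1) c(1) cr.\<alpha>(1)])
  qed
  define Bd where "Bd = (2 * \<tau> / q + \<tau> ^ 11 / q\<^sup>2) / sqrt sdc"
  have q0: "0 < q" by (simp add: q_def)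
  have Bd: "\<bar>S.FDP_stat \<omega> - S.lin_stat \<omega>\<bar> \<le> Bd" if om: "\<omega> \<in> space (extended m)" "\<omega> \<notin> bad" for \<omega>
  proof -
    obtain z where z: "BH_threshold \<alpha> m (\<lambda>i. normal_tail (\<delta> * of_bool (H i (fst \<omega>)) + Y m i (fst \<omega>))) = normal_tail z"
      "\<bar>z - zs\<bar> \<le> \<tau> ^ 12" "\<bar>S.null_dev z \<omega> - S.null_dev zs \<omega>\<bar> \<le> 2 * \<tau> ^ 21" "\<bar>S.null_dev zs \<omega>\<bar> \<le> \<tau> ^ 19"
      using bad(3)[OF om] by blast
    have "\<bar>S.FDP_stat \<omega> - S.lin_stat \<omega>\<bar> \<le> (2 * \<tau> ^ 21 / q + \<tau> ^ 19 * \<tau> ^ 12 / q\<^sup>2) / sqrt (sdc * \<tau> ^ 40)"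
      using S.stat_difference[OF z(1), of "\<tau> ^ 12" "\<tau> ^ 21" "\<tau> ^ 19"] z(2-4) \<tau>(2)
      unfolding sdc rate zs_def q_def by simp
    also have "sqrt (sdc * \<tau> ^ 40) = sqrt sdc * \<tau> ^ 20"
    proof -
      have "\<tau> ^ 40 = (\<tau> ^ 20)\<^sup>2" by (simp flip: power_mult)
      then have "sqrt (\<tau> ^ 40) = \<tau> ^ 20" using \<tau>(1) by (simp only: real_sqrt_abs abs_of_nonneg zero_le_power less_imp_le)
      then show ?thesis by (simp add: real_sqrt_mult)
    qed
    also have "2 * \<tau> ^ 21 / q + \<tau> ^ 19 * \<tau> ^ 12 / q\<^sup>2 = \<tau> ^ 20 * (2 * \<tau> / q + \<tau> ^ 11 / q\<^sup>2)"
    proof -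
      have "\<tau> ^ 21 = \<tau> ^ 20 * \<tau>" "\<tau> ^ 19 * \<tau> ^ 12 = \<tau> ^ 20 * \<tau> ^ 11" by (simp_all flip: power_add power_Suc2)
      then show ?thesis by (simp add: distrib_left)
    qed
    also have "\<tau> ^ 20 * (2 * \<tau> / q + \<tau> ^ 11 / q\<^sup>2) / (sqrt sdc * \<tau> ^ 20) = Bd"
      unfolding Bd_def using \<tau>(1) by (simp add: mult.commute[of "sqrt sdc"])
    finally show ?thesis .
  qed
  have Bd0: "0 \<le> Bd" unfolding Bd_def using \<tau>(1) q0 sdc0 by (intro divide_nonneg_nonneg add_nonneg_nonneg) auto
  have 1: "cmod ((CLINT \<omega>|extended m. iexp (s * S.FDP_stat \<omega>)) - (CLINT \<omega>|extended m. iexp (s * S.lin_stat \<omega>)))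
      \<le> 2 * S.prob bad + \<bar>s\<bar> * Bd"
    by (rule S.char_stat_difference[OF bad(1) Bd Bd0])
  have 2: "cmod ((CLINT \<omega>|extended m. iexp (s * S.lin_stat \<omega>)) - exp (- s\<^sup>2 / 2)) \<le>
     8 * (C + C\<^sup>2) * (\<bar>s\<bar> / sqrt (sdc * real m)) * (s\<^sup>2 / sdc)
     + sqrt (s\<^sup>2 / sdc * (4 * \<eta> + (30 * \<kappa> + 2 + 2 / \<eta>\<^sup>2) * \<theta>))"
    using S.char_lin_stat[OF _ \<eta>, of s] s unfolding sdc corr(1) C_def \<kappa>_def zs_def by simp
  have "cmod ((CLINT \<omega>|extended m. iexp (s * S.FDP_stat \<omega>)) - exp (- s\<^sup>2 / 2)) \<le>
     cmod ((CLINT \<omega>|extended m. iexp (s * S.FDP_stat \<omega>)) - (CLINT \<omega>|extended m. iexp (s * S.lin_stat \<omega>)))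
     + cmod ((CLINT \<omega>|extended m. iexp (s * S.lin_stat \<omega>)) - exp (- s\<^sup>2 / 2))"
    using norm_triangle_ineq[of "(CLINT \<omega>|extended m. iexp (s * S.FDP_stat \<omega>)) - (CLINT \<omega>|extended m. iexp (s * S.lin_stat \<omega>))"
      "(CLINT \<omega>|extended m. iexp (s * S.lin_stat \<omega>)) - exp (- s\<^sup>2 / 2)"] by simp
  then show ?thesis unfolding char using 1 2 prob_bad unfolding Bd_def by linarith
qed

end

section \<open>The central limit theorem for the false discovery proportion\<close>

lemma r_m_sq:
  assumes "1 \<le> m"
  shows "(r_m \<Gamma> m)\<^sup>2 = 1 / (1 / real m + \<bar>gamma_m \<Gamma> m\<bar>)"
proof -
  have "0 < 1 / real m + \<bar>gamma_m \<Gamma> m\<bar>" using assms by (intro add_pos_nonneg) auto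
  then show ?thesis unfolding r_m_def by (simp add: powr_minus inverse_eq_divide powr_half_sqrt power_divide)
qed

text \<open>Since \<open>|\<gamma>\<^sub>m| \<le> 1\<close>, the rate \<open>r\<^sub>m\<close> is bounded below, so a higher power of it is a stronger normalisation.\<close>

lemma (in two_group_mixture) cond_c_imp_cond_a:
  assumes "cond_c \<Gamma>"
  shows "cond_a \<Gamma>"
proof -
  obtain \<epsilon> where \<epsilon>: "0 < \<epsilon>"
    "(\<lambda>m. r_m \<Gamma> m powr (2 + \<epsilon>) / (real m)\<^sup>2 * offdiag_sum m (\<lambda>i j. (\<Gamma> m i j)\<^sup>2)) \<longlonglongrightarrow> 0" (is "?c \<longlonglongrightarrow> 0")
    using assms unfolding cond_c_def by blast
  define k :: real where "k = (2 powr (- 1 / 2)) powr \<epsilon>"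
  have k: "0 < k" by (simp add: k_def)
  have "(\<lambda>m. ?c m / k) \<longlonglongrightarrow> 0 / k" by (intro tendsto_divide \<epsilon>(2) tendsto_const) (use k in auto)
  then have lim: "(\<lambda>m. ?c m / k) \<longlonglongrightarrow> 0" by simp
  show ?thesis unfolding cond_a_def
  proof (rule Lim_null_comparison[OF _ lim], rule eventually_sequentiallyI[of 1])
    fix m :: nat assume m: "1 \<le> m"
    define r where "r = r_m \<Gamma> m"
    define g where "g = offdiag_sum m (\<lambda>i j. (\<Gamma> m i j)\<^sup>2)"
    have g: "0 \<le> g / (real m)\<^sup>2" unfolding g_def offdiag_sum_def by (intro divide_nonneg_nonneg sum_nonneg) auto
    have pos: "0 < 1 / real m + \<bar>gamma_m \<Gamma> m\<bar>" using m by (intro add_pos_nonneg) auto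
    have "1 / real m \<le> 1" using m by simp
    then have "1 / real m + \<bar>gamma_m \<Gamma> m\<bar> \<le> 2" using gamma_m_bounds(2)[OF m] by linarith
    then have r: "2 powr (- 1 / 2) \<le> r" unfolding r_def r_m_def using pos by (intro powr_mono2') auto
    then have r0: "0 < r" by (rule less_le_trans[rotated]) simp
    have "k \<le> r powr \<epsilon>" unfolding k_def using r \<epsilon>(1) by (intro powr_mono2) auto
    then have "r\<^sup>2 * k \<le> r\<^sup>2 * r powr \<epsilon>" by (intro mult_left_mono) auto
    also have "\<dots> = r powr (2 + \<epsilon>)" using r0 by (simp add: powr_add)
    finally have "r\<^sup>2 \<le> r powr (2 + \<epsilon>) / k" using k by (simp add: le_divide_eq)
    then have "r\<^sup>2 * (g / (real m)\<^sup>2) \<le> r powr (2 + \<epsilon>) / k * (g / (real m)\<^sup>2)" using g by (rule mult_right_mono)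
    moreover have "0 \<le> r\<^sup>2 * (g / (real m)\<^sup>2)" using g by (intro mult_nonneg_nonneg) auto
    ultimately have "norm (r\<^sup>2 * (g / (real m)\<^sup>2)) \<le> r powr (2 + \<epsilon>) / k * (g / (real m)\<^sup>2)" by simp
    then show "norm ((r_m \<Gamma> m)\<^sup>2 / (real m)\<^sup>2 * offdiag_sum m (\<lambda>i j. (\<Gamma> m i j)\<^sup>2)) \<le> ?c m / k"
      unfolding r_def[symmetric] g_def[symmetric] by (simp add: mult_ac)
  qed
qed

text \<open>By Jensen's inequality \<open>\<gamma>\<^sub>m\<^sup>2\<close> is at most the mean squared correlation, which condition (a) bounds by
  \<open>o(1) (1/m + |\<gamma>\<^sub>m|)\<close>; hence \<open>\<gamma>\<^sub>m\<close> vanishes.\<close>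

lemma (in two_group_mixture) rates_tendsto_zero:
  assumes "cond_a \<Gamma>"
  shows "(\<lambda>m. offdiag_sum m (\<lambda>i j. (\<Gamma> m i j)\<^sup>2) / (real m)\<^sup>2 / (1 / real m + \<bar>gamma_m \<Gamma> m\<bar>)) \<longlonglongrightarrow> 0" (is "?\<theta> \<longlonglongrightarrow> 0")
    and "(\<lambda>m. 1 / real m + \<bar>gamma_m \<Gamma> m\<bar>) \<longlonglongrightarrow> 0" (is "?\<rho> \<longlonglongrightarrow> 0")
proof -
  have eq: "\<forall>\<^sub>F m in sequentially. (r_m \<Gamma> m)\<^sup>2 / (real m)\<^sup>2 * offdiag_sum m (\<lambda>i j. (\<Gamma> m i j)\<^sup>2) = ?\<theta> m"
    by (rule eventually_sequentiallyI[of 1]) (simp add: r_m_sq mult_ac)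
  show \<theta>: "?\<theta> \<longlonglongrightarrow> 0" using assms unfolding cond_a_def by (rule Lim_transform_eventually[OF _ eq])
  have "(\<lambda>m. sqrt (2 * ?\<theta> m)) \<longlonglongrightarrow> sqrt (2 * 0)" by (intro tendsto_intros \<theta>)
  then have lim: "(\<lambda>m. sqrt (2 * ?\<theta> m)) \<longlonglongrightarrow> 0" by simp
  have "(\<lambda>m. gamma_m \<Gamma> m) \<longlonglongrightarrow> 0"
  proof (rule Lim_null_comparison[OF _ lim], rule eventually_sequentiallyI[of 1])
    fix m :: nat assume m: "1 \<le> m"
    note b = gamma_m_bounds[OF m]
    have pos: "0 < ?\<rho> m" using m by (intro add_pos_nonneg) auto
    have "1 / real m \<le> 1" using m by simp
    then have le2: "?\<rho> m \<le> 2" using b(2) by linarith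
    have "0 \<le> ?\<theta> m" using pos unfolding offdiag_sum_def by (intro divide_nonneg_nonneg sum_nonneg) auto
    then have "?\<rho> m * ?\<theta> m \<le> 2 * ?\<theta> m" using le2 by (rule mult_right_mono[rotated])
    moreover have "offdiag_sum m (\<lambda>i j. (\<Gamma> m i j)\<^sup>2) / (real m)\<^sup>2 = ?\<rho> m * ?\<theta> m"
      using nonzero_mult_div_cancel_left[OF less_imp_neq[OF pos, symmetric], of "offdiag_sum m (\<lambda>i j. (\<Gamma> m i j)\<^sup>2) / (real m)\<^sup>2"]
      unfolding times_divide_eq_right ..
    ultimately have "(gamma_m \<Gamma> m)\<^sup>2 \<le> 2 * ?\<theta> m" using b(1) by linarith
    then show "norm (gamma_m \<Gamma> m) \<le> sqrt (2 * ?\<theta> m)" by (simp add: real_le_rsqrt real_norm_def abs_le_square_iff)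
  qed
  then have "(\<lambda>m. 1 / real m + \<bar>gamma_m \<Gamma> m\<bar>) \<longlonglongrightarrow> 0 + \<bar>0\<bar>" by (intro tendsto_intros lim_1_over_n)
  then show "?\<rho> \<longlonglongrightarrow> 0" by simp
qed

text \<open>The scale \<open>\<eta>\<close> is the distance at which \<open>\<xi>\<^sub>i\<close> counts as far from \<open>Y\<^sub>i\<close> in the coupling; \<open>\<eta> \<rightarrow> 0\<close> and \<open>\<theta>/\<eta>\<^sup>2 \<rightarrow> 0\<close> hold
  for \<open>\<eta> = \<theta>\<^sup>1\<^sup>/\<^sup>4\<close>, and the summand \<open>1/m\<close> keeps \<open>\<eta>\<close> positive when all correlations vanish.\<close>

lemma balanced_scale:
  fixes \<theta> :: "nat \<Rightarrow> real"
  assumes \<theta>: "\<theta> \<longlonglongrightarrow> 0" and nonneg: "\<And>m. 1 \<le> m \<Longrightarrow> 0 \<le> \<theta> m"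
  defines "\<eta> \<equiv> (\<lambda>m. sqrt (sqrt (\<theta> m)) + 1 / real m)"
  shows "\<eta> \<longlonglongrightarrow> 0" and "(\<lambda>m. \<theta> m / (\<eta> m)\<^sup>2) \<longlonglongrightarrow> 0" and "\<And>m. 1 \<le> m \<Longrightarrow> 0 < \<eta> m"
proof -
  have "\<eta> \<longlonglongrightarrow> sqrt (sqrt 0) + 0" unfolding \<eta>_def by (intro tendsto_intros \<theta> lim_1_over_n)
  then show "\<eta> \<longlonglongrightarrow> 0" by simp
  show pos: "0 < \<eta> m" if "1 \<le> m" for m unfolding \<eta>_def using that nonneg[OF that] by (intro add_nonneg_pos) auto
  have "(\<lambda>m. sqrt (\<theta> m)) \<longlonglongrightarrow> sqrt 0" by (intro tendsto_intros \<theta>)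
  then have lim: "(\<lambda>m. sqrt (\<theta> m)) \<longlonglongrightarrow> 0" by simp
  show "(\<lambda>m. \<theta> m / (\<eta> m)\<^sup>2) \<longlonglongrightarrow> 0"
  proof (rule Lim_null_comparison[OF _ lim], rule eventually_sequentiallyI[of 1])
    fix m :: nat assume m: "1 \<le> m"
    have "(sqrt (sqrt (\<theta> m)))\<^sup>2 \<le> (\<eta> m)\<^sup>2" using nonneg[OF m] unfolding \<eta>_def by (intro power_mono) auto
    then have "sqrt (\<theta> m) * sqrt (\<theta> m) \<le> sqrt (\<theta> m) * (\<eta> m)\<^sup>2" using nonneg[OF m] by (intro mult_left_mono) auto
    then have "\<theta> m \<le> sqrt (\<theta> m) * (\<eta> m)\<^sup>2" using nonneg[OF m] by simp
    then have "\<theta> m / (\<eta> m)\<^sup>2 \<le> sqrt (\<theta> m)" using pos[OF m] by (simp add: divide_le_eq)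
    then show "norm (\<theta> m / (\<eta> m)\<^sup>2) \<le> sqrt (\<theta> m)" using nonneg[OF m] by simp
  qed
qed

lemma (in two_group_mixture) char_normalised_FDP_tendsto:
  assumes cr: "crossing \<delta> \<pi>0 \<alpha>" and a: "cond_a \<Gamma>"
  shows "(\<lambda>m. char (distr M borel (normalised_FDP \<alpha> \<delta> m)) s) \<longlonglongrightarrow> exp (- s\<^sup>2 / 2)"
proof -
  interpret cr: crossing \<delta> \<pi>0 \<alpha> by fact
  let ?zs = "cr.z_star"
  define \<rho> where "\<rho> m = 1 / real m + \<bar>gamma_m \<Gamma> m\<bar>" for m
  define \<theta> where "\<theta> m = offdiag_sum m (\<lambda>i j. (\<Gamma> m i j)\<^sup>2) / (real m)\<^sup>2 / \<rho> m" for m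
  define \<tau> where "\<tau> m = \<rho> m powr (1 / 40)" for m
  define \<eta> where "\<eta> m = sqrt (sqrt (\<theta> m)) + 1 / real m" for m
  have \<rho>: "\<rho> \<longlonglongrightarrow> 0" and \<theta>: "\<theta> \<longlonglongrightarrow> 0"
    using rates_tendsto_zero[OF a] unfolding \<rho>_def \<theta>_def by simp_all
  have \<rho>0: "0 < \<rho> m" if "1 \<le> m" for m unfolding \<rho>_def using that by (intro add_pos_nonneg) auto
  have \<theta>0: "0 \<le> \<theta> m" if "1 \<le> m" for m
    unfolding \<theta>_def offdiag_sum_def using \<rho>0[OF that] by (intro divide_nonneg_nonneg sum_nonneg) auto
  have \<eta>: "\<eta> \<longlonglongrightarrow> 0" "(\<lambda>m. \<theta> m / (\<eta> m)\<^sup>2) \<longlonglongrightarrow> 0" "0 < \<eta> m" if "1 \<le> m" for m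
    using balanced_scale[of \<theta>, OF \<theta> \<theta>0] that unfolding \<eta>_def by simp_all
  note \<eta>_lim = \<eta>(1,2)[OF order_refl]
  have \<tau>: "\<tau> \<longlonglongrightarrow> 0"
  proof -
    have "(\<lambda>m. \<rho> m powr (1 / 40)) \<longlonglongrightarrow> 0 powr (1 / 40)"
      by (rule tendsto_powr2[OF \<rho>]) (auto simp: \<rho>_def intro!: always_eventually)
    then show ?thesis unfolding \<tau>_def by simp
  qed
  have \<tau>40: "\<tau> m ^ 40 = \<rho> m" if "1 \<le> m" for m
    unfolding \<tau>_def using \<rho>0[OF that] by (simp add: powr_powr flip: powr_realpow)
  obtain z0 where z0: "normal_tail z0 = \<alpha>" using normal_tail_surj[OF cr.\<alpha>] .
  \<comment> \<open>No threshold exceeds \<open>\<alpha>\<close>, so only points to the right of \<open>?zs - L\<close> matter\<close>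
  define L where "L = max 0 (?zs - z0)"
  have L: "\<alpha> \<le> normal_tail (?zs - L)" "0 \<le> L" unfolding z0[symmetric] L_def normal_tail_le_iff by simp_all
  obtain c where c: "0 < c" "c \<le> 1"
    "\<And>z. ?zs \<le> z \<Longrightarrow> z \<le> ?zs + 1 \<Longrightarrow> normal_tail z / \<alpha> + c * (z - ?zs) \<le> mixture_tail \<delta> \<pi>0 z"
    "\<And>z. z \<le> ?zs \<Longrightarrow> ?zs - (L + 2) \<le> z \<Longrightarrow> mixture_tail \<delta> \<pi>0 z \<le> normal_tail z / \<alpha> - c * (?zs - z)"
    using cr.linear_margin[of "L + 2"] L(2) by (metis add_nonneg_nonneg zero_le_numeral)
  define sdc where "sdc = min (\<pi>0\<^sup>2 * (std_normal_density ?zs)\<^sup>2) (\<pi>0 * (1 - \<pi>0) * normal_tail ?zs / 2)"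
  define q where "q = normal_tail (?zs + 1)"
  define B where "B = \<bar>?zs\<bar> + (L + 2) + \<delta> + 1"
  define K where "K = (LINT x|std_normal_distribution. (1 + B + \<bar>x\<bar>)\<^sup>2) + (1 + 2 * B)\<^sup>2"
  define C where "C = (LINT x|std_normal_distribution. (1 + \<bar>x\<bar>) ^ 3)"
  define \<kappa> where "\<kappa> = (LINT x|std_normal_distribution. indicator {?zs..} x * (1 + \<bar>?zs\<bar> + \<bar>x\<bar>)\<^sup>2)"
  have sdc: "0 < sdc" using cr.p0 normal_density_pos[of 1 0 ?zs] unfolding sdc_def by simp
  define bound where "bound m =
    2 * ((1 + 20 * K * \<theta> m) * (20 / c\<^sup>2 * \<tau> m ^ 16 + 32 * L / (c ^ 3 * \<alpha>) * \<tau> m ^ 4 + 4 * \<tau> m + 4 * \<tau> m ^ 10 + (\<tau> m)\<^sup>2))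
    + \<bar>s\<bar> * ((2 * \<tau> m / q + \<tau> m ^ 11 / q\<^sup>2) / sqrt sdc)
    + 8 * (C + C\<^sup>2) * (\<bar>s\<bar> / sqrt (sdc * real m)) * (s\<^sup>2 / sdc)
    + sqrt (s\<^sup>2 / sdc * (4 * \<eta> m + (30 * \<kappa> + 2 + 2 / (\<eta> m)\<^sup>2) * \<theta> m))" for m
  have lim: "bound \<longlonglongrightarrow> 0"
  proof -
    have 1: "(\<lambda>m. \<bar>s\<bar> / sqrt (sdc * real m)) \<longlonglongrightarrow> 0"
      using sdc by real_asymp
    have 2: "(\<lambda>m. (30 * \<kappa> + 2 + 2 / (\<eta> m)\<^sup>2) * \<theta> m) \<longlonglongrightarrow> 0"
    proof -
      have "(\<lambda>m. (30 * \<kappa> + 2) * \<theta> m + 2 * (\<theta> m / (\<eta> m)\<^sup>2)) \<longlonglongrightarrow> (30 * \<kappa> + 2) * 0 + 2 * 0"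
        by (intro tendsto_intros \<theta> \<eta>_lim)
      then show ?thesis by (simp add: algebra_simps)
    qed
    have "bound \<longlonglongrightarrow> 2 * ((1 + 20 * K * 0) * (20 / c\<^sup>2 * 0 ^ 16 + 32 * L / (c ^ 3 * \<alpha>) * 0 ^ 4 + 4 * 0 + 4 * 0 ^ 10 + 0\<^sup>2))
    + \<bar>s\<bar> * ((2 * 0 / q + 0 ^ 11 / q\<^sup>2) / sqrt sdc) + 8 * (C + C\<^sup>2) * 0 * (s\<^sup>2 / sdc)
    + sqrt (s\<^sup>2 / sdc * (4 * 0 + 0))"
      unfolding bound_def using sdc
      by (intro tendsto_add tendsto_mult tendsto_const tendsto_real_sqrt tendsto_divide tendsto_power \<theta> \<tau> \<eta>_lim(1) 1 2)
         (auto simp: q_def)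
    then show ?thesis by simp
  qed
  have ev: "\<forall>\<^sub>F m in sequentially. norm (char (distr M borel (normalised_FDP \<alpha> \<delta> m)) s - exp (- s\<^sup>2 / 2)) \<le> bound m"
  proof -
    have "(\<lambda>m. \<tau> m ^ 12) \<longlonglongrightarrow> 0 ^ 12" by (intro tendsto_power \<tau>)
    then have e1: "\<forall>\<^sub>F m in sequentially. \<tau> m ^ 12 < 1 / 2" by (rule order_tendstoD) simp
    have "filterlim (\<lambda>m. sdc * real m) at_top sequentially" using sdc by real_asymp
    then have e2: "\<forall>\<^sub>F m in sequentially. s\<^sup>2 \<le> sdc * real m" unfolding filterlim_at_top by blast
    from eventually_ge_at_top[of 1] e1 e2 show ?thesis
    proof eventually_elim
      case (elim m)
      have "0 < \<tau> m" unfolding \<tau>_def using \<rho>0[OF elim(1)] by simp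
      then show ?case
        unfolding bound_def using elim(2)
        using FDP_char_bound[OF cr elim(1) \<eta>(3)[OF elim(1)], where \<tau> = "\<tau> m" and c = c and R = "L + 2" and L = L and B = B and s = s] \<tau>40[OF elim(1)] c L elim(3)
        unfolding \<rho>_def sdc_def q_def K_def C_def \<kappa>_def \<theta>_def B_def by simp
    qed
  qed
  have "(\<lambda>m. char (distr M borel (normalised_FDP \<alpha> \<delta> m)) s - exp (- s\<^sup>2 / 2)) \<longlonglongrightarrow> 0"
    by (rule Lim_null_comparison[OF ev lim])
  then show ?thesis by (simp add: LIM_zero_iff)
qed

theorem corollary4p2:
  fixes M :: "'a measure"
    and H :: "nat \<Rightarrow> 'a \<Rightarrow> bool"
    and Y :: "nat \<Rightarrow> nat \<Rightarrow> 'a \<Rightarrow> real"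
    and \<Gamma> :: "nat \<Rightarrow> nat \<Rightarrow> nat \<Rightarrow> real"
    and \<delta> \<pi>0 \<alpha> :: real
  assumes "\<delta> > 0" and "0 < \<pi>0" and "\<pi>0 < 1" and "0 < \<alpha>" and "\<alpha> < 1"
    and "two_group_mixture M \<pi>0 H Y \<Gamma>"
    and "(cond_a \<Gamma> \<and> cond_b \<Gamma>) \<or> (cond_c \<Gamma> \<and> cond_d \<Gamma>)"
  shows "weak_conv_m
    (\<lambda>m. distr M borel (\<lambda>\<omega>.
       (FDP \<alpha> \<delta> H Y m \<omega> - \<pi>0 * \<alpha>) /
       (\<pi>0 * \<alpha> * sqrt ((1 / t_star \<delta> \<pi>0 \<alpha> - \<pi>0) / (\<pi>0 * real m)
                        + h_fun (t_star \<delta> \<pi>0 \<alpha>) * gamma_m \<Gamma> m))))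
    std_normal_distribution"
proof -
  interpret two_group_mixture M \<pi>0 H Y \<Gamma> by fact
  have cr: "crossing \<delta> \<pi>0 \<alpha>" using assms(1-5) by unfold_locales
  have a: "cond_a \<Gamma>" using assms(7) cond_c_imp_cond_a by blast
  have meas: "normalised_FDP \<alpha> \<delta> m \<in> borel_measurable M" for m
    using FDP_measurable[OF assms(4,5)] unfolding normalised_FDP_def by simp
  have "weak_conv_m (\<lambda>m. distr M borel (normalised_FDP \<alpha> \<delta> m)) std_normal_distribution"
  proof (rule levy_continuity)
    show "real_distribution (distr M borel (normalised_FDP \<alpha> \<delta> m))" for m
      by (rule real_distribution_distr[OF meas])
    show "real_distribution std_normal_distribution" by (rule real_dist_normal_dist)
    show "(\<lambda>m. char (distr M borel (normalised_FDP \<alpha> \<delta> m)) s) \<longlonglongrightarrow> char std_normal_distribution s" for s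
      using char_normalised_FDP_tendsto[OF cr a, of s] by (simp add: char_std_normal_distribution)
  qed
  then show ?thesis unfolding normalised_FDP_def .
qed

end
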